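(* Let $K/k$ be a finite Galois extension with Galois group $\mathcal{G}$, and let $\varphi\colon\mathcal{G}\to\mathrm{GL}(2,\mathbb{Z})$ be an injective homomorphism identifying $\mathcal{G}$ with one of the subgroups of $D_8=\langle B,J\rangle$ listed below. Then $H^1(\mathcal{G},{}_\varphi\mathscr{T}(K))$ is the following group: - $\mathcal{G}=D_8=\langle B,J\rangle$: $\mathrm{Br}(K^{D_4}|K^{D_2})$, where $D_4=\langle-I,C\rangle$ and $D_2=\langle C\rangle$; - $\mathcal{G}=D_4=\langle-I,C\rangle$: $\mathrm{Br}(k|K^{D_2})\oplus\mathrm{Br}(k|K^{D_2})$, where $D_2=\langle C\rangle$; - $\mathcal{G}=D_4'=\langle-I,J\rangle$: $\mathrm{Br}(K^{C_2}|K)$, where $C_2=\langle-I\rangle$; - $\mathcal{G}=C_4=\langle B\rangle$: $\mathrm{Br}(K^{C_2}|K)$, where $C_2=\langle-I\rangle$; - $\mathcal{G}=D_2=\langle C\rangle$: $\mathrm{Br}(k|K)$; - $\mathcal{G}=D_2'=\langle J\rangle$: the trivial group; - $\mathcal{G}=C_2=\langle-I\rangle$: $\mathrm{Br}(k|K)\oplus\mathrm{Br}(k|K)$; - $\mathcal{G}=C_1=\langle I\rangle$: the trivial group.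
   Context: In $\mathrm{GL}(2,\mathbb{Z})$: $B=\begin{pmatrix}0&-1\\1&0\end{pmatrix}$, $C=\begin{pmatrix}1&0\\0&-1\end{pmatrix}=JB$, $J=\begin{pmatrix}0&1\\1&0\end{pmatrix}$, $I$ the identity. ${}_\varphi\mathscr{T}$ is the $k$-torus with ${}_\varphi\mathscr{T}(K)=\mathbb{Z}^2\otimes K^\times$, with $g\in\mathcal{G}$ acting by $g(n\otimes\lambda)=\varphi_g(n)\otimes g(\lambda)$. Subgroups of $\varphi(\mathcal{G})$ are regarded as subgroups of $\mathcal{G}$ via $\varphi$, and $K^H$ denotes the fixed field of $H$. For fields $L\subset K'$, $\mathrm{Br}(L|K')$ is the group of similarity classes of central simple $L$-algebras split by $K'$.
   Formalization: In the case D_4=<-I,C> the second summand is Br(k|K^{<-C>}) instead of a second copy of Br(k|K^{D_2}) with D_2=<C>; the printed formula fails for k=R((t)), K=C((sqrt t)), where H^1 has order 8, not 16 or 4. *)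

theory Defs
  imports
    "HOL-Algebra.Algebra"
    "Jordan_Normal_Form.Matrix"
begin

section \<open>Tensor products\<close>

text \<open>The tensor product over \<open>\<int>\<close> of two abelian groups, both written multiplicatively: the free
  abelian group on pairs, modulo the bilinearity relations.\<close>

definition bilinear_rels ::
  "('a, 'm) monoid_scheme \<Rightarrow> ('b, 'n) monoid_scheme \<Rightarrow> ('a \<times> 'b \<Rightarrow>\<^sub>0 int) set" where
  "bilinear_rels G H =
     {frag_of (x \<otimes>\<^bsub>G\<^esub> x', y) - (frag_of (x, y) + frag_of (x', y)) | x x' y.
        x \<in> carrier G \<and> x' \<in> carrier G \<and> y \<in> carrier H} \<union>
     {frag_of (x, y \<otimes>\<^bsub>H\<^esub> y') - (frag_of (x, y) + frag_of (x, y')) | x y y'.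
        x \<in> carrier G \<and> y \<in> carrier H \<and> y' \<in> carrier H}"

definition tensor_group_rels ::
  "('a, 'm) monoid_scheme \<Rightarrow> ('b, 'n) monoid_scheme \<Rightarrow> ('a \<times> 'b \<Rightarrow>\<^sub>0 int) set" where
  "tensor_group_rels G H =
     generate (free_Abelian_group (carrier G \<times> carrier H)) (bilinear_rels G H)"

definition tensor_group ::
  "('a, 'm) monoid_scheme \<Rightarrow> ('b, 'n) monoid_scheme \<Rightarrow> ('a \<times> 'b \<Rightarrow>\<^sub>0 int) set monoid" where
  "tensor_group G H = free_Abelian_group (carrier G \<times> carrier H) Mod tensor_group_rels G H"

text \<open>The tensor product over \<open>F\<close> of two \<open>F\<close>-algebras, again as a quotient of the free abelian group
  on pairs.  The operations are induced by those of the free abelian group; each union is over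
  representatives, all of which give the same coset.

  The scalars act on the first factor.  Hence, if \<open>A\<close> carries scalars from a larger field than
  \<open>F\<close>, then so does \<open>tensor_alg F A B\<close>; this is used below to regard \<open>E \<otimes>\<^sub>F B\<close> as an algebra
  over an extension field \<open>E\<close> of \<open>F\<close>.\<close>

definition tensor_alg_rels ::
  "('r, 'x) ring_scheme \<Rightarrow> ('r, 'a, 'm) module_scheme \<Rightarrow> ('r, 'b, 'n) module_scheme
     \<Rightarrow> ('a \<times> 'b \<Rightarrow>\<^sub>0 int) set" where
  "tensor_alg_rels F A B =
     generate (free_Abelian_group (carrier A \<times> carrier B))
       (bilinear_rels (add_monoid A) (add_monoid B) \<union>
        {frag_of (r \<odot>\<^bsub>A\<^esub> a, b) - frag_of (a, r \<odot>\<^bsub>B\<^esub> b) | r a b.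
           r \<in> carrier F \<and> a \<in> carrier A \<and> b \<in> carrier B})"

definition tensor_alg ::
  "('r, 'x) ring_scheme \<Rightarrow> ('r, 'a, 'm) module_scheme \<Rightarrow> ('r, 'b, 'n) module_scheme
     \<Rightarrow> ('r, ('a \<times> 'b \<Rightarrow>\<^sub>0 int) set) module" where
  "tensor_alg F A B =
    (let FG = free_Abelian_group (carrier A \<times> carrier B); N = tensor_alg_rels F A B in
     \<lparr> carrier = carrier (FG Mod N),
       monoid.mult = (\<lambda>P Q. \<Union>x\<in>P. \<Union>y\<in>Q. N #>\<^bsub>FG\<^esub>
         frag_extend (\<lambda>(a, b). frag_extend (\<lambda>(a', b'). frag_of (a \<otimes>\<^bsub>A\<^esub> a', b \<otimes>\<^bsub>B\<^esub> b')) y) x),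
       one = N #>\<^bsub>FG\<^esub> frag_of (\<one>\<^bsub>A\<^esub>, \<one>\<^bsub>B\<^esub>),
       ring.zero = \<one>\<^bsub>FG Mod N\<^esub>,
       ring.add = (\<otimes>\<^bsub>FG Mod N\<^esub>),
       smult = (\<lambda>r P. \<Union>x\<in>P. N #>\<^bsub>FG\<^esub> frag_extend (\<lambda>(a, b). frag_of (r \<odot>\<^bsub>A\<^esub> a, b)) x) \<rparr>)"


section \<open>Central simple algebras and relative Brauer groups\<close>

text \<open>A subset \<open>L\<close> of a field, as a ring and as an algebra (over itself or a smaller field).\<close>

definition fld :: "'a::field set \<Rightarrow> ('a, 'a) module" where
  "fld L = \<lparr> carrier = L, monoid.mult = (*), one = 1, ring.zero = 0, ring.add = (+), smult = (*) \<rparr>"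

definition mat_alg :: "'a::field set \<Rightarrow> nat \<Rightarrow> ('a, 'a mat) module" where
  "mat_alg L n =
     \<lparr> carrier = {M \<in> carrier_mat n n. elements_mat M \<subseteq> L}, monoid.mult = (*), one = 1\<^sub>m n,
       ring.zero = 0\<^sub>m n n, ring.add = (+), smult = (\<cdot>\<^sub>m) \<rparr>"

text \<open>The locale \<open>algebra\<close> of \<open>HOL-Algebra.Module\<close> is restricted to commutative algebras.\<close>

locale assoc_algebra = module F A + ring A for F :: "('r, 'x) ring_scheme" and A (structure) +
  assumes smult_mult_left: "\<lbrakk>r \<in> carrier F; x \<in> carrier A; y \<in> carrier A\<rbrakk>
      \<Longrightarrow> (r \<odot> x) \<otimes> y = r \<odot> (x \<otimes> y)"
    and smult_mult_right: "\<lbrakk>r \<in> carrier F; x \<in> carrier A; y \<in> carrier A\<rbrakk>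
      \<Longrightarrow> x \<otimes> (r \<odot> y) = r \<odot> (x \<otimes> y)"

definition alg_iso ::
  "('r, 'x) ring_scheme \<Rightarrow> ('r, 'a, 'm) module_scheme \<Rightarrow> ('r, 'b, 'n) module_scheme \<Rightarrow> bool" where
  "alg_iso F A B \<longleftrightarrow>
     (\<exists>h \<in> ring_iso A B. \<forall>r \<in> carrier F. \<forall>x \<in> carrier A. h (r \<odot>\<^bsub>A\<^esub> x) = r \<odot>\<^bsub>B\<^esub> h x)"

definition finitely_generated_module ::
  "('r, 'x) ring_scheme \<Rightarrow> ('r, 'a, 'm) module_scheme \<Rightarrow> bool" where
  "finitely_generated_module F A \<longleftrightarrow>
     (\<exists>S. finite S \<and> S \<subseteq> carrier A \<and> (\<forall>N. submodule N F A \<and> S \<subseteq> N \<longrightarrow> N = carrier A))"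

definition simple_ring :: "('a, 'm) ring_scheme \<Rightarrow> bool" where
  "simple_ring A \<longleftrightarrow> ring A \<and> carrier A \<noteq> {\<zero>\<^bsub>A\<^esub>} \<and>
     (\<forall>I. ideal I A \<longrightarrow> I = {\<zero>\<^bsub>A\<^esub>} \<or> I = carrier A)"

definition central_algebra ::
  "('r, 'x) ring_scheme \<Rightarrow> ('r, 'a, 'm) module_scheme \<Rightarrow> bool" where
  "central_algebra F A \<longleftrightarrow>
     {z \<in> carrier A. \<forall>x \<in> carrier A. z \<otimes>\<^bsub>A\<^esub> x = x \<otimes>\<^bsub>A\<^esub> z} = {r \<odot>\<^bsub>A\<^esub> \<one>\<^bsub>A\<^esub> | r. r \<in> carrier F}"

definition central_simple_algebra ::
  "('r, 'x) ring_scheme \<Rightarrow> ('r, 'a, 'm) module_scheme \<Rightarrow> bool" where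
  "central_simple_algebra F A \<longleftrightarrow>
     assoc_algebra F A \<and> finitely_generated_module F A \<and> simple_ring A \<and> central_algebra F A"

definition similar_alg ::
  "'a::field set \<Rightarrow> ('a, 'b, 'm) module_scheme \<Rightarrow> ('a, 'c, 'n) module_scheme \<Rightarrow> bool" where
  "similar_alg L A B \<longleftrightarrow>
     (\<exists>r s. r \<ge> 1 \<and> s \<ge> 1 \<and>
        alg_iso (fld L) (tensor_alg (fld L) A (mat_alg L r)) (tensor_alg (fld L) B (mat_alg L s)))"

text \<open>\<open>E \<otimes>\<^sub>L A \<cong> M\<^sub>n(E)\<close> as \<open>E\<close>-algebras.\<close>

definition split_by :: "'a::field set \<Rightarrow> 'a set \<Rightarrow> ('a, 'b, 'm) module_scheme \<Rightarrow> bool" where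
  "split_by L E A \<longleftrightarrow> (\<exists>n \<ge> 1. alg_iso (fld E) (tensor_alg (fld L) (fld E) A) (mat_alg E n))"

text \<open>All algebras cannot be collected in one HOL type, so the elements of the Brauer group are
  the similarity classes of those algebras whose carrier is a set of vectors over the ambient
  field.  Nothing is lost, since a finite-dimensional algebra over \<open>L\<close> is isomorphic to one with
  carrier \<open>L\<^sup>n\<close>.  The product of two classes is the class of the tensor product, i.e. the
  set of all algebras on vectors that are similar to it.\<close>

definition brauer_class ::
  "'a::field set \<Rightarrow> ('a, 'b, 'm) module_scheme \<Rightarrow> ('a, 'a vec) module set" where
  "brauer_class L A =
     {B :: ('a, 'a vec) module. central_simple_algebra (fld L) B \<and> similar_alg L A B}"

definition Br :: "'a::field set \<Rightarrow> 'a set \<Rightarrow> ('a, 'a vec) module set monoid" where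
  "Br L E =
     \<lparr> carrier = {brauer_class L A | A :: ('a, 'a vec) module.
         central_simple_algebra (fld L) A \<and> split_by L E A},
       monoid.mult = (\<lambda>P Q. \<Union>A\<in>P. \<Union>B\<in>Q. brauer_class L (tensor_alg (fld L) A B)),
       one = brauer_class L (fld L) \<rparr>"


section \<open>Galois extensions\<close>

text \<open>The top field \<open>K\<close> of an extension is the whole type \<open>'a::field\<close>; all other fields are
  subfields of it.\<close>

definition Gal :: "'a::field set \<Rightarrow> ('a \<Rightarrow> 'a) monoid" where
  "Gal k = \<lparr> carrier = {\<sigma> \<in> ring_iso (fld UNIV) (fld UNIV). \<forall>x\<in>k. \<sigma> x = x},
             monoid.mult = (\<circ>), one = id \<rparr>"

definition fixed_field :: "('a \<Rightarrow> 'a) set \<Rightarrow> 'a set" where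
  "fixed_field S = {x. \<forall>\<sigma>\<in>S. \<sigma> x = x}"

definition finite_galois :: "'a::field set \<Rightarrow> bool" where
  "finite_galois k \<longleftrightarrow> subfield k (fld UNIV) \<and> ring.finite_dimension (fld UNIV) k UNIV \<and>
     fixed_field (carrier (Gal k)) = k"


section \<open>First group cohomology\<close>

definition cocycles1 ::
  "('g, 'x) monoid_scheme \<Rightarrow> ('m, 'y) monoid_scheme \<Rightarrow> ('g \<Rightarrow> 'm \<Rightarrow> 'm) \<Rightarrow> ('g \<Rightarrow> 'm) set" where
  "cocycles1 G M act =
     {f \<in> carrier G \<rightarrow>\<^sub>E carrier M.
        \<forall>g\<in>carrier G. \<forall>h\<in>carrier G. f (g \<otimes>\<^bsub>G\<^esub> h) = f g \<otimes>\<^bsub>M\<^esub> act g (f h)}"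

definition coboundaries1 ::
  "('g, 'x) monoid_scheme \<Rightarrow> ('m, 'y) monoid_scheme \<Rightarrow> ('g \<Rightarrow> 'm \<Rightarrow> 'm) \<Rightarrow> ('g \<Rightarrow> 'm) set" where
  "coboundaries1 G M act =
     {\<lambda>g\<in>carrier G. act g m \<otimes>\<^bsub>M\<^esub> inv\<^bsub>M\<^esub> m | m. m \<in> carrier M}"

definition H1 ::
  "('g, 'x) monoid_scheme \<Rightarrow> ('m, 'y) monoid_scheme \<Rightarrow> ('g \<Rightarrow> 'm \<Rightarrow> 'm) \<Rightarrow> ('g \<Rightarrow> 'm) set monoid" where
  "H1 G M act =
     (product_group (carrier G) (\<lambda>_. M)) \<lparr>carrier := cocycles1 G M act\<rparr> Mod coboundaries1 G M act"


section \<open>The torus and the subgroups of \<open>GL(2,\<int>)\<close>\<close>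

definition GL2Z :: "int mat monoid" where
  "GL2Z = units_of (ring_mat TYPE(int) 2 ())"

definition matB :: "int mat" where "matB = mat_of_rows_list 2 [[0, -1], [1, 0]]"
definition matC :: "int mat" where "matC = mat_of_rows_list 2 [[1, 0], [0, -1]]"
definition matJ :: "int mat" where "matJ = mat_of_rows_list 2 [[0, 1], [1, 0]]"
definition matI :: "int mat" where "matI = 1\<^sub>m 2"

definition D8 :: "int mat set" where "D8 = generate GL2Z {matB, matJ}"
definition D4 :: "int mat set" where "D4 = generate GL2Z {- matI, matC}"
definition D4' :: "int mat set" where "D4' = generate GL2Z {- matI, matJ}"
definition C4 :: "int mat set" where "C4 = generate GL2Z {matB}"
definition D2 :: "int mat set" where "D2 = generate GL2Z {matC}"
definition D2' :: "int mat set" where "D2' = generate GL2Z {matJ}"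
definition C2 :: "int mat set" where "C2 = generate GL2Z {- matI}"
definition C1 :: "int mat set" where "C1 = generate GL2Z {matI}"

text \<open>The conjugate \<open>B D\<^sub>2 B\<^sup>-\<^sup>1\<close> of \<open>D\<^sub>2\<close>, the other subgroup of \<open>D\<^sub>4\<close> in the \<open>GL(2,\<int>)\<close>-conjugacy
  class of \<open>D\<^sub>2\<close>.  It is needed for \<open>D\<^sub>4\<close>: the lattice \<open>\<int>\<^sup>2\<close> is there the sum of the lines spanned
  by \<open>e\<^sub>1\<close> and \<open>e\<^sub>2\<close>, which are fixed pointwise by \<open>D\<^sub>2\<close> and by this conjugate respectively,
  so that the two summands of the cohomology belong to two different quadratic extensions of \<open>k\<close>.
  They cannot be replaced by two copies of the first one: for \<open>k = \<real>((t))\<close>, \<open>K = \<complex>((\<surd>t))\<close> the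
  extension \<open>\<complex>((t))\<close> of \<open>k\<close> has a relative Brauer group of order 4, and \<open>\<real>((\<surd>t))\<close> one of order 2.\<close>

definition D2_conj :: "int mat set" where "D2_conj = generate GL2Z {- matC}"

definition torus :: "(int vec \<times> 'a::field \<Rightarrow>\<^sub>0 int) set monoid" where
  "torus = tensor_group (add_monoid (module_vec TYPE(int) 2)) (units_of (fld (UNIV :: 'a set)))"

text \<open>The action \<open>g (n \<otimes> \<lambda>) = \<phi>\<^sub>g(n) \<otimes> g(\<lambda>)\<close>; as before, the union is over representatives.\<close>

definition torus_action ::
  "(('a::field \<Rightarrow> 'a) \<Rightarrow> int mat) \<Rightarrow> ('a \<Rightarrow> 'a)
     \<Rightarrow> (int vec \<times> 'a \<Rightarrow>\<^sub>0 int) set \<Rightarrow> (int vec \<times> 'a \<Rightarrow>\<^sub>0 int) set" where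
  "torus_action \<phi> g P =
    (let V = add_monoid (module_vec TYPE(int) 2); U = units_of (fld (UNIV :: 'a set)) in
     \<Union>x\<in>P. tensor_group_rels V U #>\<^bsub>free_Abelian_group (carrier V \<times> carrier U)\<^esub>
       frag_extend (\<lambda>(n, l). frag_of (\<phi> g *\<^sub>v n, g l)) x)"

text \<open>\<open>K\<^sup>H\<close> for a set \<open>H\<close> of matrices, viewed in the Galois group via \<open>\<phi>\<close>.\<close>

definition fixed_field_via ::
  "'a::field set \<Rightarrow> (('a \<Rightarrow> 'a) \<Rightarrow> int mat) \<Rightarrow> int mat set \<Rightarrow> 'a set" where
  "fixed_field_via k \<phi> H = fixed_field {\<sigma> \<in> carrier (Gal k). \<phi> \<sigma> \<in> H}"

end

(*  For a quadratic extension E/L with conjugation s, both sides are compared with the group L^*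
    modulo the norms x s(x) of E^*.

    Brauer groups.  If A is a central simple algebra over L split by E, then A becomes M_n(E) over
    E, and the conjugation of E acts there, by Skolem-Noether, as M |-> P s(M) P^-1 with
    P s(P) = c for some c in L^*.  So A = {M in M_n(E). P s(M) = M P}.  The class of c modulo
    norms is invariant under similarity, multiplicative in A, and determines A up to similarity;
    the quaternion algebra E + E u with u^2 = c realises it.

    Cohomology.  The torus is K^* x K^* with monomial action.  A one-dimensional factor on which
    the group acts through a character e is handled by Hilbert 90 for the kernel of e, here of
    order at most 2: every cocycle is cohomologous to one that is 1 on the kernel of e and a
    constant l in L^* off it, and l matters modulo norms from the fixed field E of the kernel.
    When the group contains non-diagonal matrices, the lattice is induced from the subgroup of
    diagonal ones, and Shapiro's lemma reduces the computation to the same one-dimensional case.  *)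

theory Submission
  imports Defs
begin

section \<open>Quotients of free abelian groups as sets of fibres\<close>

text \<open>Tensor products and the torus are quotients of free abelian groups whose operations are
  unions over representatives; the obstacle throughout is to control their elements. A bilinear map
  into a concrete group is shown to have exactly the relations as its kernel. For algebras this is
  done without bases, by removing summands one at a time from a vanishing sum. Where an isomorphism
  out of a tensor product is given rather than built, the argument runs through pure tensors and
  their products.

  \<open>E\<close> is not presented by a square root: any element moved by the conjugation serves as
  second basis vector over \<open>L\<close>, so characteristic 2 is covered.

  Two steps carry the comparison with norms. Equal classes must give similar algebras: doubling the
  semilinear module V of \<open>P\<close> removes all dependence on \<open>P\<close>, since V + V is
  the scalar extension of V from L to E. Conversely, similarity must preserve the class: the matrix
  factor is cut away by an idempotent whose image inherits the semilinear operator, with the same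
  square.\<close>

lemma generate_free_Abelian_group:
  assumes "R \<subseteq> carrier (free_Abelian_group S)"
  defines "N \<equiv> generate (free_Abelian_group S) R"
  shows generate_free_zero: "0 \<in> N"
    and generate_free_add: "\<And>x y. x \<in> N \<Longrightarrow> y \<in> N \<Longrightarrow> x + y \<in> N"
    and generate_free_minus: "\<And>x. x \<in> N \<Longrightarrow> - x \<in> N"
    and generate_free_diff: "\<And>x y. x \<in> N \<Longrightarrow> y \<in> N \<Longrightarrow> x - y \<in> N"
    and generate_free_incl: "R \<subseteq> N"
    and generate_free_carrier: "N \<subseteq> carrier (free_Abelian_group S)"
proof -
  have sub: "subgroup N (free_Abelian_group S)"
    unfolding N_def by (rule group.generate_is_subgroup[OF group_free_Abelian_group assms(1)])
  show z: "0 \<in> N" using subgroup.one_closed[OF sub] by simp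
  show a: "x + y \<in> N" if "x \<in> N" "y \<in> N" for x y
    using subgroup.m_closed[OF sub that] by simp
  show c: "N \<subseteq> carrier (free_Abelian_group S)" by (rule subgroup.subset[OF sub])
  show m: "- x \<in> N" if "x \<in> N" for x
    using subgroup.m_inv_closed[OF sub that] c that
    by (metis carrier_free_Abelian_group_iff inv_free_Abelian_group subsetD)
  show "x - y \<in> N" if "x \<in> N" "y \<in> N" for x y
    using a[OF that(1) m[OF that(2)]] by simp
  show "R \<subseteq> N" unfolding N_def by (auto intro: generate.incl)
qed

text \<open>A surjection from a free abelian group onto a known group \<open>T\<close>, with kernel
  \<open>N\<close>, turns every coset of \<open>N\<close> into a fibre. The quotient is then
  computed in \<open>T\<close>, although its elements are sets of formal sums.\<close>

locale free_quotient = comm_group T for T :: "('t, 'y) monoid_scheme" (structure) +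
  fixes S :: "'s set" and \<Phi> :: "('s \<Rightarrow>\<^sub>0 int) \<Rightarrow> 't" and N :: "('s \<Rightarrow>\<^sub>0 int) set"
  assumes hom: "\<Phi> \<in> hom (free_Abelian_group S) T"
    and surj: "carrier T \<subseteq> \<Phi> ` carrier (free_Abelian_group S)"
    and ker: "N = {x \<in> carrier (free_Abelian_group S). \<Phi> x = \<one>}"
begin

definition fib :: "'t \<Rightarrow> ('s \<Rightarrow>\<^sub>0 int) set" where
  "fib t = {x \<in> carrier (free_Abelian_group S). \<Phi> x = t}"

lemma \<Phi>_closed: "x \<in> carrier (free_Abelian_group S) \<Longrightarrow> \<Phi> x \<in> carrier T"
  using hom by (auto simp: hom_def)

lemma \<Phi>_add: "\<lbrakk>x \<in> carrier (free_Abelian_group S); y \<in> carrier (free_Abelian_group S)\<rbrakk>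
    \<Longrightarrow> \<Phi> (x + y) = \<Phi> x \<otimes> \<Phi> y"
  using hom by (auto simp: hom_def)

lemma group_hom_\<Phi>: "group_hom (free_Abelian_group S) T \<Phi>"
  using hom by (simp add: group_hom_def group_hom_axioms_def is_group)

lemma \<Phi>_minus: "x \<in> carrier (free_Abelian_group S) \<Longrightarrow> \<Phi> (- x) = inv \<Phi> x"
  using group_hom.hom_inv[OF group_hom_\<Phi>] by fastforce

lemma free_diff: "\<lbrakk>x \<in> carrier (free_Abelian_group S); y \<in> carrier (free_Abelian_group S)\<rbrakk>
    \<Longrightarrow> x - y \<in> carrier (free_Abelian_group S)"
  using keys_diff[of x y] by (fastforce simp del: keys_diff)

lemma free_add: "\<lbrakk>x \<in> carrier (free_Abelian_group S); y \<in> carrier (free_Abelian_group S)\<rbrakk>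
    \<Longrightarrow> x + y \<in> carrier (free_Abelian_group S)"
  using keys_add[of x y] by fastforce

lemma \<Phi>_diff: "\<lbrakk>x \<in> carrier (free_Abelian_group S); y \<in> carrier (free_Abelian_group S)\<rbrakk>
    \<Longrightarrow> \<Phi> (x - y) = \<Phi> x \<otimes> inv \<Phi> y"
  using \<Phi>_add[of x "- y"] \<Phi>_minus[of y] by simp

lemma coset_eq_fib:
  assumes "x \<in> carrier (free_Abelian_group S)"
  shows "N #>\<^bsub>free_Abelian_group S\<^esub> x = fib (\<Phi> x)"
proof -
  have "y \<in> N #>\<^bsub>free_Abelian_group S\<^esub> x" if y: "y \<in> fib (\<Phi> x)" for y
  proof -
    have yc: "y \<in> carrier (free_Abelian_group S)" and ye: "\<Phi> y = \<Phi> x" using y by (auto simp: fib_def)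
    have "y - x \<in> N" using free_diff[OF yc assms] \<Phi>_diff[OF yc assms] ye \<Phi>_closed[OF assms]
      by (simp add: ker)
    then show ?thesis unfolding r_coset_def by force
  qed
  moreover have "y \<in> fib (\<Phi> x)" if "y \<in> N #>\<^bsub>free_Abelian_group S\<^esub> x" for y
  proof -
    obtain z where z: "z \<in> N" "y = z + x" using \<open>y \<in> N #>\<^bsub>_\<^esub> x\<close> by (auto simp: r_coset_def)
    have zc: "z \<in> carrier (free_Abelian_group S)" "\<Phi> z = \<one>" using z by (auto simp: ker)
    show ?thesis using free_add[OF zc(1) assms] \<Phi>_add[OF zc(1) assms] \<Phi>_closed[OF assms] zc
      unfolding z fib_def by simp
  qed
  ultimately show ?thesis by blast
qed

lemma fib_nonempty: "t \<in> carrier T \<Longrightarrow> \<exists>x \<in> carrier (free_Abelian_group S). \<Phi> x = t \<and> x \<in> fib t"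
  using surj by (auto simp: fib_def)

lemma fibD: "x \<in> fib t \<Longrightarrow> x \<in> carrier (free_Abelian_group S) \<and> \<Phi> x = t"
  by (auto simp: fib_def)

lemma fib_inj: "\<lbrakk>s \<in> carrier T; fib s = fib t\<rbrakk> \<Longrightarrow> s = t"
  using fib_nonempty[of s] fibD by metis

lemma carrier_Mod: "carrier (free_Abelian_group S Mod N) = fib ` carrier T"
proof
  show "carrier (free_Abelian_group S Mod N) \<subseteq> fib ` carrier T"
    using coset_eq_fib \<Phi>_closed by (auto simp: FactGroup_def RCOSETS_def)
  show "fib ` carrier T \<subseteq> carrier (free_Abelian_group S Mod N)"
  proof
    fix P assume "P \<in> fib ` carrier T"
    then obtain x where "x \<in> carrier (free_Abelian_group S)" "P = fib (\<Phi> x)"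
      using fib_nonempty by blast
    then show "P \<in> carrier (free_Abelian_group S Mod N)"
      using coset_eq_fib[of x] unfolding FactGroup_def RCOSETS_def by auto
  qed
qed

lemma mult_Mod:
  assumes "s \<in> carrier T" "t \<in> carrier T"
  shows "fib s \<otimes>\<^bsub>free_Abelian_group S Mod N\<^esub> fib t = fib (s \<otimes> t)"
proof -
  obtain x where x: "x \<in> carrier (free_Abelian_group S)" "\<Phi> x = s" using fib_nonempty[OF assms(1)] by blast
  have "z \<in> fib s <#>\<^bsub>free_Abelian_group S\<^esub> fib t" if "z \<in> fib (s \<otimes> t)" for z
  proof -
    have z: "z \<in> carrier (free_Abelian_group S)" "\<Phi> z = s \<otimes> t" using fibD[OF that] by auto
    have "\<Phi> (z - x) = t" using \<Phi>_diff[OF z(1) x(1)] z(2) x(2) assms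
      by (metis inv_solve_right' m_comm m_closed)
    then have "z - x \<in> fib t" using free_diff[OF z(1) x(1)] by (simp add: fib_def)
    moreover have "x \<in> fib s" using x by (simp add: fib_def)
    ultimately show ?thesis unfolding set_mult_def by force
  qed
  moreover have "z \<in> fib (s \<otimes> t)" if zst: "z \<in> fib s <#>\<^bsub>free_Abelian_group S\<^esub> fib t" for z
  proof -
    obtain u v where "u \<in> fib s" "v \<in> fib t" "z = u + v" using zst unfolding set_mult_def by fastforce
    then show ?thesis using fibD[of u s] fibD[of v t] free_add[of u v] \<Phi>_add[of u v]
      unfolding fib_def by simp
  qed
  ultimately show ?thesis by (auto simp: FactGroup_def)
qed

lemma one_Mod: "\<one>\<^bsub>free_Abelian_group S Mod N\<^esub> = fib \<one>"
  by (simp add: FactGroup_def ker fib_def)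

text \<open>This collapses the unions over representatives by which tensor operations are defined:
  it suffices that the image under \<open>\<Phi>\<close> is the same for all
  representatives.\<close>

lemma UN_coset:
  assumes "\<And>x. x \<in> P \<Longrightarrow> f x \<in> carrier (free_Abelian_group S) \<and> \<Phi> (f x) = t" and "P \<noteq> {}"
  shows "(\<Union>x\<in>P. N #>\<^bsub>free_Abelian_group S\<^esub> f x) = fib t"
  using assms coset_eq_fib by auto

end

section \<open>Isomorphisms out of tensor products of algebras\<close>

text \<open>Closure alone is what transport along a bijection needs; for a tensor algebra it is
  established before any ring law. The scalar set \<open>S\<close> is separate from the base field
  because \<open>E\<close> acts on a tensor product taken over \<open>L\<close>.\<close>

definition closed_alg :: "'r set \<Rightarrow> ('r, 'b, 'm) module_scheme \<Rightarrow> bool" where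
  "closed_alg S A \<longleftrightarrow> \<one>\<^bsub>A\<^esub> \<in> carrier A \<and> \<zero>\<^bsub>A\<^esub> \<in> carrier A \<and>
     (\<forall>x\<in>carrier A. \<forall>y\<in>carrier A. x \<oplus>\<^bsub>A\<^esub> y \<in> carrier A \<and> x \<otimes>\<^bsub>A\<^esub> y \<in> carrier A) \<and>
     (\<forall>r\<in>S. \<forall>x\<in>carrier A. r \<odot>\<^bsub>A\<^esub> x \<in> carrier A)"

text \<open>In contrast to \<open>ring_iso\<close>, preservation of zero is recorded, since the
  structures involved need not yet be known to be additive groups.\<close>

definition alg_map :: "'r set \<Rightarrow> ('r, 'b, 'm) module_scheme \<Rightarrow> ('r, 'c, 'n) module_scheme \<Rightarrow> ('b \<Rightarrow> 'c) \<Rightarrow> bool" where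
  "alg_map S A B h \<longleftrightarrow> bij_betw h (carrier A) (carrier B) \<and>
     (\<forall>x\<in>carrier A. \<forall>y\<in>carrier A. h (x \<oplus>\<^bsub>A\<^esub> y) = h x \<oplus>\<^bsub>B\<^esub> h y \<and> h (x \<otimes>\<^bsub>A\<^esub> y) = h x \<otimes>\<^bsub>B\<^esub> h y) \<and>
     h \<one>\<^bsub>A\<^esub> = \<one>\<^bsub>B\<^esub> \<and> h \<zero>\<^bsub>A\<^esub> = \<zero>\<^bsub>B\<^esub> \<and>
     (\<forall>r\<in>S. \<forall>x\<in>carrier A. h (r \<odot>\<^bsub>A\<^esub> x) = r \<odot>\<^bsub>B\<^esub> h x)"

lemma alg_mapD:
  assumes "alg_map S A B h"
  shows "bij_betw h (carrier A) (carrier B)" "inj_on h (carrier A)" "h ` carrier A = carrier B"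
    "x \<in> carrier A \<Longrightarrow> h x \<in> carrier B"
    "\<lbrakk>x \<in> carrier A; y \<in> carrier A\<rbrakk> \<Longrightarrow> h (x \<oplus>\<^bsub>A\<^esub> y) = h x \<oplus>\<^bsub>B\<^esub> h y"
    "\<lbrakk>x \<in> carrier A; y \<in> carrier A\<rbrakk> \<Longrightarrow> h (x \<otimes>\<^bsub>A\<^esub> y) = h x \<otimes>\<^bsub>B\<^esub> h y"
    "h \<one>\<^bsub>A\<^esub> = \<one>\<^bsub>B\<^esub>" "h \<zero>\<^bsub>A\<^esub> = \<zero>\<^bsub>B\<^esub>"
    "\<lbrakk>r \<in> S; x \<in> carrier A\<rbrakk> \<Longrightarrow> h (r \<odot>\<^bsub>A\<^esub> x) = r \<odot>\<^bsub>B\<^esub> h x"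
  using assms by (auto simp: alg_map_def bij_betw_def)

lemma closed_algD:
  assumes "closed_alg S A"
  shows "\<one>\<^bsub>A\<^esub> \<in> carrier A" "\<zero>\<^bsub>A\<^esub> \<in> carrier A"
    "\<lbrakk>x \<in> carrier A; y \<in> carrier A\<rbrakk> \<Longrightarrow> x \<oplus>\<^bsub>A\<^esub> y \<in> carrier A"
    "\<lbrakk>x \<in> carrier A; y \<in> carrier A\<rbrakk> \<Longrightarrow> x \<otimes>\<^bsub>A\<^esub> y \<in> carrier A"
    "\<lbrakk>r \<in> S; x \<in> carrier A\<rbrakk> \<Longrightarrow> r \<odot>\<^bsub>A\<^esub> x \<in> carrier A"
  using assms by (auto simp: closed_alg_def)

lemma alg_map_comp:
  assumes "alg_map S A B h" "alg_map S B C g"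
  shows "alg_map S A C (g \<circ> h)"
proof -
  have "bij_betw (g \<circ> h) (carrier A) (carrier C)"
    using assms by (auto simp: alg_map_def intro: bij_betw_trans)
  moreover have "\<And>x. x \<in> carrier A \<Longrightarrow> h x \<in> carrier B" using alg_mapD(4)[OF assms(1)] .
  ultimately show ?thesis using assms unfolding alg_map_def by simp
qed

lemma alg_map_inv:
  assumes c: "closed_alg S A" and h: "alg_map S A B h"
  shows "alg_map S B A (inv_into (carrier A) h)"
proof -
  let ?g = "inv_into (carrier A) h"
  note hD = alg_mapD[OF h] and cD = closed_algD[OF c]
  have gh: "?g (h x) = x" if "x \<in> carrier A" for x using inv_into_f_f[OF hD(2) that] .
  have ex: "\<exists>x\<in>carrier A. u = h x" if "u \<in> carrier B" for u using hD(3) that by auto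
  have p: "?g (h x \<oplus>\<^bsub>B\<^esub> h y) = x \<oplus>\<^bsub>A\<^esub> y" "?g (h x \<otimes>\<^bsub>B\<^esub> h y) = x \<otimes>\<^bsub>A\<^esub> y"
    if "x \<in> carrier A" "y \<in> carrier A" for x y
    using gh[OF cD(3)[OF that]] gh[OF cD(4)[OF that]] hD(5)[OF that] hD(6)[OF that] by auto
  have q: "?g (r \<odot>\<^bsub>B\<^esub> h x) = r \<odot>\<^bsub>A\<^esub> x" if "r \<in> S" "x \<in> carrier A" for r x
    using gh[OF cD(5)[OF that]] hD(9)[OF that] by auto
  have gB: "?g u \<in> carrier A \<and> h (?g u) = u" if "u \<in> carrier B" for u
    using ex[OF that] gh by auto
  have "?g (u \<oplus>\<^bsub>B\<^esub> v) = ?g u \<oplus>\<^bsub>A\<^esub> ?g v \<and> ?g (u \<otimes>\<^bsub>B\<^esub> v) = ?g u \<otimes>\<^bsub>A\<^esub> ?g v"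
    if "u \<in> carrier B" "v \<in> carrier B" for u v
    using p[of "?g u" "?g v"] gB[OF that(1)] gB[OF that(2)] by simp
  moreover have "?g (r \<odot>\<^bsub>B\<^esub> u) = r \<odot>\<^bsub>A\<^esub> ?g u" if "r \<in> S" "u \<in> carrier B" for r u
    using q[of r "?g u"] gB[OF that(2)] that(1) by simp
  moreover have "?g \<one>\<^bsub>B\<^esub> = \<one>\<^bsub>A\<^esub>" "?g \<zero>\<^bsub>B\<^esub> = \<zero>\<^bsub>A\<^esub>"
    using gh[OF cD(1)] gh[OF cD(2)] hD(7,8) by simp_all
  ultimately show ?thesis unfolding alg_map_def using bij_betw_inv_into[OF hD(1)] by blast
qed

lemma alg_map_closed:
  assumes c: "closed_alg S A" and h: "alg_map S A B h"
  shows "closed_alg S B"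
proof -
  note hD = alg_mapD[OF h] and cD = closed_algD[OF c]
  have ex: "\<exists>x\<in>carrier A. u = h x" if "u \<in> carrier B" for u using hD(3) that by auto
  have "u \<oplus>\<^bsub>B\<^esub> v \<in> carrier B \<and> u \<otimes>\<^bsub>B\<^esub> v \<in> carrier B" if "u \<in> carrier B" "v \<in> carrier B" for u v
    using ex[OF that(1)] ex[OF that(2)] hD(4)[OF cD(3)] hD(4)[OF cD(4)] hD(5,6) by metis
  moreover have "r \<odot>\<^bsub>B\<^esub> u \<in> carrier B" if "r \<in> S" "u \<in> carrier B" for r u
    using ex[OF that(2)] hD(4)[OF cD(5)] hD(9) that(1) by metis
  ultimately show ?thesis unfolding closed_alg_def
    using hD(4)[OF cD(1)] hD(4)[OF cD(2)] hD(7,8) by simp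
qed

definition ring_alg :: "'a::field set \<Rightarrow> ('a, 'b, 'm) module_scheme \<Rightarrow> bool" where
  "ring_alg L A \<longleftrightarrow> ring A \<and> module (fld L) A"

lemma alg_iso_iff:
  "alg_iso (fld L) A B \<longleftrightarrow> (\<exists>h. h \<in> ring_iso A B \<and> (\<forall>r\<in>L. \<forall>x\<in>carrier A. h (r \<odot>\<^bsub>A\<^esub> x) = r \<odot>\<^bsub>B\<^esub> h x))"
  by (auto simp: alg_iso_def fld_def)

lemma alg_map_imp_alg_iso: "alg_map L A B h \<Longrightarrow> alg_iso (fld L) A B"
  unfolding alg_iso_iff ring_iso_def Ring.ring_hom_def
  by (rule exI[of _ h]) (auto simp: alg_map_def bij_betw_def)

lemma ring_alg_closed:
  assumes "ring_alg L A" shows "closed_alg L A"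
proof -
  interpret ring A using assms by (simp add: ring_alg_def)
  interpret M: module "fld L" A using assms by (simp add: ring_alg_def)
  show ?thesis using M.smult_closed by (simp add: closed_alg_def fld_def)
qed

text \<open>The axioms are equations, which an injective map preserving the operations reflects; the
  only existence statement, that of negatives, is pulled back by surjectivity.\<close>

lemma ring_alg_transfer:
  assumes c: "closed_alg L A" and h: "alg_map L A B h" and B: "ring_alg L B"
  shows "ring_alg L A"
proof -
  interpret B: ring B using B by (simp add: ring_alg_def)
  interpret BM: module "fld L" B using B by (simp add: ring_alg_def)
  note hD = alg_mapD[OF h] and cD = closed_algD[OF c]
  have L: "\<And>x. x \<in> carrier (fld L) \<longleftrightarrow> x \<in> L" by (simp add: fld_def)
  have I: "x = y \<longleftrightarrow> h x = h y" if "x \<in> carrier A" "y \<in> carrier A" for x y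
    using hD(2) that by (auto simp: inj_on_def)
  have neg: "\<exists>y\<in>carrier A. y \<oplus>\<^bsub>A\<^esub> x = \<zero>\<^bsub>A\<^esub>" if x: "x \<in> carrier A" for x
  proof -
    have "\<ominus>\<^bsub>B\<^esub> h x \<in> h ` carrier A" unfolding hD(3) using hD(4)[OF x] by simp
    then obtain y where y: "y \<in> carrier A" "h y = \<ominus>\<^bsub>B\<^esub> h x" by auto
    then have "h (y \<oplus>\<^bsub>A\<^esub> x) = h \<zero>\<^bsub>A\<^esub>" using hD(4)[OF x] by (simp add: hD x B.l_neg)
    then show ?thesis using y I[OF cD(3)[OF y(1) x] cD(2)] by auto
  qed
  have ag: "abelian_group A"
    by (rule abelian_groupI; (erule neg | simp add: cD I hD B.a_ac))
  have "ring A"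
    by (rule ringI[OF ag], rule monoidI) (simp_all add: cD I hD B.m_assoc B.l_distr B.r_distr)
  moreover have "module (fld L) A"
    apply (rule moduleI[OF BM.R.is_cring ag])
    using BM.R.m_closed BM.R.a_closed BM.R.one_closed
    by (simp_all add: L cD I hD BM.smult_l_distr BM.smult_r_distr BM.smult_assoc1)
  ultimately show ?thesis by (simp add: ring_alg_def)
qed

section \<open>Tensor products modulo their relations\<close>

locale tensor_pair =
  fixes L :: "'a::field set" and A :: "('a, 'b, 'm) module_scheme" and B :: "('a, 'c, 'n) module_scheme"
  assumes A: "module (fld L) A" and B: "module (fld L) B"
begin

interpretation A: module "fld L" A by (rule A)
interpretation B: module "fld L" B by (rule B)
abbreviation "SAB \<equiv> carrier A \<times> carrier B"
abbreviation "FG \<equiv> free_Abelian_group SAB"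
abbreviation "N \<equiv> tensor_alg_rels (fld L) A B"

definition "rels = bilinear_rels (add_monoid A) (add_monoid B) \<union>
        {frag_of (r \<odot>\<^bsub>A\<^esub> a, b) - frag_of (a, r \<odot>\<^bsub>B\<^esub> b) | r a b.
           r \<in> carrier (fld L) \<and> a \<in> carrier A \<and> b \<in> carrier B}"

lemma carrier_fld: "x \<in> carrier (fld L) \<longleftrightarrow> x \<in> L" by (simp add: fld_def)

lemma N_gen: "N = generate FG rels"
  by (simp add: tensor_alg_rels_def rels_def)

lemma diff_FG: "\<lbrakk>x \<in> carrier FG; y \<in> carrier FG\<rbrakk> \<Longrightarrow> x - y \<in> carrier FG"
  using keys_diff[of x y] by (fastforce simp del: keys_diff)

lemma add_FG: "\<lbrakk>x \<in> carrier FG; y \<in> carrier FG\<rbrakk> \<Longrightarrow> x + y \<in> carrier FG"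
  using keys_add[of x y] by fastforce

lemma rels_FG: "rels \<subseteq> carrier FG"
  unfolding rels_def bilinear_rels_def
  by (auto simp del: carrier_free_Abelian_group_iff simp: carrier_fld intro!: diff_FG add_FG)

lemma N_zero: "0 \<in> N" unfolding N_gen by (rule generate_free_zero[OF rels_FG])
lemma N_add: "\<lbrakk>x \<in> N; y \<in> N\<rbrakk> \<Longrightarrow> x + y \<in> N" unfolding N_gen by (rule generate_free_add[OF rels_FG])
lemma N_minus: "x \<in> N \<Longrightarrow> - x \<in> N" unfolding N_gen by (rule generate_free_minus[OF rels_FG])
lemma N_diff: "\<lbrakk>x \<in> N; y \<in> N\<rbrakk> \<Longrightarrow> x - y \<in> N" unfolding N_gen by (rule generate_free_diff[OF rels_FG])
lemma N_FG: "N \<subseteq> carrier FG" unfolding N_gen by (rule generate_free_carrier[OF rels_FG])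
lemma N_incl: "x \<in> rels \<Longrightarrow> x \<in> N" using generate_free_incl[OF rels_FG] N_gen by auto
lemma N_sum: "(\<And>i. i \<in> I \<Longrightarrow> f i \<in> N) \<Longrightarrow> sum f I \<in> N"
  by (induction I rule: infinite_finite_induct) (auto intro: N_zero N_add)

lemma N_addl: "\<lbrakk>a \<in> carrier A; a' \<in> carrier A; b \<in> carrier B\<rbrakk>
    \<Longrightarrow> frag_of (a \<oplus>\<^bsub>A\<^esub> a', b) - (frag_of (a, b) + frag_of (a', b)) \<in> N"
  by (rule N_incl) (auto simp: rels_def bilinear_rels_def)
lemma N_addr: "\<lbrakk>a \<in> carrier A; b \<in> carrier B; b' \<in> carrier B\<rbrakk>
    \<Longrightarrow> frag_of (a, b \<oplus>\<^bsub>B\<^esub> b') - (frag_of (a, b) + frag_of (a, b')) \<in> N"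
  by (rule N_incl) (auto simp: rels_def bilinear_rels_def)
lemma N_bal: "\<lbrakk>r \<in> L; a \<in> carrier A; b \<in> carrier B\<rbrakk>
    \<Longrightarrow> frag_of (r \<odot>\<^bsub>A\<^esub> a, b) - frag_of (a, r \<odot>\<^bsub>B\<^esub> b) \<in> N"
  by (rule N_incl) (auto simp: rels_def carrier_fld)

lemma N_zerol: "b \<in> carrier B \<Longrightarrow> frag_of (\<zero>\<^bsub>A\<^esub>, b) \<in> N"
  using N_minus[OF N_addl[of "\<zero>\<^bsub>A\<^esub>" "\<zero>\<^bsub>A\<^esub>" b]] by simp
lemma N_zeror: "a \<in> carrier A \<Longrightarrow> frag_of (a, \<zero>\<^bsub>B\<^esub>) \<in> N"
  using N_minus[OF N_addr[of a "\<zero>\<^bsub>B\<^esub>" "\<zero>\<^bsub>B\<^esub>"]] by simp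

lemma N_negl:
  assumes "a \<in> carrier A" "b \<in> carrier B"
  shows "frag_of (\<ominus>\<^bsub>A\<^esub> a, b) + frag_of (a, b) \<in> N"
proof -
  have "frag_of (\<zero>\<^bsub>A\<^esub>, b) - (frag_of (\<ominus>\<^bsub>A\<^esub> a, b) + frag_of (a, b)) \<in> N"
    using N_addl[of "\<ominus>\<^bsub>A\<^esub> a" a b] assms by (simp add: A.l_neg)
  from N_diff[OF N_zerol[OF assms(2)] this] show ?thesis by (simp add: add.commute)
qed

text \<open>Moves the coefficients of a linear combination across the tensor sign. This is what
  allows one summand to be distributed over the others once the right-hand entries satisfy a linear
  relation.\<close>

lemma N_comb:
  assumes "finite I" "a \<in> carrier A" "\<And>i. i \<in> I \<Longrightarrow> l i \<in> L" "\<And>i. i \<in> I \<Longrightarrow> b i \<in> carrier B"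
  shows "frag_of (a, finsum B (\<lambda>i. l i \<odot>\<^bsub>B\<^esub> b i) I) - (\<Sum>i\<in>I. frag_of (l i \<odot>\<^bsub>A\<^esub> a, b i)) \<in> N"
  using assms(1,3,4)
proof (induction I rule: finite_induct)
  case empty
  then show ?case using N_zeror[OF assms(2)] by simp
next
  case (insert j I)
  let ?s = "finsum B (\<lambda>i. l i \<odot>\<^bsub>B\<^esub> b i) I"
  have cl: "l i \<odot>\<^bsub>B\<^esub> b i \<in> carrier B" if "i \<in> insert j I" for i
    using insert.prems that by (simp add: carrier_fld)
  have sc: "?s \<in> carrier B" using cl by (intro B.finsum_closed) auto
  have eq: "finsum B (\<lambda>i. l i \<odot>\<^bsub>B\<^esub> b i) (insert j I) = l j \<odot>\<^bsub>B\<^esub> b j \<oplus>\<^bsub>B\<^esub> ?s"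
    using insert.hyps cl by (intro B.finsum_insert) auto
  have 1: "frag_of (a, l j \<odot>\<^bsub>B\<^esub> b j \<oplus>\<^bsub>B\<^esub> ?s) - (frag_of (a, l j \<odot>\<^bsub>B\<^esub> b j) + frag_of (a, ?s)) \<in> N"
    using N_addr[OF assms(2) cl[of j] sc] by simp
  have 2: "frag_of (l j \<odot>\<^bsub>A\<^esub> a, b j) - frag_of (a, l j \<odot>\<^bsub>B\<^esub> b j) \<in> N"
    using N_bal[of "l j" a "b j"] insert.prems assms(2) by simp
  have 3: "frag_of (a, ?s) - (\<Sum>i\<in>I. frag_of (l i \<odot>\<^bsub>A\<^esub> a, b i)) \<in> N"
    using insert.IH insert.prems by simp
  have "frag_of (a, l j \<odot>\<^bsub>B\<^esub> b j \<oplus>\<^bsub>B\<^esub> ?s) - (\<Sum>i\<in>insert j I. frag_of (l i \<odot>\<^bsub>A\<^esub> a, b i))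
     = (frag_of (a, l j \<odot>\<^bsub>B\<^esub> b j \<oplus>\<^bsub>B\<^esub> ?s) - (frag_of (a, l j \<odot>\<^bsub>B\<^esub> b j) + frag_of (a, ?s)))
       + (frag_of (a, ?s) - (\<Sum>i\<in>I. frag_of (l i \<odot>\<^bsub>A\<^esub> a, b i)))
       - (frag_of (l j \<odot>\<^bsub>A\<^esub> a, b j) - frag_of (a, l j \<odot>\<^bsub>B\<^esub> b j))"
    using insert.hyps by (simp add: algebra_simps)
  also have "\<dots> \<in> N" by (rule N_diff[OF N_add[OF 1 3] 2])
  finally show ?case unfolding eq .
qed

text \<open>Integer coefficients disappear because a negative sign can be absorbed into the left
  entry, so unsigned sums of pure tensors suffice.\<close>

lemma represent:
  assumes "x \<in> carrier FG"
  shows "\<exists>(n::nat) a b. (\<forall>i<n. a i \<in> carrier A \<and> b i \<in> carrier B) \<and> x - (\<Sum>i<n. frag_of (a i, b i)) \<in> N"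
proof -
  have "Poly_Mapping.keys x \<subseteq> SAB" using assms by simp
  then show ?thesis
  proof (induction rule: free_Abelian_group_induct[consumes 1, case_names zero diff of])
    case zero
    then show ?case by (intro exI[of _ 0]) (simp add: N_zero)
  next
    case (diff x y)
    obtain n :: nat and a b where x: "\<forall>i<n. a i \<in> carrier A \<and> b i \<in> carrier B" "x - (\<Sum>i<n. frag_of (a i, b i)) \<in> N"
      using diff by blast
    obtain m :: nat and c d where y: "\<forall>i<m. c i \<in> carrier A \<and> d i \<in> carrier B" "y - (\<Sum>i<m. frag_of (c i, d i)) \<in> N"
      using diff by blast
    define a' where "a' i = (if i < n then a i else \<ominus>\<^bsub>A\<^esub> c (i - n))" for i
    define b' where "b' i = (if i < n then b i else d (i - n))" for i
    have split: "(\<Sum>i<n+p. f i) = (\<Sum>i<n. f i) + (\<Sum>i<p. f (n + i))" for f :: "nat \<Rightarrow> ('b \<times> 'c) \<Rightarrow>\<^sub>0 int" and p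
      by (induction p) (auto simp: algebra_simps)
    have s: "(\<Sum>i<n+m. frag_of (a' i, b' i)) = (\<Sum>i<n. frag_of (a i, b i)) + (\<Sum>i<m. frag_of (\<ominus>\<^bsub>A\<^esub> c i, d i))"
      unfolding split by (simp add: a'_def b'_def)
    have "(\<Sum>i<m. frag_of (\<ominus>\<^bsub>A\<^esub> c i, d i) + frag_of (c i, d i)) \<in> N"
      using y by (intro N_sum N_negl) auto
    then have 3: "(\<Sum>i<m. frag_of (\<ominus>\<^bsub>A\<^esub> c i, d i)) + (\<Sum>i<m. frag_of (c i, d i)) \<in> N"
      by (simp add: sum.distrib)
    have "x - y - (\<Sum>i<n+m. frag_of (a' i, b' i)) = (x - (\<Sum>i<n. frag_of (a i, b i)))
       - (y - (\<Sum>i<m. frag_of (c i, d i))) - ((\<Sum>i<m. frag_of (\<ominus>\<^bsub>A\<^esub> c i, d i)) + (\<Sum>i<m. frag_of (c i, d i)))"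
      unfolding s by (simp add: algebra_simps)
    also have "\<dots> \<in> N" by (rule N_diff[OF N_diff[OF x(2) y(2)] 3])
    finally have "x - y - (\<Sum>i<n+m. frag_of (a' i, b' i)) \<in> N" .
    moreover have "\<forall>i<n+m. a' i \<in> carrier A \<and> b' i \<in> carrier B"
      using x(1) y(1) by (auto simp: a'_def b'_def)
    ultimately show ?case by blast
  next
    case (of p)
    then show ?case
      by (intro exI[of _ 1] exI[of _ "\<lambda>_. fst p"] exI[of _ "\<lambda>_. snd p"]) (auto simp: N_zero)
  qed
qed

lemma idempotent_zero:
  assumes "t \<in> carrier (tensor_alg (fld L) A B)" "t \<oplus>\<^bsub>tensor_alg (fld L) A B\<^esub> t = t"
  shows "t = \<zero>\<^bsub>tensor_alg (fld L) A B\<^esub>"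
proof -
  have "N \<subseteq> carrier FG" "subgroup N FG"
    unfolding N_gen using group.generate_is_subgroup[OF group_free_Abelian_group rels_FG] subgroup.subset by auto
  then have "N \<lhd> FG" using comm_group.subgroup_imp_normal[OF abelian_free_Abelian_group] by blast
  then interpret Q: Group.group "FG Mod N" by (rule normal.factorgroup_is_group)
  show ?thesis using Q.r_cancel_one[of t t] assms by (simp add: tensor_alg_def Let_def)
qed

end

text \<open>Conditions under which a bilinear map \<open>\<beta>\<close> exhibits \<open>C\<close>
  as the tensor product without choosing bases. The decisive one is \<open>beta_indep\<close>: a
  vanishing sum in which some left entry is nonzero forces a nontrivial \<open>L\<close>-linear
  relation among the right entries.\<close>

locale tensor_map = tensor_pair L A B
  for L :: "'a::field set" and A :: "('a, 'b, 'm) module_scheme" and B :: "('a, 'c, 'n) module_scheme" +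
  fixes C :: "('a, 'd, 'o) module_scheme" and \<beta> :: "'b \<Rightarrow> 'c \<Rightarrow> 'd"
  assumes C: "abelian_group C"
    and L_inv: "x \<in> L \<Longrightarrow> inverse x \<in> L"
    and beta_closed: "\<lbrakk>a \<in> carrier A; b \<in> carrier B\<rbrakk> \<Longrightarrow> \<beta> a b \<in> carrier C"
    and beta_addl: "\<lbrakk>a \<in> carrier A; a' \<in> carrier A; b \<in> carrier B\<rbrakk> \<Longrightarrow> \<beta> (a \<oplus>\<^bsub>A\<^esub> a') b = \<beta> a b \<oplus>\<^bsub>C\<^esub> \<beta> a' b"
    and beta_addr: "\<lbrakk>a \<in> carrier A; b \<in> carrier B; b' \<in> carrier B\<rbrakk> \<Longrightarrow> \<beta> a (b \<oplus>\<^bsub>B\<^esub> b') = \<beta> a b \<oplus>\<^bsub>C\<^esub> \<beta> a b'"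
    and beta_bal: "\<lbrakk>r \<in> L; a \<in> carrier A; b \<in> carrier B\<rbrakk> \<Longrightarrow> \<beta> (r \<odot>\<^bsub>A\<^esub> a) b = \<beta> a (r \<odot>\<^bsub>B\<^esub> b)"
    and beta_indep: "\<And>(I :: nat set) a b j. \<lbrakk>finite I; \<And>i. i \<in> I \<Longrightarrow> a i \<in> carrier A; \<And>i. i \<in> I \<Longrightarrow> b i \<in> carrier B;
        finsum C (\<lambda>i. \<beta> (a i) (b i)) I = \<zero>\<^bsub>C\<^esub>; j \<in> I; a j \<noteq> \<zero>\<^bsub>A\<^esub>\<rbrakk>
        \<Longrightarrow> \<exists>l. (\<forall>i\<in>I. l i \<in> L) \<and> (\<exists>i\<in>I. l i \<noteq> 0) \<and> finsum B (\<lambda>i. l i \<odot>\<^bsub>B\<^esub> b i) I = \<zero>\<^bsub>B\<^esub>"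
    and beta_span: "carrier C \<subseteq> generate (add_monoid C) {\<beta> a b | a b. a \<in> carrier A \<and> b \<in> carrier B}"
begin

interpretation A: module "fld L" A by (rule A)
interpretation B: module "fld L" B by (rule B)
interpretation C: abelian_group C by (rule C)

definition \<Phi> where
  "\<Phi> = (SOME h. h \<in> hom FG (add_monoid C) \<and> (\<forall>a\<in>carrier A. \<forall>b\<in>carrier B. h (frag_of (a, b)) = \<beta> a b))"

lemma \<Phi>_hom: "\<Phi> \<in> hom FG (add_monoid C)"
  and \<Phi>_of: "\<lbrakk>a \<in> carrier A; b \<in> carrier B\<rbrakk> \<Longrightarrow> \<Phi> (frag_of (a, b)) = \<beta> a b"
proof -
  have cg: "comm_group (add_monoid C)" by (rule C.a_comm_group)
  have "(\<lambda>(a, b). \<beta> a b) ` SAB \<subseteq> carrier (add_monoid C)" using beta_closed by auto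
  then obtain h where "h \<in> hom FG (add_monoid C)" "\<And>x. x \<in> SAB \<Longrightarrow> h (frag_of x) = (\<lambda>(a, b). \<beta> a b) x"
    using comm_group.free_Abelian_group_universal[OF cg] by metis
  then have "\<exists>h. h \<in> hom FG (add_monoid C) \<and> (\<forall>a\<in>carrier A. \<forall>b\<in>carrier B. h (frag_of (a, b)) = \<beta> a b)"
    by (intro exI[of _ h]) auto
  from someI_ex[OF this] show "\<Phi> \<in> hom FG (add_monoid C)"
    "\<lbrakk>a \<in> carrier A; b \<in> carrier B\<rbrakk> \<Longrightarrow> \<Phi> (frag_of (a, b)) = \<beta> a b"
    unfolding \<Phi>_def by auto
qed

lemma \<Phi>_closed: "x \<in> carrier FG \<Longrightarrow> \<Phi> x \<in> carrier C"
  using \<Phi>_hom by (auto simp: hom_def)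

lemma \<Phi>_add: "\<lbrakk>x \<in> carrier FG; y \<in> carrier FG\<rbrakk> \<Longrightarrow> \<Phi> (x + y) = \<Phi> x \<oplus>\<^bsub>C\<^esub> \<Phi> y"
  using \<Phi>_hom by (auto simp: hom_def)

lemma \<Phi>_group_hom: "group_hom FG (add_monoid C) \<Phi>"
  using \<Phi>_hom by (simp add: group_hom_def group_hom_axioms_def C.a_group)

lemma \<Phi>_zero: "\<Phi> 0 = \<zero>\<^bsub>C\<^esub>"
  using group_hom.hom_one[OF \<Phi>_group_hom] by simp

lemma \<Phi>_minus: "x \<in> carrier FG \<Longrightarrow> \<Phi> (- x) = \<ominus>\<^bsub>C\<^esub> \<Phi> x"
  using group_hom.hom_inv[OF \<Phi>_group_hom, of x] by (simp add: a_inv_def)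

lemma \<Phi>_diff: "\<lbrakk>x \<in> carrier FG; y \<in> carrier FG\<rbrakk> \<Longrightarrow> \<Phi> (x - y) = \<Phi> x \<ominus>\<^bsub>C\<^esub> \<Phi> y"
  using \<Phi>_add[of x "- y"] \<Phi>_minus[of y] by (simp add: a_minus_def)

lemma of_FG: "\<lbrakk>a \<in> carrier A; b \<in> carrier B\<rbrakk> \<Longrightarrow> frag_of (a, b) \<in> carrier FG" by simp

lemma \<Phi>_rels: "x \<in> rels \<Longrightarrow> \<Phi> x = \<zero>\<^bsub>C\<^esub>"
proof -
  have z: "u = v \<Longrightarrow> v \<in> carrier C \<Longrightarrow> u \<ominus>\<^bsub>C\<^esub> v = \<zero>\<^bsub>C\<^esub>" for u v by (simp add: C.minus_eq C.r_neg)
  assume "x \<in> rels"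
  then show ?thesis unfolding rels_def bilinear_rels_def
    by (auto simp del: carrier_free_Abelian_group_iff
        simp: \<Phi>_diff \<Phi>_add add_FG of_FG \<Phi>_of beta_addl beta_addr beta_bal beta_closed carrier_fld intro!: z)
qed

lemma \<Phi>_N: "x \<in> N \<Longrightarrow> \<Phi> x = \<zero>\<^bsub>C\<^esub>"
proof -
  assume x: "x \<in> N"
  have "rels \<subseteq> kernel FG (add_monoid C) \<Phi>" using \<Phi>_rels rels_FG by (auto simp: kernel_def simp del: carrier_free_Abelian_group_iff)
  then have "generate FG rels \<subseteq> kernel FG (add_monoid C) \<Phi>"
    using group.generate_subgroup_incl[OF group_free_Abelian_group] group_hom.subgroup_kernel[OF \<Phi>_group_hom] by blast
  then show ?thesis using x unfolding N_gen kernel_def by auto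
qed

lemma \<Phi>_sum:
  assumes "finite I" "\<And>i. i \<in> I \<Longrightarrow> a i \<in> carrier A" "\<And>i. i \<in> I \<Longrightarrow> b i \<in> carrier B"
  shows "(\<Sum>i\<in>I. frag_of (a i, b i)) \<in> carrier FG \<and> \<Phi> (\<Sum>i\<in>I. frag_of (a i, b i)) = finsum C (\<lambda>i. \<beta> (a i) (b i)) I"
  using assms
proof (induction I rule: finite_induct)
  case empty
  then show ?case by (simp add: \<Phi>_zero)
next
  case (insert j I)
  then have "finsum C (\<lambda>i. \<beta> (a i) (b i)) (insert j I) = \<beta> (a j) (b j) \<oplus>\<^bsub>C\<^esub> finsum C (\<lambda>i. \<beta> (a i) (b i)) I"
    by (intro C.finsum_insert) (auto intro!: beta_closed)
  moreover have "(\<Sum>i\<in>insert j I. frag_of (a i, b i)) = frag_of (a j, b j) + (\<Sum>i\<in>I. frag_of (a i, b i))"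
    using insert.hyps by simp
  moreover have "(\<Sum>i\<in>I. frag_of (a i, b i)) \<in> carrier FG" "frag_of (a j, b j) \<in> carrier FG"
    "\<Phi> (\<Sum>i\<in>I. frag_of (a i, b i)) = finsum C (\<lambda>i. \<beta> (a i) (b i)) I"
    using insert by auto
  ultimately show ?case using \<Phi>_add[of "frag_of (a j, b j)" "\<Sum>i\<in>I. frag_of (a i, b i)"]
      \<Phi>_of[of "a j" "b j"] insert.prems add_FG[of "frag_of (a j, b j)" "\<Sum>i\<in>I. frag_of (a i, b i)"] by simp
qed

text \<open>Induction on the number of summands. A relation among the right entries with nonzero
  coefficient at \<open>j\<close> expresses \<open>b j\<close> through the others; moving its
  coefficients to the left turns \<open>a i\<close> into \<open>a i\<close> minus a multiple of
  \<open>a j\<close> and makes the summand at \<open>j\<close> disappear. The remaining sum has the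
  same image, so the induction continues.\<close>

lemma eliminate:
  fixes I :: "nat set"
  assumes "finite I" "\<And>i. i \<in> I \<Longrightarrow> a i \<in> carrier A" "\<And>i. i \<in> I \<Longrightarrow> b i \<in> carrier B"
    and "finsum C (\<lambda>i. \<beta> (a i) (b i)) I = \<zero>\<^bsub>C\<^esub>"
  shows "(\<Sum>i\<in>I. frag_of (a i, b i)) \<in> N"
  using assms
proof (induction "card I" arbitrary: I a)
  case 0
  then show ?case using N_zero by simp
next
  case (Suc k)
  show ?case
  proof (cases "\<forall>i\<in>I. a i = \<zero>\<^bsub>A\<^esub>")
    case True
    then show ?thesis using Suc.prems(3) N_zerol by (intro N_sum) auto
  next
    case False
    then obtain j0 where "j0 \<in> I" "a j0 \<noteq> \<zero>\<^bsub>A\<^esub>" by auto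
    then obtain l j where l: "\<forall>i\<in>I. l i \<in> L" "j \<in> I" "l j \<noteq> 0" "finsum B (\<lambda>i. l i \<odot>\<^bsub>B\<^esub> b i) I = \<zero>\<^bsub>B\<^esub>"
      using beta_indep[of I a b j0] Suc.prems by auto
    define c where "c = inverse (l j)"
    define J where "J = I - {j}"
    have I: "I = insert j J" "j \<notin> J" "finite J" using l(2) Suc.prems(1) by (auto simp: J_def)
    have cL: "c \<in> L" using L_inv[of "l j"] l(1,2) by (auto simp: c_def)
    have Lmult: "x * y \<in> L" if "x \<in> L" "y \<in> L" for x y
      using A.R.m_closed[of x y] that by (simp add: fld_def)
    have aA: "\<And>i. i \<in> J \<Longrightarrow> a i \<in> carrier A" "a j \<in> carrier A" and bB: "\<And>i. i \<in> J \<Longrightarrow> b i \<in> carrier B" "b j \<in> carrier B"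
      and lL: "\<And>i. i \<in> J \<Longrightarrow> c * l i \<in> L"
      using Suc.prems l(1) I(1) Lmult cL by auto
    obtain xx where xx_def: "xx = finsum B (\<lambda>i. (c * l i) \<odot>\<^bsub>B\<^esub> b i) J" by blast
    have xxc: "xx \<in> carrier B" unfolding xx_def using lL bB by (intro B.finsum_closed) (auto simp: carrier_fld)
    have "c \<odot>\<^bsub>B\<^esub> finsum B (\<lambda>i. l i \<odot>\<^bsub>B\<^esub> b i) I = finsum B (\<lambda>i. c \<odot>\<^bsub>B\<^esub> (l i \<odot>\<^bsub>B\<^esub> b i)) I"
      using Suc.prems l(1) cL by (intro B.finsum_smult_ldistr) (auto simp: carrier_fld)
    also have "\<dots> = finsum B (\<lambda>i. (c * l i) \<odot>\<^bsub>B\<^esub> b i) I"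
      using Suc.prems l(1) cL B.smult_assoc1[of c]
      by (intro B.finsum_cong') (auto simp: carrier_fld fld_def Lmult)
    also have "\<dots> = (c * l j) \<odot>\<^bsub>B\<^esub> b j \<oplus>\<^bsub>B\<^esub> xx"
      unfolding I xx_def using I lL bB cL l(1) Lmult by (intro B.finsum_insert) (auto simp: carrier_fld)
    also have "(c * l j) \<odot>\<^bsub>B\<^esub> b j = b j"
      using B.smult_one[OF bB(2)] l(3) by (simp add: c_def fld_def)
    finally have bxx: "b j \<oplus>\<^bsub>B\<^esub> xx = \<zero>\<^bsub>B\<^esub>" using l(4) cL by (simp add: carrier_fld)
    obtain a' where a'_def: "\<And>i. a' i = a i \<ominus>\<^bsub>A\<^esub> ((c * l i) \<odot>\<^bsub>A\<^esub> a j)" by (rule that) (rule refl)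
    have ca: "(c * l i) \<odot>\<^bsub>A\<^esub> a j \<in> carrier A" if "i \<in> J" for i using lL[OF that] aA by (simp add: carrier_fld)
    have a'A: "a' i \<in> carrier A" if "i \<in> J" for i using ca[OF that] aA that by (simp add: a'_def)
    have a'eq: "a' i \<oplus>\<^bsub>A\<^esub> ((c * l i) \<odot>\<^bsub>A\<^esub> a j) = a i" if "i \<in> J" for i
      using ca[OF that] aA(1)[OF that] by (simp add: a'_def A.minus_eq A.a_assoc A.l_neg)
    have 1: "(\<Sum>i\<in>J. frag_of (a i, b i) - (frag_of (a' i, b i) + frag_of ((c * l i) \<odot>\<^bsub>A\<^esub> a j, b i))) \<in> N"
      using N_addl[OF a'A ca bB(1)] a'eq by (intro N_sum) fastforce
    have 2: "frag_of (a j, xx) - (\<Sum>i\<in>J. frag_of ((c * l i) \<odot>\<^bsub>A\<^esub> a j, b i)) \<in> N"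
      unfolding xx_def using I(3) aA lL bB by (intro N_comb) auto
    have 3: "frag_of (a j, \<zero>\<^bsub>B\<^esub>) - (frag_of (a j, b j) + frag_of (a j, xx)) \<in> N"
      using N_addr[OF aA(2) bB(2) xxc] bxx by simp
    have 4: "frag_of (a j, \<zero>\<^bsub>B\<^esub>) \<in> N" using N_zeror aA by simp
    have "(\<Sum>i\<in>I. frag_of (a i, b i)) - (\<Sum>i\<in>J. frag_of (a' i, b i)) =
      (\<Sum>i\<in>J. frag_of (a i, b i) - (frag_of (a' i, b i) + frag_of ((c * l i) \<odot>\<^bsub>A\<^esub> a j, b i)))
      - (frag_of (a j, xx) - (\<Sum>i\<in>J. frag_of ((c * l i) \<odot>\<^bsub>A\<^esub> a j, b i)))
      - (frag_of (a j, \<zero>\<^bsub>B\<^esub>) - (frag_of (a j, b j) + frag_of (a j, xx)))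
      + frag_of (a j, \<zero>\<^bsub>B\<^esub>)"
      using I by (simp add: sum_subtractf sum.distrib algebra_simps)
    also have "\<dots> \<in> N" by (rule N_add[OF N_diff[OF N_diff[OF 1 2] 3] 4])
    finally have D: "(\<Sum>i\<in>I. frag_of (a i, b i)) - (\<Sum>i\<in>J. frag_of (a' i, b i)) \<in> N" .
    have sI: "(\<Sum>i\<in>I. frag_of (a i, b i)) \<in> carrier FG" "\<Phi> (\<Sum>i\<in>I. frag_of (a i, b i)) = \<zero>\<^bsub>C\<^esub>"
      using \<Phi>_sum[of I a b] Suc.prems by auto
    have sJ: "(\<Sum>i\<in>J. frag_of (a' i, b i)) \<in> carrier FG"
      "\<Phi> (\<Sum>i\<in>J. frag_of (a' i, b i)) = finsum C (\<lambda>i. \<beta> (a' i) (b i)) J"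
      using \<Phi>_sum[OF I(3), of a' b] a'A bB by auto
    have "\<Phi> (\<Sum>i\<in>I. frag_of (a i, b i)) \<ominus>\<^bsub>C\<^esub> \<Phi> (\<Sum>i\<in>J. frag_of (a' i, b i)) = \<zero>\<^bsub>C\<^esub>"
      using \<Phi>_N[OF D] \<Phi>_diff[OF sI(1) sJ(1)] by simp
    then have "finsum C (\<lambda>i. \<beta> (a' i) (b i)) J = \<zero>\<^bsub>C\<^esub>"
      using sI(2) sJ(2) \<Phi>_closed[OF sJ(1)] by (simp add: C.minus_eq)
    moreover have "k = card J" using Suc.hyps(2) I by simp
    ultimately have "(\<Sum>i\<in>J. frag_of (a' i, b i)) \<in> N"
      using Suc.hyps(1)[of J a'] I(3) a'A bB by blast
    from N_add[OF D this] show ?thesis by simp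
  qed
qed

lemma kernel_eq: "N = {x \<in> carrier FG. \<Phi> x = \<zero>\<^bsub>C\<^esub>}"
proof
  show "N \<subseteq> {x \<in> carrier FG. \<Phi> x = \<zero>\<^bsub>C\<^esub>}" using \<Phi>_N N_FG by (auto simp del: carrier_free_Abelian_group_iff)
  show "{x \<in> carrier FG. \<Phi> x = \<zero>\<^bsub>C\<^esub>} \<subseteq> N"
  proof
    fix x assume "x \<in> {x \<in> carrier FG. \<Phi> x = \<zero>\<^bsub>C\<^esub>}"
    then have x: "x \<in> carrier FG" "\<Phi> x = \<zero>\<^bsub>C\<^esub>" by auto
    obtain n :: nat and a b where r: "\<forall>i<n. a i \<in> carrier A \<and> b i \<in> carrier B" "x - (\<Sum>i<n. frag_of (a i, b i)) \<in> N"
      using represent[OF x(1)] by blast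
    have s: "(\<Sum>i<n. frag_of (a i, b i)) \<in> carrier FG"
      "\<Phi> (\<Sum>i<n. frag_of (a i, b i)) = finsum C (\<lambda>i. \<beta> (a i) (b i)) {..<n}"
      using \<Phi>_sum[of "{..<n}" a b] r(1) by auto
    have "\<Phi> x \<ominus>\<^bsub>C\<^esub> \<Phi> (\<Sum>i<n. frag_of (a i, b i)) = \<zero>\<^bsub>C\<^esub>"
      using \<Phi>_N[OF r(2)] \<Phi>_diff[OF x(1) s(1)] by simp
    then have "finsum C (\<lambda>i. \<beta> (a i) (b i)) {..<n} = \<zero>\<^bsub>C\<^esub>"
      using x(2) s(2) \<Phi>_closed[OF s(1)] by (simp add: C.minus_eq)
    then have "(\<Sum>i<n. frag_of (a i, b i)) \<in> N" using r(1) by (intro eliminate) auto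
    from N_add[OF r(2) this] show "x \<in> N" by simp
  qed
qed

lemma \<Phi>_surj: "carrier C \<subseteq> \<Phi> ` carrier FG"
proof -
  have "subgroup (\<Phi> ` carrier FG) (add_monoid C)"
    using group_hom.img_is_subgroup[OF \<Phi>_group_hom] .
  moreover have "{\<beta> a b | a b. a \<in> carrier A \<and> b \<in> carrier B} \<subseteq> \<Phi> ` carrier FG"
  proof
    fix z assume "z \<in> {\<beta> a b | a b. a \<in> carrier A \<and> b \<in> carrier B}"
    then obtain a b where z: "z = \<beta> a b" "a \<in> carrier A" "b \<in> carrier B" by blast
    show "z \<in> \<Phi> ` carrier FG" unfolding z(1) \<Phi>_of[OF z(2,3), symmetric]
      by (rule imageI[OF of_FG[OF z(2,3)]])
  qed
  ultimately show ?thesis using beta_span group.generate_subgroup_incl[OF C.a_group] by blast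
qed

lemma free_quotient: "free_quotient (add_monoid C) SAB \<Phi> N"
proof -
  interpret comm_group "add_monoid C" by (rule C.a_comm_group)
  show ?thesis by unfold_locales (use \<Phi>_hom \<Phi>_surj kernel_eq in auto)
qed

end

text \<open>The multiplicative refinement. Scalars from \<open>S\<close> act through the left
  factor, so that taking \<open>A = fld E\<close> yields an algebra over \<open>E\<close> although
  the tensor product is over \<open>L\<close>.\<close>

locale tensor_alg_map = tensor_map L A B C \<beta>
  for L :: "'a::field set" and A :: "('a, 'b, 'm) module_scheme" and B :: "('a, 'c, 'n) module_scheme"
    and C :: "('a, 'd, 'o) module_scheme" and \<beta> :: "'b \<Rightarrow> 'c \<Rightarrow> 'd" +
  fixes S :: "'a set"
  assumes ring_C: "ring C" and A_closed: "closed_alg S A" and B_mult: "\<lbrakk>b \<in> carrier B; b' \<in> carrier B\<rbrakk> \<Longrightarrow> b \<otimes>\<^bsub>B\<^esub> b' \<in> carrier B"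
    and B_one: "\<one>\<^bsub>B\<^esub> \<in> carrier B"
    and C_smult: "\<lbrakk>r \<in> S; x \<in> carrier C\<rbrakk> \<Longrightarrow> r \<odot>\<^bsub>C\<^esub> x \<in> carrier C"
    and C_smult_distr: "\<lbrakk>r \<in> S; x \<in> carrier C; y \<in> carrier C\<rbrakk> \<Longrightarrow> r \<odot>\<^bsub>C\<^esub> (x \<oplus>\<^bsub>C\<^esub> y) = r \<odot>\<^bsub>C\<^esub> x \<oplus>\<^bsub>C\<^esub> r \<odot>\<^bsub>C\<^esub> y"
    and beta_mult: "\<lbrakk>a \<in> carrier A; a' \<in> carrier A; b \<in> carrier B; b' \<in> carrier B\<rbrakk>
        \<Longrightarrow> \<beta> (a \<otimes>\<^bsub>A\<^esub> a') (b \<otimes>\<^bsub>B\<^esub> b') = \<beta> a b \<otimes>\<^bsub>C\<^esub> \<beta> a' b'"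
    and beta_one: "\<beta> \<one>\<^bsub>A\<^esub> \<one>\<^bsub>B\<^esub> = \<one>\<^bsub>C\<^esub>"
    and beta_smult: "\<lbrakk>r \<in> S; a \<in> carrier A; b \<in> carrier B\<rbrakk> \<Longrightarrow> \<beta> (r \<odot>\<^bsub>A\<^esub> a) b = r \<odot>\<^bsub>C\<^esub> \<beta> a b"
begin

interpretation C: ring C by (rule ring_C)
interpretation Q: free_quotient "add_monoid C" SAB \<Phi> N by (rule free_quotient)

definition "mult_rep x y = frag_extend (\<lambda>(a, b). frag_extend (\<lambda>(a', b'). frag_of (a \<otimes>\<^bsub>A\<^esub> a', b \<otimes>\<^bsub>B\<^esub> b')) y) x"

definition "smult_rep r x = frag_extend (\<lambda>(a, b). frag_of (r \<odot>\<^bsub>A\<^esub> a, b)) x"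

lemma minus_minus_minus: "\<lbrakk>x \<in> carrier C; y \<in> carrier C; z \<in> carrier C\<rbrakk>
   \<Longrightarrow> (x \<ominus>\<^bsub>C\<^esub> y) \<otimes>\<^bsub>C\<^esub> z = x \<otimes>\<^bsub>C\<^esub> z \<ominus>\<^bsub>C\<^esub> y \<otimes>\<^bsub>C\<^esub> z \<and> z \<otimes>\<^bsub>C\<^esub> (x \<ominus>\<^bsub>C\<^esub> y) = z \<otimes>\<^bsub>C\<^esub> x \<ominus>\<^bsub>C\<^esub> z \<otimes>\<^bsub>C\<^esub> y"
  by (simp add: C.minus_eq C.l_distr C.r_distr C.l_minus C.r_minus)

lemma mult_rep_of:
  assumes "a \<in> carrier A" "b \<in> carrier B" "y \<in> carrier FG"
  shows "mult_rep (frag_of (a, b)) y \<in> carrier FG \<and> \<Phi> (mult_rep (frag_of (a, b)) y) = \<beta> a b \<otimes>\<^bsub>C\<^esub> \<Phi> y"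
proof -
  have "Poly_Mapping.keys y \<subseteq> SAB" using assms(3) by simp
  then show ?thesis
  proof (induction rule: free_Abelian_group_induct[consumes 1, case_names zero diff of])
    case zero
    show ?case using beta_closed[OF assms(1,2)] by (simp add: mult_rep_def \<Phi>_zero)
  next
    case (diff x y)
    have e: "mult_rep (frag_of (a, b)) (x - y) = mult_rep (frag_of (a, b)) x - mult_rep (frag_of (a, b)) y"
      by (simp add: mult_rep_def frag_extend_diff)
    have c: "x \<in> carrier FG" "y \<in> carrier FG" using diff by simp_all
    show ?case unfolding e using diff c minus_minus_minus[OF \<Phi>_closed[OF c(1)] \<Phi>_closed[OF c(2)] beta_closed[OF assms(1,2)]]
      by (simp add: diff_FG \<Phi>_diff del: carrier_free_Abelian_group_iff)
  next
    case (of p)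
    then show ?case using assms closed_algD(4)[OF A_closed] B_mult beta_mult
      by (cases p) (auto simp: mult_rep_def \<Phi>_of)
  qed
qed

lemma mult_rep:
  assumes "x \<in> carrier FG" "y \<in> carrier FG"
  shows "mult_rep x y \<in> carrier FG \<and> \<Phi> (mult_rep x y) = \<Phi> x \<otimes>\<^bsub>C\<^esub> \<Phi> y"
proof -
  have "Poly_Mapping.keys x \<subseteq> SAB" using assms(1) by simp
  then show ?thesis
  proof (induction rule: free_Abelian_group_induct[consumes 1, case_names zero diff of])
    case zero
    show ?case using \<Phi>_closed[OF assms(2)] by (simp add: mult_rep_def \<Phi>_zero)
  next
    case (diff u v)
    have e: "mult_rep (u - v) y = mult_rep u y - mult_rep v y"
      by (simp add: mult_rep_def frag_extend_diff)
    have c: "u \<in> carrier FG" "v \<in> carrier FG" using diff by simp_all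
    show ?case unfolding e using diff c minus_minus_minus[OF \<Phi>_closed[OF c(1)] \<Phi>_closed[OF c(2)] \<Phi>_closed[OF assms(2)]]
      by (simp add: diff_FG \<Phi>_diff del: carrier_free_Abelian_group_iff)
  next
    case (of p)
    then show ?case using mult_rep_of[OF _ _ assms(2)] by (cases p) (auto simp: \<Phi>_of)
  qed
qed

lemma smult_rep:
  assumes r: "r \<in> S" and "x \<in> carrier FG"
  shows "smult_rep r x \<in> carrier FG \<and> \<Phi> (smult_rep r x) = r \<odot>\<^bsub>C\<^esub> \<Phi> x"
proof -
  \<comment> \<open>Additivity of the scalar action is what is available; its values on zero and on
    differences are derived from it.\<close>
  have z: "r \<odot>\<^bsub>C\<^esub> \<zero>\<^bsub>C\<^esub> = \<zero>\<^bsub>C\<^esub>"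
    using C_smult_distr[OF r, of "\<zero>\<^bsub>C\<^esub>" "\<zero>\<^bsub>C\<^esub>"] C_smult[OF r, of "\<zero>\<^bsub>C\<^esub>"] by simp
  have d: "r \<odot>\<^bsub>C\<^esub> (u \<ominus>\<^bsub>C\<^esub> v) = r \<odot>\<^bsub>C\<^esub> u \<ominus>\<^bsub>C\<^esub> r \<odot>\<^bsub>C\<^esub> v" if "u \<in> carrier C" "v \<in> carrier C" for u v
  proof -
    have "r \<odot>\<^bsub>C\<^esub> ((u \<ominus>\<^bsub>C\<^esub> v) \<oplus>\<^bsub>C\<^esub> v) = r \<odot>\<^bsub>C\<^esub> (u \<ominus>\<^bsub>C\<^esub> v) \<oplus>\<^bsub>C\<^esub> r \<odot>\<^bsub>C\<^esub> v"
      using that by (intro C_smult_distr[OF r]) auto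
    moreover have "(u \<ominus>\<^bsub>C\<^esub> v) \<oplus>\<^bsub>C\<^esub> v = u" using that by (simp add: C.minus_eq C.a_assoc C.l_neg)
    moreover have "r \<odot>\<^bsub>C\<^esub> (u \<ominus>\<^bsub>C\<^esub> v) \<in> carrier C" "r \<odot>\<^bsub>C\<^esub> v \<in> carrier C" using that C_smult[OF r] by auto
    ultimately show ?thesis by (simp add: C.minus_eq C.a_assoc C.r_neg)
  qed
  have "Poly_Mapping.keys x \<subseteq> SAB" using assms(2) by simp
  then show ?thesis
  proof (induction rule: free_Abelian_group_induct[consumes 1, case_names zero diff of])
    case zero
    show ?case using z by (simp add: smult_rep_def \<Phi>_zero)
  next
    case (diff u v)
    have e: "smult_rep r (u - v) = smult_rep r u - smult_rep r v"
      by (simp add: smult_rep_def frag_extend_diff)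
    have c: "u \<in> carrier FG" "v \<in> carrier FG" using diff by simp_all
    show ?case unfolding e using diff c d[OF \<Phi>_closed[OF c(1)] \<Phi>_closed[OF c(2)]]
      by (simp add: diff_FG \<Phi>_diff del: carrier_free_Abelian_group_iff)
  next
    case (of p)
    then show ?case using closed_algD(5)[OF A_closed r] beta_smult[OF r] by (cases p) (auto simp: smult_rep_def \<Phi>_of)
  qed
qed

lemma tensor_alg_simps:
  "carrier (tensor_alg (fld L) A B) = Q.fib ` carrier C"
  "\<lbrakk>s \<in> carrier C; t \<in> carrier C\<rbrakk> \<Longrightarrow> Q.fib s \<oplus>\<^bsub>tensor_alg (fld L) A B\<^esub> Q.fib t = Q.fib (s \<oplus>\<^bsub>C\<^esub> t)"
  "\<lbrakk>s \<in> carrier C; t \<in> carrier C\<rbrakk> \<Longrightarrow> Q.fib s \<otimes>\<^bsub>tensor_alg (fld L) A B\<^esub> Q.fib t = Q.fib (s \<otimes>\<^bsub>C\<^esub> t)"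
  "\<lbrakk>r \<in> S; t \<in> carrier C\<rbrakk> \<Longrightarrow> r \<odot>\<^bsub>tensor_alg (fld L) A B\<^esub> Q.fib t = Q.fib (r \<odot>\<^bsub>C\<^esub> t)"
  "\<one>\<^bsub>tensor_alg (fld L) A B\<^esub> = Q.fib \<one>\<^bsub>C\<^esub>"
  "\<zero>\<^bsub>tensor_alg (fld L) A B\<^esub> = Q.fib \<zero>\<^bsub>C\<^esub>"
proof -
  show "carrier (tensor_alg (fld L) A B) = Q.fib ` carrier C"
    using Q.carrier_Mod by (simp add: tensor_alg_def Let_def)
  show "\<lbrakk>s \<in> carrier C; t \<in> carrier C\<rbrakk> \<Longrightarrow> Q.fib s \<oplus>\<^bsub>tensor_alg (fld L) A B\<^esub> Q.fib t = Q.fib (s \<oplus>\<^bsub>C\<^esub> t)"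
    using Q.mult_Mod[of s t] by (simp add: tensor_alg_def Let_def)
  show "\<one>\<^bsub>tensor_alg (fld L) A B\<^esub> = Q.fib \<one>\<^bsub>C\<^esub>"
    using Q.coset_eq_fib[of "frag_of (\<one>\<^bsub>A\<^esub>, \<one>\<^bsub>B\<^esub>)"] closed_algD(1)[OF A_closed] B_one beta_one
    by (simp add: tensor_alg_def Let_def \<Phi>_of)
  show "\<zero>\<^bsub>tensor_alg (fld L) A B\<^esub> = Q.fib \<zero>\<^bsub>C\<^esub>"
    using Q.one_Mod by (simp add: tensor_alg_def Let_def)
  show "Q.fib s \<otimes>\<^bsub>tensor_alg (fld L) A B\<^esub> Q.fib t = Q.fib (s \<otimes>\<^bsub>C\<^esub> t)" if st: "s \<in> carrier C" "t \<in> carrier C"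
  proof -
    have ne: "Q.fib s \<noteq> {}" "Q.fib t \<noteq> {}" using Q.fib_nonempty[of s] Q.fib_nonempty[of t] st by auto
    have "Q.fib s \<otimes>\<^bsub>tensor_alg (fld L) A B\<^esub> Q.fib t = (\<Union>x\<in>Q.fib s. \<Union>y\<in>Q.fib t. N #>\<^bsub>FG\<^esub> mult_rep x y)"
      by (simp add: tensor_alg_def Let_def mult_rep_def)
    also have "\<dots> = (\<Union>x\<in>Q.fib s. Q.fib (s \<otimes>\<^bsub>C\<^esub> t))"
      by (intro SUP_cong refl Q.UN_coset ne) (use mult_rep Q.fibD in auto)
    finally show ?thesis using ne by simp
  qed
  show "r \<odot>\<^bsub>tensor_alg (fld L) A B\<^esub> Q.fib t = Q.fib (r \<odot>\<^bsub>C\<^esub> t)" if rt: "r \<in> S" "t \<in> carrier C"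
  proof -
    have ne: "Q.fib t \<noteq> {}" using Q.fib_nonempty[of t] rt by auto
    have "r \<odot>\<^bsub>tensor_alg (fld L) A B\<^esub> Q.fib t = (\<Union>x\<in>Q.fib t. N #>\<^bsub>FG\<^esub> smult_rep r x)"
      by (simp add: tensor_alg_def Let_def smult_rep_def)
    also have "\<dots> = Q.fib (r \<odot>\<^bsub>C\<^esub> t)"
      by (rule Q.UN_coset[OF _ ne]) (use smult_rep rt Q.fibD in auto)
    finally show ?thesis .
  qed
qed

theorem fib_alg_map: "alg_map S C (tensor_alg (fld L) A B) Q.fib"
  and closed_alg_target: "closed_alg S C"
proof -
  show "alg_map S C (tensor_alg (fld L) A B) Q.fib" unfolding alg_map_def
    using Q.fib_inj by (auto simp: tensor_alg_simps bij_betw_def inj_on_def)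
  show "closed_alg S C" unfolding closed_alg_def using C_smult by auto
qed

lemma ex_tensor_alg_map: "\<exists>h. alg_map S (tensor_alg (fld L) A B) C h"
  using alg_map_inv[OF closed_alg_target fib_alg_map] by blast

lemma tensor_alg_closed: "closed_alg S (tensor_alg (fld L) A B)"
  by (rule alg_map_closed[OF closed_alg_target fib_alg_map])

end

text \<open>Here the tensor algebra is handled through representatives instead of a model. This is
  needed when an isomorphism from it is a hypothesis, as in splitting and in similarity.\<close>

locale tensor_ring = tensor_pair L A B
  for L :: "'a::field set" and A :: "('a, 'b, 'm) module_scheme" and B :: "('a, 'c, 'n) module_scheme" +
  fixes S :: "'a set"
  assumes ring_A: "ring A" and ring_B: "ring B"
    and A_smultl: "\<lbrakk>r \<in> L; a \<in> carrier A; a' \<in> carrier A\<rbrakk> \<Longrightarrow> (r \<odot>\<^bsub>A\<^esub> a) \<otimes>\<^bsub>A\<^esub> a' = r \<odot>\<^bsub>A\<^esub> (a \<otimes>\<^bsub>A\<^esub> a')"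
    and A_smultr: "\<lbrakk>r \<in> L; a \<in> carrier A; a' \<in> carrier A\<rbrakk> \<Longrightarrow> a \<otimes>\<^bsub>A\<^esub> (r \<odot>\<^bsub>A\<^esub> a') = r \<odot>\<^bsub>A\<^esub> (a \<otimes>\<^bsub>A\<^esub> a')"
    and B_smultl: "\<lbrakk>r \<in> L; b \<in> carrier B; b' \<in> carrier B\<rbrakk> \<Longrightarrow> (r \<odot>\<^bsub>B\<^esub> b) \<otimes>\<^bsub>B\<^esub> b' = r \<odot>\<^bsub>B\<^esub> (b \<otimes>\<^bsub>B\<^esub> b')"
    and B_smultr: "\<lbrakk>r \<in> L; b \<in> carrier B; b' \<in> carrier B\<rbrakk> \<Longrightarrow> b \<otimes>\<^bsub>B\<^esub> (r \<odot>\<^bsub>B\<^esub> b') = r \<odot>\<^bsub>B\<^esub> (b \<otimes>\<^bsub>B\<^esub> b')"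
    and S_closed: "\<lbrakk>s \<in> S; a \<in> carrier A\<rbrakk> \<Longrightarrow> s \<odot>\<^bsub>A\<^esub> a \<in> carrier A"
    and S_add: "\<lbrakk>s \<in> S; a \<in> carrier A; a' \<in> carrier A\<rbrakk> \<Longrightarrow> s \<odot>\<^bsub>A\<^esub> (a \<oplus>\<^bsub>A\<^esub> a') = s \<odot>\<^bsub>A\<^esub> a \<oplus>\<^bsub>A\<^esub> s \<odot>\<^bsub>A\<^esub> a'"
    and S_comm: "\<lbrakk>s \<in> S; r \<in> L; a \<in> carrier A\<rbrakk> \<Longrightarrow> s \<odot>\<^bsub>A\<^esub> (r \<odot>\<^bsub>A\<^esub> a) = r \<odot>\<^bsub>A\<^esub> (s \<odot>\<^bsub>A\<^esub> a)"
begin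

interpretation A: module "fld L" A by (rule A)
interpretation B: module "fld L" B by (rule B)
interpretation RA: ring A by (rule ring_A)
interpretation RB: ring B by (rule ring_B)

abbreviation "T \<equiv> tensor_alg (fld L) A B"

definition "prod_rep x y = frag_extend (\<lambda>(a, b). frag_extend (\<lambda>(a', b'). frag_of (a \<otimes>\<^bsub>A\<^esub> a', b \<otimes>\<^bsub>B\<^esub> b')) y) x"

definition "scal_rep r x = frag_extend (\<lambda>(a, b). frag_of (r \<odot>\<^bsub>A\<^esub> a, b)) x"

lemma prod_rep_of: "prod_rep (frag_of (a, b)) (frag_of (a', b')) = frag_of (a \<otimes>\<^bsub>A\<^esub> a', b \<otimes>\<^bsub>B\<^esub> b')"
  by (simp add: prod_rep_def)
lemma prod_rep_diffl: "prod_rep (x - y) z = prod_rep x z - prod_rep y z"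
  by (simp add: prod_rep_def frag_extend_diff)
lemma prod_rep_addl: "prod_rep (x + y) z = prod_rep x z + prod_rep y z"
  by (simp add: prod_rep_def frag_extend_add)
lemma prod_rep_zero: "prod_rep 0 z = 0" "prod_rep z 0 = 0"
  by (simp_all add: prod_rep_def frag_extend_eq_0 case_prod_beta)
lemma frag_extend_add_fun: "frag_extend (\<lambda>p. f p + g p) x = frag_extend f x + frag_extend g x"
  by (simp add: frag_extend_def frag_cmul_distrib2 sum.distrib)
lemma frag_extend_minus_fun: "frag_extend (\<lambda>p. - f p) x = - frag_extend f x"
proof -
  have "frag_extend (\<lambda>p. - f p) x + frag_extend f x = 0"
    unfolding frag_extend_add_fun[symmetric] by (simp add: frag_extend_eq_0)
  then show ?thesis by (simp add: eq_neg_iff_add_eq_0)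
qed
lemma prod_rep_addr: "prod_rep z (x + y) = prod_rep z x + prod_rep z y"
  unfolding prod_rep_def split_def frag_extend_add frag_extend_add_fun ..
lemma prod_rep_diffr: "prod_rep z (x - y) = prod_rep z x - prod_rep z y"
proof -
  have "prod_rep z (- y) = - prod_rep z y"
    unfolding prod_rep_def split_def frag_extend_minus frag_extend_minus_fun ..
  then show ?thesis using prod_rep_addr[of z x "- y"] by simp
qed

lemma free_induct:
  assumes "x \<in> carrier FG" "Q 0" "\<And>x y. \<lbrakk>Q x; Q y\<rbrakk> \<Longrightarrow> Q (x - y)"
    "\<And>a b. \<lbrakk>a \<in> carrier A; b \<in> carrier B\<rbrakk> \<Longrightarrow> Q (frag_of (a, b))"
  shows "Q x"
proof -
  have "Poly_Mapping.keys x \<subseteq> SAB" using assms(1) by simp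
  then show ?thesis
    by (induction rule: free_Abelian_group_induct[consumes 1]) (use assms in auto)
qed

lemma N_induct:
  assumes "x \<in> N" "Q 0" "\<And>r. r \<in> rels \<Longrightarrow> Q r" "\<And>x. Q x \<Longrightarrow> Q (- x)" "\<And>x y. \<lbrakk>Q x; Q y\<rbrakk> \<Longrightarrow> Q (x + y)"
  shows "Q x"
  using assms(1) unfolding N_gen
proof (induction rule: generate.induct)
  case (inv h)
  then have "h \<in> carrier FG" using rels_FG by blast
  then have "inv\<^bsub>FG\<^esub> h = - h" by simp
  then show ?case using assms(3,4) inv by simp
qed (use assms in auto)

lemma relsE:
  assumes "r \<in> rels"
  obtains a a' b where "a \<in> carrier A" "a' \<in> carrier A" "b \<in> carrier B" "r = frag_of (a \<oplus>\<^bsub>A\<^esub> a', b) - (frag_of (a, b) + frag_of (a', b))"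
  | a b b' where "a \<in> carrier A" "b \<in> carrier B" "b' \<in> carrier B" "r = frag_of (a, b \<oplus>\<^bsub>B\<^esub> b') - (frag_of (a, b) + frag_of (a, b'))"
  | l a b where "l \<in> L" "a \<in> carrier A" "b \<in> carrier B" "r = frag_of (l \<odot>\<^bsub>A\<^esub> a, b) - frag_of (a, l \<odot>\<^bsub>B\<^esub> b)"
  using assms unfolding rels_def bilinear_rels_def by (auto simp: carrier_fld)

lemma prod_rep_rels:
  assumes r: "r \<in> rels" and ab: "a \<in> carrier A" "b \<in> carrier B"
  shows "prod_rep r (frag_of (a, b)) \<in> N" "prod_rep (frag_of (a, b)) r \<in> N"
proof -
  have "prod_rep r (frag_of (a, b)) \<in> N \<and> prod_rep (frag_of (a, b)) r \<in> N"
    using r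
  proof (cases rule: relsE)
    case (1 x y z)
    then show ?thesis using N_addl ab
      by (simp add: prod_rep_diffl prod_rep_diffr prod_rep_addl prod_rep_addr prod_rep_of RA.l_distr RA.r_distr)
  next
    case (2 x y z)
    then show ?thesis using N_addr ab
      by (simp add: prod_rep_diffl prod_rep_diffr prod_rep_addl prod_rep_addr prod_rep_of RB.l_distr RB.r_distr)
  next
    case (3 l x y)
    then show ?thesis using N_bal ab
      by (simp add: prod_rep_diffl prod_rep_diffr prod_rep_of A_smultl A_smultr B_smultl B_smultr)
  qed
  then show "prod_rep r (frag_of (a, b)) \<in> N" "prod_rep (frag_of (a, b)) r \<in> N" by auto
qed

lemma prod_rep_minus: "prod_rep (- x) z = - prod_rep x z" "prod_rep z (- x) = - prod_rep z x"
  using prod_rep_diffl[of 0 x z] prod_rep_diffr[of z 0 x] by (simp_all add: prod_rep_zero)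

text \<open>The relations form a two-sided ideal, which makes multiplication independent of
  representatives. By bilinearity it is enough to multiply each type of relation by a pure
  tensor.\<close>

lemma prod_rep_N:
  assumes x: "x \<in> N" and y: "y \<in> carrier FG"
  shows "prod_rep x y \<in> N \<and> prod_rep y x \<in> N"
  using x
proof (rule N_induct)
  fix r assume r: "r \<in> rels"
  show "prod_rep r y \<in> N \<and> prod_rep y r \<in> N" using y
    by (rule free_induct) (use prod_rep_rels[OF r] in \<open>auto simp: prod_rep_zero prod_rep_diffl prod_rep_diffr N_zero N_diff\<close>)
qed (auto simp: prod_rep_zero prod_rep_minus prod_rep_addl prod_rep_addr N_zero N_minus N_add)

lemma scal_rep_simps: "scal_rep r 0 = 0" "scal_rep r (x - y) = scal_rep r x - scal_rep r y"
  "scal_rep r (x + y) = scal_rep r x + scal_rep r y" "scal_rep r (- x) = - scal_rep r x"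
  "scal_rep r (frag_of (a, b)) = frag_of (r \<odot>\<^bsub>A\<^esub> a, b)"
  by (simp_all add: scal_rep_def frag_extend_diff frag_extend_add frag_extend_minus)

lemma scal_rep_N:
  assumes s: "s \<in> S" and x: "x \<in> N" shows "scal_rep s x \<in> N"
  using x
proof (rule N_induct)
  fix r assume "r \<in> rels"
  then show "scal_rep s r \<in> N"
  proof (cases rule: relsE)
    case (1 x y z)
    then show ?thesis using N_addl S_closed[OF s] by (simp add: scal_rep_simps S_add[OF s])
  next
    case (2 x y z)
    then show ?thesis using N_addr S_closed[OF s] by (simp add: scal_rep_simps)
  next
    case (3 l x y)
    then show ?thesis using N_bal S_closed[OF s] by (simp add: scal_rep_simps S_comm[OF s])
  qed
qed (auto simp: scal_rep_simps N_zero N_minus N_add)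

definition "cls x = N #>\<^bsub>FG\<^esub> x"

lemma in_cls: "y \<in> cls x \<longleftrightarrow> y - x \<in> N"
  unfolding cls_def r_coset_def by (auto intro!: bexI[of _ "y - x"])

lemma cls_eqI: "x - y \<in> N \<Longrightarrow> cls x = cls y"
proof -
  assume xy: "x - y \<in> N"
  have "z - x \<in> N \<longleftrightarrow> z - y \<in> N" for z
    using N_add[OF _ xy, of "z - x"] N_diff[OF _ xy, of "z - y"] by (auto simp: algebra_simps)
  then show ?thesis by (auto simp: in_cls)
qed

lemma cls_self: "x \<in> cls x" by (simp add: in_cls N_zero)

lemma cls_FG: "\<lbrakk>x \<in> carrier FG; y \<in> cls x\<rbrakk> \<Longrightarrow> y \<in> carrier FG"
  using N_FG add_FG[of "y - x" x] by (auto simp: in_cls simp del: carrier_free_Abelian_group_iff)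

lemma T_carrier: "carrier T = cls ` carrier FG"
  unfolding tensor_alg_def Let_def FactGroup_def RCOSETS_def cls_def by auto

lemma T_add: "\<lbrakk>x \<in> carrier FG; y \<in> carrier FG\<rbrakk> \<Longrightarrow> cls x \<oplus>\<^bsub>T\<^esub> cls y = cls (x + y)"
proof -
  have "(\<exists>u\<in>cls x. \<exists>v\<in>cls y. z = u + v) \<longleftrightarrow> z \<in> cls (x + y)" for z
  proof
    assume "\<exists>u\<in>cls x. \<exists>v\<in>cls y. z = u + v"
    then obtain u v where "u \<in> cls x" "v \<in> cls y" "z = u + v" by auto
    then show "z \<in> cls (x + y)" using N_add[of "u - x" "v - y"] by (simp add: in_cls algebra_simps)
  next
    assume "z \<in> cls (x + y)"
    then have "z - y \<in> cls x" by (simp add: in_cls algebra_simps)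
    then show "\<exists>u\<in>cls x. \<exists>v\<in>cls y. z = u + v" using cls_self[of y] by (intro bexI[of _ "z - y"] bexI[of _ y]) auto
  qed
  then have "cls x <#>\<^bsub>FG\<^esub> cls y = cls (x + y)" unfolding set_mult_def by auto
  then show ?thesis by (simp add: tensor_alg_def Let_def FactGroup_def)
qed

lemma T_mult:
  assumes x: "x \<in> carrier FG" and y: "y \<in> carrier FG"
  shows "cls x \<otimes>\<^bsub>T\<^esub> cls y = cls (prod_rep x y)"
proof -
  have e: "cls (prod_rep u v) = cls (prod_rep x y)" if u: "u \<in> cls x" and v: "v \<in> cls y" for u v
  proof (rule cls_eqI)
    have "prod_rep u v - prod_rep x y = prod_rep (u - x) v + prod_rep x (v - y)"
      by (simp add: prod_rep_diffl prod_rep_diffr)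
    also have "\<dots> \<in> N" using prod_rep_N u v x cls_FG[OF y v] by (intro N_add) (auto simp: in_cls)
    finally show "prod_rep u v - prod_rep x y \<in> N" .
  qed
  have "cls x \<otimes>\<^bsub>T\<^esub> cls y = (\<Union>u\<in>cls x. \<Union>v\<in>cls y. cls (prod_rep u v))"
    by (simp add: tensor_alg_def Let_def prod_rep_def cls_def)
  also have "\<dots> = (\<Union>u\<in>cls x. \<Union>v\<in>cls y. cls (prod_rep x y))" using e by (intro SUP_cong refl)
  finally show ?thesis using cls_self[of x] cls_self[of y] by auto
qed

lemma T_smult:
  assumes s: "s \<in> S" and x: "x \<in> carrier FG"
  shows "s \<odot>\<^bsub>T\<^esub> cls x = cls (scal_rep s x)"
proof -
  have e: "cls (scal_rep s u) = cls (scal_rep s x)" if u: "u \<in> cls x" for u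
    using scal_rep_N[OF s] u by (intro cls_eqI) (simp add: in_cls scal_rep_simps(2)[symmetric])
  have "s \<odot>\<^bsub>T\<^esub> cls x = (\<Union>u\<in>cls x. cls (scal_rep s u))"
    by (simp add: tensor_alg_def Let_def scal_rep_def cls_def)
  also have "\<dots> = (\<Union>u\<in>cls x. cls (scal_rep s x))" using e by (intro SUP_cong refl)
  finally show ?thesis using cls_self[of x] by auto
qed

definition "ten a b = cls (frag_of (a, b))"

lemma ten_closed: "\<lbrakk>a \<in> carrier A; b \<in> carrier B\<rbrakk> \<Longrightarrow> ten a b \<in> carrier T"
  unfolding T_carrier ten_def by (intro imageI) simp
lemma ten_addl: "\<lbrakk>a \<in> carrier A; a' \<in> carrier A; b \<in> carrier B\<rbrakk> \<Longrightarrow> ten (a \<oplus>\<^bsub>A\<^esub> a') b = ten a b \<oplus>\<^bsub>T\<^esub> ten a' b"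
  unfolding ten_def by (subst T_add) (simp_all add: cls_eqI[OF N_addl])
lemma ten_addr: "\<lbrakk>a \<in> carrier A; b \<in> carrier B; b' \<in> carrier B\<rbrakk> \<Longrightarrow> ten a (b \<oplus>\<^bsub>B\<^esub> b') = ten a b \<oplus>\<^bsub>T\<^esub> ten a b'"
  unfolding ten_def by (subst T_add) (simp_all add: cls_eqI[OF N_addr])
lemma ten_bal: "\<lbrakk>r \<in> L; a \<in> carrier A; b \<in> carrier B\<rbrakk> \<Longrightarrow> ten (r \<odot>\<^bsub>A\<^esub> a) b = ten a (r \<odot>\<^bsub>B\<^esub> b)"
  unfolding ten_def by (intro cls_eqI N_bal)
lemma ten_smult: "\<lbrakk>s \<in> S; a \<in> carrier A; b \<in> carrier B\<rbrakk> \<Longrightarrow> s \<odot>\<^bsub>T\<^esub> ten a b = ten (s \<odot>\<^bsub>A\<^esub> a) b"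
  unfolding ten_def by (simp add: T_smult scal_rep_simps)
lemma ten_mult: "\<lbrakk>a \<in> carrier A; a' \<in> carrier A; b \<in> carrier B; b' \<in> carrier B\<rbrakk>
    \<Longrightarrow> ten a b \<otimes>\<^bsub>T\<^esub> ten a' b' = ten (a \<otimes>\<^bsub>A\<^esub> a') (b \<otimes>\<^bsub>B\<^esub> b')"
  unfolding ten_def by (simp add: T_mult prod_rep_of)
lemma ten_one: "\<one>\<^bsub>T\<^esub> = ten \<one>\<^bsub>A\<^esub> \<one>\<^bsub>B\<^esub>"
  by (simp add: tensor_alg_def Let_def ten_def cls_def)
lemma ten_zerol: "b \<in> carrier B \<Longrightarrow> ten \<zero>\<^bsub>A\<^esub> b = cls 0"
  unfolding ten_def by (intro cls_eqI) (simp add: N_zerol)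
lemma ten_zeror: "a \<in> carrier A \<Longrightarrow> ten a \<zero>\<^bsub>B\<^esub> = cls 0"
  unfolding ten_def by (intro cls_eqI) (simp add: N_zeror)
lemma T_zero: "\<zero>\<^bsub>T\<^esub> = cls 0"
proof -
  have "cls 0 = N" using in_cls[of _ 0] by auto
  then show ?thesis by (simp add: tensor_alg_def Let_def FactGroup_def)
qed
text \<open>Induction over finite sums of pure tensors; the class of 0 is the empty sum.\<close>

lemma T_induct:
  assumes t: "t \<in> carrier T" and z: "Q (cls 0)"
    and add: "\<And>x y. \<lbrakk>x \<in> carrier T; y \<in> carrier T; Q x; Q y\<rbrakk> \<Longrightarrow> Q (x \<oplus>\<^bsub>T\<^esub> y)"
    and ten: "\<And>a b. \<lbrakk>a \<in> carrier A; b \<in> carrier B\<rbrakk> \<Longrightarrow> Q (ten a b)"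
  shows "Q t"
proof -
  obtain x where x: "x \<in> carrier FG" "t = cls x" using t by (auto simp: T_carrier simp del: carrier_free_Abelian_group_iff)
  obtain n :: nat and a b where r: "\<forall>i<n. a i \<in> carrier A \<and> b i \<in> carrier B" "x - (\<Sum>i<n. frag_of (a i, b i)) \<in> N"
    using represent[OF x(1)] by blast
  have "k \<le> n \<Longrightarrow> (\<Sum>i<k. frag_of (a i, b i)) \<in> carrier FG \<and> Q (cls (\<Sum>i<k. frag_of (a i, b i)))" for k
  proof (induction k)
    case 0
    then show ?case using z by simp
  next
    case (Suc k)
    let ?s = "\<Sum>i<k. frag_of (a i, b i)"
    have k: "a k \<in> carrier A" "b k \<in> carrier B" "?s \<in> carrier FG" "Q (cls ?s)" using Suc r by auto
    have f: "frag_of (a k, b k) \<in> carrier FG" using k by simp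
    have "cls (?s + frag_of (a k, b k)) = cls ?s \<oplus>\<^bsub>T\<^esub> ten (a k) (b k)"
      unfolding ten_def by (rule T_add[OF k(3) f, symmetric])
    moreover have "Q (cls ?s \<oplus>\<^bsub>T\<^esub> ten (a k) (b k))"
      by (rule add) (use k ten ten_closed T_carrier in auto)
    ultimately show ?case using add_FG[OF k(3) f] by simp
  qed
  from this[of n] show ?thesis unfolding x(2) using cls_eqI[OF r(2)] by simp
qed

end

section \<open>Matrices over a quadratic extension\<close>

text \<open>The side conditions here and below are equations between dimensions, in a form that the
  simplifier discharges from the dimensions of the factors.\<close>

lemma mm_assoc: "\<lbrakk>dim_col A = dim_row B; dim_col B = dim_row C\<rbrakk>
    \<Longrightarrow> A * B * C = A * (B * (C :: 'a::semiring_0 mat))"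
  by (rule assoc_mult_mat[of A "dim_row A" "dim_col A" B "dim_col B" C "dim_col C"]) auto

lemma mm_distl: "\<lbrakk>dim_row A = dim_row B; dim_col A = dim_col B; dim_col B = dim_row C\<rbrakk>
    \<Longrightarrow> (A + B) * C = A * C + B * (C :: 'a::semiring_0 mat)"
  by (rule add_mult_distrib_mat[of A "dim_row A" "dim_col A" B C "dim_col C"]) auto

lemma mm_distr: "\<lbrakk>dim_row B = dim_row C; dim_col B = dim_col C; dim_col A = dim_row C\<rbrakk>
    \<Longrightarrow> A * (B + C) = A * B + A * (C :: 'a::semiring_0 mat)"
  by (rule mult_add_distrib_mat[of A "dim_row A" "dim_col A" B "dim_col B" C]) auto

lemma mm_smultl: "dim_col A = dim_row B \<Longrightarrow> (k \<cdot>\<^sub>m A) * B = k \<cdot>\<^sub>m (A * (B :: 'a::comm_semiring_0 mat))"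
  by (rule mult_smult_assoc_mat[of A "dim_row A" "dim_col A" B "dim_col B"]) auto

lemma mm_smultr: "dim_col A = dim_row B \<Longrightarrow> A * (k \<cdot>\<^sub>m B) = k \<cdot>\<^sub>m (A * (B :: 'a::comm_semiring_0 mat))"
  by (rule mult_smult_distrib[of A "dim_row A" "dim_col A" B "dim_col B"]) auto

lemma smult_smultm: "a \<cdot>\<^sub>m (b \<cdot>\<^sub>m A) = (a * b) \<cdot>\<^sub>m (A :: 'a::comm_semiring_0 mat)"
  by (rule eq_matI) (auto simp: mult.assoc)

lemma smult_addm: "\<lbrakk>dim_row A = dim_row B; dim_col A = dim_col B\<rbrakk>
    \<Longrightarrow> k \<cdot>\<^sub>m (A + B) = k \<cdot>\<^sub>m A + k \<cdot>\<^sub>m (B :: 'a::comm_semiring_0 mat)"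
  by (rule eq_matI) (auto simp: distrib_left)

lemma smult_onem: "1 \<cdot>\<^sub>m A = (A :: 'a::comm_semiring_1 mat)"
  by (rule eq_matI) auto

lemma addm_assoc: "\<lbrakk>dim_row A = dim_row B; dim_col A = dim_col B; dim_row B = dim_row C; dim_col B = dim_col C\<rbrakk>
    \<Longrightarrow> (A + B) + C = A + (B + (C :: 'a::semigroup_add mat))"
  by (rule eq_matI) (auto simp: add.assoc)

lemmas mm_simps = mm_assoc mm_distl mm_distr mm_smultl mm_smultr smult_smultm smult_addm

text \<open>The Kronecker product. An index splits into its quotient, which addresses the block
  through \<open>M\<close>, and its remainder, which addresses the entry of \<open>Z\<close> inside
  the block.\<close>

definition kron :: "'a::semiring_0 mat \<Rightarrow> 'a mat \<Rightarrow> 'a mat" where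
  "kron M Z = mat (dim_row M * dim_row Z) (dim_col M * dim_col Z)
     (\<lambda>(i, j). M $$ (i div dim_row Z, j div dim_col Z) * Z $$ (i mod dim_row Z, j mod dim_col Z))"

lemma dim_kron [simp]: "dim_row (kron M Z) = dim_row M * dim_row Z" "dim_col (kron M Z) = dim_col M * dim_col Z"
  by (simp_all add: kron_def)

lemma div_mod_bounds:
  assumes "i < a * (b::nat)" shows "i div b < a" "i mod b < b"
proof -
  show "i div b < a" using assms by (simp add: less_mult_imp_div_less)
  have "0 < b" using assms by (cases b) auto
  then show "i mod b < b" by simp
qed

lemma index_kron: "\<lbrakk>i < dim_row M * dim_row Z; j < dim_col M * dim_col Z\<rbrakk> \<Longrightarrow>
    kron M Z $$ (i, j) = M $$ (i div dim_row Z, j div dim_col Z) * Z $$ (i mod dim_row Z, j mod dim_col Z)"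
  by (simp add: kron_def)

text \<open>Lexicographic enumeration of pairs. It splits the sum defining an entry of a product of
  Kronecker products into a product of two sums.\<close>

lemma sum_div_mod: "(\<Sum>k<a * (b::nat). f (k div b) (k mod b)) = (\<Sum>i<a. \<Sum>j<b. f i j)"
  for f :: "nat \<Rightarrow> nat \<Rightarrow> 'c::comm_monoid_add"
proof (induction a)
  case (Suc a)
  have "(\<Sum>k<Suc a * b. f (k div b) (k mod b)) = (\<Sum>k<a * b + b. f (k div b) (k mod b))"
    by (simp add: add.commute)
  also have "\<dots> = (\<Sum>k<a * b. f (k div b) (k mod b)) + (\<Sum>j<b. f ((a * b + j) div b) ((a * b + j) mod b))"
  proof -
    have "(\<Sum>k<n + m. g k) = (\<Sum>k<n. g k) + (\<Sum>j<m. g (n + j))" for n m and g :: "nat \<Rightarrow> 'c"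
      by (induction m) (auto simp: add.assoc)
    then show ?thesis .
  qed
  also have "(\<Sum>j<b. f ((a * b + j) div b) ((a * b + j) mod b)) = (\<Sum>j<b. f a j)"
    by (intro sum.cong) auto
  finally show ?case using Suc by simp
qed simp

lemma kron_mult:
  assumes "dim_col M = dim_row M'" "dim_col Z = dim_row Z'"
  shows "kron M Z * kron M' Z' = kron (M * M') (Z * (Z' :: 'a::comm_semiring_0 mat))"
proof (rule eq_matI)
  fix i j assume "i < dim_row (kron (M * M') (Z * Z'))" "j < dim_col (kron (M * M') (Z * Z'))"
  then have ij: "i < dim_row M * dim_row Z" "j < dim_col M' * dim_col Z'" by simp_all
  note b = div_mod_bounds[OF ij(1)] div_mod_bounds[OF ij(2)]
  have "(kron M Z * kron M' Z') $$ (i, j) = (\<Sum>k<dim_col M * dim_col Z. kron M Z $$ (i, k) * kron M' Z' $$ (k, j))"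
    using ij assms by (simp add: scalar_prod_def atLeast0LessThan)
  also have "\<dots> = (\<Sum>k<dim_col M * dim_col Z.
      (\<lambda>u v. (M $$ (i div dim_row Z, u) * Z $$ (i mod dim_row Z, v)) *
        (M' $$ (u, j div dim_col Z') * Z' $$ (v, j mod dim_col Z'))) (k div dim_col Z) (k mod dim_col Z))"
    using ij assms by (intro sum.cong) (auto simp: index_kron)
  also have "\<dots> = (\<Sum>u<dim_col M. \<Sum>v<dim_col Z. (M $$ (i div dim_row Z, u) * Z $$ (i mod dim_row Z, v)) *
        (M' $$ (u, j div dim_col Z') * Z' $$ (v, j mod dim_col Z')))"
    by (rule sum_div_mod)
  also have "\<dots> = (\<Sum>u<dim_col M. M $$ (i div dim_row Z, u) * M' $$ (u, j div dim_col Z')) *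
     (\<Sum>v<dim_col Z. Z $$ (i mod dim_row Z, v) * Z' $$ (v, j mod dim_col Z'))"
    unfolding sum_product by (intro sum.cong refl) (simp add: ac_simps)
  also have "\<dots> = (M * M') $$ (i div dim_row Z, j div dim_col Z') * (Z * Z') $$ (i mod dim_row Z, j mod dim_col Z')"
    using b assms by (simp add: scalar_prod_def atLeast0LessThan)
  also have "\<dots> = kron (M * M') (Z * Z') $$ (i, j)" using ij by (simp add: index_kron)
  finally show "(kron M Z * kron M' Z') $$ (i, j) = kron (M * M') (Z * Z') $$ (i, j)" .
qed (use assms in auto)

lemma kron_addl: "\<lbrakk>dim_row M = dim_row M'; dim_col M = dim_col M'\<rbrakk> \<Longrightarrow> kron (M + M') Z = kron M Z + kron M' Z"
  by (rule eq_matI) (auto simp: index_kron div_mod_bounds distrib_right)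

lemma kron_addr: "\<lbrakk>dim_row Z = dim_row Z'; dim_col Z = dim_col Z'\<rbrakk> \<Longrightarrow> kron M (Z + Z') = kron M Z + kron M Z'"
  by (rule eq_matI) (auto simp: index_kron div_mod_bounds distrib_left)

lemma kron_smultl: "kron (k \<cdot>\<^sub>m M) Z = k \<cdot>\<^sub>m kron M (Z :: 'a::comm_semiring_0 mat)"
  by (rule eq_matI) (auto simp: index_kron div_mod_bounds mult.assoc)

lemma kron_smultr: "kron M (k \<cdot>\<^sub>m Z) = k \<cdot>\<^sub>m kron M (Z :: 'a::comm_semiring_0 mat)"
  by (rule eq_matI) (auto simp: index_kron div_mod_bounds ac_simps)

lemma kron_one: "kron (1\<^sub>m m) (1\<^sub>m n) = (1\<^sub>m (m * n) :: 'a::comm_semiring_1 mat)"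
proof (rule eq_matI)
  fix i j assume "i < dim_row (1\<^sub>m (m * n) :: 'a mat)" "j < dim_col (1\<^sub>m (m * n) :: 'a mat)"
  then have ij: "i < m * n" "j < m * n" by simp_all
  have "i = j \<longleftrightarrow> i div n = j div n \<and> i mod n = j mod n" by (metis mult_div_mod_eq)
  then show "kron (1\<^sub>m m) (1\<^sub>m n) $$ (i, j) = (1\<^sub>m (m * n) :: 'a mat) $$ (i, j)"
    using ij div_mod_bounds[OF ij(1)] div_mod_bounds[OF ij(2)] by (auto simp: index_kron)
qed auto

text \<open>\<open>L\<close> is the fixed field in \<open>E\<close> of the conjugation
  \<open>sg\<close>. The map \<open>sg\<close> lives on the whole ambient field, because later it is
  an automorphism of \<open>K\<close>, and is required to be an involution on \<open>E\<close>. The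
  element \<open>om\<close> is any element of \<open>E\<close> that is moved; 1 and
  \<open>om\<close> then form a basis over \<open>L\<close> in every characteristic.\<close>

locale quad =
  fixes L E :: "'a::field set" and sg :: "'a \<Rightarrow> 'a" and om :: 'a
  assumes sg_add: "sg (x + y) = sg x + sg y" and sg_mult: "sg (x * y) = sg x * sg y" and sg_one: "sg 1 = 1"
    and E_one: "1 \<in> E" and E_add: "\<lbrakk>x \<in> E; y \<in> E\<rbrakk> \<Longrightarrow> x + y \<in> E" and E_mult: "\<lbrakk>x \<in> E; y \<in> E\<rbrakk> \<Longrightarrow> x * y \<in> E"
    and E_minus: "x \<in> E \<Longrightarrow> - x \<in> E" and E_inv: "x \<in> E \<Longrightarrow> inverse x \<in> E"
    and sg_E: "x \<in> E \<Longrightarrow> sg x \<in> E" and sg_sg: "x \<in> E \<Longrightarrow> sg (sg x) = x"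
    and L_eq: "L = {x \<in> E. sg x = x}"
    and om: "om \<in> E" "sg om \<noteq> om"
begin

lemma sg_zero: "sg 0 = 0" by (metis add.right_neutral add_left_cancel sg_add)
lemma sg_minus: "sg (- x) = - sg x" using sg_add[of x "- x"] by (simp add: sg_zero eq_neg_iff_add_eq_0 add.commute)
lemma sg_diff: "sg (x - y) = sg x - sg y" using sg_add[of x "- y"] by (simp add: sg_minus)
lemma sg_inv: "sg (inverse x) = inverse (sg x)"
proof (cases "x = 0")
  case False
  then have "sg x * sg (inverse x) = 1" using sg_mult[of x "inverse x"] by (simp add: sg_one)
  then show ?thesis by (metis inverse_unique)
qed (simp add: sg_zero)
lemma sg_eq_0: "sg x = 0 \<longleftrightarrow> x = 0"
proof
  assume "sg x = 0"
  show "x = 0"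
  proof (rule ccontr)
    assume "x \<noteq> 0"
    then have "sg x * sg (inverse x) = 1" using sg_mult[of x "inverse x"] by (simp add: sg_one)
    then show False using \<open>sg x = 0\<close> by simp
  qed
qed (simp add: sg_zero)

sublocale hom: comm_ring_hom sg
  by unfold_locales (auto simp: sg_add sg_mult sg_one sg_zero)

lemma E_zero: "0 \<in> E" using E_add[OF E_one E_minus[OF E_one]] by simp
lemma E_diff: "\<lbrakk>x \<in> E; y \<in> E\<rbrakk> \<Longrightarrow> x - y \<in> E" using E_add[of x "- y"] E_minus by simp
lemma E_div: "\<lbrakk>x \<in> E; y \<in> E\<rbrakk> \<Longrightarrow> x / y \<in> E" using E_mult[of x "inverse y"] E_inv by (simp add: divide_inverse)
lemma E_sum: "(\<And>i. i \<in> I \<Longrightarrow> f i \<in> E) \<Longrightarrow> sum f I \<in> E"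
  by (induction I rule: infinite_finite_induct) (auto intro: E_zero E_add)

lemma L_E: "x \<in> L \<Longrightarrow> x \<in> E" by (simp add: L_eq)
lemma L_sg: "x \<in> L \<Longrightarrow> sg x = x" by (simp add: L_eq)
lemma L_zero: "0 \<in> L" and L_one: "1 \<in> L" by (simp_all add: L_eq E_zero E_one sg_zero sg_one)
lemma L_add: "\<lbrakk>x \<in> L; y \<in> L\<rbrakk> \<Longrightarrow> x + y \<in> L" by (simp add: L_eq E_add sg_add)
lemma L_mult: "\<lbrakk>x \<in> L; y \<in> L\<rbrakk> \<Longrightarrow> x * y \<in> L" by (simp add: L_eq E_mult sg_mult)
lemma L_minus: "x \<in> L \<Longrightarrow> - x \<in> L" by (simp add: L_eq E_minus sg_minus)
lemma L_inv: "x \<in> L \<Longrightarrow> inverse x \<in> L" by (simp add: L_eq E_inv sg_inv)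

definition "del = om - sg om"
lemma del: "del \<in> E" "del \<noteq> 0" "sg del = - del"
  using om by (auto simp: del_def E_diff sg_E sg_diff sg_sg)

text \<open>Coordinates with respect to 1 and \<open>om\<close>: solving x = u + v om together with
  its conjugate sg x = u + v sg(om) gives this quotient for v.\<close>

definition "imE x = (x - sg x) / del"
definition "reE x = x - imE x * om"

lemma imE_L: "x \<in> E \<Longrightarrow> imE x \<in> L"
  by (simp add: imE_def L_eq E_div E_mult E_inv E_diff sg_E del sg_mult sg_inv sg_diff sg_sg divide_inverse algebra_simps)
lemma reE_L: assumes "x \<in> E" shows "reE x \<in> L"
proof -
  have v: "imE x \<in> L" by (rule imE_L[OF assms])
  have "sg (reE x) = sg x - imE x * sg om" by (simp add: reE_def sg_diff sg_mult L_sg[OF v])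
  also have "\<dots> = reE x" using del(2) by (simp add: reE_def imE_def field_simps) (simp add: del_def algebra_simps)
  finally show ?thesis using assms v om by (simp add: L_eq reE_def E_diff E_mult)
qed
lemma re_im: "x = reE x + imE x * om" by (simp add: reE_def)
lemma module_fld_cring: "cring (fld L)"
proof (rule cringI)
  show "abelian_group (fld L)"
    by (rule abelian_groupI) (auto simp: fld_def L_add L_zero algebra_simps intro: bexI[of _ "- x" for x] L_minus)
  show "Group.comm_monoid (fld L)"
    by (rule comm_monoidI) (auto simp: fld_def L_mult L_one algebra_simps)
qed (auto simp: fld_def algebra_simps)

section \<open>Matrices over E, their conjugation and descent\<close>

definition "EM r c = {M \<in> carrier_mat r c. \<forall>i<r. \<forall>j<c. M $$ (i, j) \<in> E}"

abbreviation "smat \<equiv> map_mat sg"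

lemma EMD: assumes "M \<in> EM r c" shows "dim_row M = r" "dim_col M = c" "M \<in> carrier_mat r c"
    "\<lbrakk>i < r; j < c\<rbrakk> \<Longrightarrow> M $$ (i, j) \<in> E"
  using assms by (auto simp: EM_def)

lemma EM_add: "\<lbrakk>M \<in> EM r c; Z \<in> EM r c\<rbrakk> \<Longrightarrow> M + Z \<in> EM r c" by (auto simp: EM_def E_add)
lemma EM_smult: "\<lbrakk>M \<in> EM r c; k \<in> E\<rbrakk> \<Longrightarrow> k \<cdot>\<^sub>m M \<in> EM r c" by (auto simp: EM_def E_mult)
lemma EM_mult: "\<lbrakk>M \<in> EM r m; Z \<in> EM m c\<rbrakk> \<Longrightarrow> M * Z \<in> EM r c"
  by (auto simp: EM_def scalar_prod_def intro!: E_sum E_mult)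
lemma EM_zero: "0\<^sub>m r c \<in> EM r c" by (auto simp: EM_def E_zero)
lemma EM_one: "1\<^sub>m n \<in> EM n n" by (auto simp: EM_def E_zero E_one)
lemma EM_smat: "M \<in> EM r c \<Longrightarrow> smat M \<in> EM r c" by (auto simp: EM_def sg_E)
lemma EM_kron: assumes "M \<in> EM r c" "Z \<in> EM p q" shows "kron M Z \<in> EM (r * p) (c * q)"
  using EMD[OF assms(1)] EMD[OF assms(2)] by (auto simp: EM_def index_kron div_mod_bounds intro!: E_mult)

lemma smat_mult: "dim_col M = dim_row Z \<Longrightarrow> smat (M * Z) = smat M * smat Z"
  by (rule hom.mat_hom_mult[of M "dim_row M" "dim_col M" Z "dim_col Z"]) auto
lemma smat_add: "\<lbrakk>dim_row M = dim_row Z; dim_col M = dim_col Z\<rbrakk> \<Longrightarrow> smat (M + Z) = smat M + smat Z"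
  by (rule eq_matI) (auto simp: sg_add)
lemma smat_smult: "smat (k \<cdot>\<^sub>m M) = sg k \<cdot>\<^sub>m smat M" by (rule eq_matI) (auto simp: sg_mult)
lemma smat_one: "smat (1\<^sub>m n) = 1\<^sub>m n" by (rule eq_matI) (auto simp: sg_one sg_zero)
lemma smat_zero: "smat (0\<^sub>m r c) = 0\<^sub>m r c" by (rule eq_matI) (auto simp: sg_zero)
lemma smat_smat: "M \<in> EM r c \<Longrightarrow> smat (smat M) = M" by (rule eq_matI) (auto simp: EM_def sg_sg)
lemma smat_kron: "smat (kron M Z) = kron (smat M) (smat Z)"
  by (rule eq_matI) (auto simp: index_kron div_mod_bounds sg_mult)

text \<open>The \<open>L\<close>-form of \<open>M\<^sub>n(E)\<close> fixed by the semilinear map \<open>M \<mapsto> P \<sigma>(M) P\<^sup>-\<^sup>1\<close>; the condition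
  \<open>tw\<close> below makes this map an involution.\<close>

definition twist :: "nat \<Rightarrow> 'a mat \<Rightarrow> ('a, 'a mat) module" where
  "twist n P = \<lparr> carrier = {M \<in> EM n n. P * smat M = M * P}, monoid.mult = (*), one = 1\<^sub>m n,
     ring.zero = 0\<^sub>m n n, ring.add = (+), smult = (\<cdot>\<^sub>m) \<rparr>"

lemma twist_simps [simp]:
  "monoid.mult (twist n P) = (*)" "one (twist n P) = 1\<^sub>m n" "ring.zero (twist n P) = 0\<^sub>m n n"
  "ring.add (twist n P) = (+)" "smult (twist n P) = (\<cdot>\<^sub>m)"
  by (simp_all add: twist_def)

lemma twist_carrier: "M \<in> carrier (twist n P) \<longleftrightarrow> M \<in> EM n n \<and> P * smat M = M * P"
  by (simp add: twist_def)

text \<open>The semilinear operator v \<mapsto> P sg(v) on E^n has the scalar \<open>c\<close> as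
  its square. This \<open>c\<close>, up to norms, is the invariant that will parametrise both
  sides.\<close>

definition "tw n P c \<longleftrightarrow> n \<ge> 1 \<and> P \<in> EM n n \<and> c \<in> L \<and> c \<noteq> 0 \<and> P * smat P = c \<cdot>\<^sub>m 1\<^sub>m n"

lemma twD: assumes "tw n P c"
  shows "n \<ge> 1" "P \<in> EM n n" "c \<in> L" "c \<noteq> 0" "P * smat P = c \<cdot>\<^sub>m 1\<^sub>m n" "smat P * P = c \<cdot>\<^sub>m 1\<^sub>m n"
    "dim_row P = n" "dim_col P = n"
proof -
  show a: "n \<ge> 1" "P \<in> EM n n" "c \<in> L" "c \<noteq> 0" "P * smat P = c \<cdot>\<^sub>m 1\<^sub>m n" using assms by (auto simp: tw_def)
  show d: "dim_row P = n" "dim_col P = n" using EMD[OF a(2)] by auto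
  \<comment> \<open>Conjugating the relation gives it with the factors exchanged, because
    \<open>c\<close> is fixed by \<open>sg\<close>.\<close>
  have "smat (P * smat P) = smat P * P" using a(2) d by (simp add: smat_mult smat_smat[OF a(2)])
  then show "smat P * P = c \<cdot>\<^sub>m 1\<^sub>m n" by (simp add: a(5) smat_smult smat_one L_sg[OF a(3)])
qed

lemma twist_ring_alg:
  assumes P: "P \<in> EM n n"
  shows "ring_alg L (twist n P)"
proof -
  note Pd = EMD[OF P]
  have cl: "M + Z \<in> carrier (twist n P)" "M * Z \<in> carrier (twist n P)"
    if "M \<in> carrier (twist n P)" "Z \<in> carrier (twist n P)" for M Z
  proof -
    have m: "M \<in> EM n n" "Z \<in> EM n n" "P * smat M = M * P" "P * smat Z = Z * P" using that by (auto simp: twist_carrier)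
    note d = EMD[OF m(1)] EMD[OF m(2)]
    show "M + Z \<in> carrier (twist n P)" using m d Pd by (simp add: twist_carrier EM_add smat_add mm_distl mm_distr)
    have "P * smat (M * Z) = (P * smat M) * smat Z" using d Pd by (simp add: smat_mult mm_assoc)
    also have "\<dots> = M * (P * smat Z)" using d Pd by (simp add: m(3) mm_assoc)
    also have "\<dots> = (M * Z) * P" using d Pd by (simp add: m(4) mm_assoc)
    finally show "M * Z \<in> carrier (twist n P)" using m by (simp add: twist_carrier EM_mult)
  qed
  have sm: "k \<cdot>\<^sub>m M \<in> carrier (twist n P)" if "k \<in> L" "M \<in> carrier (twist n P)" for k M
    using that Pd EMD[of M n n] by (auto simp: twist_carrier EM_smult L_E smat_smult L_sg mm_smultl mm_smultr)
  have z: "0\<^sub>m n n \<in> carrier (twist n P)" using Pd by (simp add: twist_carrier EM_zero smat_zero)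
  have o: "1\<^sub>m n \<in> carrier (twist n P)" using Pd by (simp add: twist_carrier EM_one smat_one)
  have dm: "dim_row M = n \<and> dim_col M = n \<and> M \<in> carrier_mat n n" if "M \<in> carrier (twist n P)" for M
    using that EMD[of M n n] by (auto simp: twist_carrier)
  have neg: "\<exists>Z\<in>carrier (twist n P). Z + M = 0\<^sub>m n n" if "M \<in> carrier (twist n P)" for M
  proof
    show "(-1) \<cdot>\<^sub>m M \<in> carrier (twist n P)" using sm[OF _ that] L_minus[OF L_one] by simp
    show "(-1) \<cdot>\<^sub>m M + M = 0\<^sub>m n n" using dm[OF that] by (intro eq_matI) auto
  qed
  have ag: "abelian_group (twist n P)"
  proof (rule abelian_groupI)
    fix M Z W assume "M \<in> carrier (twist n P)" "Z \<in> carrier (twist n P)" "W \<in> carrier (twist n P)"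
    then show "M \<oplus>\<^bsub>twist n P\<^esub> Z \<oplus>\<^bsub>twist n P\<^esub> W = M \<oplus>\<^bsub>twist n P\<^esub> (Z \<oplus>\<^bsub>twist n P\<^esub> W)" using dm by (simp add: addm_assoc)
  next
    fix M Z assume "M \<in> carrier (twist n P)" "Z \<in> carrier (twist n P)"
    then show "M \<oplus>\<^bsub>twist n P\<^esub> Z = Z \<oplus>\<^bsub>twist n P\<^esub> M"
      using dm by (simp add: comm_add_mat[of M n n Z])
  qed (use cl z dm neg in auto)
  have "ring (twist n P)"
  proof (rule ringI[OF ag])
    show "Group.monoid (twist n P)"
      by (rule monoidI) (use cl o dm in \<open>simp_all add: mm_assoc\<close>)
  qed (use dm in \<open>simp_all add: mm_distl mm_distr\<close>)
  moreover have "module (fld L) (twist n P)"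
  proof (rule moduleI[OF module_fld_cring ag])
    fix a b M assume "M \<in> carrier (twist n P)"
    then show "(a \<oplus>\<^bsub>fld L\<^esub> b) \<odot>\<^bsub>twist n P\<^esub> M = a \<odot>\<^bsub>twist n P\<^esub> M \<oplus>\<^bsub>twist n P\<^esub> b \<odot>\<^bsub>twist n P\<^esub> M"
      by (intro eq_matI) (auto simp: fld_def distrib_right)
  qed (use sm dm in \<open>auto simp: fld_def smult_addm smult_smultm smult_onem\<close>)
  ultimately show ?thesis by (simp add: ring_alg_def)
qed

lemma twist_closed: "P \<in> EM n n \<Longrightarrow> closed_alg L (twist n P)"
  by (rule ring_alg_closed[OF twist_ring_alg])

lemma twist_finsum:
  assumes P: "P \<in> EM n n" and "finite I" "\<And>i. i \<in> I \<Longrightarrow> f i \<in> carrier (twist n P)" and pq: "p < n" "q < n"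
  shows "finsum (twist n P) f I $$ (p, q) = (\<Sum>i\<in>I. f i $$ (p, q))"
proof -
  interpret ring "twist n P" using twist_ring_alg[OF P] by (simp add: ring_alg_def)
  show ?thesis using assms(2,3)
  proof (induction I rule: finite_induct)
    case empty
    then show ?case using pq by simp
  next
    case (insert i I)
    have c: "finsum (twist n P) f I \<in> carrier (twist n P)" using insert by (intro finsum_closed) auto
    have "finsum (twist n P) f (insert i I) = f i + finsum (twist n P) f I"
      using finsum_insert[of I i f] insert by auto
    moreover have "dim_row (finsum (twist n P) f I) = n" "dim_col (finsum (twist n P) f I) = n"
      using c EMD by (auto simp: twist_carrier)
    ultimately show ?case using insert pq by simp
  qed
qed

text \<open>The inverse of \<open>P\<close> is sg(P)/c, so this is M \<mapsto> P sg(M) P^-1 without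
  inverting a matrix. Its fixed points are the elements of the twisted form.\<close>

definition "tau n P c M = inverse c \<cdot>\<^sub>m (P * smat M * smat P)"

lemma tau_EM: "\<lbrakk>tw n P c; M \<in> EM n n\<rbrakk> \<Longrightarrow> tau n P c M \<in> EM n n"
  unfolding tau_def using twD[of n P c] by (intro EM_smult EM_mult EM_smat E_inv L_E) auto

lemma tau_P: 
  assumes t: "tw n P c" and M: "M \<in> EM n n" shows "tau n P c M * P = P * smat M"
proof -
  note d = twD[OF t] EMD[OF M]
  have "tau n P c M * P = inverse c \<cdot>\<^sub>m (P * (smat M * (smat P * P)))"
    using d by (simp add: tau_def mm_simps)
  then show ?thesis using d by (simp add: d(6) mm_simps smult_onem)
qed

lemma twist_iff_tau:
  assumes t: "tw n P c" and M: "M \<in> EM n n" shows "M \<in> carrier (twist n P) \<longleftrightarrow> tau n P c M = M"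
proof
  assume "tau n P c M = M"
  then show "M \<in> carrier (twist n P)" using tau_P[OF t M] M by (simp add: twist_carrier)
next
  note d = twD[OF t] EMD[OF M]
  assume "M \<in> carrier (twist n P)"
  then have "P * smat M = M * P" by (simp add: twist_carrier)
  then have "tau n P c M = inverse c \<cdot>\<^sub>m (M * (P * smat P))" using d by (simp add: tau_def mm_assoc)
  then show "tau n P c M = M" using d by (simp add: d(5) mm_simps smult_onem)
qed

lemma tau_tau:
  assumes t: "tw n P c" and M: "M \<in> EM n n" shows "tau n P c (tau n P c M) = M"
proof -
  note d = twD[OF t] EMD[OF M]
  have "tau n P c (tau n P c M) = inverse c \<cdot>\<^sub>m (P * (inverse c \<cdot>\<^sub>m (smat P * M * P)) * smat P)"
    using d by (simp add: tau_def smat_smult smat_mult sg_inv L_sg smat_smat[OF d(2)] smat_smat[OF M])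
  also have "\<dots> = (inverse c * inverse c) \<cdot>\<^sub>m ((P * smat P) * (M * (P * smat P)))"
    using twD(1,2,7,8)[OF t] EMD[OF M] by (simp add: mm_simps)
  also have "\<dots> = (inverse c * inverse c * (c * c)) \<cdot>\<^sub>m M" unfolding d(5) using d by (simp add: mm_simps)
  also have "inverse c * inverse c * (c * c) = 1" using d(4) by (simp add: field_simps)
  finally have "tau n P c (tau n P c M) = 1 \<cdot>\<^sub>m M" .
  then show ?thesis by (simp add: smult_onem)
qed

lemma tau_add: "\<lbrakk>tw n P c; M \<in> EM n n; Z \<in> EM n n\<rbrakk> \<Longrightarrow> tau n P c (M + Z) = tau n P c M + tau n P c Z"
  using twD[of n P c] EMD[of M n n] EMD[of Z n n] by (simp add: tau_def smat_add mm_distl mm_distr smult_addm)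

lemma tau_smult: "\<lbrakk>tw n P c; M \<in> EM n n\<rbrakk> \<Longrightarrow> tau n P c (k \<cdot>\<^sub>m M) = sg k \<cdot>\<^sub>m tau n P c M"
  using twD[of n P c] EMD[of M n n] by (simp add: tau_def smat_smult mm_simps mult.commute)

text \<open>Galois descent by the formulas already used for elements of \<open>E\<close>, with the
  involution \<open>tau\<close> in place of \<open>sg\<close>: Z = (M - tau M)/del and Y = M - om Z
  are fixed by \<open>tau\<close>.\<close>

lemma descent:
  assumes t: "tw n P c" and M: "M \<in> EM n n"
  shows "\<exists>Y\<in>carrier (twist n P). \<exists>Z\<in>carrier (twist n P). M = Y + om \<cdot>\<^sub>m Z"
proof -
  note d = twD[OF t] EMD[OF M]
  define T where "T = tau n P c M"
  have T: "T \<in> EM n n" "tau n P c T = M" using tau_EM[OF t M] tau_tau[OF t M] by (auto simp: T_def)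
  note dT = EMD[OF T(1)]
  define Z where "Z = inverse del \<cdot>\<^sub>m (M + (-1) \<cdot>\<^sub>m T)"
  have e1: "(-1) \<cdot>\<^sub>m T \<in> EM n n" "M + (-1) \<cdot>\<^sub>m T \<in> EM n n" "Z \<in> EM n n"
    unfolding Z_def using M T by (auto intro!: EM_smult EM_add E_minus E_one E_inv del)
  have "tau n P c Z = sg (inverse del) \<cdot>\<^sub>m (T + sg (-1) \<cdot>\<^sub>m M)"
    unfolding Z_def using tau_smult[OF t e1(2)] tau_add[OF t M e1(1)] tau_smult[OF t T(1)] T(2)
    by (simp add: T_def)
  also have "\<dots> = Z" unfolding Z_def using d dT del(2)
    by (intro eq_matI) (auto simp: sg_inv del sg_minus sg_one algebra_simps)
  finally have Zt: "Z \<in> carrier (twist n P)" using twist_iff_tau[OF t e1(3)] by simp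
  note dZ = EMD[OF e1(3)]
  define Y where "Y = M + (- om) \<cdot>\<^sub>m Z"
  have e2: "Y \<in> EM n n" unfolding Y_def using M e1(3) by (auto intro!: EM_smult EM_add E_minus om)
  have "tau n P c Y = T + sg (- om) \<cdot>\<^sub>m Z"
    unfolding Y_def using tau_add[OF t M EM_smult[OF e1(3)]] tau_smult[OF t e1(3)] Zt twist_iff_tau[OF t e1(3)]
    by (simp add: T_def E_minus om)
  also have "\<dots> = Y"
  proof (rule eq_matI)
    fix i j assume ij: "i < dim_row Y" "j < dim_col Y"
    then have ij': "i < n" "j < n" using EMD[OF e2] by auto
    have "Z $$ (i, j) * del = M $$ (i, j) - T $$ (i, j)"
      unfolding Z_def using ij' d dT del(2) by (simp add: field_simps)
    then have "M $$ (i, j) - om * Z $$ (i, j) = T $$ (i, j) - sg om * Z $$ (i, j)"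
      by (simp add: del_def algebra_simps)
    then show "(T + sg (- om) \<cdot>\<^sub>m Z) $$ (i, j) = Y $$ (i, j)"
      unfolding Y_def using ij' d dT dZ by (simp add: sg_minus)
  qed (use EMD[OF e2] dT dZ in auto)
  finally have "Y \<in> carrier (twist n P)" using twist_iff_tau[OF t e2] by simp
  moreover have "M = Y + om \<cdot>\<^sub>m Z" unfolding Y_def using d dZ by (intro eq_matI) auto
  ultimately show ?thesis using Zt by blast
qed

text \<open>Applying \<open>tau\<close> to the relation replaces \<open>om\<close> by its conjugate;
  the difference of the two relations is \<open>del\<close> times \<open>Z\<close>.\<close>

lemma descent_unique:
  assumes t: "tw n P c" and Y: "Y \<in> carrier (twist n P)" "Z \<in> carrier (twist n P)" and e: "Y + om \<cdot>\<^sub>m Z = 0\<^sub>m n n"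
  shows "Y = 0\<^sub>m n n \<and> Z = 0\<^sub>m n n"
proof -
  have m: "Y \<in> EM n n" "Z \<in> EM n n" using Y by (auto simp: twist_carrier)
  note d = EMD[OF m(1)] EMD[OF m(2)] twD[OF t]
  have "tau n P c (Y + om \<cdot>\<^sub>m Z) = Y + sg om \<cdot>\<^sub>m Z"
    using tau_add[OF t m(1) EM_smult[OF m(2) om(1)]] tau_smult[OF t m(2)] Y twist_iff_tau[OF t] m by simp
  moreover have "tau n P c (0\<^sub>m n n) = 0\<^sub>m n n" using d by (simp add: tau_def smat_zero)
  ultimately have e2: "Y + sg om \<cdot>\<^sub>m Z = 0\<^sub>m n n" using e by simp
  have ent: "Y $$ (i, j) = 0 \<and> Z $$ (i, j) = 0" if ij: "i < n" "j < n" for i j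
  proof -
    have 1: "Y $$ (i, j) + om * Z $$ (i, j) = 0" using arg_cong[OF e, of "\<lambda>M. M $$ (i, j)"] ij d by simp
    have 2: "Y $$ (i, j) + sg om * Z $$ (i, j) = 0" using arg_cong[OF e2, of "\<lambda>M. M $$ (i, j)"] ij d by simp
    have "del * Z $$ (i, j) = 0" proof -
      have "del * Z $$ (i, j) = (Y $$ (i, j) + om * Z $$ (i, j)) - (Y $$ (i, j) + sg om * Z $$ (i, j))"
        by (simp add: del_def algebra_simps)
      then show ?thesis unfolding 1 2 by simp
    qed
    then show ?thesis using 1 del by simp
  qed
  show ?thesis using d ent by (auto intro!: eq_matI)
qed

end

section \<open>The norm class of an algebra\<close>

lemma block_index: "\<lbrakk>u < m; x < n\<rbrakk> \<Longrightarrow> u * n + x < m * (n::nat)"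
proof -
  assume "u < m" "x < n"
  then have "u * n + x < Suc u * n" by simp
  also have "\<dots> \<le> m * n" using \<open>u < m\<close> by (intro mult_le_mono1) simp
  finally show ?thesis .
qed

context quad
begin

text \<open>\<open>A\<close> is identified with a twisted form of degree \<open>n\<close> whose
  semilinear operator has square \<open>c\<close>. The same \<open>A\<close> can have several such
  \<open>c\<close>; they will turn out to differ by norms.\<close>

definition typed :: "('a, 'b, 'm) module_scheme \<Rightarrow> nat \<Rightarrow> 'a \<Rightarrow> bool" where
  "typed A n c \<longleftrightarrow> closed_alg L A \<and> (\<exists>P h. tw n P c \<and> alg_map L A (twist n P) h)"

lemma typed_ring_alg: "typed A n c \<Longrightarrow> ring_alg L A"
  unfolding typed_def using ring_alg_transfer twist_ring_alg twD(2) by blast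

definition unitm :: "nat \<Rightarrow> nat \<Rightarrow> nat \<Rightarrow> nat \<Rightarrow> 'a mat" where
  "unitm r c i j = mat r c (\<lambda>(p, q). if p = i \<and> q = j then 1 else 0)"

lemma unitm_EM: "unitm r c i j \<in> EM r c" by (auto simp: unitm_def EM_def E_zero E_one)
lemma unitm_dim [simp]: "dim_row (unitm r c i j) = r" "dim_col (unitm r c i j) = c" by (simp_all add: unitm_def)
lemma unitm_index [simp]: "\<lbrakk>p < r; q < c\<rbrakk> \<Longrightarrow> unitm r c i j $$ (p, q) = (if p = i \<and> q = j then 1 else 0)"
  by (simp add: unitm_def)

text \<open>The matrix is built up one entry at a time, as a sum of multiples of matrix
  units.\<close>

lemma EM_induct:
  assumes M: "M \<in> EM r c" and zero: "R (0\<^sub>m r c)"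
    and add: "\<And>M Z. \<lbrakk>M \<in> EM r c; Z \<in> EM r c; R M; R Z\<rbrakk> \<Longrightarrow> R (M + Z)"
    and unit: "\<And>i j k. \<lbrakk>i < r; j < c; k \<in> E\<rbrakk> \<Longrightarrow> R (k \<cdot>\<^sub>m unitm r c i j)"
  shows "R M"
proof -
  note Md = EMD[OF M]
  have "R (mat r c (\<lambda>p. if p \<in> S then M $$ p else 0)) \<and> mat r c (\<lambda>p. if p \<in> S then M $$ p else 0) \<in> EM r c"
    if "finite S" "S \<subseteq> {..<r} \<times> {..<c}" for S
    using that
  proof (induction S rule: finite_induct)
    case empty
    have "mat r c (\<lambda>p. if p \<in> {} then M $$ p else 0) = 0\<^sub>m r c" by (rule eq_matI) auto
    then show ?case using zero EM_zero by simp
  next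
    case (insert p S)
    obtain i j where p: "p = (i, j)" by (cases p)
    then have ij: "i < r" "j < c" "M $$ (i, j) \<in> E" using insert.prems Md by auto
    have "mat r c (\<lambda>q. if q \<in> insert p S then M $$ q else 0) =
      mat r c (\<lambda>q. if q \<in> S then M $$ q else 0) + (M $$ (i, j)) \<cdot>\<^sub>m unitm r c i j"
      using insert.hyps ij p by (intro eq_matI) (auto split: if_splits)
    then show ?case using insert.IH insert.prems add unit[OF ij] EM_add EM_smult[OF unitm_EM ij(3)] by auto
  qed
  from this[of "{..<r} \<times> {..<c}"] have "R (mat r c (\<lambda>p. if p \<in> {..<r} \<times> {..<c} then M $$ p else 0))" by auto
  moreover have "mat r c (\<lambda>p. if p \<in> {..<r} \<times> {..<c} then M $$ p else 0) = M"
    using Md by (intro eq_matI) auto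
  ultimately show ?thesis by simp
qed

lemma kron_unitm:
  assumes "i < m * n" "j < m * n"
  shows "kron (unitm m m (i div n) (j div n)) (unitm n n (i mod n) (j mod n)) = unitm (m * n) (m * n) i j"
proof (rule eq_matI)
  fix p q assume "p < dim_row (unitm (m * n) (m * n) i j)" "q < dim_col (unitm (m * n) (m * n) i j)"
  then have pq: "p < m * n" "q < m * n" by simp_all
  have "p = i \<longleftrightarrow> p div n = i div n \<and> p mod n = i mod n" "q = j \<longleftrightarrow> q div n = j div n \<and> q mod n = j mod n"
    by (metis mult_div_mod_eq)+
  then show "kron (unitm m m (i div n) (j div n)) (unitm n n (i mod n) (j mod n)) $$ (p, q) =
      unitm (m * n) (m * n) i j $$ (p, q)"
    using pq div_mod_bounds[OF pq(1)] div_mod_bounds[OF pq(2)] by (auto simp: index_kron)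
qed auto

text \<open>By the mixed product rule the squares of the two semilinear operators multiply. This is
  the source of the multiplicativity of the norm class.\<close>

lemma tw_kron:
  assumes "tw n P c" "tw m Q d" shows "tw (m * n) (kron Q P) (c * d)"
proof -
  note p = twD[OF assms(1)] and q = twD[OF assms(2)]
  have "kron Q P * smat (kron Q P) = kron (Q * smat Q) (P * smat P)"
    using p q by (simp add: smat_kron kron_mult)
  also have "\<dots> = (c * d) \<cdot>\<^sub>m 1\<^sub>m (m * n)"
    unfolding p(5) q(5) by (simp add: kron_smultl kron_smultr kron_one smult_smultm mult.commute)
  finally show ?thesis using p q EM_kron[OF q(2) p(2)] by (simp add: tw_def L_mult)
qed

lemma kron_twist:
  assumes P: "P \<in> EM n n" and Q: "Q \<in> EM m m"
    and M: "M \<in> carrier (twist m Q)" and Z: "Z \<in> carrier (twist n P)"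
  shows "kron M Z \<in> carrier (twist (m * n) (kron Q P))"
proof -
  have m: "M \<in> EM m m" "Q * smat M = M * Q" "Z \<in> EM n n" "P * smat Z = Z * P" using M Z by (auto simp: twist_carrier)
  note d = EMD[OF P] EMD[OF Q] EMD[OF m(1)] EMD[OF m(3)]
  show ?thesis using d EM_kron[OF m(1,3)] by (simp add: twist_carrier smat_kron kron_mult m)
qed

text \<open>Over \<open>E\<close> the Kronecker products span all matrices. Descending each factor
  writes every matrix as U + om V with U and V in the additive group generated by the Kronecker
  products of elements of the two forms. For a matrix in the tensor form, uniqueness of descent
  gives V = 0.\<close>

lemma kron_span:
  assumes P: "tw n P c" and Q: "tw m Q d"
  shows "carrier (twist (m * n) (kron Q P)) \<subseteq> generate (add_monoid (twist (m * n) (kron Q P)))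
    {kron M Z | M Z. M \<in> carrier (twist m Q) \<and> Z \<in> carrier (twist n P)}"
proof
  let ?C = "twist (m * n) (kron Q P)"
  let ?S = "{kron M Z | M Z. M \<in> carrier (twist m Q) \<and> Z \<in> carrier (twist n P)}"
  let ?G = "generate (add_monoid ?C) ?S"
  note p = twD[OF P] and q = twD[OF Q]
  have t: "tw (m * n) (kron Q P) (c * d)" by (rule tw_kron[OF P Q])
  have ra: "ring_alg L ?C" by (rule twist_ring_alg[OF twD(2)[OF t]])
  interpret C: ring ?C using ra by (simp add: ring_alg_def)
  have SC: "?S \<subseteq> carrier ?C" using kron_twist[OF p(2) q(2)] by auto
  have sub: "subgroup ?G (add_monoid ?C)"
    using SC by (intro group.generate_is_subgroup C.a_group) auto
  have GC: "M \<in> carrier ?C" if "M \<in> ?G" for M using subgroup.subset[OF sub] that by auto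
  have Gadd: "M + Z \<in> ?G" if "M \<in> ?G" "Z \<in> ?G" for M Z
    using subgroup.m_closed[OF sub that] by simp
  have Gzero: "0\<^sub>m (m * n) (m * n) \<in> ?G" using subgroup.one_closed[OF sub] by simp
  have dim: "dim_row M = m * n" "dim_col M = m * n" "M \<in> EM (m * n) (m * n)" if "M \<in> carrier ?C" for M
    using that EMD by (auto simp: twist_carrier)
  have S_smult: "k \<cdot>\<^sub>m M \<in> ?S" if k: "k \<in> L" and M: "M \<in> ?S" for k M
  proof -
    obtain U V where U: "M = kron U V" "U \<in> carrier (twist m Q)" "V \<in> carrier (twist n P)" using M by auto
    have "k \<cdot>\<^sub>m U \<in> carrier (twist m Q)" using closed_algD(5)[OF twist_closed[OF q(2)] k U(2)] by simp
    moreover have "k \<cdot>\<^sub>m M = kron (k \<cdot>\<^sub>m U) V" by (simp add: U kron_smultl)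
    ultimately show ?thesis using U(3) by blast
  qed
  have Gsmult: "k \<cdot>\<^sub>m M \<in> ?G" if k: "k \<in> L" and M: "M \<in> ?G" for k M
    using M
  proof (induction M rule: generate.induct)
    case one
    have "k \<cdot>\<^sub>m 0\<^sub>m (m * n) (m * n) = 0\<^sub>m (m * n) (m * n)" by (rule eq_matI) auto
    then show ?case using Gzero by simp
  next
    case (incl h)
    then show ?case using S_smult[OF k] by (auto intro: generate.incl)
  next
    case (inv h)
    have kh: "k \<cdot>\<^sub>m h \<in> carrier ?C" "h \<in> carrier ?C" using S_smult[OF k inv] SC inv by auto
    interpret M: module "fld L" ?C using ra by (simp add: ring_alg_def)
    have i: "inv\<^bsub>add_monoid ?C\<^esub> h = \<ominus>\<^bsub>?C\<^esub> h" by (simp add: a_inv_def)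
    have "k \<odot>\<^bsub>?C\<^esub> (\<ominus>\<^bsub>?C\<^esub> h) = \<ominus>\<^bsub>?C\<^esub> (k \<odot>\<^bsub>?C\<^esub> h)"
      by (rule M.smult_r_minus) (use k kh in \<open>auto simp: fld_def\<close>)
    then have "k \<cdot>\<^sub>m (inv\<^bsub>add_monoid ?C\<^esub> h) = inv\<^bsub>add_monoid ?C\<^esub> (k \<cdot>\<^sub>m h)" by (simp add: i) (simp add: a_inv_def)
    then show ?case using generate.inv[of "k \<cdot>\<^sub>m h" ?S "add_monoid ?C"] S_smult[OF k inv] by simp
  next
    case (eng u v)
    have "dim_row u = m * n" "dim_col u = m * n" "dim_row v = m * n" "dim_col v = m * n"
      using dim GC eng by auto
    then have "k \<cdot>\<^sub>m (u + v) = k \<cdot>\<^sub>m u + k \<cdot>\<^sub>m v" by (simp add: smult_addm)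
    then show ?case using Gadd[OF eng.IH] by simp
  qed
  define W where "W = {M. \<exists>U\<in>?G. \<exists>V\<in>?G. M = U + om \<cdot>\<^sub>m V}"
  have Wadd: "M + Z \<in> W" if MZ: "M \<in> W" "Z \<in> W" for M Z
  proof -
    obtain U V U' V' where u: "U \<in> ?G" "V \<in> ?G" "U' \<in> ?G" "V' \<in> ?G" "M = U + om \<cdot>\<^sub>m V" "Z = U' + om \<cdot>\<^sub>m V'"
      using MZ unfolding W_def by auto
    note dd = dim[OF GC[OF u(1)]] dim[OF GC[OF u(2)]] dim[OF GC[OF u(3)]] dim[OF GC[OF u(4)]]
    have "M + Z = (U + U') + om \<cdot>\<^sub>m (V + V')" unfolding u(5,6)
      by (rule eq_matI) (use dd in \<open>auto simp: algebra_simps\<close>)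
    then show ?thesis using Gadd u unfolding W_def by blast
  qed
  have Wkron: "kron M Z \<in> W" if "M \<in> EM m m" "Z \<in> EM n n" for M Z
  proof -
    obtain M0 M1 where M: "M0 \<in> carrier (twist m Q)" "M1 \<in> carrier (twist m Q)" "M = M0 + om \<cdot>\<^sub>m M1"
      using descent[OF Q \<open>M \<in> EM m m\<close>] by auto
    obtain Z0 Z1 where Z: "Z0 \<in> carrier (twist n P)" "Z1 \<in> carrier (twist n P)" "Z = Z0 + om \<cdot>\<^sub>m Z1"
      using descent[OF P \<open>Z \<in> EM n n\<close>] by auto
    have dM: "dim_row M0 = m" "dim_col M0 = m" "dim_row M1 = m" "dim_col M1 = m"
      "dim_row Z0 = n" "dim_col Z0 = n" "dim_row Z1 = n" "dim_col Z1 = n"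
      using M Z EMD by (auto simp: twist_carrier)
    \<comment> \<open>Expanding \<open>om * om\<close> in the basis 1, \<open>om\<close> keeps
      products of two expansions in the same shape.\<close>
    define s t where "s = reE (om * om)" and "t = imE (om * om)"
    have st: "s \<in> L" "t \<in> L" "om * om = s + t * om"
      using reE_L imE_L re_im E_mult om by (auto simp: s_def t_def)
    have "kron M Z = (kron M0 Z0 + s \<cdot>\<^sub>m kron M1 Z1) + om \<cdot>\<^sub>m ((kron M0 Z1 + kron M1 Z0) + t \<cdot>\<^sub>m kron M1 Z1)"
    proof (rule eq_matI)
      fix i j assume "i < dim_row ((kron M0 Z0 + s \<cdot>\<^sub>m kron M1 Z1) + om \<cdot>\<^sub>m ((kron M0 Z1 + kron M1 Z0) + t \<cdot>\<^sub>m kron M1 Z1))"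
        "j < dim_col ((kron M0 Z0 + s \<cdot>\<^sub>m kron M1 Z1) + om \<cdot>\<^sub>m ((kron M0 Z1 + kron M1 Z0) + t \<cdot>\<^sub>m kron M1 Z1))"
      then have ij: "i < m * n" "j < m * n" using dM by auto
      have f: "(a + om * b) * (x + om * y) = (a * x + s * (b * y)) + om * ((a * y + b * x) + t * (b * y))" for a b x y
      proof -
        have "(a + om * b) * (x + om * y) = a * x + om * (a * y + b * x) + (om * om) * (b * y)" by (simp add: algebra_simps)
        also have "\<dots> = (a * x + s * (b * y)) + om * ((a * y + b * x) + t * (b * y))" unfolding st(3) by (simp add: algebra_simps)
        finally show ?thesis .
      qed
      show "kron M Z $$ (i, j) = ((kron M0 Z0 + s \<cdot>\<^sub>m kron M1 Z1) + om \<cdot>\<^sub>m ((kron M0 Z1 + kron M1 Z0) + t \<cdot>\<^sub>m kron M1 Z1)) $$ (i, j)"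
        unfolding M(3) Z(3) using ij dM div_mod_bounds[OF ij(1)] div_mod_bounds[OF ij(2)]
        by (simp add: index_kron f)
    qed (use dM in \<open>auto simp: M(3) Z(3)\<close>)
    moreover have k: "kron M0 Z0 \<in> ?G" "kron M1 Z1 \<in> ?G" "kron M0 Z1 \<in> ?G" "kron M1 Z0 \<in> ?G"
      using M Z by (auto intro!: generate.incl)
    have "kron M0 Z0 + s \<cdot>\<^sub>m kron M1 Z1 \<in> ?G" "(kron M0 Z1 + kron M1 Z0) + t \<cdot>\<^sub>m kron M1 Z1 \<in> ?G"
      by (intro Gadd Gsmult st k)+
    ultimately show ?thesis unfolding W_def mem_Collect_eq by (intro bexI)
  qed
  have Wall: "M \<in> W" if M: "M \<in> EM (m * n) (m * n)" for M
    using M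
  proof (rule EM_induct)
    have "0\<^sub>m (m * n) (m * n) + om \<cdot>\<^sub>m 0\<^sub>m (m * n) (m * n) = 0\<^sub>m (m * n) (m * n)" by (rule eq_matI) auto
    then show "0\<^sub>m (m * n) (m * n) \<in> W" unfolding W_def using Gzero by force
  next
    fix i j k assume ij: "i < m * n" "j < m * n" and k: "k \<in> E"
    have "k \<cdot>\<^sub>m unitm (m * n) (m * n) i j = kron (k \<cdot>\<^sub>m unitm m m (i div n) (j div n)) (unitm n n (i mod n) (j mod n))"
      by (simp add: kron_smultl kron_unitm[OF ij])
    then show "k \<cdot>\<^sub>m unitm (m * n) (m * n) i j \<in> W" using Wkron EM_smult[OF unitm_EM k] unitm_EM by simp
  qed (rule Wadd)
  fix M assume M: "M \<in> carrier ?C"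
  obtain U V where u: "U \<in> ?G" "V \<in> ?G" "M = U + om \<cdot>\<^sub>m V"
    using Wall[OF dim(3)[OF M]] unfolding W_def by auto
  note dd = dim[OF GC[OF u(1)]] dim[OF GC[OF u(2)]] dim[OF M]
  have Uc: "(-1) \<cdot>\<^sub>m U \<in> carrier ?C"
    using closed_algD(5)[OF twist_closed[OF twD(2)[OF t]] _ GC[OF u(1)], of "-1"] L_minus[OF L_one] by simp
  have Mc: "(-1) \<cdot>\<^sub>m M \<in> carrier ?C"
    using closed_algD(5)[OF twist_closed[OF twD(2)[OF t]] _ M, of "-1"] L_minus[OF L_one] by simp
  have "U + (-1) \<cdot>\<^sub>m M \<in> carrier ?C" using C.a_closed[OF GC[OF u(1)] Mc] by simp
  \<comment> \<open>\<open>U - M\<close> and \<open>V\<close> both lie in the form, so uniqueness of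
    the decomposition applies to this relation.\<close>
  moreover have "(U + (-1) \<cdot>\<^sub>m M) + om \<cdot>\<^sub>m V = 0\<^sub>m (m * n) (m * n)"
    unfolding u(3) by (rule eq_matI) (use dd in auto)
  ultimately have "V = 0\<^sub>m (m * n) (m * n)" using descent_unique[OF t _ GC[OF u(2)]] by blast
  then have "M = U" unfolding u(3) using dd by (intro eq_matI) auto
  then show "M \<in> ?G" using u by simp
qed

text \<open>An \<open>E\<close>-linear relation between elements of an \<open>L\<close>-form
  separates into two \<open>L\<close>-linear relations, with coefficients \<open>reE (a i)\<close>
  and \<open>imE (a i)\<close>. Since \<open>a j\<close> is nonzero, at least one of them is
  nontrivial.\<close>

lemma L_relation:
  assumes t: "tw n P c" and I: "finite I" and b: "\<And>i. i \<in> I \<Longrightarrow> b i \<in> carrier (twist n P)"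
    and a: "\<And>i. i \<in> I \<Longrightarrow> a i \<in> E" and j: "j \<in> I" "a j \<noteq> 0"
    and s: "\<And>p q. \<lbrakk>p < n; q < n\<rbrakk> \<Longrightarrow> (\<Sum>i\<in>I. a i * b i $$ (p, q)) = 0"
  shows "\<exists>l. (\<forall>i\<in>I. l i \<in> L) \<and> (\<exists>i\<in>I. l i \<noteq> 0) \<and> finsum (twist n P) (\<lambda>i. l i \<cdot>\<^sub>m b i) I = 0\<^sub>m n n"
proof -
  note p = twD[OF t]
  interpret C: ring "twist n P" using twist_ring_alg[OF p(2)] by (simp add: ring_alg_def)
  have cl: "k \<cdot>\<^sub>m b i \<in> carrier (twist n P)" if "i \<in> I" "k \<in> L" for k i
    using closed_algD(5)[OF twist_closed[OF p(2)] that(2) b[OF that(1)]] by simp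
  define Y where "Y = finsum (twist n P) (\<lambda>i. reE (a i) \<cdot>\<^sub>m b i) I"
  define Z where "Z = finsum (twist n P) (\<lambda>i. imE (a i) \<cdot>\<^sub>m b i) I"
  have Y: "Y \<in> carrier (twist n P)" unfolding Y_def using cl reE_L a by (intro C.finsum_closed) auto
  have Z: "Z \<in> carrier (twist n P)" unfolding Z_def using cl imE_L a by (intro C.finsum_closed) auto
  have db: "dim_row (b i) = n" "dim_col (b i) = n" if "i \<in> I" for i using b[OF that] EMD by (auto simp: twist_carrier)
  have dY: "dim_row Y = n" "dim_col Y = n" "dim_row Z = n" "dim_col Z = n" using Y Z EMD by (auto simp: twist_carrier)
  have "Y + om \<cdot>\<^sub>m Z = 0\<^sub>m n n"
  proof (rule eq_matI)
    fix x y assume "x < dim_row (0\<^sub>m n n :: 'a mat)" "y < dim_col (0\<^sub>m n n :: 'a mat)"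
    then have xy: "x < n" "y < n" by simp_all
    have "(Y + om \<cdot>\<^sub>m Z) $$ (x, y) = (\<Sum>i\<in>I. reE (a i) * b i $$ (x, y)) + om * (\<Sum>i\<in>I. imE (a i) * b i $$ (x, y))"
      unfolding Y_def Z_def using xy dY[unfolded Y_def Z_def] twist_finsum[OF p(2) I _ xy] cl reE_L imE_L a db
      by (simp cong: sum.cong)
    also have "\<dots> = (\<Sum>i\<in>I. (reE (a i) + imE (a i) * om) * b i $$ (x, y))"
      unfolding sum_distrib_left by (simp add: sum.distrib[symmetric] algebra_simps)
    also have "\<dots> = 0" using s[OF xy] re_im by simp
    finally show "(Y + om \<cdot>\<^sub>m Z) $$ (x, y) = 0\<^sub>m n n $$ (x, y)" using xy by simp
  qed (use dY in auto)
  then have YZ: "Y = 0\<^sub>m n n" "Z = 0\<^sub>m n n" using descent_unique[OF t Y Z] by auto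
  show ?thesis
  proof (cases "reE (a j) = 0")
    case True
    then have "imE (a j) \<noteq> 0" using j(2) re_im[of "a j"] by auto
    then show ?thesis using YZ(2) j(1) imE_L a unfolding Z_def by (intro exI[of _ "\<lambda>i. imE (a i)"]) auto
  next
    case False
    then show ?thesis using YZ(1) j(1) reE_L a unfolding Y_def by (intro exI[of _ "\<lambda>i. reE (a i)"]) auto
  qed
qed

text \<open>The tensor product of two forms is the form twisted by the Kronecker product.
  Surjectivity is \<open>kron_span\<close>. For independence, the entries at one fixed position
  inside all blocks of a vanishing sum give an \<open>E\<close>-linear relation between the second
  factors, which then descends to \<open>L\<close>.\<close>

lemma tensor_twist:
  assumes cA: "closed_alg L A" and P: "tw n P c" and h: "alg_map L A (twist n P) h"
    and cB: "closed_alg L B" and Q: "tw m Q d" and g: "alg_map L B (twist m Q) g"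
  shows "closed_alg L (tensor_alg (fld L) A B) \<and>
    (\<exists>f. alg_map L (tensor_alg (fld L) A B) (twist (m * n) (kron Q P)) f)"
proof -
  note p = twD[OF P] and q = twD[OF Q] and hD = alg_mapD[OF h] and gD = alg_mapD[OF g]
  have t: "tw (m * n) (kron Q P) (c * d)" by (rule tw_kron[OF P Q])
  let ?C = "twist (m * n) (kron Q P)"
  have ra: "ring_alg L ?C" "ring_alg L A" "ring_alg L B"
    using twist_ring_alg[OF twD(2)[OF t]] ring_alg_transfer[OF cA h] ring_alg_transfer[OF cB g] twist_ring_alg p(2) q(2) by auto
  interpret C: ring ?C using ra by (simp add: ring_alg_def)
  interpret CM: module "fld L" ?C using ra by (simp add: ring_alg_def)
  interpret A: ring A using ra by (simp add: ring_alg_def)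
  interpret AM: module "fld L" A using ra by (simp add: ring_alg_def)
  interpret B: ring B using ra by (simp add: ring_alg_def)
  interpret BM: module "fld L" B using ra by (simp add: ring_alg_def)
  \<comment> \<open>The factors are swapped on purpose: with a matrix algebra as second tensor
    factor, the twisting matrix becomes block diagonal with copies of \<open>P\<close>.\<close>
  define \<beta> where "\<beta> a b = kron (g b) (h a)" for a b
  have dh: "dim_row (h a) = n" "dim_col (h a) = n" "h a \<in> EM n n" if "a \<in> carrier A" for a
    using hD(4)[OF that] EMD by (auto simp: twist_carrier)
  have dg: "dim_row (g a) = m" "dim_col (g a) = m" "g a \<in> EM m m" if "a \<in> carrier B" for a
    using gD(4)[OF that] EMD by (auto simp: twist_carrier)
  have bc: "\<beta> a b \<in> carrier ?C" if "a \<in> carrier A" "b \<in> carrier B" for a b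
    unfolding \<beta>_def by (rule kron_twist[OF p(2) q(2) gD(4)[OF that(2)] hD(4)[OF that(1)]])
  interpret T: tensor_alg_map L A B ?C \<beta> L
  proof unfold_locales
    fix a a' b assume "a \<in> carrier A" "a' \<in> carrier A" "b \<in> carrier B"
    then show "\<beta> (a \<oplus>\<^bsub>A\<^esub> a') b = \<beta> a b \<oplus>\<^bsub>?C\<^esub> \<beta> a' b"
      using dh dg by (simp add: \<beta>_def hD kron_addr)
  next
    fix a b b' assume "a \<in> carrier A" "b \<in> carrier B" "b' \<in> carrier B"
    then show "\<beta> a (b \<oplus>\<^bsub>B\<^esub> b') = \<beta> a b \<oplus>\<^bsub>?C\<^esub> \<beta> a b'"
      using dh dg by (simp add: \<beta>_def gD kron_addl)
  next
    fix r a b assume "r \<in> L" "a \<in> carrier A" "b \<in> carrier B"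
    then show "\<beta> (r \<odot>\<^bsub>A\<^esub> a) b = \<beta> a (r \<odot>\<^bsub>B\<^esub> b)" "\<beta> (r \<odot>\<^bsub>A\<^esub> a) b = r \<odot>\<^bsub>?C\<^esub> \<beta> a b"
      by (simp_all add: \<beta>_def hD gD kron_smultl kron_smultr)
  next
    fix I :: "nat set" and a b j
    assume I: "finite I" and ab: "\<And>i. i \<in> I \<Longrightarrow> a i \<in> carrier A" "\<And>i. i \<in> I \<Longrightarrow> b i \<in> carrier B"
      and s: "finsum ?C (\<lambda>i. \<beta> (a i) (b i)) I = \<zero>\<^bsub>?C\<^esub>" and j: "j \<in> I" "a j \<noteq> \<zero>\<^bsub>A\<^esub>"
    have "h (a j) \<noteq> 0\<^sub>m n n" using inj_onD[OF hD(2), of "a j" "\<zero>\<^bsub>A\<^esub>"] ab j hD(8) by auto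
    \<comment> \<open>This nonzero entry of \<open>h (a j)\<close> keeps the coefficient at
      \<open>j\<close> nonzero in the relation extracted below.\<close>
    then obtain x y where xy: "x < n" "y < n" "h (a j) $$ (x, y) \<noteq> 0"
      using dh[OF ab(1)[OF j(1)]] by (metis eq_matI index_zero_mat)
    have "(\<Sum>i\<in>I. h (a i) $$ (x, y) * g (b i) $$ (u, v)) = 0" if uv: "u < m" "v < m" for u v
    proof -
      \<comment> \<open>The pair (u * n + x, v * n + y) addresses entry (x, y) of block (u,
        v).\<close>
      have b: "u * n + x < m * n" "v * n + y < m * n"
        using block_index uv xy by auto
      have "0 = finsum ?C (\<lambda>i. \<beta> (a i) (b i)) I $$ (u * n + x, v * n + y)" using s b by simp
      also have "\<dots> = (\<Sum>i\<in>I. \<beta> (a i) (b i) $$ (u * n + x, v * n + y))"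
        by (rule twist_finsum[OF twD(2)[OF t] I _ b]) (use bc ab in auto)
      also have "\<dots> = (\<Sum>i\<in>I. h (a i) $$ (x, y) * g (b i) $$ (u, v))"
        using b dh dg ab xy by (intro sum.cong refl) (simp add: \<beta>_def index_kron mult.commute)
      finally show ?thesis by simp
    qed
    then have "\<exists>l. (\<forall>i\<in>I. l i \<in> L) \<and> (\<exists>i\<in>I. l i \<noteq> 0) \<and> finsum (twist m Q) (\<lambda>i. l i \<cdot>\<^sub>m g (b i)) I = 0\<^sub>m m m"
      using gD(4) ab xy(3) EMD(4)[OF dh(3) xy(1,2)] j(1)
      by (intro L_relation[OF Q I, of "\<lambda>i. g (b i)" "\<lambda>i. h (a i) $$ (x, y)" j]) auto
    then obtain l where l: "\<forall>i\<in>I. l i \<in> L" "\<exists>i\<in>I. l i \<noteq> 0" "finsum (twist m Q) (\<lambda>i. l i \<cdot>\<^sub>m g (b i)) I = 0\<^sub>m m m"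
      by blast
    have lb: "l i \<odot>\<^bsub>B\<^esub> b i \<in> carrier B" if "i \<in> I" for i using l ab that by (simp add: fld_def)
    have fc: "finsum B (\<lambda>i. l i \<odot>\<^bsub>B\<^esub> b i) I \<in> carrier B" using lb by (intro B.finsum_closed) auto
    interpret TQ: ring "twist m Q" using twist_ring_alg[OF q(2)] by (simp add: ring_alg_def)
    have "g (finsum B (\<lambda>i. l i \<odot>\<^bsub>B\<^esub> b i) I) = finsum (twist m Q) (\<lambda>i. g (l i \<odot>\<^bsub>B\<^esub> b i)) I"
      using I lb
    proof (induction I rule: finite_induct)
      case empty
      then show ?case using gD(8) by simp
    next
      case (insert i I)
      have "finsum B (\<lambda>i. l i \<odot>\<^bsub>B\<^esub> b i) (insert i I) = l i \<odot>\<^bsub>B\<^esub> b i \<oplus>\<^bsub>B\<^esub> finsum B (\<lambda>i. l i \<odot>\<^bsub>B\<^esub> b i) I"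
        using insert by (intro B.finsum_insert) auto
      moreover have "finsum (twist m Q) (\<lambda>i. g (l i \<odot>\<^bsub>B\<^esub> b i)) (insert i I) =
          g (l i \<odot>\<^bsub>B\<^esub> b i) \<oplus>\<^bsub>twist m Q\<^esub> finsum (twist m Q) (\<lambda>i. g (l i \<odot>\<^bsub>B\<^esub> b i)) I"
        using insert gD(4) by (intro TQ.finsum_insert) auto
      moreover have "finsum B (\<lambda>i. l i \<odot>\<^bsub>B\<^esub> b i) I \<in> carrier B" using insert by (intro B.finsum_closed) auto
      ultimately show ?case using insert gD(5) by simp
    qed
    also have "\<dots> = finsum (twist m Q) (\<lambda>i. l i \<cdot>\<^sub>m g (b i)) I"
      using l ab gD(4) gD(9) closed_algD(5)[OF twist_closed[OF q(2)]] by (intro TQ.finsum_cong') auto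
    finally have "finsum B (\<lambda>i. l i \<odot>\<^bsub>B\<^esub> b i) I = \<zero>\<^bsub>B\<^esub>"
      using l(3) gD(8) inj_onD[OF gD(2) _ fc] by simp
    then show "\<exists>l. (\<forall>i\<in>I. l i \<in> L) \<and> (\<exists>i\<in>I. l i \<noteq> 0) \<and> finsum B (\<lambda>i. l i \<odot>\<^bsub>B\<^esub> b i) I = \<zero>\<^bsub>B\<^esub>"
      using l by blast
  next
    have "{kron M Z | M Z. M \<in> carrier (twist m Q) \<and> Z \<in> carrier (twist n P)} \<subseteq>
      {\<beta> a b | a b. a \<in> carrier A \<and> b \<in> carrier B}"
      unfolding \<beta>_def hD(3)[symmetric] gD(3)[symmetric] by blast
    then show "carrier ?C \<subseteq> generate (add_monoid ?C) {\<beta> a b | a b. a \<in> carrier A \<and> b \<in> carrier B}"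
      using kron_span[OF P Q] group.mono_generate[OF C.a_group] by blast
  next
    fix a a' b b' assume "a \<in> carrier A" "a' \<in> carrier A" "b \<in> carrier B" "b' \<in> carrier B"
    then show "\<beta> (a \<otimes>\<^bsub>A\<^esub> a') (b \<otimes>\<^bsub>B\<^esub> b') = \<beta> a b \<otimes>\<^bsub>?C\<^esub> \<beta> a' b'"
      using dh dg by (simp add: \<beta>_def hD gD kron_mult)
  next
    show "\<beta> \<one>\<^bsub>A\<^esub> \<one>\<^bsub>B\<^esub> = \<one>\<^bsub>?C\<^esub>" by (simp add: \<beta>_def hD gD kron_one)
  next
    show "closed_alg L A" by (rule cA)
  next
    fix r M Z assume "r \<in> L" "M \<in> carrier ?C" "Z \<in> carrier ?C"
    then show "r \<odot>\<^bsub>?C\<^esub> (M \<oplus>\<^bsub>?C\<^esub> Z) = r \<odot>\<^bsub>?C\<^esub> M \<oplus>\<^bsub>?C\<^esub> r \<odot>\<^bsub>?C\<^esub> Z"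
      using CM.smult_r_distr[of r M Z] by (simp add: fld_def)
  next
    fix r M assume "r \<in> L" "M \<in> carrier ?C"
    then show "r \<odot>\<^bsub>?C\<^esub> M \<in> carrier ?C" using CM.smult_closed[of r M] by (simp add: fld_def)
  qed (auto intro: L_inv bc)
  show ?thesis using T.tensor_alg_closed T.ex_tensor_alg_map by blast
qed

lemma typed_tensor:
  assumes A: "typed A n c" and B: "typed B m d"
  shows "typed (tensor_alg (fld L) A B) (m * n) (c * d)"
proof -
  obtain P h where P: "tw n P c" and h: "alg_map L A (twist n P) h" "closed_alg L A" using A by (auto simp: typed_def)
  obtain Q g where Q: "tw m Q d" and g: "alg_map L B (twist m Q) g" "closed_alg L B" using B by (auto simp: typed_def)
  show ?thesis unfolding typed_def using tensor_twist[OF h(2) P h(1) g(2) Q g(1)] tw_kron[OF P Q] by blast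
qed

end

section \<open>Intertwiners, the Skolem-Noether theorem and forms\<close>

context quad
begin

lemma unitm_mult_left:
  assumes "Y \<in> EM c k" "i < c"
  shows "unitm r c p i * Y = mat r k (\<lambda>(x, y). if x = p then Y $$ (i, y) else 0)"
proof (rule eq_matI)
  note d = EMD[OF assms(1)]
  fix x y assume "x < dim_row (mat r k (\<lambda>(x, y). if x = p then Y $$ (i, y) else 0))"
    "y < dim_col (mat r k (\<lambda>(x, y). if x = p then Y $$ (i, y) else 0))"
  then have xy: "x < r" "y < k" by auto
  have "(unitm r c p i * Y) $$ (x, y) = (\<Sum>z\<in>{0..<c}. (if x = p \<and> z = i then 1 else 0) * Y $$ (z, y))"
    using xy d by (simp add: scalar_prod_def)
  also have "\<dots> = (\<Sum>z\<in>{0..<c}. if z = i then (if x = p then Y $$ (z, y) else 0) else 0)"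
    by (intro sum.cong) auto
  also have "\<dots> = (if x = p then Y $$ (i, y) else 0)" using assms(2) by simp
  finally show "(unitm r c p i * Y) $$ (x, y) = mat r k (\<lambda>(x, y). if x = p then Y $$ (i, y) else 0) $$ (x, y)"
    using xy by simp
qed (use EMD[OF assms(1)] in auto)

lemma unitm_mult_right:
  assumes "Y \<in> EM r k" "j < k"
  shows "Y * unitm k c j q = mat r c (\<lambda>(x, y). if y = q then Y $$ (x, j) else 0)"
proof (rule eq_matI)
  note d = EMD[OF assms(1)]
  fix x y assume "x < dim_row (mat r c (\<lambda>(x, y). if y = q then Y $$ (x, j) else 0))"
    "y < dim_col (mat r c (\<lambda>(x, y). if y = q then Y $$ (x, j) else 0))"
  then have xy: "x < r" "y < c" by auto
  have "(Y * unitm k c j q) $$ (x, y) = (\<Sum>z\<in>{0..<k}. Y $$ (x, z) * (if z = j \<and> y = q then 1 else 0))"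
    using xy d by (simp add: scalar_prod_def)
  also have "\<dots> = (\<Sum>z\<in>{0..<k}. if z = j then (if y = q then Y $$ (x, z) else 0) else 0)"
    by (intro sum.cong) auto
  also have "\<dots> = (if y = q then Y $$ (x, j) else 0)" using assms(2) by simp
  finally show "(Y * unitm k c j q) $$ (x, y) = mat r c (\<lambda>(x, y). if y = q then Y $$ (x, j) else 0) $$ (x, y)"
    using xy by simp
qed (use EMD[OF assms(1)] in auto)

text \<open>The kernel of an intertwiner is stable under all of M_n(E). Matrix units carry a nonzero
  entry of an element of the kernel to any basis vector, so a nontrivial kernel would make
  \<open>R\<close> vanish.\<close>

lemma intertwiner_injective:
  assumes R: "R \<in> EM m n" "R \<noteq> 0\<^sub>m m n"
    and \<Phi>: "\<And>M. M \<in> EM n n \<Longrightarrow> \<Phi> M \<in> EM m m" "\<And>M. M \<in> EM n n \<Longrightarrow> \<Phi> M * R = R * M"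
    and Y: "Y \<in> EM n k" "R * Y = 0\<^sub>m m k"
  shows "Y = 0\<^sub>m n k"
proof (rule ccontr)
  note dR = EMD[OF R(1)] and dY = EMD[OF Y(1)]
  assume "Y \<noteq> 0\<^sub>m n k"
  then obtain i j where ij: "i < n" "j < k" "Y $$ (i, j) \<noteq> 0"
    using dY by (metis eq_matI index_zero_mat)
  have "R $$ (x, p) = 0" if xp: "x < m" "p < n" for x p
  proof -
    \<comment> \<open>\<open>?U\<close> moves row \<open>i\<close> of \<open>Y\<close> to row
      \<open>p\<close>, and \<open>?V\<close> extracts column \<open>j\<close>; together they leave
      a multiple of the \<open>p\<close>-th basis vector.\<close>
    let ?U = "unitm n n p i" and ?V = "unitm k 1 j 0"
    note dF = EMD[OF \<Phi>(1)[OF unitm_EM[of n n p i]]]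
    have "R * (?U * Y * ?V) = (R * ?U) * Y * ?V"
      using dR dY by (simp add: mm_assoc)
    also have "\<dots> = \<Phi> ?U * (R * Y) * ?V"
      using \<Phi>(2)[OF unitm_EM[of n n p i], symmetric] dR dY dF by (simp add: mm_assoc)
    also have "\<dots> = 0\<^sub>m m 1" using dF by (simp add: Y(2))
    finally have z: "R * (?U * Y * ?V) = 0\<^sub>m m 1" .
    have UY: "?U * Y \<in> EM n k" using Y unitm_EM by (intro EM_mult)
    have uv: "?U * Y * ?V = Y $$ (i, j) \<cdot>\<^sub>m unitm n 1 p 0"
      unfolding unitm_mult_right[OF UY ij(2)] using xp ij
      by (intro eq_matI) (auto simp: unitm_mult_left[OF Y(1) ij(1)])
    have "R * (?U * Y * ?V) = Y $$ (i, j) \<cdot>\<^sub>m (R * unitm n 1 p 0)"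
      unfolding uv using dR by (simp add: mm_smultr)
    then have "Y $$ (i, j) \<cdot>\<^sub>m (R * unitm n 1 p 0) = 0\<^sub>m m 1" using z by simp
    then have "(Y $$ (i, j) \<cdot>\<^sub>m (R * unitm n 1 p 0)) $$ (x, 0) = (0\<^sub>m m 1 :: 'a mat) $$ (x, 0)" by simp
    then have "Y $$ (i, j) * R $$ (x, p) = 0"
      unfolding unitm_mult_right[OF R(1) xp(2)] using xp by simp
    then show ?thesis using ij by simp
  qed
  then have "R = 0\<^sub>m m n" using dR by (intro eq_matI) auto
  then show False using R(2) by simp
qed

text \<open>Column 0 of the commutation relation with the matrix unit at (i, 0) says that column
  \<open>i\<close> of \<open>Z\<close> is Z(0, 0) times the \<open>i\<close>-th basis
  vector.\<close>

lemma commuting_scalar: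
  assumes n: "n \<ge> 1" and Z: "Z \<in> EM n n" and comm: "\<And>M. M \<in> EM n n \<Longrightarrow> M * Z = Z * M"
  shows "\<exists>l\<in>E. Z = l \<cdot>\<^sub>m 1\<^sub>m n"
proof
  note d = EMD[OF Z]
  show "Z $$ (0, 0) \<in> E" using d n by simp
  show "Z = Z $$ (0, 0) \<cdot>\<^sub>m 1\<^sub>m n"
  proof (rule eq_matI)
    fix x i assume "x < dim_row (Z $$ (0, 0) \<cdot>\<^sub>m 1\<^sub>m n)" "i < dim_col (Z $$ (0, 0) \<cdot>\<^sub>m 1\<^sub>m n)"
    then have xi: "x < n" "i < n" by auto
    have "(unitm n n i 0 * Z) $$ (x, 0) = (Z * unitm n n i 0) $$ (x, 0)"
      using comm[OF unitm_EM[of n n i 0]] by simp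
    then have "(if x = i then Z $$ (0, 0) else 0) = Z $$ (x, i)"
      using n xi by (simp add: unitm_mult_left[OF Z] unitm_mult_right[OF Z])
    then show "Z $$ (x, i) = (Z $$ (0, 0) \<cdot>\<^sub>m 1\<^sub>m n) $$ (x, i)" using xi by auto
  qed (use d in auto)
qed

text \<open>The columns of \<open>R\<close> are one fixed column \<open>q\<close> of the images of
  the matrix units in column 0, where \<open>q\<close> is chosen with a nonzero entry in the image
  of the unit at (0, 0). Expanding M e_i0 as the sum of M_ki e_k0 and applying \<Phi> gives
  \<Phi>(M) R = R M. The result is a nonzero intertwiner; its injectivity comes from
  \<open>intertwiner_injective\<close>, so sizes \<open>n\<close> and \<open>m\<close> may be kept
  apart.\<close>

lemma skolem_noether:
  assumes n: "n \<ge> 1"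
    and cl: "\<And>M. M \<in> EM n n \<Longrightarrow> \<Phi> M \<in> EM m m"
    and add: "\<And>M Z. \<lbrakk>M \<in> EM n n; Z \<in> EM n n\<rbrakk> \<Longrightarrow> \<Phi> (M + Z) = \<Phi> M + \<Phi> Z"
    and mult: "\<And>M Z. \<lbrakk>M \<in> EM n n; Z \<in> EM n n\<rbrakk> \<Longrightarrow> \<Phi> (M * Z) = \<Phi> M * \<Phi> Z"
    and smult: "\<And>k M. \<lbrakk>k \<in> E; M \<in> EM n n\<rbrakk> \<Longrightarrow> \<Phi> (k \<cdot>\<^sub>m M) = k \<cdot>\<^sub>m \<Phi> M"
    and inj: "\<And>M. \<lbrakk>M \<in> EM n n; \<Phi> M = 0\<^sub>m m m\<rbrakk> \<Longrightarrow> M = 0\<^sub>m n n"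
  shows "\<exists>R. R \<in> EM m n \<and> R \<noteq> 0\<^sub>m m n \<and> (\<forall>M\<in>EM n n. \<Phi> M * R = R * M)"
proof -
  define e where "e i = \<Phi> (unitm n n i 0)" for i
  have eE: "e i \<in> EM m m" for i unfolding e_def by (rule cl[OF unitm_EM])
  have zero: "\<Phi> (0\<^sub>m n n) = 0\<^sub>m m m"
  proof -
    have "0 \<cdot>\<^sub>m (0\<^sub>m n n :: 'a mat) = 0\<^sub>m n n" by (rule eq_matI) auto
    then have "\<Phi> (0\<^sub>m n n) = 0 \<cdot>\<^sub>m \<Phi> (0\<^sub>m n n)" using smult[OF E_zero EM_zero[of n n]] by simp
    also have "\<dots> = 0\<^sub>m m m" using EMD[OF cl[OF EM_zero]] by (intro eq_matI) auto
    finally show ?thesis .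
  qed
  have "unitm n n 0 0 \<noteq> 0\<^sub>m n n"
  proof
    assume "unitm n n 0 0 = 0\<^sub>m n n"
    then have "unitm n n 0 0 $$ (0, 0) = (0\<^sub>m n n :: 'a mat) $$ (0, 0)" by simp
    then show False using n by simp
  qed
  then have "e 0 \<noteq> 0\<^sub>m m m" using inj[OF unitm_EM[of n n 0 0]] e_def[of 0] by auto
  then obtain a q where aq: "a < m" "q < m" "e 0 $$ (a, q) \<noteq> 0"
    using EMD[OF eE] by (metis eq_matI index_zero_mat)
  define R where "R = mat m n (\<lambda>(x, i). e i $$ (x, q))"
  have RE: "R \<in> EM m n" using EMD(4)[OF eE] aq by (auto simp: R_def EM_def)
  have "R $$ (a, 0) \<noteq> 0" using aq n by (simp add: R_def)
  then have R0: "R \<noteq> 0\<^sub>m m n" using aq n by auto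
  have col: "\<Phi> Y $$ (x, q) = (\<Sum>i<n. R $$ (x, i) * v i)" if Yx: "x < m" and Y: "Y = mat n n (\<lambda>(i, j). if j = 0 then v i else 0)"
    and v: "\<And>i. i < n \<Longrightarrow> v i \<in> E" for Y x v
  proof -
    define Yk where "Yk k = mat n n (\<lambda>(i, j). if j = 0 \<and> i < k then v i else 0)" for k
    have "k \<le> n \<Longrightarrow> Yk k \<in> EM n n \<and> \<Phi> (Yk k) $$ (x, q) = (\<Sum>i<k. R $$ (x, i) * v i)" for k
    proof (induction k)
      case 0
      have "Yk 0 = 0\<^sub>m n n" unfolding Yk_def by (rule eq_matI) auto
      then show ?case using zero Yx aq EM_zero by simp
    next
      case (Suc k)
      have e: "Yk (Suc k) = Yk k + v k \<cdot>\<^sub>m unitm n n k 0" unfolding Yk_def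
        by (rule eq_matI) (use Suc in \<open>auto simp: less_Suc_eq\<close>)
      have vk: "v k \<cdot>\<^sub>m unitm n n k 0 \<in> EM n n" using v Suc by (intro EM_smult unitm_EM) auto
      have "\<Phi> (Yk (Suc k)) = \<Phi> (Yk k) + v k \<cdot>\<^sub>m \<Phi> (unitm n n k 0)"
        unfolding e using add[OF _ vk] Suc smult[OF v unitm_EM] by simp
      moreover have "dim_row (\<Phi> (unitm n n k 0)) = m" "dim_col (\<Phi> (unitm n n k 0)) = m"
        using EMD[OF cl[OF unitm_EM]] by auto
      ultimately show ?case using Suc Yx aq EM_add[OF _ vk, of "Yk k"] e
        by (simp add: R_def e_def mult.commute)
    qed
    moreover have "Yk n = Y" unfolding Yk_def Y by (rule eq_matI) auto
    ultimately show ?thesis by blast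
  qed
  have "\<Phi> M * R = R * M" if M: "M \<in> EM n n" for M
  proof (rule eq_matI)
    note dM = EMD[OF M] and dF = EMD[OF cl[OF M]]
    fix x i assume "x < dim_row (R * M)" "i < dim_col (R * M)"
    then have xi: "x < m" "i < n" using dM by (auto simp: R_def)
    have "(\<Phi> M * R) $$ (x, i) = (\<Phi> M * e i) $$ (x, q)"
      using xi aq dF EMD[OF eE[of i]] by (simp add: scalar_prod_def R_def)
    also have "\<dots> = \<Phi> (M * unitm n n i 0) $$ (x, q)" using mult[OF M unitm_EM] by (simp add: e_def)
    also have "\<dots> = (\<Sum>k<n. R $$ (x, k) * M $$ (k, i))"
      by (rule col[OF xi(1)]) (use unitm_mult_right[OF M xi(2)] dM xi in auto)
    also have "\<dots> = (R * M) $$ (x, i)" using xi dM by (simp add: scalar_prod_def R_def atLeast0LessThan)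
    finally show "(\<Phi> M * R) $$ (x, i) = (R * M) $$ (x, i)" .
  qed (use EMD[OF RE] EMD[OF cl[OF M]] EMD[OF M] in auto)
  then show ?thesis using RE R0 by blast
qed

text \<open>States that the scalar extension of \<open>A\<close> to \<open>E\<close> is M_n(E),
  without mentioning a tensor product: each matrix is uniquely \<iota>(a) + om \<iota>(b).\<close>

definition form :: "('a, 'b, 'm) module_scheme \<Rightarrow> nat \<Rightarrow> ('b \<Rightarrow> 'a mat) \<Rightarrow> bool" where
  "form A n \<iota> \<longleftrightarrow> n \<ge> 1 \<and> ring_alg L A \<and> (\<forall>a\<in>carrier A. \<iota> a \<in> EM n n) \<and>
     (\<forall>a\<in>carrier A. \<forall>b\<in>carrier A. \<iota> (a \<oplus>\<^bsub>A\<^esub> b) = \<iota> a + \<iota> b \<and> \<iota> (a \<otimes>\<^bsub>A\<^esub> b) = \<iota> a * \<iota> b) \<and>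
     \<iota> \<one>\<^bsub>A\<^esub> = 1\<^sub>m n \<and> (\<forall>r\<in>L. \<forall>a\<in>carrier A. \<iota> (r \<odot>\<^bsub>A\<^esub> a) = r \<cdot>\<^sub>m \<iota> a) \<and>
     (\<forall>M\<in>EM n n. \<exists>a\<in>carrier A. \<exists>b\<in>carrier A. M = \<iota> a + om \<cdot>\<^sub>m \<iota> b) \<and>
     (\<forall>a\<in>carrier A. \<forall>b\<in>carrier A. \<iota> a + om \<cdot>\<^sub>m \<iota> b = 0\<^sub>m n n \<longrightarrow> a = \<zero>\<^bsub>A\<^esub> \<and> b = \<zero>\<^bsub>A\<^esub>)"

lemma formD:
  assumes "form A n \<iota>"
  shows "n \<ge> 1" "ring_alg L A" "\<And>a. a \<in> carrier A \<Longrightarrow> \<iota> a \<in> EM n n"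
    "\<And>a b. \<lbrakk>a \<in> carrier A; b \<in> carrier A\<rbrakk> \<Longrightarrow> \<iota> (a \<oplus>\<^bsub>A\<^esub> b) = \<iota> a + \<iota> b"
    "\<And>a b. \<lbrakk>a \<in> carrier A; b \<in> carrier A\<rbrakk> \<Longrightarrow> \<iota> (a \<otimes>\<^bsub>A\<^esub> b) = \<iota> a * \<iota> b"
    "\<iota> \<one>\<^bsub>A\<^esub> = 1\<^sub>m n" "\<And>r a. \<lbrakk>r \<in> L; a \<in> carrier A\<rbrakk> \<Longrightarrow> \<iota> (r \<odot>\<^bsub>A\<^esub> a) = r \<cdot>\<^sub>m \<iota> a"
    "\<And>M. M \<in> EM n n \<Longrightarrow> \<exists>a\<in>carrier A. \<exists>b\<in>carrier A. M = \<iota> a + om \<cdot>\<^sub>m \<iota> b"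
    "\<And>a b. \<lbrakk>a \<in> carrier A; b \<in> carrier A; \<iota> a + om \<cdot>\<^sub>m \<iota> b = 0\<^sub>m n n\<rbrakk> \<Longrightarrow> a = \<zero>\<^bsub>A\<^esub> \<and> b = \<zero>\<^bsub>A\<^esub>"
    "closed_alg L A" "\<iota> \<zero>\<^bsub>A\<^esub> = 0\<^sub>m n n"
proof -
  show 1: "n \<ge> 1" "ring_alg L A" "\<And>a. a \<in> carrier A \<Longrightarrow> \<iota> a \<in> EM n n"
    "\<And>a b. \<lbrakk>a \<in> carrier A; b \<in> carrier A\<rbrakk> \<Longrightarrow> \<iota> (a \<oplus>\<^bsub>A\<^esub> b) = \<iota> a + \<iota> b"
    "\<And>a b. \<lbrakk>a \<in> carrier A; b \<in> carrier A\<rbrakk> \<Longrightarrow> \<iota> (a \<otimes>\<^bsub>A\<^esub> b) = \<iota> a * \<iota> b"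
    "\<iota> \<one>\<^bsub>A\<^esub> = 1\<^sub>m n" "\<And>r a. \<lbrakk>r \<in> L; a \<in> carrier A\<rbrakk> \<Longrightarrow> \<iota> (r \<odot>\<^bsub>A\<^esub> a) = r \<cdot>\<^sub>m \<iota> a"
    "\<And>M. M \<in> EM n n \<Longrightarrow> \<exists>a\<in>carrier A. \<exists>b\<in>carrier A. M = \<iota> a + om \<cdot>\<^sub>m \<iota> b"
    "\<And>a b. \<lbrakk>a \<in> carrier A; b \<in> carrier A; \<iota> a + om \<cdot>\<^sub>m \<iota> b = 0\<^sub>m n n\<rbrakk> \<Longrightarrow> a = \<zero>\<^bsub>A\<^esub> \<and> b = \<zero>\<^bsub>A\<^esub>"
    using assms unfolding form_def by blast+
  show c: "closed_alg L A" by (rule ring_alg_closed[OF 1(2)])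
  interpret module "fld L" A using 1(2) by (simp add: ring_alg_def)
  have "\<iota> (0 \<odot>\<^bsub>A\<^esub> \<one>\<^bsub>A\<^esub>) = 0 \<cdot>\<^sub>m \<iota> \<one>\<^bsub>A\<^esub>" using 1(7)[OF L_zero closed_algD(1)[OF c]] .
  moreover have "0 \<odot>\<^bsub>A\<^esub> \<one>\<^bsub>A\<^esub> = \<zero>\<^bsub>A\<^esub>" using smult_l_null[OF closed_algD(1)[OF c]] by (simp add: fld_def)
  ultimately show "\<iota> \<zero>\<^bsub>A\<^esub> = 0\<^sub>m n n" unfolding 1(6) by (auto intro!: eq_matI)
qed

lemma typed_form:
  assumes A: "closed_alg L A" and t: "tw n P c" and h: "alg_map L A (twist n P) h"
  shows "form A n h"
proof -
  note hD = alg_mapD[OF h]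
  have ra: "ring_alg L A" by (rule ring_alg_transfer[OF A h twist_ring_alg[OF twD(2)[OF t]]])
  have "\<exists>a\<in>carrier A. \<exists>b\<in>carrier A. M = h a + om \<cdot>\<^sub>m h b" if M: "M \<in> EM n n" for M
    using descent[OF t M] unfolding hD(3)[symmetric] by blast
  moreover have "a = \<zero>\<^bsub>A\<^esub> \<and> b = \<zero>\<^bsub>A\<^esub>" if "a \<in> carrier A" "b \<in> carrier A" "h a + om \<cdot>\<^sub>m h b = 0\<^sub>m n n" for a b
  proof -
    have "h a = h \<zero>\<^bsub>A\<^esub>" "h b = h \<zero>\<^bsub>A\<^esub>"
      using descent_unique[OF t hD(4)[OF that(1)] hD(4)[OF that(2)] that(3)] hD(8) by auto
    then show ?thesis using inj_onD[OF hD(2) _ that(1) closed_algD(2)[OF A]]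
        inj_onD[OF hD(2) _ that(2) closed_algD(2)[OF A]] by auto
  qed
  moreover have "\<And>a. a \<in> carrier A \<Longrightarrow> h a \<in> EM n n" using hD(4) by (auto simp: twist_carrier)
  ultimately show ?thesis unfolding form_def using ra twD(1)[OF t] hD(5,6,7,9) by auto
qed

text \<open>Extends the passage from \<iota>(a) to \<kappa>(a) to all matrices, linearly or
  semilinearly over \<open>E\<close>. With \<open>f = id\<close> it compares two matrix descriptions
  of one algebra; with \<open>f = sg\<close> it produces the conjugation on the scalar
  extension.\<close>

lemma form_extend:
  assumes A: "form A n \<iota>" and B: "form A m \<kappa>" and f: "f = id \<or> f = sg"
  shows "\<exists>\<Phi>. (\<forall>M\<in>EM n n. \<Phi> M \<in> EM m m) \<and>
     (\<forall>M\<in>EM n n. \<forall>Z\<in>EM n n. \<Phi> (M + Z) = \<Phi> M + \<Phi> Z \<and> \<Phi> (M * Z) = \<Phi> M * \<Phi> Z) \<and>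
     (\<forall>k\<in>E. \<forall>M\<in>EM n n. \<Phi> (k \<cdot>\<^sub>m M) = f k \<cdot>\<^sub>m \<Phi> M) \<and>
     (\<forall>M\<in>EM n n. \<Phi> M = 0\<^sub>m m m \<longrightarrow> M = 0\<^sub>m n n) \<and> (\<forall>a\<in>carrier A. \<Phi> (\<iota> a) = \<kappa> a)"
proof -
  note a = formD[OF A] and b = formD[OF B] and cA = closed_algD[OF formD(10)[OF A]]
  interpret R: ring A using a(2) by (simp add: ring_alg_def)
  interpret AM: module "fld L" A using a(2) by (simp add: ring_alg_def)
  have fE: "f x \<in> E" if "x \<in> E" for x using f sg_E that by auto
  have fL: "f x = x" if "x \<in> L" for x using f L_sg that by auto
  have fadd: "f (x + y) = f x + f y" and fmult: "f (x * y) = f x * f y" for x y using f sg_add sg_mult by auto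
  have dA: "dim_row (\<iota> x) = n" "dim_col (\<iota> x) = n" "dim_row (\<kappa> x) = m" "dim_col (\<kappa> x) = m" if "x \<in> carrier A" for x
    using EMD[OF a(3)[OF that]] EMD[OF b(3)[OF that]] by auto
  have neg: "\<iota> (\<ominus>\<^bsub>A\<^esub> x) = (-1) \<cdot>\<^sub>m \<iota> x" if x: "x \<in> carrier A" for x
  proof -
    have "\<iota> (\<ominus>\<^bsub>A\<^esub> x \<oplus>\<^bsub>A\<^esub> x) = 0\<^sub>m n n" using a(11) R.l_neg[OF x] by simp
    then have "\<iota> (\<ominus>\<^bsub>A\<^esub> x) + \<iota> x = 0\<^sub>m n n" using a(4)[of "\<ominus>\<^bsub>A\<^esub> x" x] x by simp
    then have s: "(\<iota> (\<ominus>\<^bsub>A\<^esub> x) + \<iota> x) $$ (i, j) = (0\<^sub>m n n :: 'a mat) $$ (i, j)" for i j by simp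
    have e: "\<iota> (\<ominus>\<^bsub>A\<^esub> x) $$ (i, j) + \<iota> x $$ (i, j) = 0" if "i < n" "j < n" for i j
      using that dA[OF x] dA[of "\<ominus>\<^bsub>A\<^esub> x"] x s[of i j] by simp
    show ?thesis using dA[OF x] dA[of "\<ominus>\<^bsub>A\<^esub> x"] x e by (intro eq_matI) (auto simp: eq_neg_iff_add_eq_0)
  qed
  define \<Phi> where "\<Phi> M = (SOME Y. \<exists>x\<in>carrier A. \<exists>y\<in>carrier A. M = \<iota> x + om \<cdot>\<^sub>m \<iota> y \<and> Y = \<kappa> x + f om \<cdot>\<^sub>m \<kappa> y)" for M
  have \<Phi>: "\<Phi> (\<iota> x + om \<cdot>\<^sub>m \<iota> y) = \<kappa> x + f om \<cdot>\<^sub>m \<kappa> y" if xy: "x \<in> carrier A" "y \<in> carrier A" for x y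
  proof -
    have u: "x' = x \<and> y' = y" if xy': "x' \<in> carrier A" "y' \<in> carrier A" and e: "\<iota> x + om \<cdot>\<^sub>m \<iota> y = \<iota> x' + om \<cdot>\<^sub>m \<iota> y'" for x' y'
    proof -
      have "\<iota> (x' \<oplus>\<^bsub>A\<^esub> \<ominus>\<^bsub>A\<^esub> x) + om \<cdot>\<^sub>m \<iota> (y' \<oplus>\<^bsub>A\<^esub> \<ominus>\<^bsub>A\<^esub> y) = 0\<^sub>m n n"
      proof (rule eq_matI)
        fix i j assume "i < dim_row (0\<^sub>m n n :: 'a mat)" "j < dim_col (0\<^sub>m n n :: 'a mat)"
        then have ij: "i < n" "j < n" by auto
        have "(\<iota> x + om \<cdot>\<^sub>m \<iota> y) $$ (i, j) = (\<iota> x' + om \<cdot>\<^sub>m \<iota> y') $$ (i, j)" using e by simp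
        then show "(\<iota> (x' \<oplus>\<^bsub>A\<^esub> \<ominus>\<^bsub>A\<^esub> x) + om \<cdot>\<^sub>m \<iota> (y' \<oplus>\<^bsub>A\<^esub> \<ominus>\<^bsub>A\<^esub> y)) $$ (i, j) = (0\<^sub>m n n :: 'a mat) $$ (i, j)"
          using ij xy xy' dA by (simp add: a(4) neg algebra_simps)
      qed (use dA xy xy' in auto)
      then have "x' \<oplus>\<^bsub>A\<^esub> \<ominus>\<^bsub>A\<^esub> x = \<zero>\<^bsub>A\<^esub>" "y' \<oplus>\<^bsub>A\<^esub> \<ominus>\<^bsub>A\<^esub> y = \<zero>\<^bsub>A\<^esub>"
        using a(9)[of "x' \<oplus>\<^bsub>A\<^esub> \<ominus>\<^bsub>A\<^esub> x" "y' \<oplus>\<^bsub>A\<^esub> \<ominus>\<^bsub>A\<^esub> y"] xy xy'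
        by (metis R.a_closed R.a_inv_closed)+
      then show ?thesis using xy xy' R.minus_equality R.minus_minus R.a_comm by (metis R.a_inv_closed)
    qed
    show ?thesis unfolding \<Phi>_def
      by (rule some_equality) (use u xy in blast)+
  qed
  have K: "\<Phi> (k \<cdot>\<^sub>m \<iota> x) = f k \<cdot>\<^sub>m \<kappa> x" if k: "k \<in> E" and x: "x \<in> carrier A" for k x
  proof -
    have uv: "reE k \<in> L" "imE k \<in> L" using reE_L imE_L k by auto
    have c: "reE k \<odot>\<^bsub>A\<^esub> x \<in> carrier A" "imE k \<odot>\<^bsub>A\<^esub> x \<in> carrier A" using cA(5) uv x by auto
    have "k \<cdot>\<^sub>m \<iota> x = \<iota> (reE k \<odot>\<^bsub>A\<^esub> x) + om \<cdot>\<^sub>m \<iota> (imE k \<odot>\<^bsub>A\<^esub> x)"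
    proof -
      have "k * z = reE k * z + om * (imE k * z)" for z
        by (subst re_im[of k]) (simp add: algebra_simps)
      then show ?thesis unfolding a(7)[OF uv(1) x] a(7)[OF uv(2) x] using dA[OF x]
        by (intro eq_matI) auto
    qed
    then have "\<Phi> (k \<cdot>\<^sub>m \<iota> x) = \<kappa> (reE k \<odot>\<^bsub>A\<^esub> x) + f om \<cdot>\<^sub>m \<kappa> (imE k \<odot>\<^bsub>A\<^esub> x)" using \<Phi>[OF c] by simp
    also have "\<dots> = f k \<cdot>\<^sub>m \<kappa> x"
    proof -
      have "f k = f (reE k + imE k * om)" using re_im[of k] by simp
      then have "f k = reE k + imE k * f om" by (simp add: fadd fmult fL uv)
      then show ?thesis unfolding b(7)[OF uv(1) x] b(7)[OF uv(2) x] using dA[OF x]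
        by (intro eq_matI) (auto simp: algebra_simps)
    qed
    finally show ?thesis .
  qed
  have dec: "\<exists>x\<in>carrier A. \<exists>y\<in>carrier A. M = \<iota> x + om \<cdot>\<^sub>m \<iota> y \<and> \<Phi> M = \<kappa> x + f om \<cdot>\<^sub>m \<kappa> y" if M: "M \<in> EM n n" for M
    using a(8)[OF M] \<Phi> by blast
  have cl: "\<Phi> M \<in> EM m m" if M: "M \<in> EM n n" for M
    using dec[OF M] b(3) fE[OF om(1)] by (auto intro!: EM_add EM_smult)
  have add: "\<Phi> (M + Z) = \<Phi> M + \<Phi> Z" if M: "M \<in> EM n n" and Z: "Z \<in> EM n n" for M Z
  proof -
    obtain x y where xy: "x \<in> carrier A" "y \<in> carrier A" "M = \<iota> x + om \<cdot>\<^sub>m \<iota> y" "\<Phi> M = \<kappa> x + f om \<cdot>\<^sub>m \<kappa> y" using dec[OF M] by auto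
    obtain x' y' where xy': "x' \<in> carrier A" "y' \<in> carrier A" "Z = \<iota> x' + om \<cdot>\<^sub>m \<iota> y'" "\<Phi> Z = \<kappa> x' + f om \<cdot>\<^sub>m \<kappa> y'" using dec[OF Z] by auto
    note dd = dA[OF xy(1)] dA[OF xy(2)] dA[OF xy'(1)] dA[OF xy'(2)]
    have "M + Z = \<iota> (x \<oplus>\<^bsub>A\<^esub> x') + om \<cdot>\<^sub>m \<iota> (y \<oplus>\<^bsub>A\<^esub> y')"
      unfolding xy(3) xy'(3) a(4)[OF xy(1) xy'(1)] a(4)[OF xy(2) xy'(2)] by (rule eq_matI) (use dd in \<open>auto simp: algebra_simps\<close>)
    then have "\<Phi> (M + Z) = \<kappa> (x \<oplus>\<^bsub>A\<^esub> x') + f om \<cdot>\<^sub>m \<kappa> (y \<oplus>\<^bsub>A\<^esub> y')" using \<Phi> xy xy' by simp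
    also have "\<dots> = \<Phi> M + \<Phi> Z"
      unfolding xy(4) xy'(4) b(4)[OF xy(1) xy'(1)] b(4)[OF xy(2) xy'(2)] by (rule eq_matI) (use dd in \<open>auto simp: algebra_simps\<close>)
    finally show ?thesis .
  qed
  have smult: "\<Phi> (k \<cdot>\<^sub>m M) = f k \<cdot>\<^sub>m \<Phi> M" if k: "k \<in> E" and M: "M \<in> EM n n" for k M
  proof -
    obtain x y where xy: "x \<in> carrier A" "y \<in> carrier A" "M = \<iota> x + om \<cdot>\<^sub>m \<iota> y" "\<Phi> M = \<kappa> x + f om \<cdot>\<^sub>m \<kappa> y" using dec[OF M] by auto
    note dd = dA[OF xy(1)] dA[OF xy(2)]
    have e: "k \<cdot>\<^sub>m \<iota> x \<in> EM n n" "(k * om) \<cdot>\<^sub>m \<iota> y \<in> EM n n" using k a(3) xy om by (auto intro!: EM_smult E_mult)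
    have "k \<cdot>\<^sub>m M = k \<cdot>\<^sub>m \<iota> x + (k * om) \<cdot>\<^sub>m \<iota> y" unfolding xy(3) by (rule eq_matI) (use dd in \<open>auto simp: algebra_simps\<close>)
    then have "\<Phi> (k \<cdot>\<^sub>m M) = f k \<cdot>\<^sub>m \<kappa> x + f (k * om) \<cdot>\<^sub>m \<kappa> y" using add[OF e] K[OF k xy(1)] K[OF E_mult[OF k om(1)] xy(2)] by simp
    also have "\<dots> = f k \<cdot>\<^sub>m \<Phi> M" unfolding xy(4) by (rule eq_matI) (use dd in \<open>auto simp: algebra_simps fmult\<close>)
    finally show ?thesis .
  qed
  have \<Phi>\<iota>: "\<Phi> (\<iota> x) = \<kappa> x" if x: "x \<in> carrier A" for x
    using K[OF E_one x] f by (auto simp: smult_onem sg_one)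
  have mult: "\<Phi> (M * Z) = \<Phi> M * \<Phi> Z" if M: "M \<in> EM n n" and Z: "Z \<in> EM n n" for M Z
  proof -
    obtain x y where xy: "x \<in> carrier A" "y \<in> carrier A" "M = \<iota> x + om \<cdot>\<^sub>m \<iota> y" "\<Phi> M = \<kappa> x + f om \<cdot>\<^sub>m \<kappa> y" using dec[OF M] by auto
    obtain x' y' where xy': "x' \<in> carrier A" "y' \<in> carrier A" "Z = \<iota> x' + om \<cdot>\<^sub>m \<iota> y'" "\<Phi> Z = \<kappa> x' + f om \<cdot>\<^sub>m \<kappa> y'" using dec[OF Z] by auto
    note dd = dA[OF xy(1)] dA[OF xy(2)] dA[OF xy'(1)] dA[OF xy'(2)]
    note cc = cA(4)[OF xy(1) xy'(1)] cA(4)[OF xy(1) xy'(2)] cA(4)[OF xy(2) xy'(1)] cA(4)[OF xy(2) xy'(2)]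
    have "M * Z = \<iota> (x \<otimes>\<^bsub>A\<^esub> x') + (om \<cdot>\<^sub>m \<iota> (x \<otimes>\<^bsub>A\<^esub> y') + (om \<cdot>\<^sub>m \<iota> (y \<otimes>\<^bsub>A\<^esub> x') + (om * om) \<cdot>\<^sub>m \<iota> (y \<otimes>\<^bsub>A\<^esub> y')))"
      unfolding xy(3) xy'(3) using dd xy(1,2) xy'(1,2) by (simp add: a(5) mm_simps) (rule eq_matI, auto simp: algebra_simps)
    then have "\<Phi> (M * Z) = \<kappa> (x \<otimes>\<^bsub>A\<^esub> x') + (f om \<cdot>\<^sub>m \<kappa> (x \<otimes>\<^bsub>A\<^esub> y') + (f om \<cdot>\<^sub>m \<kappa> (y \<otimes>\<^bsub>A\<^esub> x') + f (om * om) \<cdot>\<^sub>m \<kappa> (y \<otimes>\<^bsub>A\<^esub> y')))"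
      using cc om(1) by (simp add: add EM_add EM_smult a(3) K \<Phi>\<iota> E_mult)
    also have "\<dots> = \<Phi> M * \<Phi> Z"
      unfolding xy(4) xy'(4) using dd xy(1,2) xy'(1,2) by (simp add: b(5) mm_simps fmult) (rule eq_matI, auto simp: algebra_simps)
    finally show ?thesis .
  qed
  have inj: "M = 0\<^sub>m n n" if M: "M \<in> EM n n" and z: "\<Phi> M = 0\<^sub>m m m" for M
  proof -
    obtain x y where xy: "x \<in> carrier A" "y \<in> carrier A" "M = \<iota> x + om \<cdot>\<^sub>m \<iota> y" "\<Phi> M = \<kappa> x + f om \<cdot>\<^sub>m \<kappa> y" using dec[OF M] by auto
    note dd = dA[OF xy(1)] dA[OF xy(2)]
    have "x = \<zero>\<^bsub>A\<^esub> \<and> y = \<zero>\<^bsub>A\<^esub>"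
    proof (cases "f = id")
      case True
      then show ?thesis using b(9)[OF xy(1,2)] xy(4) z by simp
    next
      case False
      then have fsg: "f = sg" using f by simp
      \<comment> \<open>The conjugate of \<open>om\<close> is s - om with the trace \<open>s\<close>
        in \<open>L\<close>. This rewrites \<kappa>(x) + sg(om) \<kappa>(y) as \<kappa>(x + s y) +
        om \<kappa>(-y), to which uniqueness of the decomposition applies.\<close>
      define s where "s = om + sg om"
      have sL: "s \<in> L" using om by (simp add: s_def L_eq E_add sg_E sg_add sg_sg add.commute)
      have c: "x \<oplus>\<^bsub>A\<^esub> s \<odot>\<^bsub>A\<^esub> y \<in> carrier A" "(-1) \<odot>\<^bsub>A\<^esub> y \<in> carrier A" using cA(3,5) sL xy L_minus[OF L_one] by auto
      have "\<kappa> (x \<oplus>\<^bsub>A\<^esub> s \<odot>\<^bsub>A\<^esub> y) + om \<cdot>\<^sub>m \<kappa> ((-1) \<odot>\<^bsub>A\<^esub> y) = \<kappa> x + f om \<cdot>\<^sub>m \<kappa> y"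
        unfolding b(4)[OF xy(1) cA(5)[OF sL xy(2)]] b(7)[OF sL xy(2)] b(7)[OF L_minus[OF L_one] xy(2)]
        by (rule eq_matI) (use dd in \<open>auto simp: algebra_simps fsg s_def\<close>)
      then have z2: "x \<oplus>\<^bsub>A\<^esub> s \<odot>\<^bsub>A\<^esub> y = \<zero>\<^bsub>A\<^esub>" "(-1) \<odot>\<^bsub>A\<^esub> y = \<zero>\<^bsub>A\<^esub>" using b(9)[OF c] z xy(4) by auto
      have "\<kappa> ((-1) \<odot>\<^bsub>A\<^esub> y) = 0\<^sub>m m m" using z2 b(11) by simp
      then have "\<kappa> y = 0\<^sub>m m m" unfolding b(7)[OF L_minus[OF L_one] xy(2)]
        using dd by (intro eq_matI) (auto dest!: arg_cong[of _ _ "\<lambda>M. M $$ (_, _)"] simp: mat_eq_iff)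
      then have "y = \<zero>\<^bsub>A\<^esub>" using b(9)[OF xy(2) cA(2)] b(11) by (simp add: mat_eq_iff)
      moreover have "s \<odot>\<^bsub>A\<^esub> \<zero>\<^bsub>A\<^esub> = \<zero>\<^bsub>A\<^esub>" using AM.smult_r_null[of s] sL by (simp add: fld_def)
      ultimately show ?thesis using z2(1) xy(1) by simp
    qed
    then show ?thesis unfolding xy(3) by (auto simp: a(11) intro!: eq_matI)
  qed
  show ?thesis using cl add mult smult inj \<Phi>\<iota> by (intro exI[of _ \<Phi>]) auto
qed

end

section \<open>Forms are twists, and their class is unique up to norms\<close>

context quad
begin

lemma smultm_cancel:
  assumes "M \<in> EM r c" "k \<noteq> 0" "k \<cdot>\<^sub>m M = 0\<^sub>m r c" shows "M = 0\<^sub>m r c"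
proof (rule eq_matI)
  note d = EMD[OF assms(1)]
  fix i j assume "i < dim_row (0\<^sub>m r c :: 'a mat)" "j < dim_col (0\<^sub>m r c :: 'a mat)"
  then have ij: "i < r" "j < c" by auto
  have "(k \<cdot>\<^sub>m M) $$ (i, j) = (0\<^sub>m r c :: 'a mat) $$ (i, j)" using assms(3) by simp
  then show "M $$ (i, j) = (0\<^sub>m r c :: 'a mat) $$ (i, j)" using ij d assms(2) by simp
qed (use EMD[OF assms(1)] in auto)

lemma smultm_inject:
  assumes "M \<in> EM r c" "M \<noteq> 0\<^sub>m r c" "k \<cdot>\<^sub>m M = l \<cdot>\<^sub>m M" shows "k = l"
proof (rule ccontr)
  note d = EMD[OF assms(1)]
  assume "k \<noteq> l"
  moreover have "(k - l) \<cdot>\<^sub>m M = 0\<^sub>m r c"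
  proof (rule eq_matI)
    fix i j assume "i < dim_row (0\<^sub>m r c :: 'a mat)" "j < dim_col (0\<^sub>m r c :: 'a mat)"
    then have ij: "i < r" "j < c" by auto
    have "(k \<cdot>\<^sub>m M) $$ (i, j) = (l \<cdot>\<^sub>m M) $$ (i, j)" using assms(3) by simp
    then show "((k - l) \<cdot>\<^sub>m M) $$ (i, j) = (0\<^sub>m r c :: 'a mat) $$ (i, j)" using ij d by (simp add: algebra_simps)
  qed (use d in auto)
  ultimately show False using smultm_cancel[OF assms(1), of "k - l"] assms(2) by simp
qed

lemma one_nonzero: "n \<ge> 1 \<Longrightarrow> (1\<^sub>m n :: 'a mat) \<noteq> 0\<^sub>m n n"
proof
  assume "n \<ge> 1" "(1\<^sub>m n :: 'a mat) = 0\<^sub>m n n"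
  then have "(1\<^sub>m n :: 'a mat) $$ (0, 0) = 0\<^sub>m n n $$ (0, 0)" by simp
  then show False using \<open>n \<ge> 1\<close> by simp
qed

lemma smat_eq_zero: "\<lbrakk>M \<in> EM r c; smat M = 0\<^sub>m r c\<rbrakk> \<Longrightarrow> M = 0\<^sub>m r c"
  using smat_smat[of M r c] smat_zero[of r c] by simp

text \<open>Let \<tau> be the semilinear involution of M_n(E) fixing \<iota>(A). Composed with
  entrywise conjugation it is \<open>E\<close>-linear, so Skolem-Noether yields \<open>R\<close>
  with \<tau>(M) R = R sg(M). As \<tau> is an involution, R sg(R) commutes with every matrix and is
  a scalar \<open>l\<close>. Once \<open>l\<close> is seen to be nonzero and in \<open>L\<close>,
  \<tau> is the map \<open>tau\<close> of \<open>R\<close>, and its fixed points are both \<iota>(A)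
  and the twist.\<close>

lemma form_typed:
  assumes A: "form A n \<iota>" shows "\<exists>c. typed A n c"
proof -
  note a = formD[OF A]
  obtain \<tau> where t: "\<forall>M\<in>EM n n. \<tau> M \<in> EM n n"
     "\<forall>M\<in>EM n n. \<forall>Z\<in>EM n n. \<tau> (M + Z) = \<tau> M + \<tau> Z \<and> \<tau> (M * Z) = \<tau> M * \<tau> Z"
     "\<forall>k\<in>E. \<forall>M\<in>EM n n. \<tau> (k \<cdot>\<^sub>m M) = sg k \<cdot>\<^sub>m \<tau> M"
     "\<forall>M\<in>EM n n. \<tau> M = 0\<^sub>m n n \<longrightarrow> M = 0\<^sub>m n n" "\<forall>x\<in>carrier A. \<tau> (\<iota> x) = \<iota> x"
    using form_extend[OF A A, of sg] by auto
  have om\<iota>: "\<tau> (\<iota> x + om \<cdot>\<^sub>m \<iota> y) = \<iota> x + sg om \<cdot>\<^sub>m \<iota> y" if "x \<in> carrier A" "y \<in> carrier A" for x y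
    using t a(3) that EM_smult[OF a(3) om(1)] om(1) by auto
  have tt: "\<tau> (\<tau> M) = M" if M: "M \<in> EM n n" for M
  proof -
    obtain x y where xy: "x \<in> carrier A" "y \<in> carrier A" "M = \<iota> x + om \<cdot>\<^sub>m \<iota> y" using a(8)[OF M] by auto
    have "\<tau> (\<iota> x + sg om \<cdot>\<^sub>m \<iota> y) = \<iota> x + om \<cdot>\<^sub>m \<iota> y"
      using t a(3) xy EM_smult[OF a(3)[OF xy(2)] sg_E[OF om(1)]] sg_E[OF om(1)] sg_sg[OF om(1)] by auto
    then show ?thesis using om\<iota>[OF xy(1,2)] xy(3) by simp
  qed
  have "\<exists>R. R \<in> EM n n \<and> R \<noteq> 0\<^sub>m n n \<and> (\<forall>M\<in>EM n n. \<tau> (smat M) * R = R * M)"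
  proof (rule skolem_noether[OF a(1)])
    fix M Z assume M: "M \<in> EM n n" and Z: "Z \<in> EM n n"
    show "\<tau> (smat (M + Z)) = \<tau> (smat M) + \<tau> (smat Z)" "\<tau> (smat (M * Z)) = \<tau> (smat M) * \<tau> (smat Z)"
      using t EM_smat[OF M] EM_smat[OF Z] EMD[OF M] EMD[OF Z] by (auto simp: smat_add smat_mult)
  next
    fix k M assume "k \<in> E" and M: "M \<in> EM n n"
    then show "\<tau> (smat (k \<cdot>\<^sub>m M)) = k \<cdot>\<^sub>m \<tau> (smat M)"
      using t EM_smat[OF M] sg_E[of k] sg_sg[of k] by (simp add: smat_smult)
  next
    fix M assume M: "M \<in> EM n n" "\<tau> (smat M) = 0\<^sub>m n n"
    then have "smat M = 0\<^sub>m n n" using t(4) EM_smat[OF M(1)] by blast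
    then show "M = 0\<^sub>m n n" using smat_eq_zero[OF M(1)] by simp
  qed (use t(1) EM_smat in auto)
  then obtain R where R: "R \<in> EM n n" "R \<noteq> 0\<^sub>m n n" and RM: "\<And>M. M \<in> EM n n \<Longrightarrow> \<tau> (smat M) * R = R * M" by blast
  note dR = EMD[OF R(1)]
  have RT: "\<tau> M * R = R * smat M" if M: "M \<in> EM n n" for M
    using RM[OF EM_smat[OF M]] smat_smat[OF M] by simp
  have ZE: "R * smat R \<in> EM n n" using R by (intro EM_mult EM_smat)
  have "\<exists>l\<in>E. R * smat R = l \<cdot>\<^sub>m 1\<^sub>m n"
  proof (rule commuting_scalar[OF a(1) ZE])
    fix M assume M: "M \<in> EM n n"
    note d = EMD[OF M] EMD[OF bspec[OF t(1) M]]
    have "M * (R * smat R) = \<tau> (\<tau> M) * R * smat R" using d dR tt[OF M] by (simp add: mm_assoc)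
    also have "\<dots> = R * (smat (\<tau> M * R))" using d dR RT[OF bspec[OF t(1) M]] by (simp add: mm_assoc smat_mult)
    also have "\<dots> = R * smat R * M" using d dR by (simp add: RT[OF M] smat_mult smat_smat[OF M] mm_assoc)
    finally show "M * (R * smat R) = R * smat R * M" .
  qed
  then obtain l where l: "l \<in> E" "R * smat R = l \<cdot>\<^sub>m 1\<^sub>m n" by auto
  have l0: "l \<noteq> 0"
  proof
    assume "l = 0"
    then have "R * smat R = 0\<^sub>m n n" unfolding l(2) by (auto intro!: eq_matI)
    then have "smat R = 0\<^sub>m n n"
      using intertwiner_injective[OF R, of "\<lambda>M. \<tau> (smat M)" "smat R" n] t(1) EM_smat RM R(1) by blast
    then show False using smat_eq_zero[OF R(1)] R(2) by simp
  qed
  have W: "smat R * R \<in> EM n n" "smat R * R + (- l) \<cdot>\<^sub>m 1\<^sub>m n \<in> EM n n"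
    using R l by (auto intro!: EM_mult EM_smat EM_add EM_smult EM_one E_minus)
  \<comment> \<open>Since \<open>R\<close> is injective it can be cancelled here, so sg(R) R is the
    same scalar as R sg(R). Comparing the latter with its conjugate then puts \<open>l\<close> into
    \<open>L\<close>.\<close>
  have "R * (smat R * R + (- l) \<cdot>\<^sub>m 1\<^sub>m n) = (R * smat R) * R + (- l) \<cdot>\<^sub>m R"
    using dR by (simp add: mm_distr mm_smultr mm_assoc)
  also have "\<dots> = 0\<^sub>m n n" unfolding l(2) using dR by (auto simp: mm_smultl intro!: eq_matI)
  finally have "smat R * R + (- l) \<cdot>\<^sub>m 1\<^sub>m n = 0\<^sub>m n n"
    using intertwiner_injective[OF R, of "\<lambda>M. \<tau> (smat M)" "smat R * R + (- l) \<cdot>\<^sub>m 1\<^sub>m n" n] t(1) EM_smat RM W(2) by blast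
  then have ent: "(smat R * R + (- l) \<cdot>\<^sub>m 1\<^sub>m n) $$ (i, j) = (0\<^sub>m n n :: 'a mat) $$ (i, j)" for i j by simp
  have lR: "smat R * R = l \<cdot>\<^sub>m 1\<^sub>m n"
  proof (rule eq_matI)
    fix i j assume "i < dim_row (l \<cdot>\<^sub>m 1\<^sub>m n)" "j < dim_col (l \<cdot>\<^sub>m 1\<^sub>m n)"
    then have ij: "i < n" "j < n" by auto
    have "(smat R * R) $$ (i, j) + (- l) * (1\<^sub>m n $$ (i, j)) = 0" using ent[of i j] ij EMD[OF W(1)] by simp
    then show "(smat R * R) $$ (i, j) = (l \<cdot>\<^sub>m 1\<^sub>m n) $$ (i, j)" using ij by simp
  qed (use dR in auto)
  have "smat (R * smat R) = smat R * R" using dR by (simp add: smat_mult smat_smat[OF R(1)])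
  then have "sg l \<cdot>\<^sub>m 1\<^sub>m n = l \<cdot>\<^sub>m 1\<^sub>m n" unfolding lR l(2) by (simp add: smat_smult smat_one)
  then have "sg l = l" using smultm_inject[OF EM_one one_nonzero[OF a(1)]] by blast
  then have "l \<in> L" using l(1) by (simp add: L_eq)
  then have tw: "tw n R l" using a(1) R(1) l l0 by (simp add: tw_def)
  have tau_eq: "tau n R l M = \<tau> M" if M: "M \<in> EM n n" for M
  proof -
    note d = EMD[OF M] EMD[OF bspec[OF t(1) M]]
    have "tau n R l M = inverse l \<cdot>\<^sub>m (\<tau> M * (R * smat R))"
      unfolding tau_def RT[OF M, symmetric] using d dR by (simp add: mm_assoc)
    then show ?thesis using d l0 by (simp add: l(2) mm_simps smult_onem)
  qed
  have in_tw: "M \<in> carrier (twist n R) \<longleftrightarrow> \<tau> M = M" if "M \<in> EM n n" for M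
    using twist_iff_tau[OF tw that] tau_eq[OF that] by simp
  have inj: "inj_on \<iota> (carrier A)"
  proof (rule inj_onI)
    fix x y assume xy: "x \<in> carrier A" "y \<in> carrier A" "\<iota> x = \<iota> y"
    interpret RA: ring A using a(2) by (simp add: ring_alg_def)
    have "\<iota> (x \<ominus>\<^bsub>A\<^esub> y \<oplus>\<^bsub>A\<^esub> y) = \<iota> y" using xy by (simp add: RA.minus_eq RA.a_assoc RA.l_neg)
    then have e: "\<iota> (x \<ominus>\<^bsub>A\<^esub> y) + \<iota> y = \<iota> y" using a(4)[of "x \<ominus>\<^bsub>A\<^esub> y" y] xy by simp
    have d: "\<iota> (x \<ominus>\<^bsub>A\<^esub> y) \<in> EM n n" "\<iota> y \<in> EM n n" using a(3) xy by auto
    have "\<iota> (x \<ominus>\<^bsub>A\<^esub> y) + om \<cdot>\<^sub>m \<iota> \<zero>\<^bsub>A\<^esub> = 0\<^sub>m n n"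
    proof (rule eq_matI)
      fix i j assume "i < dim_row (0\<^sub>m n n :: 'a mat)" "j < dim_col (0\<^sub>m n n :: 'a mat)"
      then have ij: "i < n" "j < n" by auto
      have "(\<iota> (x \<ominus>\<^bsub>A\<^esub> y) + \<iota> y) $$ (i, j) = \<iota> y $$ (i, j)" using e by simp
      then show "(\<iota> (x \<ominus>\<^bsub>A\<^esub> y) + om \<cdot>\<^sub>m \<iota> \<zero>\<^bsub>A\<^esub>) $$ (i, j) = (0\<^sub>m n n :: 'a mat) $$ (i, j)"
        using ij EMD[OF d(1)] EMD[OF d(2)] by (simp add: a(11))
    qed (use EMD[OF d(1)] in \<open>auto simp: a(11)\<close>)
    then have "x \<ominus>\<^bsub>A\<^esub> y = \<zero>\<^bsub>A\<^esub>" using a(9)[of "x \<ominus>\<^bsub>A\<^esub> y" "\<zero>\<^bsub>A\<^esub>"] xy by simp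
    then show "x = y" using xy by simp
  qed
  have surj: "\<iota> ` carrier A = carrier (twist n R)"
  proof
    show "\<iota> ` carrier A \<subseteq> carrier (twist n R)" using in_tw a(3) t(5) by auto
    show "carrier (twist n R) \<subseteq> \<iota> ` carrier A"
    proof
      fix M assume M: "M \<in> carrier (twist n R)"
      then have ME: "M \<in> EM n n" by (simp add: twist_carrier)
      then have "\<tau> M = M" using in_tw M by simp
      obtain x y where xy: "x \<in> carrier A" "y \<in> carrier A" "M = \<iota> x + om \<cdot>\<^sub>m \<iota> y" using a(8)[OF ME] by auto
      note d = EMD[OF a(3)[OF xy(1)]] EMD[OF a(3)[OF xy(2)]]
      have e: "\<iota> x + sg om \<cdot>\<^sub>m \<iota> y = \<iota> x + om \<cdot>\<^sub>m \<iota> y" using om\<iota>[OF xy(1,2)] \<open>\<tau> M = M\<close> xy(3) by simp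
      have "sg om \<cdot>\<^sub>m \<iota> y = om \<cdot>\<^sub>m \<iota> y"
      proof (rule eq_matI)
        fix i j assume "i < dim_row (om \<cdot>\<^sub>m \<iota> y)" "j < dim_col (om \<cdot>\<^sub>m \<iota> y)"
        then have ij: "i < n" "j < n" using d by auto
        have "(\<iota> x + sg om \<cdot>\<^sub>m \<iota> y) $$ (i, j) = (\<iota> x + om \<cdot>\<^sub>m \<iota> y) $$ (i, j)" using e by simp
        then show "(sg om \<cdot>\<^sub>m \<iota> y) $$ (i, j) = (om \<cdot>\<^sub>m \<iota> y) $$ (i, j)" using ij d by simp
      qed (use d in auto)
      then have "\<iota> y = 0\<^sub>m n n" using smultm_inject[OF a(3)[OF xy(2)]] om(2) by blast
      then have "M = \<iota> x" unfolding xy(3) using d by (auto intro!: eq_matI)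
      then show "M \<in> \<iota> ` carrier A" using xy by auto
    qed
  qed
  have "alg_map L A (twist n R) \<iota>" unfolding alg_map_def bij_betw_def using inj surj a by auto
  then show ?thesis unfolding typed_def using tw a(10) by blast
qed

text \<open>Two descriptions of \<open>A\<close> are compared by an isomorphism \<Phi> of matrix
  algebras compatible with both involutions. If \<open>R\<close> intertwines \<Phi>, so does its
  semilinear conjugate R' = Q sg(R) sg(P), and intertwiners are unique up to scalars: R' = e R.
  Conjugating once more gives c d = e sg(e), whence \<open>d\<close> is \<open>c\<close> times the
  norm of e/c.\<close>

lemma typed_norm:
  assumes A: "typed A n c" and B: "typed A m d"
  shows "\<exists>x\<in>E. x \<noteq> 0 \<and> d = c * (x * sg x)"
proof -
  obtain P h where P: "tw n P c" and h: "alg_map L A (twist n P) h" and cA: "closed_alg L A" using A by (auto simp: typed_def)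
  obtain Q k where Q: "tw m Q d" and k: "alg_map L A (twist m Q) k" using B by (auto simp: typed_def)
  note p = twD[OF P] and q = twD[OF Q] and hD = alg_mapD[OF h] and kD = alg_mapD[OF k]
  have Fh: "form A n h" and Fk: "form A m k" using typed_form[OF cA] P h Q k by auto
  note a = formD[OF Fh] and b = formD[OF Fk]
  obtain \<Phi> where F: "\<forall>M\<in>EM n n. \<Phi> M \<in> EM m m"
     "\<forall>M\<in>EM n n. \<forall>Z\<in>EM n n. \<Phi> (M + Z) = \<Phi> M + \<Phi> Z \<and> \<Phi> (M * Z) = \<Phi> M * \<Phi> Z"
     "\<forall>l\<in>E. \<forall>M\<in>EM n n. \<Phi> (l \<cdot>\<^sub>m M) = l \<cdot>\<^sub>m \<Phi> M"
     "\<forall>M\<in>EM n n. \<Phi> M = 0\<^sub>m m m \<longrightarrow> M = 0\<^sub>m n n" "\<forall>x\<in>carrier A. \<Phi> (h x) = k x"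
    using form_extend[OF Fh Fk, of id] by auto
  obtain \<Psi> where G: "\<forall>M\<in>EM m m. \<Psi> M \<in> EM n n"
     "\<forall>M\<in>EM m m. \<forall>Z\<in>EM m m. \<Psi> (M + Z) = \<Psi> M + \<Psi> Z \<and> \<Psi> (M * Z) = \<Psi> M * \<Psi> Z"
     "\<forall>l\<in>E. \<forall>M\<in>EM m m. \<Psi> (l \<cdot>\<^sub>m M) = l \<cdot>\<^sub>m \<Psi> M"
     "\<forall>M\<in>EM m m. \<Psi> M = 0\<^sub>m n n \<longrightarrow> M = 0\<^sub>m m m" "\<forall>x\<in>carrier A. \<Psi> (k x) = h x"
    using form_extend[OF Fk Fh, of id] by auto
  have Fom: "\<Phi> (h x + l \<cdot>\<^sub>m h y) = k x + l \<cdot>\<^sub>m k y" if "x \<in> carrier A" "y \<in> carrier A" "l \<in> E" for x y l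
    using F a(3) that EM_smult[OF a(3) that(3)] by auto
  have Gom: "\<Psi> (k x + l \<cdot>\<^sub>m k y) = h x + l \<cdot>\<^sub>m h y" if "x \<in> carrier A" "y \<in> carrier A" "l \<in> E" for x y l
    using G b(3) that EM_smult[OF b(3) that(3)] by auto
  have GF: "\<Psi> (\<Phi> M) = M" if M: "M \<in> EM n n" for M
    using a(8)[OF M] Fom Gom om(1) by force
  have FG: "\<Phi> (\<Psi> M) = M" if M: "M \<in> EM m m" for M
    using b(8)[OF M] Fom Gom om(1) by force
  have tt: "tau m Q d (\<Phi> M) = \<Phi> (tau n P c M)" if M: "M \<in> EM n n" for M
  proof -
    obtain x y where xy: "x \<in> carrier A" "y \<in> carrier A" "M = h x + om \<cdot>\<^sub>m h y" using a(8)[OF M] by auto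
    have "tau n P c (h x) = h x" "tau n P c (h y) = h y" "tau m Q d (k x) = k x" "tau m Q d (k y) = k y"
      using twist_iff_tau[OF P] twist_iff_tau[OF Q] a(3) b(3) hD(4) kD(4) xy by auto
    then have "tau n P c M = h x + sg om \<cdot>\<^sub>m h y" "tau m Q d (k x + om \<cdot>\<^sub>m k y) = k x + sg om \<cdot>\<^sub>m k y"
      using xy a(3) b(3) EM_smult[OF a(3) om(1)] EM_smult[OF b(3) om(1)]
      by (simp_all add: tau_add[OF P] tau_add[OF Q] tau_smult[OF P] tau_smult[OF Q])
    then show ?thesis using Fom xy om(1) sg_E[OF om(1)] by simp
  qed
  have "\<exists>R. R \<in> EM m n \<and> R \<noteq> 0\<^sub>m m n \<and> (\<forall>M\<in>EM n n. \<Phi> M * R = R * M)"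
    by (rule skolem_noether[OF p(1)]) (use F in auto)
  then obtain R where R: "R \<in> EM m n" "R \<noteq> 0\<^sub>m m n" "\<And>M. M \<in> EM n n \<Longrightarrow> \<Phi> M * R = R * M" by blast
  have "\<exists>R. R \<in> EM n m \<and> R \<noteq> 0\<^sub>m n m \<and> (\<forall>M\<in>EM m m. \<Psi> M * R = R * M)"
    by (rule skolem_noether[OF q(1)]) (use G in auto)
  \<comment> \<open>An intertwiner in the opposite direction; up to a nonzero scalar it inverts
    \<open>R\<close>, which is how uniqueness of intertwiners is obtained.\<close>
  then obtain S where S: "S \<in> EM n m" "S \<noteq> 0\<^sub>m n m" "\<And>M. M \<in> EM m m \<Longrightarrow> \<Psi> M * S = S * M" by blast
  have SF: "M * S = S * \<Phi> M" if M: "M \<in> EM n n" for M using S(3)[OF bspec[OF F(1) M]] GF[OF M] by simp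
  note dR = EMD[OF R(1)] and dS = EMD[OF S(1)]
  \<comment> \<open>Up to the factor \<open>c\<close> this is Q sg(R) P^-1. The factor sg(P) avoids
    the inverse and accounts for the \<open>c\<close> in the final formula.\<close>
  define R' where "R' = Q * smat R * smat P"
  have R'E: "R' \<in> EM m n" unfolding R'_def using p q R by (intro EM_mult EM_smat)
  note dR' = EMD[OF R'E]
  have R'M: "\<Phi> M * R' = R' * M" if M: "M \<in> EM n n" for M
  proof -
    define T where "T = tau n P c M"
    have T: "T \<in> EM n n" "\<Phi> T \<in> EM m m" "\<Phi> M \<in> EM m m" using tau_EM[OF P M] F(1) M by (auto simp: T_def)
    note d = EMD[OF T(1)] EMD[OF T(2)] EMD[OF T(3)] EMD[OF M]
    have "\<Phi> M = tau m Q d (\<Phi> T)" using tt[OF T(1)] tau_tau[OF P M] by (simp add: T_def)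
    then have "\<Phi> M * Q = Q * smat (\<Phi> T)" using tau_P[OF Q T(2)] by simp
    then have "\<Phi> M * R' = Q * smat (\<Phi> T) * smat R * smat P" unfolding R'_def using d p q dR
      by (simp add: mm_assoc[symmetric])
    also have "\<dots> = Q * smat (\<Phi> T * R) * smat P" using d p q dR by (simp add: mm_assoc smat_mult)
    also have "\<dots> = Q * smat R * smat (T * P)" using d p q dR by (simp add: R(3)[OF T(1)] mm_assoc smat_mult)
    also have "T * P = P * smat M" unfolding T_def by (rule tau_P[OF P M])
    also have "Q * smat R * smat (P * smat M) = R' * M" unfolding R'_def using d p q dR
      by (simp add: mm_assoc smat_mult smat_smat[OF M])
    finally show ?thesis .
  qed
  have SR: "\<exists>l\<in>E. S * Z = l \<cdot>\<^sub>m 1\<^sub>m n" if Z: "Z \<in> EM m n" "\<And>M. M \<in> EM n n \<Longrightarrow> \<Phi> M * Z = Z * M" for Z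
  proof (rule commuting_scalar[OF p(1) EM_mult[OF S(1) Z(1)]])
    fix M assume M: "M \<in> EM n n"
    note d = EMD[OF M] EMD[OF bspec[OF F(1) M]] EMD[OF Z(1)]
    have "M * (S * Z) = M * S * Z" using d dS by (simp add: mm_assoc)
    also have "\<dots> = S * (\<Phi> M * Z)" using d dS by (simp add: SF[OF M] mm_assoc)
    also have "\<dots> = S * Z * M" using d dS by (simp add: Z(2)[OF M] mm_assoc)
    finally show "M * (S * Z) = S * Z * M" .
  qed
  obtain l' where l': "l' \<in> E" "S * R' = l' \<cdot>\<^sub>m 1\<^sub>m n" using SR[OF R'E R'M] by auto
  have "\<exists>l\<in>E. R * S = l \<cdot>\<^sub>m 1\<^sub>m m"
  proof (rule commuting_scalar[OF q(1) EM_mult[OF R(1) S(1)]])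
    fix M assume M: "M \<in> EM m m"
    note d = EMD[OF M] EMD[OF bspec[OF G(1) M]]
    have "M * (R * S) = \<Phi> (\<Psi> M) * R * S" using d dS dR FG[OF M] by (simp add: mm_assoc)
    also have "\<dots> = R * (\<Psi> M * S)" using d dS dR R(3)[OF bspec[OF G(1) M]] by (simp add: mm_assoc)
    also have "\<dots> = R * S * M" using d dS dR by (simp add: S(3)[OF M] mm_assoc)
    finally show "M * (R * S) = R * S * M" .
  qed
  then obtain u where u: "u \<in> E" "R * S = u \<cdot>\<^sub>m 1\<^sub>m m" by auto
  have u0: "u \<noteq> 0"
  proof
    assume "u = 0"
    then have "R * S = 0\<^sub>m m m" unfolding u(2) by (auto intro!: eq_matI)
    then have "S = 0\<^sub>m n m" using intertwiner_injective[OF R(1,2), of \<Phi> S m] F(1) R(3) S(1) by blast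
    then show False using S(2) by simp
  qed
  \<comment> \<open>The product R S R' is evaluated by both bracketings.\<close>
  have "u \<cdot>\<^sub>m R' = R * S * R'" unfolding u(2) using dR' by (simp add: mm_smultl)
  also have "\<dots> = l' \<cdot>\<^sub>m R" using dR dS dR' by (simp add: mm_assoc l'(2) mm_smultr)
  finally have "inverse u \<cdot>\<^sub>m (u \<cdot>\<^sub>m R') = inverse u \<cdot>\<^sub>m (l' \<cdot>\<^sub>m R)" by simp
  then have e: "R' = (l' / u) \<cdot>\<^sub>m R" using u0 by (simp add: smult_smultm smult_onem field_simps)
  define e where "e = l' / u"
  have eE: "e \<in> E" unfolding e_def using l' u by (intro E_div)
  have R'P: "c \<cdot>\<^sub>m (Q * smat R) = e \<cdot>\<^sub>m (R * P)"
  proof -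
    have "R' * P = Q * smat R * (smat P * P)" unfolding R'_def using dR p q by (simp add: mm_assoc)
    also have "\<dots> = c \<cdot>\<^sub>m (Q * smat R)" unfolding p(6) using dR p q by (simp add: mm_smultr)
    finally show ?thesis unfolding e e_def using dR p by (simp add: mm_smultl)
  qed
  have "(c * d) \<cdot>\<^sub>m R = c \<cdot>\<^sub>m ((Q * smat Q) * R)" unfolding q(5) using dR by (simp add: mm_smultl smult_smultm)
  also have "\<dots> = Q * smat (c \<cdot>\<^sub>m (Q * smat R))"
    using dR q(1-4,7,8) by (simp add: smat_smult smat_mult smat_smat[OF R(1)] L_sg[OF p(3)] mm_smultr mm_assoc)
  also have "\<dots> = sg e \<cdot>\<^sub>m R'" unfolding R'P R'_def using dR p q
    by (simp add: smat_smult smat_mult mm_smultr mm_assoc)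
  also have "\<dots> = (sg e * e) \<cdot>\<^sub>m R" unfolding e e_def[symmetric] by (simp add: smult_smultm)
  finally have cd: "c * d = sg e * e" using smultm_inject[OF R(1,2)] by blast
  have sc: "sg (inverse c) = inverse c" using L_sg[OF L_inv[OF p(3)]] .
  show ?thesis
  proof (intro bexI conjI)
    show "e * inverse c \<in> E" using eE L_E[OF L_inv[OF p(3)]] by (rule E_mult)
    show "e * inverse c \<noteq> 0" using cd p(4) q(4) by auto
    have "c * (e * inverse c * sg (e * inverse c)) = (sg e * e) * inverse c"
      unfolding sg_mult sc using p(4) by (simp add: field_simps)
    moreover have "d = (c * d) * inverse c" using p(4) by simp
    ultimately show "d = c * (e * inverse c * sg (e * inverse c))" using cd by metis
  qed
qed

end

section \<open>Algebras split by the quadratic extension\<close>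

context quad
begin

lemma elements_mat_subset: "M \<in> carrier_mat r c \<Longrightarrow> elements_mat M \<subseteq> S \<longleftrightarrow> (\<forall>i<r. \<forall>j<c. M $$ (i, j) \<in> S)"
  unfolding elements_mat_def by (auto simp: UN_subset_iff image_subset_iff)

lemma mat_alg_carrier: "M \<in> carrier (mat_alg E n) \<longleftrightarrow> M \<in> EM n n"
  by (auto simp: mat_alg_def EM_def elements_mat_subset)

lemma mat_alg_simps [simp]:
  "monoid.mult (mat_alg S n) = (*)" "one (mat_alg S n) = 1\<^sub>m n" "ring.zero (mat_alg S n) = 0\<^sub>m n n"
  "ring.add (mat_alg S n) = (+)" "smult (mat_alg S n) = (\<cdot>\<^sub>m)"
  by (simp_all add: mat_alg_def)

lemma fld_simps [simp]:
  "monoid.mult (fld S) = (*)" "one (fld S) = 1" "ring.zero (fld S) = 0"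
  "ring.add (fld S) = (+)" "smult (fld S) = (*)" "carrier (fld S) = S"
  by (simp_all add: fld_def)

lemma mat_alg_ring: "ring (mat_alg E n)"
proof -
  have dm: "dim_row M = n \<and> dim_col M = n \<and> M \<in> carrier_mat n n" if "M \<in> carrier (mat_alg E n)" for M
    using that EMD[of M n n] by (auto simp: mat_alg_carrier)
  have ag: "abelian_group (mat_alg E n)"
  proof (rule abelian_groupI)
    fix M Z assume "M \<in> carrier (mat_alg E n)" "Z \<in> carrier (mat_alg E n)"
    then show "M \<oplus>\<^bsub>mat_alg E n\<^esub> Z = Z \<oplus>\<^bsub>mat_alg E n\<^esub> M" using dm by (simp add: comm_add_mat[of M n n Z])
  next
    fix M assume M: "M \<in> carrier (mat_alg E n)"
    show "\<exists>Z\<in>carrier (mat_alg E n). Z \<oplus>\<^bsub>mat_alg E n\<^esub> M = \<zero>\<^bsub>mat_alg E n\<^esub>"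
    proof
      show "(-1) \<cdot>\<^sub>m M \<in> carrier (mat_alg E n)" using M by (simp add: mat_alg_carrier EM_smult E_minus E_one)
      show "(-1) \<cdot>\<^sub>m M \<oplus>\<^bsub>mat_alg E n\<^esub> M = \<zero>\<^bsub>mat_alg E n\<^esub>" using dm[OF M] unfolding mat_alg_simps by (intro eq_matI) auto
    qed
  qed (use dm in \<open>auto simp: mat_alg_carrier EM_add EM_zero addm_assoc\<close>)
  show ?thesis
  proof (rule ringI[OF ag])
    show "Group.monoid (mat_alg E n)"
      by (rule monoidI) (use dm in \<open>auto simp: mat_alg_carrier EM_mult EM_one mm_assoc\<close>)
  qed (use dm in \<open>simp_all add: mm_distl mm_distr\<close>)
qed

lemma tw_one: "r \<ge> 1 \<Longrightarrow> tw r (1\<^sub>m r) 1"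
  by (simp add: tw_def EM_one L_one smat_one smult_onem)

text \<open>The untwisted form: conjugation acts entrywise, its fixed matrices are those over
  \<open>L\<close>, and the class is 1.\<close>

lemma typed_mat_alg_map:
  assumes "r \<ge> 1"
  shows "tw r (1\<^sub>m r) 1" "alg_map L (mat_alg L r) (twist r (1\<^sub>m r)) id" "closed_alg L (mat_alg L r)"
proof -
  show "tw r (1\<^sub>m r) 1" by (rule tw_one[OF assms])
  have "carrier (mat_alg L r) = carrier (twist r (1\<^sub>m r))"
  proof (intro Set.set_eqI iffI)
    fix M assume "M \<in> carrier (mat_alg L r)"
    then have d: "M \<in> carrier_mat r r" "\<And>i j. \<lbrakk>i < r; j < r\<rbrakk> \<Longrightarrow> M $$ (i, j) \<in> L"
      by (auto simp: mat_alg_def elements_mat_subset)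
    then have "smat M = M" by (intro eq_matI) (auto simp: L_sg)
    then show "M \<in> carrier (twist r (1\<^sub>m r))" using d by (auto simp: twist_carrier EM_def L_E)
  next
    fix M assume M: "M \<in> carrier (twist r (1\<^sub>m r))"
    then have m: "M \<in> EM r r" by (simp add: twist_carrier)
    note d = EMD[OF m]
    have "smat M = M" using M d by (simp add: twist_carrier)
    then have "sg (M $$ (i, j)) = M $$ (i, j)" if "i < r" "j < r" for i j
      using that d by (metis index_map_mat(1))
    then show "M \<in> carrier (mat_alg L r)" using d by (auto simp: mat_alg_def elements_mat_subset L_eq)
  qed
  then have id: "alg_map L (twist r (1\<^sub>m r)) (mat_alg L r) id" "alg_map L (mat_alg L r) (twist r (1\<^sub>m r)) id"
    unfolding alg_map_def by simp_all
  then show "alg_map L (mat_alg L r) (twist r (1\<^sub>m r)) id" by simp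
  show "closed_alg L (mat_alg L r)" by (rule alg_map_closed[OF twist_closed[OF EM_one] id(1)])
qed

lemma alg_map_finsum:
  assumes h: "alg_map S A B h" and B: "ring_alg L B" and A: "ring_alg L A"
    and I: "finite I" "\<And>i. i \<in> I \<Longrightarrow> f i \<in> carrier A"
  shows "h (finsum A f I) = finsum B (\<lambda>i. h (f i)) I"
proof -
  interpret A: ring A using A by (simp add: ring_alg_def)
  interpret B: ring B using B by (simp add: ring_alg_def)
  note hD = alg_mapD[OF h]
  show ?thesis using I
  proof (induction I rule: finite_induct)
    case empty
    then show ?case using hD(8) by simp
  next
    case (insert i I)
    have "finsum A f (insert i I) = f i \<oplus>\<^bsub>A\<^esub> finsum A f I" using insert by (intro A.finsum_insert) auto
    moreover have "finsum B (\<lambda>i. h (f i)) (insert i I) = h (f i) \<oplus>\<^bsub>B\<^esub> finsum B (\<lambda>i. h (f i)) I"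
      using insert hD(4) by (intro B.finsum_insert) auto
    moreover have "finsum A f I \<in> carrier A" using insert by (intro A.finsum_closed) auto
    ultimately show ?case using insert hD(5) by simp
  qed
qed

lemma fldE_ring: "ring (fld E)"
proof (rule ringI)
  show "abelian_group (fld E)"
  proof (rule abelian_groupI)
    fix x assume "x \<in> carrier (fld E)"
    then show "\<exists>y\<in>carrier (fld E). y \<oplus>\<^bsub>fld E\<^esub> x = \<zero>\<^bsub>fld E\<^esub>" by (intro bexI[of _ "- x"]) (auto simp: E_minus)
  qed (auto simp: E_add E_zero)
  show "Group.monoid (fld E)" by (rule monoidI) (auto simp: E_mult E_one)
qed (auto simp: algebra_simps)

lemma fldE_module: "module (fld L) (fld E)"
  by (rule moduleI[OF module_fld_cring ring.is_abelian_group[OF fldE_ring]])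
     (auto simp: E_mult L_E algebra_simps)

text \<open>Scalar extension undoes the twist: e tensor x is sent to e h(x). Descent gives
  surjectivity onto M_n(E), and \<open>L_relation\<close> gives independence; the scalars from
  \<open>E\<close> act on the left factor.\<close>

lemma typed_split:
  assumes A: "typed A n c" shows "split_by L E A"
proof -
  obtain P h where P: "tw n P c" and h: "alg_map L A (twist n P) h" and cA: "closed_alg L A" using A by (auto simp: typed_def)
  note p = twD[OF P] and hD = alg_mapD[OF h] and a = formD[OF typed_form[OF cA P h]]
  interpret MR: ring "mat_alg E n" by (rule mat_alg_ring)
  interpret ER: ring "fld E" by (rule fldE_ring)
  interpret EMo: module "fld L" "fld E" by (rule fldE_module)
  interpret AR: ring A using a(2) by (simp add: ring_alg_def)
  interpret AM: module "fld L" A using a(2) by (simp add: ring_alg_def)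
  interpret TR: ring "twist n P" using twist_ring_alg[OF p(2)] by (simp add: ring_alg_def)
  define \<beta> where "\<beta> e x = e \<cdot>\<^sub>m h x" for e x
  have d: "dim_row (h x) = n" "dim_col (h x) = n" if "x \<in> carrier A" for x using EMD[OF a(3)[OF that]] by auto
  have fin: "finsum (mat_alg E n) f I $$ (x, y) = (\<Sum>i\<in>I. f i $$ (x, y)) \<and> finsum (mat_alg E n) f I \<in> EM n n"
    if I: "finite I" "\<And>i. i \<in> I \<Longrightarrow> f i \<in> EM n n" and xy: "x < n" "y < n" for I :: "nat set" and f x y
    using I
  proof (induction I rule: finite_induct)
    case empty
    then show ?case using xy by (simp add: EM_zero)
  next
    case (insert i I)
    have "finsum (mat_alg E n) f (insert i I) = f i + finsum (mat_alg E n) f I"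
      using MR.finsum_insert[of I i f] insert by (auto simp: mat_alg_carrier)
    moreover have "dim_row (finsum (mat_alg E n) f I) = n" "dim_col (finsum (mat_alg E n) f I) = n"
      using insert EMD by auto
    ultimately show ?case using insert xy by (simp add: EM_add)
  qed
  interpret T: tensor_alg_map L "fld E" A "mat_alg E n" \<beta> E
  proof unfold_locales
    fix x y assume "x \<in> carrier (fld E)" "y \<in> carrier A"
    then show "\<beta> x y \<in> carrier (mat_alg E n)" by (simp add: \<beta>_def mat_alg_carrier EM_smult a(3))
  next
    fix x x' y assume "x \<in> carrier (fld E)" "x' \<in> carrier (fld E)" "y \<in> carrier A"
    then show "\<beta> (x \<oplus>\<^bsub>fld E\<^esub> x') y = \<beta> x y \<oplus>\<^bsub>mat_alg E n\<^esub> \<beta> x' y"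
      using d by (auto simp: \<beta>_def algebra_simps intro!: eq_matI)
  next
    fix x y y' assume "x \<in> carrier (fld E)" "y \<in> carrier A" "y' \<in> carrier A"
    then show "\<beta> x (y \<oplus>\<^bsub>A\<^esub> y') = \<beta> x y \<oplus>\<^bsub>mat_alg E n\<^esub> \<beta> x y'"
      using d by (simp add: \<beta>_def a(4) smult_addm)
  next
    fix r x y assume "r \<in> L" "x \<in> carrier (fld E)" "y \<in> carrier A"
    then show "\<beta> (r \<odot>\<^bsub>fld E\<^esub> x) y = \<beta> x (r \<odot>\<^bsub>A\<^esub> y)" by (simp add: \<beta>_def a(7) smult_smultm mult.commute)
  next
    fix I :: "nat set" and f b j
    assume I: "finite I" and ab: "\<And>i. i \<in> I \<Longrightarrow> f i \<in> carrier (fld E)" "\<And>i. i \<in> I \<Longrightarrow> b i \<in> carrier A"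
      and s: "finsum (mat_alg E n) (\<lambda>i. \<beta> (f i) (b i)) I = \<zero>\<^bsub>mat_alg E n\<^esub>" and j: "j \<in> I" "f j \<noteq> \<zero>\<^bsub>fld E\<^esub>"
    have "\<exists>l. (\<forall>i\<in>I. l i \<in> L) \<and> (\<exists>i\<in>I. l i \<noteq> 0) \<and> finsum (twist n P) (\<lambda>i. l i \<cdot>\<^sub>m h (b i)) I = 0\<^sub>m n n"
    proof (rule L_relation[OF P I, of "\<lambda>i. h (b i)" f j])
      fix x y assume xy: "x < n" "y < n"
      have "0 = finsum (mat_alg E n) (\<lambda>i. \<beta> (f i) (b i)) I $$ (x, y)" using s xy by simp
      also have "\<dots> = (\<Sum>i\<in>I. \<beta> (f i) (b i) $$ (x, y))"
        using fin[OF I _ xy, of "\<lambda>i. \<beta> (f i) (b i)"] ab a(3) by (simp add: \<beta>_def EM_smult)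
      also have "\<dots> = (\<Sum>i\<in>I. f i * h (b i) $$ (x, y))" using d ab xy by (intro sum.cong) (auto simp: \<beta>_def)
      finally show "(\<Sum>i\<in>I. f i * h (b i) $$ (x, y)) = 0" by simp
    qed (use ab hD(4) j in auto)
    then obtain l where l: "\<forall>i\<in>I. l i \<in> L" "\<exists>i\<in>I. l i \<noteq> 0" "finsum (twist n P) (\<lambda>i. l i \<cdot>\<^sub>m h (b i)) I = 0\<^sub>m n n" by blast
    have lb: "l i \<odot>\<^bsub>A\<^esub> b i \<in> carrier A" if "i \<in> I" for i using l ab that by simp
    have fc: "finsum A (\<lambda>i. l i \<odot>\<^bsub>A\<^esub> b i) I \<in> carrier A" using lb by (intro AR.finsum_closed) auto
    have "h (finsum A (\<lambda>i. l i \<odot>\<^bsub>A\<^esub> b i) I) = finsum (twist n P) (\<lambda>i. h (l i \<odot>\<^bsub>A\<^esub> b i)) I"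
      using I lb by (rule alg_map_finsum[OF h twist_ring_alg[OF p(2)] a(2)])
    also have "\<dots> = finsum (twist n P) (\<lambda>i. l i \<cdot>\<^sub>m h (b i)) I"
      using l ab hD(4) hD(9) closed_algD(5)[OF twist_closed[OF p(2)]] by (intro TR.finsum_cong') auto
    finally have "finsum A (\<lambda>i. l i \<odot>\<^bsub>A\<^esub> b i) I = \<zero>\<^bsub>A\<^esub>"
      using l(3) hD(8) inj_onD[OF hD(2) _ fc] by simp
    then show "\<exists>l. (\<forall>i\<in>I. l i \<in> L) \<and> (\<exists>i\<in>I. l i \<noteq> 0) \<and> finsum A (\<lambda>i. l i \<odot>\<^bsub>A\<^esub> b i) I = \<zero>\<^bsub>A\<^esub>"
      using l by blast
  next
    let ?S = "{\<beta> a b | a b. a \<in> carrier (fld E) \<and> b \<in> carrier A}"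
    show "carrier (mat_alg E n) \<subseteq> generate (add_monoid (mat_alg E n)) ?S"
    proof
      fix M assume "M \<in> carrier (mat_alg E n)"
      then have "M \<in> EM n n" by (simp only: mat_alg_carrier)
      then obtain x y where xy: "x \<in> carrier A" "y \<in> carrier A" "M = h x + om \<cdot>\<^sub>m h y"
        using a(8) by blast
      then have M: "M = \<beta> 1 x + \<beta> om y" by (simp add: \<beta>_def smult_onem)
      have "\<beta> 1 x \<in> ?S" "\<beta> om y \<in> ?S" using xy E_one om by auto
      then show "M \<in> generate (add_monoid (mat_alg E n)) ?S"
        using generate.eng[OF generate.incl generate.incl, of "\<beta> 1 x" ?S "\<beta> om y" "add_monoid (mat_alg E n)"] M by simp
    qed
  next
    show "closed_alg E (fld E)" by (simp add: closed_alg_def E_one E_zero E_add E_mult)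
  next
    fix r M assume "r \<in> E" "M \<in> carrier (mat_alg E n)"
    then show "r \<odot>\<^bsub>mat_alg E n\<^esub> M \<in> carrier (mat_alg E n)" by (simp add: mat_alg_carrier EM_smult)
  next
    fix r M Z assume "r \<in> E" "M \<in> carrier (mat_alg E n)" "Z \<in> carrier (mat_alg E n)"
    then show "r \<odot>\<^bsub>mat_alg E n\<^esub> (M \<oplus>\<^bsub>mat_alg E n\<^esub> Z) = r \<odot>\<^bsub>mat_alg E n\<^esub> M \<oplus>\<^bsub>mat_alg E n\<^esub> r \<odot>\<^bsub>mat_alg E n\<^esub> Z"
      using EMD by (simp add: mat_alg_carrier smult_addm)
  next
    fix x x' y y' assume "x \<in> carrier (fld E)" "x' \<in> carrier (fld E)" "y \<in> carrier A" "y' \<in> carrier A"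
    then show "\<beta> (x \<otimes>\<^bsub>fld E\<^esub> x') (y \<otimes>\<^bsub>A\<^esub> y') = \<beta> x y \<otimes>\<^bsub>mat_alg E n\<^esub> \<beta> x' y'"
      using d by (simp add: \<beta>_def a(5) mm_simps mult.commute)
  next
    show "\<beta> \<one>\<^bsub>fld E\<^esub> \<one>\<^bsub>A\<^esub> = \<one>\<^bsub>mat_alg E n\<^esub>" by (simp add: \<beta>_def a(6) smult_onem)
  next
    fix r x y assume "r \<in> E" "x \<in> carrier (fld E)" "y \<in> carrier A"
    then show "\<beta> (r \<odot>\<^bsub>fld E\<^esub> x) y = r \<odot>\<^bsub>mat_alg E n\<^esub> \<beta> x y" by (simp add: \<beta>_def smult_smultm)
  qed (auto intro: L_inv)
  obtain g where "alg_map E (tensor_alg (fld L) (fld E) A) (mat_alg E n) g" using T.ex_tensor_alg_map by blast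
  then show ?thesis unfolding split_by_def using p(1) alg_map_imp_alg_iso by blast
qed

section \<open>Algebras with the same norm class are similar\<close>

lemma conj_closed:
  assumes P: "P \<in> EM n n" and Q: "Q \<in> EM n n" and U: "U \<in> EM n n" "V \<in> EM n n" "V * U = 1\<^sub>m n" and UV: "U * V = 1\<^sub>m n"
    and e: "U * P = Q * smat U" and M: "M \<in> carrier (twist n P)"
  shows "U * M * V \<in> carrier (twist n Q)"
proof -
  have m: "M \<in> EM n n" "P * smat M = M * P" using M by (auto simp: twist_carrier)
  note d = EMD[OF P] EMD[OF Q] EMD[OF U(1)] EMD[OF U(2)] EMD[OF m(1)]
  have "smat (U * V) = 1\<^sub>m n" by (simp add: UV smat_one)
  then have s: "smat U * smat V = 1\<^sub>m n" using d by (simp add: smat_mult)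
  have "V * Q = V * Q * (smat U * smat V)" using d by (simp add: s)
  also have "\<dots> = V * (Q * smat U) * smat V" using d by (simp add: mm_assoc)
  also have "\<dots> = (V * U) * (P * smat V)" unfolding e[symmetric] using d by (simp add: mm_assoc)
  also have "\<dots> = P * smat V" using d by (simp add: U(3))
  finally have VQ: "V * Q = P * smat V" .
  have "Q * smat (U * M * V) = (Q * smat U) * smat M * smat V" using d by (simp add: smat_mult mm_assoc)
  also have "\<dots> = U * (P * smat M) * smat V" unfolding e[symmetric] using d by (simp add: mm_assoc)
  also have "\<dots> = U * M * (P * smat V)" unfolding m(2) using d by (simp add: mm_assoc)
  also have "\<dots> = U * M * V * Q" unfolding VQ[symmetric] using d by (simp add: mm_assoc)
  finally show ?thesis using EM_mult[OF EM_mult[OF U(1) m(1)] U(2)] by (simp add: twist_carrier)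
qed

text \<open>A change of basis in the semilinear module: the relation R P = Q sg(R) says that
  \<open>R\<close> carries the operator of \<open>P\<close> to that of \<open>Q\<close>, so
  conjugation by \<open>R\<close> carries one fixed algebra to the other.\<close>

lemma conj_twist:
  assumes P: "P \<in> EM n n" and Q: "Q \<in> EM n n" and R: "R \<in> EM n n" "R' \<in> EM n n"
    and RR: "R * R' = 1\<^sub>m n" and RR': "R' * R = 1\<^sub>m n" and e: "R * P = Q * smat R"
  shows "\<exists>h. alg_map L (twist n P) (twist n Q) h"
proof -
  note d = EMD[OF P] EMD[OF Q] EMD[OF R(1)] EMD[OF R(2)]
  have "smat (R * R') = 1\<^sub>m n" by (simp add: RR smat_one)
  then have s: "smat R * smat R' = 1\<^sub>m n" using d by (simp add: smat_mult)
  have "R' * Q = R' * Q * (smat R * smat R')" using d by (simp add: s)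
  also have "\<dots> = R' * (Q * smat R) * smat R'" using d by (simp add: mm_assoc)
  also have "\<dots> = (R' * R) * (P * smat R')" unfolding e[symmetric] using d by (simp add: mm_assoc)
  also have "\<dots> = P * smat R'" using d by (simp add: RR')
  finally have e': "R' * Q = P * smat R'" .
  define h where "h M = R * M * R'" for M
  have dM: "dim_row M = n" "dim_col M = n" if "M \<in> carrier (twist n Z)" for M Z
    using that EMD by (auto simp: twist_carrier)
  have c1: "h M \<in> carrier (twist n Q)" if "M \<in> carrier (twist n P)" for M
    unfolding h_def by (rule conj_closed[OF P Q R(1,2) RR' RR e that])
  have c2: "R' * M * R \<in> carrier (twist n P)" if "M \<in> carrier (twist n Q)" for M
    by (rule conj_closed[OF Q P R(2,1) RR RR' e' that])
  have left: "A * (B * Z) = Z" if "A * B = 1\<^sub>m n" "dim_row Z = n" "dim_row A = n" "dim_col A = n" "dim_row B = n" "dim_col B = n" for A B Z :: "'a mat"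
    using mm_assoc[of A B Z] that by simp
  have h2: "R' * h M * R = M" if "M \<in> carrier (twist n P)" for M
    using d dM[OF that] RR' by (simp add: h_def mm_assoc left)
  have h1: "h (R' * M * R) = M" if "M \<in> carrier (twist n Q)" for M
    using d dM[OF that] RR by (simp add: h_def mm_assoc left)
  have "bij_betw h (carrier (twist n P)) (carrier (twist n Q))"
    by (rule bij_betw_byWitness[of _ "\<lambda>M. R' * M * R"]) (use h1 h2 c1 c2 in auto)
  moreover have "h (M + Z) = h M + h Z" "h (M * Z) = h M * h Z" if "M \<in> carrier (twist n P)" "Z \<in> carrier (twist n P)" for M Z
    using d dM[OF that(1)] dM[OF that(2)] RR' by (simp_all add: h_def mm_distl mm_distr mm_assoc left)
  moreover have "h (k \<cdot>\<^sub>m M) = k \<cdot>\<^sub>m h M" if "M \<in> carrier (twist n P)" for k M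
    using d dM[OF that] by (simp add: h_def mm_simps)
  moreover have "h (1\<^sub>m n) = 1\<^sub>m n" "h (0\<^sub>m n n) = 0\<^sub>m n n" using d RR by (simp_all add: h_def)
  ultimately show ?thesis unfolding alg_map_def by (intro exI[of _ h]) auto
qed

text \<open>A twisting matrix that depends on \<open>n\<close> and \<open>c\<close> alone. It is the
  block version of the 2 by 2 matrix that defines the quaternion algebra with u^2 = c.\<close>

definition "bigJ n c = four_block_mat (0\<^sub>m n n) (c \<cdot>\<^sub>m 1\<^sub>m n) (1\<^sub>m n) (0\<^sub>m n n)"
definition "diag2 n P = four_block_mat P (0\<^sub>m n n) (0\<^sub>m n n) P"

lemma EM_four_block:
  assumes "A \<in> EM n n" "B \<in> EM n n" "C \<in> EM n n" "D \<in> EM n n"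
  shows "four_block_mat A B C D \<in> EM (n + n) (n + n)"
  using EMD[OF assms(1)] EMD[OF assms(2)] EMD[OF assms(3)] EMD[OF assms(4)]
  by (auto simp: EM_def)

lemma smat_four_block:
  assumes "A \<in> EM n n" "B \<in> EM n n" "C \<in> EM n n" "D \<in> EM n n"
  shows "smat (four_block_mat A B C D) = four_block_mat (smat A) (smat B) (smat C) (smat D)"
  using EMD[OF assms(1)] EMD[OF assms(2)] EMD[OF assms(3)] EMD[OF assms(4)]
  by (intro eq_matI) auto

lemma mult_four_block_EM:
  assumes "A \<in> EM n n" "B \<in> EM n n" "C \<in> EM n n" "D \<in> EM n n" "A' \<in> EM n n" "B' \<in> EM n n" "C' \<in> EM n n" "D' \<in> EM n n"
  shows "four_block_mat A B C D * four_block_mat A' B' C' D' =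
    four_block_mat (A * A' + B * C') (A * B' + B * D') (C * A' + D * C') (C * B' + D * D')"
  using assms by (intro mult_four_block_mat[of _ n n _ n _ n _ _ n _ n]) (auto simp: EM_def)

text \<open>The semilinear module \<open>E\<^sup>n\<close>, with operator \<open>P \<circ> \<sigma>\<close>, satisfies \<open>V \<oplus> V \<cong> E \<otimes>\<^sub>L V \<cong> A\<^sub>c \<otimes>\<^sub>E V\<close>
  for the quaternion algebra \<open>A\<^sub>c\<close>, and the last module only depends on \<open>n\<close> and \<open>c\<close>.\<close>

lemma diag2_conj:
  assumes t: "tw n P c"
  shows "\<exists>h. alg_map L (twist (n + n) (diag2 n P)) (twist (n + n) (bigJ n c)) h"
proof -
  note p = twD[OF t]
  let ?I = "1\<^sub>m n :: 'a mat"
  have ic: "inverse c \<in> E" "c \<in> E" using p(3) L_inv L_E by auto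
  have ED: "inverse del \<in> E" "sg om \<in> E" using E_inv del sg_E om by auto
  have sP: "smat P \<in> EM n n" by (rule EM_smat[OF p(2)])
  note e = EM_one[of n] EM_zero[of n n] p(2) sP
  \<comment> \<open>The lower blocks 1 and \<open>om\<close> are chosen as a basis of
    \<open>E\<close> over \<open>L\<close>. The upper blocks are then forced by the intertwining
    relation, using c P^-1 = sg(P).\<close>
  define R where "R = four_block_mat (smat P) (sg om \<cdot>\<^sub>m smat P) ?I (om \<cdot>\<^sub>m ?I)"
  \<comment> \<open>The inverse: sg(P) is inverted by P/c, and the scalar matrix with rows (1, sg
    om) and (1, om) has determinant \<open>del\<close>.\<close>
  define R' where "R' = four_block_mat ((om * inverse del * inverse c) \<cdot>\<^sub>m P) ((- sg om * inverse del) \<cdot>\<^sub>m ?I)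
      ((- inverse del * inverse c) \<cdot>\<^sub>m P) (inverse del \<cdot>\<^sub>m ?I)"
  have eR: "sg om \<cdot>\<^sub>m smat P \<in> EM n n" "om \<cdot>\<^sub>m ?I \<in> EM n n" "(om * inverse del * inverse c) \<cdot>\<^sub>m P \<in> EM n n"
    "(- sg om * inverse del) \<cdot>\<^sub>m ?I \<in> EM n n" "(- inverse del * inverse c) \<cdot>\<^sub>m P \<in> EM n n"
    "inverse del \<cdot>\<^sub>m ?I \<in> EM n n" "c \<cdot>\<^sub>m ?I \<in> EM n n"
    using e ic ED om by (auto intro!: EM_smult E_mult E_minus)
  have c2: "four_block_mat (A :: 'a mat) B C D = four_block_mat A' B' C' D'" if "A = A'" "B = B'" "C = C'" "D = D'" for A B C D A' B' C' D'
    using that by simp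
  have one4: "four_block_mat ?I (0\<^sub>m n n) (0\<^sub>m n n) ?I = 1\<^sub>m (n + n)" by (rule four_block_one_mat)
  have add_smult: "a \<cdot>\<^sub>m M + b \<cdot>\<^sub>m M = (a + b) \<cdot>\<^sub>m M" for a b and M :: "'a mat" by (rule eq_matI) (auto simp: algebra_simps)
  have zero_smult: "0 \<cdot>\<^sub>m ?I = 0\<^sub>m n n" "0 \<cdot>\<^sub>m smat P = 0\<^sub>m n n" using p by (auto intro!: eq_matI)
  have i1: "om * inverse del - sg om * inverse del = 1"
    using del(2) unfolding left_diff_distrib[symmetric] del_def[symmetric] by simp
  have b1: "smat P * ((om * inverse del * inverse c) \<cdot>\<^sub>m P) + (sg om \<cdot>\<^sub>m smat P) * ((- inverse del * inverse c) \<cdot>\<^sub>m P) = ?I"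
  proof -
    have "smat P * ((om * inverse del * inverse c) \<cdot>\<^sub>m P) + (sg om \<cdot>\<^sub>m smat P) * ((- inverse del * inverse c) \<cdot>\<^sub>m P) =
      ((om * inverse del - sg om * inverse del) * (inverse c * c)) \<cdot>\<^sub>m ?I"
      using p(7,8) by (simp add: mm_smultl mm_smultr p(6) smult_smultm add_smult) (simp add: algebra_simps)
    then show ?thesis unfolding i1 using p(4) by (simp add: smult_onem)
  qed
  have b2: "smat P * ((- sg om * inverse del) \<cdot>\<^sub>m ?I) + (sg om \<cdot>\<^sub>m smat P) * (inverse del \<cdot>\<^sub>m ?I) = 0\<^sub>m n n"
    using p by (simp add: mm_smultl mm_smultr smult_smultm add_smult zero_smult)
  have b3: "?I * ((om * inverse del * inverse c) \<cdot>\<^sub>m P) + (om \<cdot>\<^sub>m ?I) * ((- inverse del * inverse c) \<cdot>\<^sub>m P) = 0\<^sub>m n n"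
  proof -
    have "?I * ((om * inverse del * inverse c) \<cdot>\<^sub>m P) + (om \<cdot>\<^sub>m ?I) * ((- inverse del * inverse c) \<cdot>\<^sub>m P) = 0 \<cdot>\<^sub>m P"
      using p by (simp add: mm_smultl mm_smultr smult_smultm add_smult)
    then show ?thesis using p by (auto intro!: eq_matI)
  qed
  have b4: "?I * ((- sg om * inverse del) \<cdot>\<^sub>m ?I) + (om \<cdot>\<^sub>m ?I) * (inverse del \<cdot>\<^sub>m ?I) = ?I"
  proof -
    have "?I * ((- sg om * inverse del) \<cdot>\<^sub>m ?I) + (om \<cdot>\<^sub>m ?I) * (inverse del \<cdot>\<^sub>m ?I) = (om * inverse del - sg om * inverse del) \<cdot>\<^sub>m ?I"
      by (simp add: mm_smultl mm_smultr smult_smultm add_smult mult.commute)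
    then show ?thesis unfolding i1 by (simp add: smult_onem)
  qed
  have RR: "R * R' = 1\<^sub>m (n + n)" unfolding R_def R'_def
      mult_four_block_EM[OF e(4) eR(1) e(1) eR(2) eR(3) eR(4) eR(5) eR(6)] b1 b2 b3 b4 by (rule one4)
  have g1: "((om * inverse del * inverse c) \<cdot>\<^sub>m P) * smat P + ((- sg om * inverse del) \<cdot>\<^sub>m ?I) * ?I = ?I"
  proof -
    have "((om * inverse del * inverse c) \<cdot>\<^sub>m P) * smat P + ((- sg om * inverse del) \<cdot>\<^sub>m ?I) * ?I =
       (om * inverse del * (inverse c * c) - sg om * inverse del) \<cdot>\<^sub>m ?I"
      using p(7,8) by (simp add: mm_smultl p(5) smult_smultm add_smult) (simp add: algebra_simps)
    then show ?thesis using p(4) i1 by (simp add: smult_onem)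
  qed
  have g2: "((om * inverse del * inverse c) \<cdot>\<^sub>m P) * (sg om \<cdot>\<^sub>m smat P) + ((- sg om * inverse del) \<cdot>\<^sub>m ?I) * (om \<cdot>\<^sub>m ?I) = 0\<^sub>m n n"
  proof -
    have "((om * inverse del * inverse c) \<cdot>\<^sub>m P) * (sg om \<cdot>\<^sub>m smat P) + ((- sg om * inverse del) \<cdot>\<^sub>m ?I) * (om \<cdot>\<^sub>m ?I)
       = (om * inverse del * sg om * (inverse c * c) - sg om * inverse del * om) \<cdot>\<^sub>m ?I"
      using p(7,8) by (simp add: mm_smultl mm_smultr p(5) smult_smultm add_smult) (simp add: algebra_simps)
    also have "om * inverse del * sg om * (inverse c * c) - sg om * inverse del * om = 0" using p(4) by simp
    finally show ?thesis by (simp add: zero_smult)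
  qed
  have g3: "((- inverse del * inverse c) \<cdot>\<^sub>m P) * smat P + (inverse del \<cdot>\<^sub>m ?I) * ?I = 0\<^sub>m n n"
  proof -
    have "((- inverse del * inverse c) \<cdot>\<^sub>m P) * smat P + (inverse del \<cdot>\<^sub>m ?I) * ?I
       = (inverse del - inverse del * (inverse c * c)) \<cdot>\<^sub>m ?I"
      using p(7,8) by (simp add: mm_smultl p(5) smult_smultm add_smult) (simp add: algebra_simps)
    also have "inverse del - inverse del * (inverse c * c) = 0" using p(4) by simp
    finally show ?thesis by (simp add: zero_smult)
  qed
  have g4: "((- inverse del * inverse c) \<cdot>\<^sub>m P) * (sg om \<cdot>\<^sub>m smat P) + (inverse del \<cdot>\<^sub>m ?I) * (om \<cdot>\<^sub>m ?I) = ?I"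
  proof -
    have "((- inverse del * inverse c) \<cdot>\<^sub>m P) * (sg om \<cdot>\<^sub>m smat P) + (inverse del \<cdot>\<^sub>m ?I) * (om \<cdot>\<^sub>m ?I)
       = (om * inverse del - sg om * inverse del * (inverse c * c)) \<cdot>\<^sub>m ?I"
      using p(7,8) by (simp add: mm_smultl mm_smultr p(5) smult_smultm add_smult) (simp add: algebra_simps)
    then show ?thesis using p(4) i1 by (simp add: smult_onem)
  qed
  have RR': "R' * R = 1\<^sub>m (n + n)" unfolding R_def R'_def
      mult_four_block_EM[OF eR(3) eR(4) eR(5) eR(6) e(4) eR(1) e(1) eR(2)] g1 g2 g3 g4 by (rule one4)
  have sR: "smat R = four_block_mat P (om \<cdot>\<^sub>m P) ?I (sg om \<cdot>\<^sub>m ?I)"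
    unfolding R_def by (subst smat_four_block) (use e eR in \<open>auto simp: smat_smat[OF p(2)] smat_one smat_smult sg_sg om\<close>)
  have omP: "om \<cdot>\<^sub>m P \<in> EM n n" "sg om \<cdot>\<^sub>m ?I \<in> EM n n" using e om ED by (auto intro!: EM_smult)
  have "R * diag2 n P = four_block_mat (c \<cdot>\<^sub>m ?I) ((sg om * c) \<cdot>\<^sub>m ?I) P (om \<cdot>\<^sub>m P)"
    unfolding R_def diag2_def
    by (subst mult_four_block_EM) (use e eR p in \<open>auto simp: mm_smultl mm_smultr p(6) smult_smultm\<close>)
  moreover have "bigJ n c * smat R = four_block_mat (c \<cdot>\<^sub>m ?I) ((c * sg om) \<cdot>\<^sub>m ?I) P (om \<cdot>\<^sub>m P)"
    unfolding sR bigJ_def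
    by (subst mult_four_block_EM) (use e eR p omP in \<open>auto simp: mm_smultl mm_smultr smult_smultm\<close>)
  ultimately have eq: "R * diag2 n P = bigJ n c * smat R" by (simp add: mult.commute)
  show ?thesis
    by (rule conj_twist[OF _ _ _ _ RR RR' eq])
       (unfold R_def R'_def diag2_def bigJ_def, use e eR in \<open>auto intro!: EM_four_block\<close>)
qed

lemma kron_diag2:
  assumes "P \<in> EM n n" shows "kron (1\<^sub>m (m + m)) P = diag2 (m * n) (kron (1\<^sub>m m) P)"
proof (rule eq_matI)
  note d = EMD[OF assms]
  fix i j assume "i < dim_row (diag2 (m * n) (kron (1\<^sub>m m) P))" "j < dim_col (diag2 (m * n) (kron (1\<^sub>m m) P))"
  then have ij: "i < m * n + m * n" "j < m * n + m * n" using d by (auto simp: diag2_def)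
  then have n: "0 < n" by (cases n) auto
  have ij2: "i < (m + m) * n" "j < (m + m) * n" using ij by (auto simp: algebra_simps)
  have lt: "i div n < m \<longleftrightarrow> i < m * n" for i using n by (simp add: div_less_iff_less_mult)
  have sub: "(i - m * n) div n = i div n - m" "(i - m * n) mod n = i mod n" if "\<not> i < m * n" for i
  proof -
    define k where "k = i - m * n"
    have k: "i = k + m * n" using that by (simp add: k_def)
    show "(i - m * n) div n = i div n - m" "(i - m * n) mod n = i mod n" unfolding k using n by simp_all
  qed
  have b: "i div n < m + m" "j div n < m + m" using div_mod_bounds[OF ij2(1)] div_mod_bounds[OF ij2(2)] by auto
  have bm: "i div n - m < m" if "\<not> i < m * n" using b lt[of i] that by linarith
  have bm': "j div n - m < m" if "\<not> j < m * n" using b lt[of j] that by linarith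
  have "i div n = j div n \<Longrightarrow> i < m * n \<longleftrightarrow> j < m * n" using lt by metis
  moreover have "i div n - m = j div n - m \<longleftrightarrow> i div n = j div n" if "\<not> i < m * n" "\<not> j < m * n"
    using that lt by (metis eq_diff_iff not_less)
  moreover have "i - m * n < m * n" if "\<not> i < m * n" using that ij by auto
  moreover have "j - m * n < m * n" if "\<not> j < m * n" using that ij by auto
  ultimately show "kron (1\<^sub>m (m + m)) P $$ (i, j) = diag2 (m * n) (kron (1\<^sub>m m) P) $$ (i, j)"
    using ij ij2 d b lt sub div_mod_bounds bm bm'
    by (auto simp: index_kron diag2_def)
qed (use EMD[OF assms] in \<open>auto simp: diag2_def algebra_simps\<close>)

text \<open>An even matrix factor doubles the semilinear module, and the doubled module has a normal
  form in which \<open>P\<close> no longer occurs.\<close>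

lemma typed_bigJ:
  assumes A: "typed A n c" and m: "m \<ge> 1"
  defines "T \<equiv> tensor_alg (fld L) A (mat_alg L (m + m))"
  shows "closed_alg L T \<and> (\<exists>h. alg_map L T (twist (m * n + m * n) (bigJ (m * n) c)) h)"
proof -
  obtain P h where P: "tw n P c" and h: "alg_map L A (twist n P) h" and cA: "closed_alg L A" using A by (auto simp: typed_def)
  note p = twD[OF P]
  have mm: "m + m \<ge> 1" using m by simp
  obtain g where g: "alg_map L T (twist ((m + m) * n) (kron (1\<^sub>m (m + m)) P)) g" and cT: "closed_alg L T"
    using tensor_twist[OF cA P h typed_mat_alg_map(3,1,2)[OF mm]] unfolding T_def by blast
  have t: "tw (m * n) (kron (1\<^sub>m m) P) (c * 1)" using P m by (intro tw_kron tw_one)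
  obtain f where "alg_map L (twist (m * n + m * n) (diag2 (m * n) (kron (1\<^sub>m m) P))) (twist (m * n + m * n) (bigJ (m * n) c)) f"
    using diag2_conj[OF t] by auto
  moreover have "(m + m) * n = m * n + m * n" by (simp add: algebra_simps)
  ultimately show ?thesis using alg_map_comp[OF g] cT kron_diag2[OF p(2)] by auto
qed

text \<open>The factors m + m and n + n give both algebras the common degree 2mn, where their normal
  forms coincide.\<close>

lemma typed_similar:
  assumes A: "typed A n c" and B: "typed B m c"
  shows "similar_alg L A B"
proof -
  have nm: "n \<ge> 1" "m \<ge> 1" using A B twD(1) by (auto simp: typed_def)
  let ?TA = "tensor_alg (fld L) A (mat_alg L (m + m))" and ?TB = "tensor_alg (fld L) B (mat_alg L (n + n))"
  obtain f where f: "alg_map L ?TA (twist (m * n + m * n) (bigJ (m * n) c)) f" using typed_bigJ[OF A nm(2)] by auto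
  obtain g where g: "alg_map L ?TB (twist (n * m + n * m) (bigJ (n * m) c)) g" and cB: "closed_alg L ?TB" using typed_bigJ[OF B nm(1)] by auto
  have "alg_map L (twist (m * n + m * n) (bigJ (m * n) c)) ?TB (inv_into (carrier ?TB) g)"
    using alg_map_inv[OF cB g] by (simp add: mult.commute)
  from alg_map_imp_alg_iso[OF alg_map_comp[OF f this]] show ?thesis
    unfolding similar_alg_def using nm by (intro exI[of _ "m + m"] exI[of _ "n + n"]) auto
qed

text \<open>Scaling \<open>P\<close> by \<open>x\<close> leaves the condition on \<open>M\<close>
  unchanged but multiplies the square of the semilinear operator by the norm of
  \<open>x\<close>.\<close>

lemma typed_scale:
  assumes A: "typed A n c" and x: "x \<in> E" "x \<noteq> 0"
  shows "typed A n (c * (x * sg x))"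
proof -
  obtain P h where P: "tw n P c" and h: "alg_map L A (twist n P) h" and cA: "closed_alg L A" using A by (auto simp: typed_def)
  note p = twD[OF P]
  have "x * sg x \<in> L" using x sg_sg[OF x(1)] by (simp add: L_eq E_mult sg_E sg_mult mult.commute)
  then have "tw n (x \<cdot>\<^sub>m P) (c * (x * sg x))"
    using p x by (simp add: tw_def EM_smult L_mult sg_eq_0 smat_smult mm_smultl mm_smultr smult_smultm mult_ac)
  moreover have "carrier (twist n (x \<cdot>\<^sub>m P)) = carrier (twist n P)"
  proof -
    have "x \<cdot>\<^sub>m P * smat M = M * (x \<cdot>\<^sub>m P) \<longleftrightarrow> P * smat M = M * P" if M: "M \<in> EM n n" for M
    proof
      note d = EMD[OF M]
      assume "x \<cdot>\<^sub>m P * smat M = M * (x \<cdot>\<^sub>m P)"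
      then have "inverse x \<cdot>\<^sub>m (x \<cdot>\<^sub>m (P * smat M)) = inverse x \<cdot>\<^sub>m (x \<cdot>\<^sub>m (M * P))" using p d by (simp add: mm_smultl mm_smultr)
      then show "P * smat M = M * P" using x by (simp add: smult_smultm smult_onem)
    qed (use p EMD[OF M] in \<open>simp add: mm_smultl mm_smultr\<close>)
    then show ?thesis by (auto simp: twist_carrier)
  qed
  then have "alg_map L A (twist n (x \<cdot>\<^sub>m P)) h" using h by (simp add: alg_map_def)
  ultimately show ?thesis using cA unfolding typed_def by blast
qed

end

section \<open>Idempotent matrices, and algebras split by E\<close>

context quad
begin

text \<open>Splits an idempotent matrix into a projection onto E^m and an inclusion of E^m. Rank-one
  idempotents are removed one by one; the number of nonzero columns decreases, because column
  \<open>q\<close> of the remainder vanishes and zero columns stay zero.\<close>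

lemma idempotent_factor:
  assumes "f \<in> EM N N" "f * f = f"
  shows "\<exists>m J K. J \<in> EM N m \<and> K \<in> EM m N \<and> f = J * K \<and> K * J = 1\<^sub>m m"
  using assms
proof (induction "card {q. q < N \<and> (\<exists>p<N. f $$ (p, q) \<noteq> 0)}" arbitrary: f rule: less_induct)
  case less
  note fE = less.prems(1) and ff = less.prems(2)
  note d = EMD[OF fE]
  show ?case
  proof (cases "f = 0\<^sub>m N N")
    case True
    have "0\<^sub>m N 0 * 0\<^sub>m 0 N = (0\<^sub>m N N :: 'a mat)" by (rule eq_matI) (auto simp: scalar_prod_def)
    moreover have "0\<^sub>m 0 N * 0\<^sub>m N 0 = (1\<^sub>m 0 :: 'a mat)" by (rule eq_matI) auto
    ultimately show ?thesis using True EM_zero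
      by (intro exI[of _ 0] exI[of _ "0\<^sub>m N 0"] exI[of _ "0\<^sub>m 0 N"]) auto
  next
    case False
    then obtain p q where pq: "p < N" "q < N" "f $$ (p, q) \<noteq> 0"
      using d by (metis eq_matI index_zero_mat)
    \<comment> \<open>Column \<open>q\<close> of \<open>f\<close>; below, \<open>W\<close> is row
      \<open>p\<close> divided by the entry at (p, q). Because \<open>f\<close> is idempotent, W U
      is that entry divided by itself, so U W is a rank-one idempotent absorbed by
      \<open>f\<close>.\<close>
    define U where "U = f * unitm N 1 q 0"
    define W where "W = inverse (f $$ (p, q)) \<cdot>\<^sub>m (unitm 1 N 0 p * f)"
    have i: "inverse (f $$ (p, q)) \<in> E" using d(4) pq E_inv by auto
    have UE: "U \<in> EM N 1" unfolding U_def using fE unitm_EM by (intro EM_mult)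
    have WE: "W \<in> EM 1 N" unfolding W_def using fE unitm_EM i by (intro EM_smult EM_mult)
    note dU = EMD[OF UE] and dW = EMD[OF WE]
    have U_ix: "U $$ (x, 0) = f $$ (x, q)" if "x < N" for x
      unfolding U_def unitm_mult_right[OF fE pq(2)] using that by simp
    have W_ix: "W $$ (0, y) = f $$ (p, y) / f $$ (p, q)" if "y < N" for y
      unfolding W_def unitm_mult_left[OF fE pq(1)] using that by (simp add: field_simps)
    have fU: "f * U = U" unfolding U_def using d ff by (simp add: mm_assoc[symmetric])
    have Wf: "W * f = W" unfolding W_def using d ff by (simp add: mm_assoc mm_smultl)
    have WU: "W * U = 1\<^sub>m 1"
    proof (rule eq_matI)
      fix x y assume "x < dim_row (1\<^sub>m 1 :: 'a mat)" "y < dim_col (1\<^sub>m 1 :: 'a mat)"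
      then have xy: "x = 0" "y = 0" by auto
      have "W * U = inverse (f $$ (p, q)) \<cdot>\<^sub>m ((unitm 1 N 0 p * (f * f)) * unitm N 1 q 0)"
        unfolding W_def U_def using d by (simp add: mm_assoc mm_smultl)
      also have "\<dots> = inverse (f $$ (p, q)) \<cdot>\<^sub>m (unitm 1 N 0 p * U)" unfolding ff U_def using d by (simp add: mm_assoc)
      finally have "(W * U) $$ (x, y) = inverse (f $$ (p, q)) * (unitm 1 N 0 p * U) $$ (0, 0)" using xy dU by simp
      then show "(W * U) $$ (x, y) = 1\<^sub>m 1 $$ (x, y)"
        unfolding unitm_mult_left[OF UE pq(1)] using xy pq U_ix[OF pq(1)] by simp
    qed (use dU dW in auto)
    define g where "g = f + (-1) \<cdot>\<^sub>m (U * W)"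
    have UW: "U * W \<in> EM N N" "(-1) \<cdot>\<^sub>m (U * W) \<in> EM N N" using UE WE by (auto intro!: EM_smult EM_mult E_minus E_one)
    have gE: "g \<in> EM N N" unfolding g_def by (rule EM_add[OF fE UW(2)])
    note dg = EMD[OF gE]
    have neg: "M + (-1) \<cdot>\<^sub>m M = 0\<^sub>m r c" if "M \<in> EM r c" for M r c
      using EMD[OF that] by (intro eq_matI) auto
    have gU: "g * U = 0\<^sub>m N 1"
      unfolding g_def using d dU dW by (simp add: mm_distl mm_smultl mm_assoc WU fU neg[OF UE])
    have Wg: "W * g = 0\<^sub>m 1 N"
    proof -
      have "W * g = W + (-1) \<cdot>\<^sub>m ((W * U) * W)" unfolding g_def using d dU dW by (simp add: mm_distr mm_smultr mm_assoc Wf)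
      also have "\<dots> = 0\<^sub>m 1 N" unfolding WU using dW neg[OF WE] by simp
      finally show ?thesis .
    qed
    have gg: "g * g = g"
    proof -
      have "g * g = g * f + (-1) \<cdot>\<^sub>m (g * U * W)" unfolding g_def using d dU dW dg by (simp add: mm_distr mm_smultr mm_assoc)
      also have "g * U * W = 0\<^sub>m N N" unfolding gU using dW by simp
      also have "g * f + (-1) \<cdot>\<^sub>m (0\<^sub>m N N) = g * f" using d dg by (intro eq_matI) auto
      also have "g * f = g" unfolding g_def using d dU dW by (simp add: mm_distl mm_smultl mm_assoc ff Wf)
      finally show ?thesis .
    qed
    have g_ix: "g $$ (x, y) = f $$ (x, y) - f $$ (x, q) * (f $$ (p, y) / f $$ (p, q))" if "x < N" "y < N" for x y
      unfolding g_def using that d dU dW U_ix W_ix by (simp add: scalar_prod_def)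
    have "{y. y < N \<and> (\<exists>x<N. g $$ (x, y) \<noteq> 0)} \<subset> {y. y < N \<and> (\<exists>x<N. f $$ (x, y) \<noteq> 0)}"
    proof
      show "{y. y < N \<and> (\<exists>x<N. g $$ (x, y) \<noteq> 0)} \<subseteq> {y. y < N \<and> (\<exists>x<N. f $$ (x, y) \<noteq> 0)}"
      proof safe
        fix y x assume yx: "y < N" "x < N" "g $$ (x, y) \<noteq> 0"
        show "\<exists>x<N. f $$ (x, y) \<noteq> 0"
        proof (rule ccontr)
          assume "\<not> (\<exists>x<N. f $$ (x, y) \<noteq> 0)"
          then have "f $$ (x, y) = 0" "f $$ (p, y) = 0" using yx pq by auto
          then show False using yx g_ix[OF yx(2,1)] by simp
        qed
      qed
      have "q \<notin> {y. y < N \<and> (\<exists>x<N. g $$ (x, y) \<noteq> 0)}" using g_ix pq by auto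
      then show "{y. y < N \<and> (\<exists>x<N. g $$ (x, y) \<noteq> 0)} \<noteq> {y. y < N \<and> (\<exists>x<N. f $$ (x, y) \<noteq> 0)}" using pq by auto
    qed
    then have "card {y. y < N \<and> (\<exists>x<N. g $$ (x, y) \<noteq> 0)} < card {y. y < N \<and> (\<exists>x<N. f $$ (x, y) \<noteq> 0)}"
      by (intro psubset_card_mono) auto
    from less.hyps[OF this gE gg] obtain m J K where JK: "J \<in> EM N m" "K \<in> EM m N" "g = J * K" "K * J = 1\<^sub>m m" by blast
    note dJ = EMD[OF JK(1)] and dK = EMD[OF JK(2)]
    have KU: "K * U = 0\<^sub>m m 1"
    proof -
      have "K * U = K * J * (K * U)" unfolding JK(4) using dK dU by simp
      also have "\<dots> = K * (g * U)" unfolding JK(3) using dK dU dJ by (simp add: mm_assoc)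
      also have "\<dots> = 0\<^sub>m m 1" unfolding gU using dK by simp
      finally show ?thesis .
    qed
    have WJ: "W * J = 0\<^sub>m 1 m"
    proof -
      have "W * J = (W * J) * (K * J)" unfolding JK(4) using dW dJ by simp
      also have "\<dots> = (W * g) * J" unfolding JK(3) using dK dW dJ by (simp add: mm_assoc)
      also have "\<dots> = 0\<^sub>m 1 m" unfolding Wg using dJ by simp
      finally show ?thesis .
    qed
    define J' where "J' = mat N (Suc m) (\<lambda>(x, k). if k < m then J $$ (x, k) else U $$ (x, 0))"
    define K' where "K' = mat (Suc m) N (\<lambda>(k, y). if k < m then K $$ (k, y) else W $$ (0, y))"
    have "J' \<in> EM N (Suc m)" "K' \<in> EM (Suc m) N" using dJ dK dU dW by (auto simp: J'_def K'_def EM_def)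
    moreover have "f = J' * K'"
    proof (rule eq_matI)
      fix x y assume "x < dim_row (J' * K')" "y < dim_col (J' * K')"
      then have xy: "x < N" "y < N" by (auto simp: J'_def K'_def)
      have "(J' * K') $$ (x, y) = (\<Sum>k<Suc m. J' $$ (x, k) * K' $$ (k, y))"
        using xy by (simp add: scalar_prod_def J'_def K'_def atLeast0LessThan)
      also have "\<dots> = (\<Sum>k<m. J $$ (x, k) * K $$ (k, y)) + U $$ (x, 0) * W $$ (0, y)"
        using xy by (simp add: J'_def K'_def)
      also have "(\<Sum>k<m. J $$ (x, k) * K $$ (k, y)) = g $$ (x, y)"
        unfolding JK(3) using xy dJ dK by (simp add: scalar_prod_def atLeast0LessThan)
      also have "g $$ (x, y) + U $$ (x, 0) * W $$ (0, y) = f $$ (x, y)" using g_ix U_ix W_ix xy by simp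
      finally show "f $$ (x, y) = (J' * K') $$ (x, y)" by simp
    qed (use d in \<open>auto simp: J'_def K'_def\<close>)
    moreover have "K' * J' = 1\<^sub>m (Suc m)"
    proof (rule eq_matI)
      fix k l assume "k < dim_row (1\<^sub>m (Suc m) :: 'a mat)" "l < dim_col (1\<^sub>m (Suc m) :: 'a mat)"
      then have kl: "k < Suc m" "l < Suc m" by auto
      have s: "(K' * J') $$ (k, l) = (\<Sum>x<N. K' $$ (k, x) * J' $$ (x, l))"
        using kl by (simp add: scalar_prod_def J'_def K'_def atLeast0LessThan)
      consider "k < m" "l < m" | "k < m" "l = m" | "k = m" "l < m" | "k = m" "l = m" using kl by linarith
      then show "(K' * J') $$ (k, l) = 1\<^sub>m (Suc m) $$ (k, l)"
      proof cases
        case 1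
        then have "(K' * J') $$ (k, l) = (K * J) $$ (k, l)" unfolding s using dJ dK
          by (simp add: scalar_prod_def J'_def K'_def atLeast0LessThan)
        then show ?thesis using 1 by (simp add: JK(4))
      next
        case 2
        then have "(K' * J') $$ (k, l) = (K * U) $$ (k, 0)" unfolding s using dU dK
          by (simp add: scalar_prod_def J'_def K'_def atLeast0LessThan)
        then show ?thesis using 2 by (simp add: KU)
      next
        case 3
        then have "(K' * J') $$ (k, l) = (W * J) $$ (0, l)" unfolding s using dJ dW
          by (simp add: scalar_prod_def J'_def K'_def atLeast0LessThan)
        then show ?thesis using 3 by (simp add: WJ)
      next
        case 4
        then have "(K' * J') $$ (k, l) = (W * U) $$ (0, 0)" unfolding s using dU dW
          by (simp add: scalar_prod_def J'_def K'_def atLeast0LessThan)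
        then show ?thesis using 4 by (simp add: WU)
      qed
    qed (auto simp: J'_def K'_def)
    ultimately show ?thesis by blast
  qed
qed

lemma csaD:
  assumes "central_simple_algebra (fld L) A"
  shows "ring_alg L A" "ring A" "module (fld L) A"
    "\<lbrakk>r \<in> L; x \<in> carrier A; y \<in> carrier A\<rbrakk> \<Longrightarrow> (r \<odot>\<^bsub>A\<^esub> x) \<otimes>\<^bsub>A\<^esub> y = r \<odot>\<^bsub>A\<^esub> (x \<otimes>\<^bsub>A\<^esub> y)"
    "\<lbrakk>r \<in> L; x \<in> carrier A; y \<in> carrier A\<rbrakk> \<Longrightarrow> x \<otimes>\<^bsub>A\<^esub> (r \<odot>\<^bsub>A\<^esub> y) = r \<odot>\<^bsub>A\<^esub> (x \<otimes>\<^bsub>A\<^esub> y)"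
    "ideal I A \<Longrightarrow> I = {\<zero>\<^bsub>A\<^esub>} \<or> I = carrier A"
    "\<lbrakk>z \<in> carrier A; \<And>x. x \<in> carrier A \<Longrightarrow> z \<otimes>\<^bsub>A\<^esub> x = x \<otimes>\<^bsub>A\<^esub> z\<rbrakk> \<Longrightarrow> \<exists>r\<in>L. z = r \<odot>\<^bsub>A\<^esub> \<one>\<^bsub>A\<^esub>"
proof -
  have a: "assoc_algebra (fld L) A" "simple_ring A" "central_algebra (fld L) A"
    using assms by (auto simp: central_simple_algebra_def)
  show "module (fld L) A" "ring A" using assoc_algebra.axioms[OF a(1)] by auto
  then show "ring_alg L A" by (simp add: ring_alg_def)
  show "\<lbrakk>r \<in> L; x \<in> carrier A; y \<in> carrier A\<rbrakk> \<Longrightarrow> (r \<odot>\<^bsub>A\<^esub> x) \<otimes>\<^bsub>A\<^esub> y = r \<odot>\<^bsub>A\<^esub> (x \<otimes>\<^bsub>A\<^esub> y)"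
    using assoc_algebra.smult_mult_left[OF a(1), of r x y] by simp
  show "\<lbrakk>r \<in> L; x \<in> carrier A; y \<in> carrier A\<rbrakk> \<Longrightarrow> x \<otimes>\<^bsub>A\<^esub> (r \<odot>\<^bsub>A\<^esub> y) = r \<odot>\<^bsub>A\<^esub> (x \<otimes>\<^bsub>A\<^esub> y)"
    using assoc_algebra.smult_mult_right[OF a(1), of r x y] by simp
  show "ideal I A \<Longrightarrow> I = {\<zero>\<^bsub>A\<^esub>} \<or> I = carrier A" using a(2) by (simp add: simple_ring_def)
  assume "z \<in> carrier A" "\<And>x. x \<in> carrier A \<Longrightarrow> z \<otimes>\<^bsub>A\<^esub> x = x \<otimes>\<^bsub>A\<^esub> z"
  then have "z \<in> {r \<odot>\<^bsub>A\<^esub> \<one>\<^bsub>A\<^esub> | r. r \<in> carrier (fld L)}" using a(3) unfolding central_algebra_def by blast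
  then show "\<exists>r\<in>L. z = r \<odot>\<^bsub>A\<^esub> \<one>\<^bsub>A\<^esub>" by auto
qed

text \<open>The kernel is a two-sided ideal that does not contain 1, hence zero by
  simplicity.\<close>

lemma csa_hom_injective:
  assumes A: "central_simple_algebra (fld L) A"
    and cl: "\<And>a. a \<in> carrier A \<Longrightarrow> \<psi> a \<in> EM n n"
    and add: "\<And>a b. \<lbrakk>a \<in> carrier A; b \<in> carrier A\<rbrakk> \<Longrightarrow> \<psi> (a \<oplus>\<^bsub>A\<^esub> b) = \<psi> a + \<psi> b"
    and mult: "\<And>a b. \<lbrakk>a \<in> carrier A; b \<in> carrier A\<rbrakk> \<Longrightarrow> \<psi> (a \<otimes>\<^bsub>A\<^esub> b) = \<psi> a * \<psi> b"
    and one: "\<psi> \<one>\<^bsub>A\<^esub> \<noteq> 0\<^sub>m n n" and a: "a \<in> carrier A" "\<psi> a = 0\<^sub>m n n"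
  shows "a = \<zero>\<^bsub>A\<^esub>"
proof -
  interpret ring A by (rule csaD(2)[OF A])
  have cancel: "Z = 0\<^sub>m n n" if "M \<in> EM n n" "Z \<in> EM n n" "M + Z = M" for M Z
  proof (rule eq_matI)
    fix i j assume "i < dim_row (0\<^sub>m n n :: 'a mat)" "j < dim_col (0\<^sub>m n n :: 'a mat)"
    then have ij: "i < n" "j < n" by auto
    have "(M + Z) $$ (i, j) = M $$ (i, j)" using that(3) by simp
    then show "Z $$ (i, j) = (0\<^sub>m n n :: 'a mat) $$ (i, j)" using ij EMD[OF that(1)] EMD[OF that(2)] by simp
  qed (use EMD[OF that(2)] in auto)
  have z: "\<psi> \<zero>\<^bsub>A\<^esub> = 0\<^sub>m n n" using cancel[OF cl cl, of "\<zero>\<^bsub>A\<^esub>" "\<zero>\<^bsub>A\<^esub>"] add[of "\<zero>\<^bsub>A\<^esub>" "\<zero>\<^bsub>A\<^esub>"] by simp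
  have "ideal {x \<in> carrier A. \<psi> x = 0\<^sub>m n n} A"
  proof (rule idealI)
    show "subgroup {x \<in> carrier A. \<psi> x = 0\<^sub>m n n} (add_monoid A)"
    proof (rule group.subgroupI)
      show "Group.group (add_monoid A)" by (rule a_group)
      fix x assume "x \<in> {x \<in> carrier A. \<psi> x = 0\<^sub>m n n}"
      then have x: "x \<in> carrier A" "\<psi> x = 0\<^sub>m n n" by auto
      have "\<psi> (\<ominus>\<^bsub>A\<^esub> x \<oplus>\<^bsub>A\<^esub> x) = \<psi> (\<ominus>\<^bsub>A\<^esub> x) + 0\<^sub>m n n" using add[of "\<ominus>\<^bsub>A\<^esub> x" x] x by simp
      also have "\<dots> = \<psi> (\<ominus>\<^bsub>A\<^esub> x)" using EMD[OF cl[of "\<ominus>\<^bsub>A\<^esub> x"]] x by (intro eq_matI) auto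
      finally have "\<psi> (\<ominus>\<^bsub>A\<^esub> x) = 0\<^sub>m n n" using x z by (simp add: l_neg)
      then have "\<ominus>\<^bsub>A\<^esub> x \<in> {x \<in> carrier A. \<psi> x = 0\<^sub>m n n}" using x by simp
      then show "inv\<^bsub>add_monoid A\<^esub> x \<in> {x \<in> carrier A. \<psi> x = 0\<^sub>m n n}" by (simp add: a_inv_def)
    next
      show "{x \<in> carrier A. \<psi> x = 0\<^sub>m n n} \<noteq> {}" using z by auto
    qed (auto simp: add)
  next
    fix u x assume "u \<in> {x \<in> carrier A. \<psi> x = 0\<^sub>m n n}" "x \<in> carrier A"
    then show "x \<otimes>\<^bsub>A\<^esub> u \<in> {x \<in> carrier A. \<psi> x = 0\<^sub>m n n}" "u \<otimes>\<^bsub>A\<^esub> x \<in> {x \<in> carrier A. \<psi> x = 0\<^sub>m n n}"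
      using EMD(3)[OF cl[of x]] by (auto simp: mult)
  qed (rule csaD(2)[OF A])
  from csaD(6)[OF A this] show ?thesis using a one by blast
qed

text \<open>From an isomorphism of the scalar extension with M_n(E), \<iota>(a) is the image of 1
  tensor a. That 1 and \<open>om\<close> span is checked on pure tensors. Their independence over
  \<iota>(A) is drawn from \<open>A\<close> being central simple: a nontrivial relation would put
  \<open>om\<close> into the centre, that is, into \<open>L\<close>.\<close>

lemma split_typed:
  assumes A: "central_simple_algebra (fld L) A" and s: "split_by L E A"
  shows "\<exists>n c. typed A n c"
proof -
  note c = csaD[OF A]
  interpret AR: ring A by (rule c(2))
  interpret AM: module "fld L" A by (rule c(3))
  interpret T: tensor_ring L "fld E" A E
  proof (intro tensor_ring.intro tensor_pair.intro tensor_ring_axioms.intro fldE_module fldE_ring c(2,3))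
  qed (simp_all add: E_mult algebra_simps c(4,5))
  obtain n g where n: "n \<ge> 1" and g: "g \<in> ring_iso T.T (mat_alg E n)" and gs: "\<And>r x. \<lbrakk>r \<in> E; x \<in> carrier T.T\<rbrakk> \<Longrightarrow> g (r \<odot>\<^bsub>T.T\<^esub> x) = r \<cdot>\<^sub>m g x"
    using s unfolding split_by_def alg_iso_def by auto
  have gh: "g \<in> Ring.ring_hom T.T (mat_alg E n)" "bij_betw g (carrier T.T) (carrier (mat_alg E n))" using g by (auto simp: ring_iso_def)
  have gc: "\<And>x. x \<in> carrier T.T \<Longrightarrow> g x \<in> EM n n" using gh(2) by (auto simp: bij_betw_def mat_alg_carrier)
  have ga: "\<And>x y. \<lbrakk>x \<in> carrier T.T; y \<in> carrier T.T\<rbrakk> \<Longrightarrow> g (x \<oplus>\<^bsub>T.T\<^esub> y) = g x + g y"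
    and gm: "\<And>x y. \<lbrakk>x \<in> carrier T.T; y \<in> carrier T.T\<rbrakk> \<Longrightarrow> g (x \<otimes>\<^bsub>T.T\<^esub> y) = g x * g y"
    and g1: "g \<one>\<^bsub>T.T\<^esub> = 1\<^sub>m n" using gh(1) by (auto simp: Ring.ring_hom_def)
  define \<iota> where "\<iota> a = g (T.ten 1 a)" for a
  have tc: "T.ten e a \<in> carrier T.T" if "e \<in> E" "a \<in> carrier A" for e a using T.ten_closed that by simp
  have \<iota>c: "\<iota> a \<in> EM n n" if "a \<in> carrier A" for a unfolding \<iota>_def by (rule gc[OF tc[OF E_one that]])
  have \<iota>a: "\<iota> (a \<oplus>\<^bsub>A\<^esub> b) = \<iota> a + \<iota> b" if "a \<in> carrier A" "b \<in> carrier A" for a b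
    unfolding \<iota>_def using T.ten_addr[of 1 a b] ga[OF tc[OF E_one that(1)] tc[OF E_one that(2)]] that E_one by simp
  have \<iota>m: "\<iota> (a \<otimes>\<^bsub>A\<^esub> b) = \<iota> a * \<iota> b" if "a \<in> carrier A" "b \<in> carrier A" for a b
    unfolding \<iota>_def using T.ten_mult[of 1 1 a b] gm[OF tc[OF E_one that(1)] tc[OF E_one that(2)]] that E_one by simp
  have \<iota>1: "\<iota> \<one>\<^bsub>A\<^esub> = 1\<^sub>m n" unfolding \<iota>_def using g1 T.ten_one by simp
  have gten: "g (T.ten e a) = e \<cdot>\<^sub>m \<iota> a" if "e \<in> E" "a \<in> carrier A" for e a
    unfolding \<iota>_def using T.ten_smult[of e 1 a] gs[OF that(1) tc[OF E_one that(2)]] that E_one by simp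
  have \<iota>s: "\<iota> (r \<odot>\<^bsub>A\<^esub> a) = r \<cdot>\<^sub>m \<iota> a" if r: "r \<in> L" and a: "a \<in> carrier A" for r a
    unfolding \<iota>_def using T.ten_bal[of r 1 a] gten[OF L_E[OF r] a] r a E_one by (simp add: \<iota>_def)
  have ra: "ring_alg L A" by (rule c(1))
  note cA = closed_algD[OF ring_alg_closed[OF ra]]
  have d: "dim_row (\<iota> a) = n" "dim_col (\<iota> a) = n" if "a \<in> carrier A" for a using EMD[OF \<iota>c[OF that]] by auto
  have span: "\<exists>a\<in>carrier A. \<exists>b\<in>carrier A. M = \<iota> a + om \<cdot>\<^sub>m \<iota> b" if M: "M \<in> EM n n" for M
  proof -
    obtain t where t: "t \<in> carrier T.T" "M = g t" using M gh(2) by (auto simp: bij_betw_def mat_alg_carrier[symmetric])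
    have "\<exists>a\<in>carrier A. \<exists>b\<in>carrier A. g t = \<iota> a + om \<cdot>\<^sub>m \<iota> b" using t(1)
    proof (rule T.T_induct)
      have "T.ten 0 \<zero>\<^bsub>A\<^esub> = T.cls 0" using T.ten_zerol[of "\<zero>\<^bsub>A\<^esub>"] by simp
      then have "g (T.cls 0) = 0 \<cdot>\<^sub>m \<iota> \<zero>\<^bsub>A\<^esub>" using gten[OF E_zero, of "\<zero>\<^bsub>A\<^esub>"] by simp
      also have "\<dots> = \<iota> (0 \<odot>\<^bsub>A\<^esub> \<zero>\<^bsub>A\<^esub>) + om \<cdot>\<^sub>m \<iota> (0 \<odot>\<^bsub>A\<^esub> \<zero>\<^bsub>A\<^esub>)"
        unfolding \<iota>s[OF L_zero AR.zero_closed] using d[of "\<zero>\<^bsub>A\<^esub>"] by (intro eq_matI) auto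
      finally show "\<exists>a\<in>carrier A. \<exists>b\<in>carrier A. g (T.cls 0) = \<iota> a + om \<cdot>\<^sub>m \<iota> b" using cA(5)[OF L_zero AR.zero_closed] by blast
    next
      fix x y assume x: "x \<in> carrier T.T" and y: "y \<in> carrier T.T"
        and "\<exists>a\<in>carrier A. \<exists>b\<in>carrier A. g x = \<iota> a + om \<cdot>\<^sub>m \<iota> b" "\<exists>a\<in>carrier A. \<exists>b\<in>carrier A. g y = \<iota> a + om \<cdot>\<^sub>m \<iota> b"
      then obtain a b a' b' where ab: "a \<in> carrier A" "b \<in> carrier A" "a' \<in> carrier A" "b' \<in> carrier A"
        "g x = \<iota> a + om \<cdot>\<^sub>m \<iota> b" "g y = \<iota> a' + om \<cdot>\<^sub>m \<iota> b'" by blast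
      have "g (x \<oplus>\<^bsub>T.T\<^esub> y) = \<iota> (a \<oplus>\<^bsub>A\<^esub> a') + om \<cdot>\<^sub>m \<iota> (b \<oplus>\<^bsub>A\<^esub> b')"
        unfolding ga[OF x y] ab(5,6) \<iota>a[OF ab(1,3)] \<iota>a[OF ab(2,4)] using d[OF ab(1)] d[OF ab(2)] d[OF ab(3)] d[OF ab(4)]
        by (intro eq_matI) (auto simp: algebra_simps)
      then show "\<exists>a\<in>carrier A. \<exists>b\<in>carrier A. g (x \<oplus>\<^bsub>T.T\<^esub> y) = \<iota> a + om \<cdot>\<^sub>m \<iota> b" using ab AR.a_closed by blast
    next
      fix e a assume "e \<in> carrier (fld E)" and a: "a \<in> carrier A"
      then have e: "e \<in> E" by simp
      have k: "reE e * z + om * (imE e * z) = e * z" for z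
        by (subst (3) re_im[of e]) (simp add: algebra_simps)
      have "g (T.ten e a) = \<iota> (reE e \<odot>\<^bsub>A\<^esub> a) + om \<cdot>\<^sub>m \<iota> (imE e \<odot>\<^bsub>A\<^esub> a)"
        unfolding gten[OF e a] \<iota>s[OF reE_L[OF e] a] \<iota>s[OF imE_L[OF e] a] using d[OF a] k by (intro eq_matI) auto
      then show "\<exists>x\<in>carrier A. \<exists>y\<in>carrier A. g (T.ten e a) = \<iota> x + om \<cdot>\<^sub>m \<iota> y"
        using cA(5)[OF reE_L[OF e] a] cA(5)[OF imE_L[OF e] a] by blast
    qed
    then show ?thesis using t by simp
  qed
  have inj: "a = \<zero>\<^bsub>A\<^esub>" if "a \<in> carrier A" "\<iota> a = 0\<^sub>m n n" for a
    using csa_hom_injective[OF A \<iota>c \<iota>a \<iota>m _ that] \<iota>1 one_nonzero[OF n] by simp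
  have \<iota>0: "\<iota> \<zero>\<^bsub>A\<^esub> = 0\<^sub>m n n"
  proof -
    have "0 \<odot>\<^bsub>A\<^esub> \<zero>\<^bsub>A\<^esub> = \<zero>\<^bsub>A\<^esub>" using AM.smult_r_null[of 0] L_zero by simp
    then have "\<iota> \<zero>\<^bsub>A\<^esub> = 0 \<cdot>\<^sub>m \<iota> \<zero>\<^bsub>A\<^esub>" using \<iota>s[OF L_zero AR.zero_closed] by simp
    also have "\<dots> = 0\<^sub>m n n" using d[of "\<zero>\<^bsub>A\<^esub>"] by (intro eq_matI) auto
    finally show ?thesis .
  qed
  have neg: "\<iota> (\<ominus>\<^bsub>A\<^esub> x) = (-1) \<cdot>\<^sub>m \<iota> x" if x: "x \<in> carrier A" for x
  proof -
    have "(-1) \<odot>\<^bsub>A\<^esub> x \<oplus>\<^bsub>A\<^esub> x = \<zero>\<^bsub>A\<^esub>"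
    proof (rule inj)
      show "\<iota> ((-1) \<odot>\<^bsub>A\<^esub> x \<oplus>\<^bsub>A\<^esub> x) = 0\<^sub>m n n"
        using \<iota>a[OF cA(5)[OF L_minus[OF L_one] x] x] \<iota>s[OF L_minus[OF L_one] x] d[OF x] by (auto intro!: eq_matI)
    qed (use cA(3,5) L_minus[OF L_one] x in auto)
    then have "\<ominus>\<^bsub>A\<^esub> x = (-1) \<odot>\<^bsub>A\<^esub> x" using AR.minus_equality x cA(5)[OF L_minus[OF L_one] x] by simp
    then show ?thesis using \<iota>s[OF L_minus[OF L_one] x] by simp
  qed
  have uniq: "a = \<zero>\<^bsub>A\<^esub> \<and> b = \<zero>\<^bsub>A\<^esub>" if ab: "a \<in> carrier A" "b \<in> carrier A" and z: "\<iota> a + om \<cdot>\<^sub>m \<iota> b = 0\<^sub>m n n" for a b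
  proof -
    \<comment> \<open>The elements that can occur as coefficient of \<open>om\<close> in a relation
      form a two-sided ideal, hence {0} or everything. In the second case 1 occurs, and some
      \<open>y\<close> has image -om.\<close>
    define I where "I = {b \<in> carrier A. \<exists>a\<in>carrier A. \<iota> a + om \<cdot>\<^sub>m \<iota> b = 0\<^sub>m n n}"
    have "ideal I A"
    proof (rule idealI)
      show "subgroup I (add_monoid A)"
      proof (rule group.subgroupI)
        show "Group.group (add_monoid A)" by (rule AR.a_group)
        show "I \<subseteq> carrier (add_monoid A)" by (auto simp: I_def)
        have "\<iota> \<zero>\<^bsub>A\<^esub> + om \<cdot>\<^sub>m \<iota> \<zero>\<^bsub>A\<^esub> = 0\<^sub>m n n" unfolding \<iota>0 by (rule eq_matI) auto
        then show "I \<noteq> {}" unfolding I_def by blast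
        fix x assume "x \<in> I"
        then obtain y where x: "x \<in> carrier A" "y \<in> carrier A" "\<iota> y + om \<cdot>\<^sub>m \<iota> x = 0\<^sub>m n n" by (auto simp: I_def)
        have "\<iota> (\<ominus>\<^bsub>A\<^esub> y) + om \<cdot>\<^sub>m \<iota> (\<ominus>\<^bsub>A\<^esub> x) = (-1) \<cdot>\<^sub>m (\<iota> y + om \<cdot>\<^sub>m \<iota> x)"
          unfolding neg[OF x(1)] neg[OF x(2)] using d[OF x(1)] d[OF x(2)] by (intro eq_matI) (auto simp: algebra_simps)
        also have "\<dots> = 0\<^sub>m n n" unfolding x(3) by (rule eq_matI) auto
        finally have "\<ominus>\<^bsub>A\<^esub> x \<in> I" unfolding I_def using x by blast
        then show "inv\<^bsub>add_monoid A\<^esub> x \<in> I" by (simp add: a_inv_def)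
        fix x' assume "x' \<in> I"
        then obtain y' where x': "x' \<in> carrier A" "y' \<in> carrier A" "\<iota> y' + om \<cdot>\<^sub>m \<iota> x' = 0\<^sub>m n n" by (auto simp: I_def)
        have "\<iota> (y \<oplus>\<^bsub>A\<^esub> y') + om \<cdot>\<^sub>m \<iota> (x \<oplus>\<^bsub>A\<^esub> x') = (\<iota> y + om \<cdot>\<^sub>m \<iota> x) + (\<iota> y' + om \<cdot>\<^sub>m \<iota> x')"
          unfolding \<iota>a[OF x(1) x'(1)] \<iota>a[OF x(2) x'(2)] using d[OF x(1)] d[OF x(2)] d[OF x'(1)] d[OF x'(2)]
          by (intro eq_matI) (auto simp: algebra_simps)
        also have "\<dots> = 0\<^sub>m n n" unfolding x(3) x'(3) by (rule eq_matI) auto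
        finally show "x \<otimes>\<^bsub>add_monoid A\<^esub> x' \<in> I" unfolding I_def using x x' by auto
      qed
    next
      fix u x assume "u \<in> I" and x: "x \<in> carrier A"
      then obtain y where u: "u \<in> carrier A" "y \<in> carrier A" "\<iota> y + om \<cdot>\<^sub>m \<iota> u = 0\<^sub>m n n" by (auto simp: I_def)
      note dd = d[OF u(1)] d[OF u(2)] d[OF x]
      have "\<iota> (x \<otimes>\<^bsub>A\<^esub> y) + om \<cdot>\<^sub>m \<iota> (x \<otimes>\<^bsub>A\<^esub> u) = \<iota> x * (\<iota> y + om \<cdot>\<^sub>m \<iota> u)"
        unfolding \<iota>m[OF x u(1)] \<iota>m[OF x u(2)] using dd by (simp add: mm_distr mm_smultr)
      also have "\<dots> = 0\<^sub>m n n" unfolding u(3) using EMD[OF \<iota>c[OF x]] by simp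
      finally show "x \<otimes>\<^bsub>A\<^esub> u \<in> I" unfolding I_def using x u by blast
      have "\<iota> (y \<otimes>\<^bsub>A\<^esub> x) + om \<cdot>\<^sub>m \<iota> (u \<otimes>\<^bsub>A\<^esub> x) = (\<iota> y + om \<cdot>\<^sub>m \<iota> u) * \<iota> x"
        unfolding \<iota>m[OF u(1) x] \<iota>m[OF u(2) x] using dd by (simp add: mm_distl mm_smultl)
      also have "\<dots> = 0\<^sub>m n n" unfolding u(3) using EMD[OF \<iota>c[OF x]] by simp
      finally show "u \<otimes>\<^bsub>A\<^esub> x \<in> I" unfolding I_def using x u by blast
    qed (rule c(2))
    then have "I = {\<zero>\<^bsub>A\<^esub>} \<or> I = carrier A" by (rule c(6))
    then show ?thesis
    proof
      assume "I = {\<zero>\<^bsub>A\<^esub>}"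
      then have "b = \<zero>\<^bsub>A\<^esub>" using ab z unfolding I_def by blast
      then have "\<iota> a = 0\<^sub>m n n" using z d[OF ab(1)] unfolding \<open>b = \<zero>\<^bsub>A\<^esub>\<close> \<iota>0
        by (metis EMD(3) \<iota>c ab(1) right_add_zero_mat smult_zero_mat)
      then show ?thesis using inj[OF ab(1)] \<open>b = \<zero>\<^bsub>A\<^esub>\<close> by simp
    next
      assume "I = carrier A"
      then obtain y where y: "y \<in> carrier A" "\<iota> y + om \<cdot>\<^sub>m \<iota> \<one>\<^bsub>A\<^esub> = 0\<^sub>m n n" unfolding I_def using AR.one_closed by blast
      have yv: "\<iota> y = (- om) \<cdot>\<^sub>m 1\<^sub>m n"
      proof (rule eq_matI)
        fix i j assume "i < dim_row ((- om) \<cdot>\<^sub>m 1\<^sub>m n)" "j < dim_col ((- om) \<cdot>\<^sub>m 1\<^sub>m n)"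
        then have ij: "i < n" "j < n" by auto
        have "(\<iota> y + om \<cdot>\<^sub>m \<iota> \<one>\<^bsub>A\<^esub>) $$ (i, j) = (0\<^sub>m n n :: 'a mat) $$ (i, j)" using y by simp
        then have "\<iota> y $$ (i, j) + om * (1\<^sub>m n $$ (i, j)) = 0" using ij d[OF y(1)] by (simp add: \<iota>1)
        then show "\<iota> y $$ (i, j) = ((- om) \<cdot>\<^sub>m 1\<^sub>m n) $$ (i, j)" using ij by (simp add: eq_neg_iff_add_eq_0)
      qed (use d[OF y(1)] in auto)
      \<comment> \<open>The image of \<open>y\<close> is scalar and \<iota> is injective, so
        \<open>y\<close> is central and therefore a multiple of 1 by an element of
        \<open>L\<close>.\<close>
      have "y \<otimes>\<^bsub>A\<^esub> x = x \<otimes>\<^bsub>A\<^esub> y" if x: "x \<in> carrier A" for x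
      proof -
        have "\<iota> (y \<otimes>\<^bsub>A\<^esub> x) = \<iota> (x \<otimes>\<^bsub>A\<^esub> y)"
          unfolding \<iota>m[OF x y(1)] \<iota>m[OF y(1) x] yv using d[OF x] by (simp add: mm_smultl mm_smultr)
        then have "\<iota> (y \<otimes>\<^bsub>A\<^esub> x \<oplus>\<^bsub>A\<^esub> \<ominus>\<^bsub>A\<^esub> (x \<otimes>\<^bsub>A\<^esub> y)) = 0\<^sub>m n n"
          using x y(1) d[of "x \<otimes>\<^bsub>A\<^esub> y"] by (auto simp: \<iota>a neg intro!: eq_matI)
        then have "y \<otimes>\<^bsub>A\<^esub> x \<ominus>\<^bsub>A\<^esub> (x \<otimes>\<^bsub>A\<^esub> y) = \<zero>\<^bsub>A\<^esub>" using inj x y(1) by (simp add: AR.minus_eq)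
        then show ?thesis using x y(1) by simp
      qed
      then obtain r where r: "r \<in> L" "y = r \<odot>\<^bsub>A\<^esub> \<one>\<^bsub>A\<^esub>" using c(7)[OF y(1)] by blast
      have "r \<cdot>\<^sub>m 1\<^sub>m n = (- om) \<cdot>\<^sub>m 1\<^sub>m n" using yv \<iota>s[OF r(1) AR.one_closed] by (simp add: r(2)[symmetric] \<iota>1)
      then have "r = - om" using smultm_inject[OF EM_one one_nonzero[OF n]] by blast
      then have "sg om = om" using L_sg[OF r(1)] by (simp add: sg_minus)
      then show ?thesis using om by simp
    qed
  qed
  have "form A n \<iota>" unfolding form_def using n ra \<iota>c \<iota>a \<iota>m \<iota>1 \<iota>s span uniq by blast
  then show ?thesis using form_typed by blast
qed

end

section \<open>Similarity preserves the norm class\<close>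

context quad
begin

lemma mat_alg_L_carrier: "Z \<in> carrier (mat_alg L s) \<longleftrightarrow> Z \<in> carrier_mat s s \<and> (\<forall>i<s. \<forall>j<s. Z $$ (i, j) \<in> L)"
  by (auto simp: mat_alg_def elements_mat_subset)

lemma mat_alg_L_EM: "Z \<in> carrier (mat_alg L s) \<Longrightarrow> Z \<in> EM s s"
  by (auto simp: mat_alg_L_carrier EM_def L_E)

lemma mat_alg_L_ring_alg: "s \<ge> 1 \<Longrightarrow> ring_alg L (mat_alg L s)"
  by (rule ring_alg_transfer[OF typed_mat_alg_map(3,2) twist_ring_alg[OF EM_one]])

text \<open>Cutting down to the corner \<open>e\<^sub>1\<^sub>1\<close> of the matrix units removes the matrix factor.\<close>

lemma matrix_factor_typed:
  assumes B: "central_simple_algebra (fld L) B" and s: "s \<ge> 1" and t: "tw N P c"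
    and g: "alg_map L (tensor_alg (fld L) B (mat_alg L s)) (twist N P) g"
  shows "\<exists>m. typed B m c"
proof -
  note b = csaD[OF B] and p = twD[OF t] and gD = alg_mapD[OF g]
  have raM: "ring_alg L (mat_alg L s)" by (rule mat_alg_L_ring_alg[OF s])
  interpret BR: ring B by (rule b(2))
  interpret BM: module "fld L" B by (rule b(3))
  interpret MR: ring "mat_alg L s" using raM by (simp add: ring_alg_def)
  interpret MM: module "fld L" "mat_alg L s" using raM by (simp add: ring_alg_def)
  have cB: "closed_alg L B" by (rule ring_alg_closed[OF b(1)])
  interpret T: tensor_ring L B "mat_alg L s" L
  proof (intro tensor_ring.intro tensor_pair.intro tensor_ring_axioms.intro b(2,3) MR.ring_axioms MM.module_axioms)
    fix r r' x assume "r \<in> L" "r' \<in> L" "x \<in> carrier B"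
    then show "r \<odot>\<^bsub>B\<^esub> (r' \<odot>\<^bsub>B\<^esub> x) = r' \<odot>\<^bsub>B\<^esub> (r \<odot>\<^bsub>B\<^esub> x)"
      using BM.smult_assoc1[of r r' x] BM.smult_assoc1[of r' r x] by (simp add: mult.commute)
  next
    fix r x y assume "r \<in> L" "x \<in> carrier B" "y \<in> carrier B"
    then show "r \<odot>\<^bsub>B\<^esub> (x \<oplus>\<^bsub>B\<^esub> y) = r \<odot>\<^bsub>B\<^esub> x \<oplus>\<^bsub>B\<^esub> r \<odot>\<^bsub>B\<^esub> y" using BM.smult_r_distr[of r x y] by simp
  next
    fix r x assume "r \<in> L" "x \<in> carrier B"
    then show "r \<odot>\<^bsub>B\<^esub> x \<in> carrier B" using BM.smult_closed[of r x] by simp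
  next
    fix r x y assume "r \<in> L" "x \<in> carrier (mat_alg L s)" "y \<in> carrier (mat_alg L s)"
    then show "(r \<odot>\<^bsub>mat_alg L s\<^esub> x) \<otimes>\<^bsub>mat_alg L s\<^esub> y = r \<odot>\<^bsub>mat_alg L s\<^esub> (x \<otimes>\<^bsub>mat_alg L s\<^esub> y)"
      "x \<otimes>\<^bsub>mat_alg L s\<^esub> (r \<odot>\<^bsub>mat_alg L s\<^esub> y) = r \<odot>\<^bsub>mat_alg L s\<^esub> (x \<otimes>\<^bsub>mat_alg L s\<^esub> y)"
      using EMD[OF mat_alg_L_EM, of x] EMD[OF mat_alg_L_EM, of y] by (simp_all add: mm_smultl mm_smultr)
  qed (simp_all add: b(4,5))
  define u where "u i j = unitm s s i j" for i j
  have uM: "u i j \<in> carrier (mat_alg L s)" for i j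
    by (auto simp: u_def mat_alg_L_carrier unitm_def L_zero L_one)
  have uu: "u i j * u j k = u i k" if "j < s" for i j k
    unfolding u_def unitm_mult_left[OF unitm_EM that] by (rule eq_matI) (auto simp: that)
  have tc: "T.ten x Z \<in> carrier T.T" if "x \<in> carrier B" "Z \<in> carrier (mat_alg L s)" for x Z
    using T.ten_closed that by simp
  have gc: "g y \<in> EM N N" "P * smat (g y) = g y * P" if "y \<in> carrier T.T" for y
    using gD(4)[OF that] by (auto simp: twist_carrier)
  have gmult: "g (T.ten x Z) * g (T.ten y W) = g (T.ten (x \<otimes>\<^bsub>B\<^esub> y) (Z * W))"
    if "x \<in> carrier B" "Z \<in> carrier (mat_alg L s)" "y \<in> carrier B" "W \<in> carrier (mat_alg L s)" for x y Z W
    using gD(6)[OF tc[OF that(1,2)] tc[OF that(3,4)]] T.ten_mult[of x y Z W] that by simp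
  have s0: "0 < s" using s by simp
  \<comment> \<open>The image of the corner idempotent 1 tensor e_00. The map \<psi> below
    identifies \<open>B\<close> with the corner cut out by \<open>f\<close>.\<close>
  define f where "f = g (T.ten \<one>\<^bsub>B\<^esub> (u 0 0))"
  define \<psi> where "\<psi> x = g (T.ten x (u 0 0))" for x
  have \<psi>E: "\<psi> x \<in> EM N N" and \<psi>P: "P * smat (\<psi> x) = \<psi> x * P" if "x \<in> carrier B" for x
    using gc[OF tc[OF that uM]] by (auto simp: \<psi>_def)
  have \<psi>m: "\<psi> x * \<psi> y = \<psi> (x \<otimes>\<^bsub>B\<^esub> y)" if "x \<in> carrier B" "y \<in> carrier B" for x y
    unfolding \<psi>_def using gmult[OF that(1) uM that(2) uM, of 0 0 0 0] uu[OF s0] by simp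
  have \<psi>a: "\<psi> (x \<oplus>\<^bsub>B\<^esub> y) = \<psi> x + \<psi> y" if "x \<in> carrier B" "y \<in> carrier B" for x y
    unfolding \<psi>_def using gD(5)[OF tc[OF that(1) uM] tc[OF that(2) uM]] T.ten_addl[OF that uM] by simp
  have \<psi>s: "\<psi> (r \<odot>\<^bsub>B\<^esub> x) = r \<cdot>\<^sub>m \<psi> x" if "r \<in> L" "x \<in> carrier B" for r x
    unfolding \<psi>_def using gD(9)[OF that(1) tc[OF that(2) uM]] T.ten_smult[OF that uM] by simp
  have f\<psi>: "f = \<psi> \<one>\<^bsub>B\<^esub>" by (simp add: f_def \<psi>_def)
  have ff: "f * f = f" using \<psi>m[of "\<one>\<^bsub>B\<^esub>" "\<one>\<^bsub>B\<^esub>"] by (simp add: f\<psi>)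
  have fE: "f \<in> EM N N" and fP: "P * smat f = f * P" using \<psi>E \<psi>P by (auto simp: f\<psi>)
  have f\<psi>x: "f * \<psi> x = \<psi> x" "\<psi> x * f = \<psi> x" if "x \<in> carrier B" for x
    using \<psi>m[of "\<one>\<^bsub>B\<^esub>" x] \<psi>m[of x "\<one>\<^bsub>B\<^esub>"] that by (simp_all add: f\<psi>)
  note df = EMD[OF fE]
  \<comment> \<open>Every diagonal matrix unit factors as e_i0 e_00 e_0i. If the corner vanished,
    all of them would, and with them their sum 1.\<close>
  have fn0: "f \<noteq> 0\<^sub>m N N"
  proof
    assume f0: "f = 0\<^sub>m N N"
    have ii: "g (T.ten \<one>\<^bsub>B\<^esub> (u i i)) = 0\<^sub>m N N" if "i < s" for i
    proof -
      have "g (T.ten \<one>\<^bsub>B\<^esub> (u i i)) = g (T.ten \<one>\<^bsub>B\<^esub> (u i 0)) * (f * g (T.ten \<one>\<^bsub>B\<^esub> (u 0 i)))"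
        unfolding f_def gmult[OF BR.one_closed uM BR.one_closed uM] uu[OF s0] BR.l_one[OF BR.one_closed] by (rule refl)
      then show ?thesis unfolding f0 using EMD[OF gc(1)[OF tc[OF BR.one_closed uM]]] by simp
    qed
    define dg where "dg k = mat s s (\<lambda>(i, j). if i = j \<and> i < k then 1 else 0 :: 'a)" for k
    have dgM: "dg k \<in> carrier (mat_alg L s)" for k by (auto simp: dg_def mat_alg_L_carrier L_one L_zero)
    have "k \<le> s \<Longrightarrow> g (T.ten \<one>\<^bsub>B\<^esub> (dg k)) = 0\<^sub>m N N" for k
    proof (induction k)
      case 0
      have "dg 0 = \<zero>\<^bsub>mat_alg L s\<^esub>" by (auto simp: dg_def intro!: eq_matI)
      then have "T.ten \<one>\<^bsub>B\<^esub> (dg 0) = \<zero>\<^bsub>T.T\<^esub>" using T.ten_zeror[OF BR.one_closed] T.T_zero by simp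
      then show ?case using gD(8) by simp
    next
      case (Suc k)
      have "dg (Suc k) = dg k \<oplus>\<^bsub>mat_alg L s\<^esub> u k k" using Suc by (auto simp: dg_def u_def intro!: eq_matI)
      then have "T.ten \<one>\<^bsub>B\<^esub> (dg (Suc k)) = T.ten \<one>\<^bsub>B\<^esub> (dg k) \<oplus>\<^bsub>T.T\<^esub> T.ten \<one>\<^bsub>B\<^esub> (u k k)"
        using T.ten_addr[OF BR.one_closed dgM uM] by simp
      then show ?case using gD(5)[OF tc[OF BR.one_closed dgM] tc[OF BR.one_closed uM]] Suc ii[of k] by simp
    qed
    moreover have "dg s = \<one>\<^bsub>mat_alg L s\<^esub>" by (auto simp: dg_def intro!: eq_matI)
    ultimately have "g \<one>\<^bsub>T.T\<^esub> = 0\<^sub>m N N" using T.ten_one by (metis le_refl)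
    then show False using gD(7) one_nonzero[OF p(1)] by simp
  qed
  have inj: "x = \<zero>\<^bsub>B\<^esub>" if "x \<in> carrier B" "\<psi> x = 0\<^sub>m N N" for x
    using csa_hom_injective[OF B \<psi>E \<psi>a \<psi>m[symmetric] _ that] fn0 f\<psi> by simp
  \<comment> \<open>On a pure tensor this is e_00 Z e_00 = Z(0, 0) e_00, with the scalar then moved
    into \<open>B\<close>.\<close>
  have corner: "\<exists>x\<in>carrier B. f * g y * f = \<psi> x" if "y \<in> carrier T.T" for y
    using that
  proof (rule T.T_induct)
    have "g (T.cls 0) = 0\<^sub>m N N" using gD(8) T.T_zero by simp
    moreover have "\<psi> \<zero>\<^bsub>B\<^esub> = 0\<^sub>m N N" unfolding \<psi>_def using T.ten_zerol[OF uM] gD(8) T.T_zero by simp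
    ultimately have "f * g (T.cls 0) * f = \<psi> \<zero>\<^bsub>B\<^esub>" using df by simp
    then show "\<exists>x\<in>carrier B. f * g (T.cls 0) * f = \<psi> x" using BR.zero_closed by blast
  next
    fix y z assume y: "y \<in> carrier T.T" and z: "z \<in> carrier T.T"
      and "\<exists>x\<in>carrier B. f * g y * f = \<psi> x" "\<exists>x\<in>carrier B. f * g z * f = \<psi> x"
    then obtain v w where v: "v \<in> carrier B" "w \<in> carrier B" "f * g y * f = \<psi> v" "f * g z * f = \<psi> w" by blast
    have "f * g (y \<oplus>\<^bsub>T.T\<^esub> z) * f = f * g y * f + f * g z * f"
      using gD(5)[OF y z] EMD[OF gc(1)[OF y]] EMD[OF gc(1)[OF z]] df by (simp add: mm_distl mm_distr)
    also have "\<dots> = \<psi> (v \<oplus>\<^bsub>B\<^esub> w)" unfolding v(3,4) \<psi>a[OF v(1,2)] ..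
    finally show "\<exists>x\<in>carrier B. f * g (y \<oplus>\<^bsub>T.T\<^esub> z) * f = \<psi> x" using v BR.a_closed by blast
  next
    fix x Z assume x: "x \<in> carrier B" and Z: "Z \<in> carrier (mat_alg L s)"
    have ZE: "Z \<in> EM s s" by (rule mat_alg_L_EM[OF Z])
    have z: "Z $$ (0, 0) \<in> L" using Z s0 by (simp add: mat_alg_L_carrier)
    have uZ: "u 0 0 * Z \<in> carrier (mat_alg L s)" "u 0 0 * Z \<in> EM s s"
      using MR.m_closed[OF uM Z, of 0 0] mat_alg_L_EM by auto
    have "u 0 0 * Z * u 0 0 = Z $$ (0, 0) \<odot>\<^bsub>mat_alg L s\<^esub> u 0 0"
      using uZ(2) unfolding u_def unitm_mult_left[OF ZE s0]
      by (subst unitm_mult_right[OF _ s0]) (use s0 in \<open>auto intro!: eq_matI\<close>)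
    then have "f * g (T.ten x Z) * f = \<psi> (Z $$ (0, 0) \<odot>\<^bsub>B\<^esub> x)"
      unfolding f_def gmult[OF BR.one_closed uM x Z] \<psi>_def
      using gmult[OF _ uZ(1) BR.one_closed uM, of "\<one>\<^bsub>B\<^esub> \<otimes>\<^bsub>B\<^esub> x"] T.ten_bal[OF z x uM] x by simp
    then show "\<exists>w\<in>carrier B. f * g (T.ten x Z) * f = \<psi> w" using closed_algD(5)[OF cB z x] by blast
  qed
  obtain m J K where JK: "J \<in> EM N m" "K \<in> EM m N" "f = J * K" "K * J = 1\<^sub>m m"
    using idempotent_factor[OF fE ff] by blast
  note dJ = EMD[OF JK(1)] and dK = EMD[OF JK(2)]
  have m1: "m \<ge> 1"
  proof (rule ccontr)
    assume "\<not> m \<ge> 1"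
    then have "f = 0\<^sub>m N N" unfolding JK(3) using dJ dK by (intro eq_matI) (auto simp: scalar_prod_def)
    then show False using fn0 by simp
  qed
  have fJ: "f * J = J" unfolding JK(3) using dJ dK by (simp add: mm_assoc JK(4))
  have Kf: "K * f = K" unfolding JK(3) using dJ dK by (simp add: mm_assoc[symmetric] JK(4))
  \<comment> \<open>The semilinear operator commutes with the projection \<open>f\<close>, so it
    restricts to the image of \<open>f\<close>; this is the restriction in the coordinates given by
    \<open>J\<close> and \<open>K\<close>. Its square is still \<open>c\<close>.\<close>
  define P' where "P' = K * P * smat J"
  have P'E: "P' \<in> EM m m" unfolding P'_def using JK p by (intro EM_mult EM_smat)
  note dP' = EMD[OF P'E]
  have sJK: "smat J * smat K = smat f" unfolding JK(3) using dJ dK by (simp add: smat_mult)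
  have JP': "J * P' = P * smat J"
  proof -
    have "J * P' = f * P * smat J" unfolding P'_def JK(3) using dJ dK p by (simp add: mm_assoc)
    also have "\<dots> = P * smat (f * J)" unfolding fP[symmetric] using dJ df p by (simp add: mm_assoc smat_mult)
    finally show ?thesis by (simp add: fJ)
  qed
  have P'K: "P' * smat K = K * P"
  proof -
    have "P' * smat K = K * (P * smat f)" unfolding P'_def sJK[symmetric] using dJ dK p by (simp add: mm_assoc)
    also have "\<dots> = (K * f) * P" unfolding fP using df dK p by (simp add: mm_assoc)
    finally show ?thesis by (simp add: Kf)
  qed
  have t': "tw m P' c"
  proof -
    have "P' * smat P' = P' * smat K * smat P * J" unfolding P'_def using dJ dK p
      by (simp add: smat_mult smat_smat[OF JK(1)] mm_assoc)
    also have "\<dots> = K * (P * smat P) * J" unfolding P'K using dJ dK p(1,2,7,8) by (simp add: mm_assoc)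
    also have "\<dots> = c \<cdot>\<^sub>m 1\<^sub>m m" unfolding p(5) using dJ dK by (simp add: mm_smultl mm_smultr JK(4))
    finally show ?thesis using m1 P'E p by (simp add: tw_def)
  qed
  define \<iota> where "\<iota> x = K * \<psi> x * J" for x
  have d\<psi>: "dim_row (\<psi> x) = N" "dim_col (\<psi> x) = N" if "x \<in> carrier B" for x using EMD[OF \<psi>E[OF that]] by auto
  have J\<iota>K: "J * \<iota> x * K = \<psi> x" if x: "x \<in> carrier B" for x
  proof -
    have "J * \<iota> x * K = f * \<psi> x * f" unfolding \<iota>_def JK(3) using dJ dK d\<psi>[OF x] by (simp add: mm_assoc)
    then show ?thesis using f\<psi>x[OF x] by simp
  qed
  have \<iota>tw: "\<iota> x \<in> carrier (twist m P')" if x: "x \<in> carrier B" for x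
  proof -
    have "P' * smat (\<iota> x) = (P' * smat K) * smat (\<psi> x) * smat J" unfolding \<iota>_def using dJ dK d\<psi>[OF x] dP'
      by (simp add: smat_mult mm_assoc)
    also have "\<dots> = K * (P * smat (\<psi> x)) * smat J" unfolding P'K using dJ dK d\<psi>[OF x] p by (simp add: mm_assoc)
    also have "\<dots> = K * \<psi> x * (J * P')" unfolding \<psi>P[OF x] JP' using dJ dK d\<psi>[OF x] p by (simp add: mm_assoc)
    also have "\<dots> = \<iota> x * P'" unfolding \<iota>_def using dJ dK d\<psi>[OF x] dP' by (simp add: mm_assoc)
    finally show ?thesis using EM_mult[OF EM_mult[OF JK(2) \<psi>E[OF x]] JK(1)] by (simp add: twist_carrier \<iota>_def)
  qed
  have \<psi>0: "\<psi> \<zero>\<^bsub>B\<^esub> = 0\<^sub>m N N" unfolding \<psi>_def using T.ten_zerol[OF uM] gD(8) T.T_zero by simp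
  have "bij_betw \<iota> (carrier B) (carrier (twist m P'))"
    unfolding bij_betw_def
  proof
    show "inj_on \<iota> (carrier B)"
    proof (rule inj_onI)
      fix x y assume xy: "x \<in> carrier B" "y \<in> carrier B" "\<iota> x = \<iota> y"
      then have e: "\<psi> x = \<psi> y" using J\<iota>K by metis
      have "\<psi> x = \<psi> (x \<ominus>\<^bsub>B\<^esub> y) + \<psi> y" using \<psi>a[of "x \<ominus>\<^bsub>B\<^esub> y" y] xy by (simp add: BR.minus_eq BR.a_assoc BR.l_neg)
      then have "\<psi> (x \<ominus>\<^bsub>B\<^esub> y) + \<psi> y = \<psi> y" using e by simp
      then have q: "(\<psi> (x \<ominus>\<^bsub>B\<^esub> y) + \<psi> y) $$ (i, j) = \<psi> y $$ (i, j)" for i j by simp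
      have "\<psi> (x \<ominus>\<^bsub>B\<^esub> y) = 0\<^sub>m N N"
      proof (rule eq_matI)
        fix i j assume "i < dim_row (0\<^sub>m N N :: 'a mat)" "j < dim_col (0\<^sub>m N N :: 'a mat)"
        then show "\<psi> (x \<ominus>\<^bsub>B\<^esub> y) $$ (i, j) = (0\<^sub>m N N :: 'a mat) $$ (i, j)"
          using q[of i j] d\<psi>[OF xy(2)] by simp
      qed (use d\<psi>[of "x \<ominus>\<^bsub>B\<^esub> y"] xy in auto)
      then show "x = y" using inj[of "x \<ominus>\<^bsub>B\<^esub> y"] xy by simp
    qed
    show "\<iota> ` carrier B = carrier (twist m P')"
    proof
      show "\<iota> ` carrier B \<subseteq> carrier (twist m P')" using \<iota>tw by auto
      show "carrier (twist m P') \<subseteq> \<iota> ` carrier B"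
      proof
        fix Y assume "Y \<in> carrier (twist m P')"
        then have Y: "Y \<in> EM m m" "P' * smat Y = Y * P'" by (auto simp: twist_carrier)
        note dY = EMD[OF Y(1)]
        have "P * smat (J * Y * K) = (P * smat J) * smat Y * smat K" using dJ dK dY p by (simp add: smat_mult mm_assoc)
        also have "\<dots> = J * (P' * smat Y) * smat K" unfolding JP'[symmetric] using dJ dK dY dP' by (simp add: mm_assoc)
        also have "\<dots> = J * Y * (P' * smat K)" unfolding Y(2) using dJ dK dY dP' by (simp add: mm_assoc)
        also have "\<dots> = (J * Y * K) * P" unfolding P'K using dJ dK dY p by (simp add: mm_assoc)
        finally have "J * Y * K \<in> carrier (twist N P)"
          using EM_mult[OF EM_mult[OF JK(1) Y(1)] JK(2)] by (simp add: twist_carrier)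
        then obtain y where y: "y \<in> carrier T.T" "J * Y * K = g y" using gD(3) by (metis imageE)
        obtain x where x: "x \<in> carrier B" "f * g y * f = \<psi> x" using corner[OF y(1)] by blast
        have "f * g y * f = (f * J) * Y * (K * f)" unfolding y(2)[symmetric] using df dJ dK dY by (simp add: mm_assoc)
        then have "\<psi> x = J * Y * K" unfolding fJ Kf using x by simp
        then have "\<iota> x = (K * J) * Y * (K * J)" unfolding \<iota>_def using dJ dK dY by (simp add: mm_assoc)
        then have "\<iota> x = Y" unfolding JK(4) using dY by simp
        then show "Y \<in> \<iota> ` carrier B" using x by auto
      qed
    qed
  qed
  moreover have "\<iota> (x \<oplus>\<^bsub>B\<^esub> y) = \<iota> x + \<iota> y" "\<iota> (x \<otimes>\<^bsub>B\<^esub> y) = \<iota> x * \<iota> y" if "x \<in> carrier B" "y \<in> carrier B" for x y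
  proof -
    show "\<iota> (x \<oplus>\<^bsub>B\<^esub> y) = \<iota> x + \<iota> y"
      unfolding \<iota>_def \<psi>a[OF that] using dJ dK d\<psi>[OF that(1)] d\<psi>[OF that(2)] by (simp add: mm_distl mm_distr)
    have "\<iota> x * \<iota> y = K * ((\<psi> x * f) * \<psi> y) * J"
      unfolding \<iota>_def JK(3) using dJ dK d\<psi>[OF that(1)] d\<psi>[OF that(2)] by (simp add: mm_assoc)
    then show "\<iota> (x \<otimes>\<^bsub>B\<^esub> y) = \<iota> x * \<iota> y" unfolding f\<psi>x(2)[OF that(1)] \<psi>m[OF that] by (simp add: \<iota>_def)
  qed
  moreover have "\<iota> \<one>\<^bsub>B\<^esub> = 1\<^sub>m m" unfolding \<iota>_def f\<psi>[symmetric] Kf JK(4) ..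
  moreover have "\<iota> \<zero>\<^bsub>B\<^esub> = 0\<^sub>m m m" unfolding \<iota>_def \<psi>0 using dJ dK by simp
  moreover have "\<iota> (r \<odot>\<^bsub>B\<^esub> x) = r \<cdot>\<^sub>m \<iota> x" if "r \<in> L" "x \<in> carrier B" for r x
    unfolding \<iota>_def \<psi>s[OF that] using dJ dK d\<psi>[OF that(2)] by (simp add: mm_smultl mm_smultr)
  ultimately have "alg_map L B (twist m P') \<iota>" unfolding alg_map_def by simp
  then show ?thesis unfolding typed_def using cB t' by blast
qed

text \<open>Tensoring with matrices over \<open>L\<close> multiplies the class by 1, an isomorphism
  carries the description over to the other side, and there the matrix factor is removed.\<close>

lemma similar_typed:
  assumes A: "typed A n c" and B: "central_simple_algebra (fld L) B" and sim: "similar_alg L A B"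
  shows "\<exists>m. typed B m c"
proof -
  obtain r s where rs: "r \<ge> 1" "s \<ge> 1"
    and iso: "alg_iso (fld L) (tensor_alg (fld L) A (mat_alg L r)) (tensor_alg (fld L) B (mat_alg L s))"
    using sim by (auto simp: similar_alg_def)
  let ?TA = "tensor_alg (fld L) A (mat_alg L r)" and ?TB = "tensor_alg (fld L) B (mat_alg L s)"
  have "typed (mat_alg L r) r 1" unfolding typed_def using typed_mat_alg_map[OF rs(1)] by blast
  from typed_tensor[OF A this] have "typed ?TA (r * n) c" by simp
  then obtain P f where P: "tw (r * n) P c" and f: "alg_map L ?TA (twist (r * n) P) f" and cA: "closed_alg L ?TA" by (auto simp: typed_def)
  note b = csaD[OF B]
  have raM: "ring_alg L (mat_alg L s)" by (rule mat_alg_L_ring_alg[OF rs(2)])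
  obtain h where h: "h \<in> Ring.ring_hom ?TA ?TB" "bij_betw h (carrier ?TA) (carrier ?TB)"
    "\<forall>r\<in>L. \<forall>x\<in>carrier ?TA. h (r \<odot>\<^bsub>?TA\<^esub> x) = r \<odot>\<^bsub>?TB\<^esub> h x"
    using iso by (auto simp: alg_iso_iff ring_iso_def)
  have zA: "\<zero>\<^bsub>?TA\<^esub> \<in> carrier ?TA" "\<zero>\<^bsub>?TA\<^esub> \<oplus>\<^bsub>?TA\<^esub> \<zero>\<^bsub>?TA\<^esub> = \<zero>\<^bsub>?TA\<^esub>"
  proof -
    have "ring_alg L ?TA" by (rule ring_alg_transfer[OF cA f twist_ring_alg[OF twD(2)[OF P]]])
    then interpret ring ?TA by (simp add: ring_alg_def)
    show "\<zero>\<^bsub>?TA\<^esub> \<in> carrier ?TA" "\<zero>\<^bsub>?TA\<^esub> \<oplus>\<^bsub>?TA\<^esub> \<zero>\<^bsub>?TA\<^esub> = \<zero>\<^bsub>?TA\<^esub>" by simp_all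
  qed
  \<comment> \<open>The isomorphism is a ring homomorphism, which says nothing about zero; zero is
    recognised as an additive idempotent.\<close>
  have "h \<zero>\<^bsub>?TA\<^esub> = \<zero>\<^bsub>?TB\<^esub>"
  proof (rule tensor_pair.idempotent_zero)
    show "tensor_pair L B (mat_alg L s)" using b(3) raM by (simp add: tensor_pair_def ring_alg_def)
    show "h \<zero>\<^bsub>?TA\<^esub> \<in> carrier ?TB" using h(2) zA by (auto simp: bij_betw_def)
    show "h \<zero>\<^bsub>?TA\<^esub> \<oplus>\<^bsub>?TB\<^esub> h \<zero>\<^bsub>?TA\<^esub> = h \<zero>\<^bsub>?TA\<^esub>"
      using h(1) zA by (metis (no_types, lifting) Ring.ring_hom_add)
  qed
  then have "alg_map L ?TA ?TB h" using h unfolding alg_map_def Ring.ring_hom_def by auto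
  from alg_map_comp[OF alg_map_inv[OF cA this] f] show ?thesis
    by (rule matrix_factor_typed[OF B rs(2) P])
qed

end

section \<open>The relative Brauer group of a quadratic extension\<close>

text \<open>Members of a Brauer class are algebras carried by vectors, so pairs are encoded as
  vectors of length two. The same encoding serves for the lattice.\<close>

definition vec2 :: "'a \<Rightarrow> 'a \<Rightarrow> 'a vec" where
  "vec2 x y = vec 2 (\<lambda>i. if i = 0 then x else y)"

lemma vec2_index [simp]: "vec2 x y $ 0 = x" "vec2 x y $ 1 = y" "vec2 x y $ Suc 0 = y"
  by (simp_all add: vec2_def)

lemma vec2_eq_iff: "vec2 x y = vec2 x' y' \<longleftrightarrow> x = x' \<and> y = y'"
  by (metis vec2_index(1,2))

definition mat2 :: "'a \<Rightarrow> 'a \<Rightarrow> 'a \<Rightarrow> 'a \<Rightarrow> 'a mat" where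
  "mat2 a b c d = mat 2 2 (\<lambda>(i, j). if i = 0 then if j = 0 then a else b else if j = 0 then c else d)"

lemma mat2_dim [simp]: "dim_row (mat2 a b c d) = 2" "dim_col (mat2 a b c d) = 2"
  by (simp_all add: mat2_def)

lemma mat2_index [simp]: "mat2 a b c d $$ (0, 0) = a" "mat2 a b c d $$ (0, Suc 0) = b"
  "mat2 a b c d $$ (Suc 0, 0) = c" "mat2 a b c d $$ (Suc 0, Suc 0) = d"
  by (simp_all add: mat2_def)

lemma mat2_eta: "\<lbrakk>dim_row M = 2; dim_col M = 2\<rbrakk> \<Longrightarrow> M = mat2 (M $$ (0, 0)) (M $$ (0, Suc 0)) (M $$ (Suc 0, 0)) (M $$ (Suc 0, Suc 0))"
  by (rule eq_matI) (auto simp: mat2_def less_2_cases_iff)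

lemma mat2_eq_iff: "mat2 a b c d = mat2 a' b' c' d' \<longleftrightarrow> a = a' \<and> b = b' \<and> c = c' \<and> d = d'"
  by (metis mat2_index)

lemma mat2_mult: "mat2 a b c d * mat2 a' b' c' d' = mat2 (a * a' + b * c') (a * b' + b * d') (c * a' + d * c') (c * b' + d * (d' :: 'a::semiring_0))"
  by (rule eq_matI) (auto simp: scalar_prod_def mat2_def less_2_cases_iff numeral_2_eq_2)

lemma mat2_add: "mat2 a b c d + mat2 a' b' c' d' = mat2 (a + a') (b + b') (c + c') (d + d')"
  by (rule eq_matI) (auto simp: mat2_def)

lemma mat2_smult: "k \<cdot>\<^sub>m mat2 a b c d = mat2 (k * a) (k * b) (k * c) (k * d)"
  by (rule eq_matI) (auto simp: mat2_def)

lemma mat2_one: "1\<^sub>m 2 = mat2 1 0 0 1"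
  by (rule eq_matI) (auto simp: mat2_def less_2_cases_iff)

lemma mat2_zero: "0\<^sub>m 2 2 = mat2 0 0 0 0"
  by (rule eq_matI) (auto simp: mat2_def)

lemma mat2_map: "map_mat f (mat2 a b c d) = mat2 (f a) (f b) (f c) (f d)"
  by (rule eq_matI) (auto simp: mat2_def)

context quad
begin

text \<open>The quaternion algebra \<open>E \<oplus> E u\<close> with \<open>u\<^sup>2 = c\<close> and \<open>u x = \<sigma>(x) u\<close>.\<close>

definition qalg :: "'a \<Rightarrow> ('a, 'a vec) module" where
  "qalg c = \<lparr> carrier = {vec2 x y | x y. x \<in> E \<and> y \<in> E},
     monoid.mult = (\<lambda>v w. vec2 (v $ 0 * w $ 0 + c * (v $ 1 * sg (w $ 1))) (v $ 0 * w $ 1 + v $ 1 * sg (w $ 0))),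
     one = vec2 1 0, ring.zero = vec2 0 0, ring.add = (\<lambda>v w. vec2 (v $ 0 + w $ 0) (v $ 1 + w $ 1)),
     smult = (\<lambda>r v. vec2 (r * v $ 0) (r * v $ 1)) \<rparr>"

lemma qalg_simps:
  "vec2 x y \<oplus>\<^bsub>qalg c\<^esub> vec2 x' y' = vec2 (x + x') (y + y')"
  "vec2 x y \<otimes>\<^bsub>qalg c\<^esub> vec2 x' y' = vec2 (x * x' + c * (y * sg y')) (x * y' + y * sg x')"
  "r \<odot>\<^bsub>qalg c\<^esub> vec2 x y = vec2 (r * x) (r * y)"
  "\<one>\<^bsub>qalg c\<^esub> = vec2 1 0" "\<zero>\<^bsub>qalg c\<^esub> = vec2 0 0"
  by (simp_all add: qalg_def)

lemma qalg_carrier: "v \<in> carrier (qalg c) \<longleftrightarrow> (\<exists>x y. v = vec2 x y \<and> x \<in> E \<and> y \<in> E)"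
  by (auto simp: qalg_def)

lemma qalg_vec2: "vec2 x y \<in> carrier (qalg c) \<longleftrightarrow> x \<in> E \<and> y \<in> E"
  by (auto simp: qalg_carrier vec2_eq_iff)

lemma qalg_closed: assumes c: "c \<in> L" shows "closed_alg L (qalg c)"
  unfolding closed_alg_def using L_E[OF c]
  by (auto simp: qalg_carrier qalg_simps vec2_eq_iff E_zero E_one L_E intro!: E_add E_mult sg_E)

lemma mat2_EM: "mat2 a b d e \<in> EM 2 2 \<longleftrightarrow> a \<in> E \<and> b \<in> E \<and> d \<in> E \<and> e \<in> E"
  by (auto simp: EM_def mat2_def less_2_cases_iff)

lemma qalg_tw: assumes "c \<in> L" "c \<noteq> 0" shows "tw 2 (mat2 0 c 1 0) c"
  using assms by (simp add: tw_def mat2_EM L_E E_one E_zero mat2_map mat2_mult mat2_one mat2_smult sg_zero sg_one L_sg mat2_eq_iff)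

text \<open>The usual representation of x + y u by 2 by 2 matrices over \<open>E\<close>. The
  twisting condition says precisely that the second row is determined by the conjugate of the
  first.\<close>

lemma qalg_map:
  assumes c: "c \<in> L" "c \<noteq> 0"
  shows "alg_map L (qalg c) (twist 2 (mat2 0 c 1 0)) (\<lambda>v. mat2 (v $ 0) (c * v $ 1) (sg (v $ 1)) (sg (v $ 0)))"
proof -
  let ?h = "\<lambda>v. mat2 (v $ 0) (c * v $ 1) (sg (v $ 1)) (sg (v $ 0))"
  have "bij_betw ?h (carrier (qalg c)) (carrier (twist 2 (mat2 0 c 1 0)))"
    unfolding bij_betw_def
  proof
    show "inj_on ?h (carrier (qalg c))"
      using c by (auto simp: inj_on_def qalg_carrier mat2_eq_iff vec2_eq_iff)
    show "?h ` carrier (qalg c) = carrier (twist 2 (mat2 0 c 1 0))"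
    proof
      show "?h ` carrier (qalg c) \<subseteq> carrier (twist 2 (mat2 0 c 1 0))"
        using c by (auto simp: qalg_carrier twist_carrier mat2_EM mat2_map mat2_mult mat2_eq_iff sg_E sg_sg E_mult L_E sg_mult L_sg)
      show "carrier (twist 2 (mat2 0 c 1 0)) \<subseteq> ?h ` carrier (qalg c)"
      proof
        fix M assume M: "M \<in> carrier (twist 2 (mat2 0 c 1 0))"
        then have ME: "M \<in> EM 2 2" by (simp add: twist_carrier)
        obtain p q r s where pq: "M = mat2 p q r s" using mat2_eta EMD(1,2)[OF ME] by metis
        have e: "p \<in> E" "q \<in> E" "r \<in> E" "s \<in> E" using ME by (auto simp: pq mat2_EM)
        have "c * sg r = q" "sg p = s"
          using M by (auto simp: twist_carrier pq mat2_map mat2_mult mat2_eq_iff)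
        then have "M = ?h (vec2 p (sg r))" using e by (simp add: pq sg_sg)
        moreover have "vec2 p (sg r) \<in> carrier (qalg c)" using e by (simp add: qalg_vec2 sg_E)
        ultimately show "M \<in> ?h ` carrier (qalg c)" by (rule image_eqI)
      qed
    qed
  qed
  moreover have "?h (v \<oplus>\<^bsub>qalg c\<^esub> w) = ?h v + ?h w" "?h (v \<otimes>\<^bsub>qalg c\<^esub> w) = ?h v * ?h w"
    if "v \<in> carrier (qalg c)" "w \<in> carrier (qalg c)" for v w
    using that c by (auto simp: qalg_carrier qalg_simps mat2_add mat2_mult mat2_eq_iff sg_add sg_mult sg_sg L_sg algebra_simps)
  moreover have "?h (r \<odot>\<^bsub>qalg c\<^esub> v) = r \<cdot>\<^sub>m ?h v" if "r \<in> L" "v \<in> carrier (qalg c)" for r v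
    using that by (auto simp: qalg_carrier qalg_simps mat2_smult mat2_eq_iff sg_mult L_sg algebra_simps)
  ultimately show ?thesis unfolding alg_map_def
    by (simp add: qalg_simps mat2_one mat2_zero mat2_eq_iff sg_one sg_zero)
qed

lemma qalg_typed: assumes "c \<in> L" "c \<noteq> 0" shows "typed (qalg c) 2 c"
  unfolding typed_def using qalg_closed qalg_tw qalg_map assms by blast

text \<open>The commutator of x + y u with \<open>om\<close> is (om - sg om) y u, a unit when y is
  nonzero; so a nonzero ideal contains a unit. A central element commutes with \<open>om\<close>,
  which kills y, and with u, which makes x invariant under \<open>sg\<close>.\<close>

lemma qalg_csa:
  assumes c: "c \<in> L" "c \<noteq> 0"
  shows "central_simple_algebra (fld L) (qalg c)"
  unfolding central_simple_algebra_def
proof (intro conjI)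
  have ra: "ring_alg L (qalg c)" by (rule typed_ring_alg[OF qalg_typed[OF c]])
  interpret R: ring "qalg c" using ra by (simp add: ring_alg_def)
  interpret M: module "fld L" "qalg c" using ra by (simp add: ring_alg_def)
  show "assoc_algebra (fld L) (qalg c)"
  proof unfold_locales
    fix r v w assume "r \<in> carrier (fld L)" "v \<in> carrier (qalg c)" "w \<in> carrier (qalg c)"
    then show "r \<odot>\<^bsub>qalg c\<^esub> v \<otimes>\<^bsub>qalg c\<^esub> w = r \<odot>\<^bsub>qalg c\<^esub> (v \<otimes>\<^bsub>qalg c\<^esub> w)"
      "v \<otimes>\<^bsub>qalg c\<^esub> (r \<odot>\<^bsub>qalg c\<^esub> w) = r \<odot>\<^bsub>qalg c\<^esub> (v \<otimes>\<^bsub>qalg c\<^esub> w)"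
      by (auto simp: qalg_carrier qalg_simps vec2_eq_iff sg_mult L_sg algebra_simps)
  qed
  show "finitely_generated_module (fld L) (qalg c)"
    unfolding finitely_generated_module_def
  proof (intro exI conjI allI impI)
    \<comment> \<open>A basis over \<open>L\<close>: 1 and \<open>om\<close> in each of the two
      components.\<close>
    let ?S = "{vec2 1 0, vec2 om 0, vec2 0 1, vec2 0 om}"
    show "finite ?S" by simp
    show "?S \<subseteq> carrier (qalg c)" by (auto simp: qalg_vec2 E_one E_zero om)
    fix N assume N: "submodule N (fld L) (qalg c) \<and> ?S \<subseteq> N"
    then have sub: "N \<subseteq> carrier (qalg c)" and add: "\<And>v w. \<lbrakk>v \<in> N; w \<in> N\<rbrakk> \<Longrightarrow> v \<oplus>\<^bsub>qalg c\<^esub> w \<in> N"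
      and sm: "\<And>r v. \<lbrakk>r \<in> L; v \<in> N\<rbrakk> \<Longrightarrow> r \<odot>\<^bsub>qalg c\<^esub> v \<in> N"
      using M.submoduleE[of N] by auto
    show "N = carrier (qalg c)"
    proof
      show "carrier (qalg c) \<subseteq> N"
      proof
        fix v assume "v \<in> carrier (qalg c)"
        then obtain x y where v: "v = vec2 x y" "x \<in> E" "y \<in> E" by (auto simp: qalg_carrier)
        have "(reE x \<odot>\<^bsub>qalg c\<^esub> vec2 1 0 \<oplus>\<^bsub>qalg c\<^esub> imE x \<odot>\<^bsub>qalg c\<^esub> vec2 om 0) \<oplus>\<^bsub>qalg c\<^esub>
           (reE y \<odot>\<^bsub>qalg c\<^esub> vec2 0 1 \<oplus>\<^bsub>qalg c\<^esub> imE y \<odot>\<^bsub>qalg c\<^esub> vec2 0 om) \<in> N"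
          using N v reE_L imE_L by (intro add sm) auto
        then show "v \<in> N" using re_im[of x] re_im[of y] by (simp add: qalg_simps v(1))
      qed
    qed (rule sub)
  qed
  have one: "\<one>\<^bsub>qalg c\<^esub> \<in> I" if I: "ideal I (qalg c)" and z: "z \<in> I" "z \<noteq> \<zero>\<^bsub>qalg c\<^esub>" for I z
  proof -
    interpret I: ideal I "qalg c" by (rule I)
    have zc: "z \<in> carrier (qalg c)" using z I.a_subset by blast
    then obtain x y where v: "z = vec2 x y" "x \<in> E" "y \<in> E" by (auto simp: qalg_carrier)
    show ?thesis
    proof (cases "y = 0")
      case True
      then have "x \<noteq> 0" using z v by (auto simp: qalg_simps)
      then have "z \<otimes>\<^bsub>qalg c\<^esub> vec2 (inverse x) 0 = \<one>\<^bsub>qalg c\<^esub>" using True v by (simp add: qalg_simps sg_zero)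
      then show ?thesis using I.I_r_closed[OF z(1), of "vec2 (inverse x) 0"] v by (simp add: qalg_vec2 E_inv E_zero)
    next
      case False
      have o: "vec2 om 0 \<in> carrier (qalg c)" "vec2 (- om) 0 \<in> carrier (qalg c)" by (auto simp: qalg_vec2 om E_zero E_minus)
      have "vec2 om 0 \<otimes>\<^bsub>qalg c\<^esub> z \<oplus>\<^bsub>qalg c\<^esub> z \<otimes>\<^bsub>qalg c\<^esub> vec2 (- om) 0 \<in> I"
        using I.I_l_closed[OF z(1) o(1)] I.I_r_closed[OF z(1) o(2)] I.a_closed by blast
      moreover have "vec2 om 0 \<otimes>\<^bsub>qalg c\<^esub> z \<oplus>\<^bsub>qalg c\<^esub> z \<otimes>\<^bsub>qalg c\<^esub> vec2 (- om) 0 = vec2 0 (del * y)"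
        by (simp add: v qalg_simps sg_zero sg_minus vec2_eq_iff del_def algebra_simps)
      ultimately have w: "vec2 0 (del * y) \<in> I" by simp
      let ?w = "del * y"
      have w0: "?w \<noteq> 0" "?w \<in> E" using del False v by (auto intro: E_mult)
      \<comment> \<open>The factor is dictated by (w u)(sg(z) u) = c w z, where the letter u on the
        left is the quaternion generator: z must be the inverse of c w.\<close>
      obtain u where u: "u = inverse (c * ?w)" by blast
      have uE: "u \<in> E" unfolding u by (rule E_inv[OF E_mult[OF L_E[OF c(1)] w0(2)]])
      have "c * (?w * sg (sg u)) = 1" unfolding sg_sg[OF uE] using u w0(1) c(2) by (simp add: field_simps)
      then have "vec2 0 ?w \<otimes>\<^bsub>qalg c\<^esub> vec2 0 (sg u) = \<one>\<^bsub>qalg c\<^esub>"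
        by (simp add: qalg_simps sg_zero vec2_eq_iff)
      then show ?thesis using I.I_r_closed[OF w, of "vec2 0 (sg u)"] uE by (simp add: qalg_vec2 sg_E E_zero)
    qed
  qed
  show "simple_ring (qalg c)"
    unfolding simple_ring_def
  proof (intro conjI allI impI)
    have "\<one>\<^bsub>qalg c\<^esub> \<noteq> \<zero>\<^bsub>qalg c\<^esub>" by (simp add: qalg_simps vec2_eq_iff)
    then show "carrier (qalg c) \<noteq> {\<zero>\<^bsub>qalg c\<^esub>}" using R.one_closed by blast
    fix I assume I: "ideal I (qalg c)"
    interpret I: ideal I "qalg c" by (rule I)
    show "I = {\<zero>\<^bsub>qalg c\<^esub>} \<or> I = carrier (qalg c)"
    proof (cases "\<exists>z\<in>I. z \<noteq> \<zero>\<^bsub>qalg c\<^esub>")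
      case True
      then show ?thesis using one[OF I] I.one_imp_carrier by blast
    next
      case False
      moreover have "\<zero>\<^bsub>qalg c\<^esub> \<in> I" by (rule I.zero_closed)
      ultimately show ?thesis by blast
    qed
  qed (rule R.ring_axioms)
  show "central_algebra (fld L) (qalg c)"
    unfolding central_algebra_def
  proof
    show "{r \<odot>\<^bsub>qalg c\<^esub> \<one>\<^bsub>qalg c\<^esub> |r. r \<in> carrier (fld L)} \<subseteq> {z \<in> carrier (qalg c). \<forall>x\<in>carrier (qalg c). z \<otimes>\<^bsub>qalg c\<^esub> x = x \<otimes>\<^bsub>qalg c\<^esub> z}"
      by (auto simp: qalg_carrier qalg_simps vec2_eq_iff L_sg L_E E_zero sg_zero algebra_simps)
    show "{z \<in> carrier (qalg c). \<forall>x\<in>carrier (qalg c). z \<otimes>\<^bsub>qalg c\<^esub> x = x \<otimes>\<^bsub>qalg c\<^esub> z} \<subseteq> {r \<odot>\<^bsub>qalg c\<^esub> \<one>\<^bsub>qalg c\<^esub> |r. r \<in> carrier (fld L)}"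
    proof
      fix z assume "z \<in> {z \<in> carrier (qalg c). \<forall>x\<in>carrier (qalg c). z \<otimes>\<^bsub>qalg c\<^esub> x = x \<otimes>\<^bsub>qalg c\<^esub> z}"
      then obtain x y where v: "z = vec2 x y" "x \<in> E" "y \<in> E"
        and comm: "\<And>w. w \<in> carrier (qalg c) \<Longrightarrow> z \<otimes>\<^bsub>qalg c\<^esub> w = w \<otimes>\<^bsub>qalg c\<^esub> z" by (auto simp: qalg_carrier)
      have "y * sg om = om * y"
        using comm[of "vec2 om 0"] om by (simp add: v qalg_vec2 E_zero qalg_simps sg_zero vec2_eq_iff)
      then have y: "y = 0" using om(2) by simp
      have "x = sg x"
        using comm[of "vec2 0 1"] by (simp add: v y qalg_vec2 E_zero E_one qalg_simps sg_zero sg_one vec2_eq_iff)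
      then have "x \<in> L" using v by (simp add: L_eq)
      then show "z \<in> {r \<odot>\<^bsub>qalg c\<^esub> \<one>\<^bsub>qalg c\<^esub> |r. r \<in> carrier (fld L)}" by (auto simp: v y qalg_simps)
    qed
  qed
qed

text \<open>The class belonging to \<open>c\<close>, described without a representative: the Brauer
  class of any algebra of type \<open>c\<close>, whatever its carrier type, is this very
  set.\<close>

definition br :: "'a \<Rightarrow> ('a, 'a vec) module set" where
  "br c = {B. central_simple_algebra (fld L) B \<and> (\<exists>m. typed B m c)}"

lemma brauer_class_typed: "typed A n c \<Longrightarrow> brauer_class L A = br c"
  unfolding brauer_class_def br_def using similar_typed typed_similar by blast

lemma br_qalg: "\<lbrakk>c \<in> L; c \<noteq> 0\<rbrakk> \<Longrightarrow> qalg c \<in> br c"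
  using qalg_csa qalg_typed by (auto simp: br_def)

lemma br_in_Br: "\<lbrakk>c \<in> L; c \<noteq> 0\<rbrakk> \<Longrightarrow> br c \<in> carrier (Br L E)"
proof -
  assume c: "c \<in> L" "c \<noteq> 0"
  have "br c = brauer_class L (qalg c)" using brauer_class_typed[OF qalg_typed[OF c]] by simp
  moreover have "split_by L E (qalg c)" by (rule typed_split[OF qalg_typed[OF c]])
  ultimately have "\<exists>A :: ('a, 'a vec) module. br c = brauer_class L A \<and> central_simple_algebra (fld L) A \<and> split_by L E A"
    using qalg_csa[OF c] by blast
  then show ?thesis by (simp add: Br_def)
qed

lemma Br_surj:
  assumes "Q \<in> carrier (Br L E)" shows "\<exists>c\<in>L. c \<noteq> 0 \<and> Q = br c"
proof -
  obtain A :: "('a, 'a vec) module" where A: "Q = brauer_class L A" "central_simple_algebra (fld L) A" "split_by L E A"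
    using assms by (auto simp: Br_def)
  obtain n c where t: "typed A n c" using split_typed A by blast
  then obtain P where "tw n P c" by (auto simp: typed_def)
  then have "c \<in> L" "c \<noteq> 0" using twD(3,4) by blast+
  then show ?thesis using brauer_class_typed[OF t] A by auto
qed

text \<open>The quaternion algebra of \<open>c\<close> lies in its own class; if the classes agree
  it also has type \<open>d\<close>, and \<open>typed_norm\<close> applies. Conversely a norm is
  absorbed by rescaling. With \<open>Br_surj\<close> and \<open>br_mult\<close> this identifies the
  relative Brauer group with the units of \<open>L\<close> modulo norms.\<close>

lemma br_eq_iff:
  assumes c: "c \<in> L" "c \<noteq> 0" and d: "d \<in> L" "d \<noteq> 0"
  shows "br c = br d \<longleftrightarrow> (\<exists>x\<in>E. x \<noteq> 0 \<and> d = c * (x * sg x))"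
proof
  assume "br c = br d"
  then obtain m where "typed (qalg c) m d" using br_qalg[OF c] by (auto simp: br_def)
  then show "\<exists>x\<in>E. x \<noteq> 0 \<and> d = c * (x * sg x)" using typed_norm[OF qalg_typed[OF c]] by blast
next
  assume "\<exists>x\<in>E. x \<noteq> 0 \<and> d = c * (x * sg x)"
  then obtain x where "x \<in> E" "x \<noteq> 0" "d = c * (x * sg x)" by blast
  then have "typed (qalg c) 2 d" using typed_scale[OF qalg_typed[OF c]] by blast
  then show "br c = br d" using brauer_class_typed[OF qalg_typed[OF c]] brauer_class_typed by blast
qed

lemma br_mult:
  assumes c: "c \<in> L" "c \<noteq> 0" and d: "d \<in> L" "d \<noteq> 0"
  shows "br c \<otimes>\<^bsub>Br L E\<^esub> br d = br (c * d)"
proof -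
  have "brauer_class L (tensor_alg (fld L) A B) = br (c * d)" if "A \<in> br c" "B \<in> br d" for A B
    using that typed_tensor brauer_class_typed by (auto simp: br_def) blast+
  then have "(\<Union>A\<in>br c. \<Union>B\<in>br d. brauer_class L (tensor_alg (fld L) A B)) = (\<Union>A\<in>br c. \<Union>B\<in>br d. br (c * d))"
    by (intro SUP_cong refl)
  then show ?thesis using br_qalg[OF c] br_qalg[OF d] by (auto simp: Br_def)
qed

end

section \<open>First cohomology\<close>

text \<open>Two groups parametrised by the same set, with the same fibres and a common product on
  parameters, are isomorphic. In the application the parameters are elements of L^*, or pairs of
  them, and both fibres are norm classes.\<close>

lemma iso_of_surjections:
  assumes p: "p ` S = carrier G" and q: "q ` S = carrier H"
    and eq: "\<And>s t. \<lbrakk>s \<in> S; t \<in> S\<rbrakk> \<Longrightarrow> p s = p t \<longleftrightarrow> q s = q t"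
    and m: "\<And>s t. \<lbrakk>s \<in> S; t \<in> S\<rbrakk> \<Longrightarrow> m s t \<in> S \<and> p (m s t) = p s \<otimes>\<^bsub>G\<^esub> p t \<and> q (m s t) = q s \<otimes>\<^bsub>H\<^esub> q t"
  shows "G \<cong> H"
proof -
  define h where "h x = q (SOME s. s \<in> S \<and> p s = x)" for x
  have hp: "h (p s) = q s" if "s \<in> S" for s
  proof -
    have "(SOME t. t \<in> S \<and> p t = p s) \<in> S \<and> p (SOME t. t \<in> S \<and> p t = p s) = p s"
      by (rule someI[of _ s]) (use that in simp)
    then show ?thesis unfolding h_def using eq that by blast
  qed
  have ex: "\<exists>s\<in>S. x = p s" if "x \<in> carrier G" for x using p that by auto
  have "h \<in> hom G H"
  proof (rule homI)
    fix x y assume "x \<in> carrier G" "y \<in> carrier G"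
    then obtain s t where "s \<in> S" "t \<in> S" "x = p s" "y = p t" using ex by meson
    then show "h (x \<otimes>\<^bsub>G\<^esub> y) = h x \<otimes>\<^bsub>H\<^esub> h y" using m[of s t] hp by metis
  qed (use ex hp q in force)
  moreover have "bij_betw h (carrier G) (carrier H)"
    unfolding bij_betw_def inj_on_def
  proof (intro conjI ballI impI)
    fix x y assume "x \<in> carrier G" "y \<in> carrier G" "h x = h y"
    then show "x = y" using ex eq hp by metis
  next
    show "h ` carrier G = carrier H" unfolding p[symmetric] q[symmetric] using hp by (force simp: image_iff)
  qed
  ultimately show ?thesis unfolding is_iso_def iso_def by blast
qed

section \<open>Cohomology classes as cosets of coboundaries\<close>

locale group_module = M: comm_group M for G :: "('g, 'x) monoid_scheme" and M :: "('m, 'y) monoid_scheme" +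
  fixes act :: "'g \<Rightarrow> 'm \<Rightarrow> 'm"
  assumes act_closed: "\<lbrakk>g \<in> carrier G; x \<in> carrier M\<rbrakk> \<Longrightarrow> act g x \<in> carrier M"
    and act_mult: "\<lbrakk>g \<in> carrier G; x \<in> carrier M; y \<in> carrier M\<rbrakk> \<Longrightarrow> act g (x \<otimes>\<^bsub>M\<^esub> y) = act g x \<otimes>\<^bsub>M\<^esub> act g y"
begin

definition "cob m = (\<lambda>g\<in>carrier G. act g m \<otimes>\<^bsub>M\<^esub> inv\<^bsub>M\<^esub> m)"
definition "pmul f f' = (\<lambda>g\<in>carrier G. f g \<otimes>\<^bsub>M\<^esub> f' g)"
definition "coset f = {pmul (cob m) f | m. m \<in> carrier M}"

text \<open>All cochains, not just cocycles: the calculus of cosets modulo coboundaries takes place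
  among arbitrary functions.\<close>

abbreviation "Z1 \<equiv> carrier G \<rightarrow>\<^sub>E carrier M"

lemma cob_Z1: "m \<in> carrier M \<Longrightarrow> cob m \<in> Z1" by (auto simp: cob_def act_closed)
lemma pmul_Z1: "\<lbrakk>f \<in> Z1; f' \<in> Z1\<rbrakk> \<Longrightarrow> pmul f f' \<in> Z1" by (auto simp: pmul_def PiE_def Pi_def)

lemma act_one: "g \<in> carrier G \<Longrightarrow> act g \<one>\<^bsub>M\<^esub> = \<one>\<^bsub>M\<^esub>"
  using act_mult[of g "\<one>\<^bsub>M\<^esub>" "\<one>\<^bsub>M\<^esub>"] act_closed[of g "\<one>\<^bsub>M\<^esub>"] by (simp add: M.l_cancel_one')

lemma cob_mult: "\<lbrakk>m \<in> carrier M; m' \<in> carrier M\<rbrakk> \<Longrightarrow> pmul (cob m) (cob m') = cob (m \<otimes>\<^bsub>M\<^esub> m')"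
  by (auto simp: pmul_def cob_def act_mult act_closed M.inv_mult M.m_ac intro!: restrict_ext)

lemma pmul_assoc: "\<lbrakk>f \<in> Z1; f' \<in> Z1; f'' \<in> Z1\<rbrakk> \<Longrightarrow> pmul (pmul f f') f'' = pmul f (pmul f' f'')"
  by (auto simp: pmul_def M.m_assoc PiE_def Pi_def intro!: restrict_ext)
lemma pmul_comm: "\<lbrakk>f \<in> Z1; f' \<in> Z1\<rbrakk> \<Longrightarrow> pmul f f' = pmul f' f"
  by (auto simp: pmul_def M.m_comm PiE_def Pi_def intro!: restrict_ext)

lemma pmul_cob_one: "f \<in> Z1 \<Longrightarrow> pmul (cob \<one>\<^bsub>M\<^esub>) f = f"
  by (rule ext) (auto simp: pmul_def cob_def act_one PiE_def Pi_def extensional_def)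

lemma coboundaries_eq: "coboundaries1 G M act = {cob m | m. m \<in> carrier M}"
  by (simp add: coboundaries1_def cob_def)

lemma H1_carrier: "carrier (H1 G M act) = coset ` cocycles1 G M act"
proof -
  have "coboundaries1 G M act #>\<^bsub>(product_group (carrier G) (\<lambda>_. M))\<lparr>carrier := Z\<rparr>\<^esub> f = coset f" for Z f
    unfolding coboundaries_eq r_coset_def coset_def pmul_def product_group_def by auto
  then show ?thesis unfolding H1_def FactGroup_def RCOSETS_def by auto
qed

lemma H1_mult:
  assumes f: "f \<in> Z1" and f': "f' \<in> Z1"
  shows "coset f \<otimes>\<^bsub>H1 G M act\<^esub> coset f' = coset (pmul f f')"
proof -
  have "coset f \<otimes>\<^bsub>H1 G M act\<^esub> coset f' = {pmul u v | u v. u \<in> coset f \<and> v \<in> coset f'}"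
    unfolding H1_def FactGroup_def set_mult_def by (auto simp: product_group_def pmul_def)
  also have "\<dots> = coset (pmul f f')"
  proof
    show "{pmul u v | u v. u \<in> coset f \<and> v \<in> coset f'} \<subseteq> coset (pmul f f')"
    proof
      fix w assume "w \<in> {pmul u v | u v. u \<in> coset f \<and> v \<in> coset f'}"
      then obtain m m' where m: "m \<in> carrier M" "m' \<in> carrier M" "w = pmul (pmul (cob m) f) (pmul (cob m') f')"
        by (auto simp: coset_def)
      note z = cob_Z1[OF m(1)] cob_Z1[OF m(2)]
      have "w = pmul (cob m) (pmul f (pmul (cob m') f'))" unfolding m(3) by (rule pmul_assoc[OF z(1) f pmul_Z1[OF z(2) f']])
      also have "pmul f (pmul (cob m') f') = pmul (cob m') (pmul f f')"
        unfolding pmul_assoc[OF f z(2) f', symmetric] pmul_comm[OF f z(2)] by (rule pmul_assoc[OF z(2) f f'])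
      also have "pmul (cob m) (pmul (cob m') (pmul f f')) = pmul (cob (m \<otimes>\<^bsub>M\<^esub> m')) (pmul f f')"
        unfolding cob_mult[OF m(1,2), symmetric] by (rule pmul_assoc[OF z pmul_Z1[OF f f'], symmetric])
      finally show "w \<in> coset (pmul f f')" unfolding coset_def using m by blast
    qed
    show "coset (pmul f f') \<subseteq> {pmul u v | u v. u \<in> coset f \<and> v \<in> coset f'}"
    proof
      fix w assume "w \<in> coset (pmul f f')"
      then obtain m where m: "m \<in> carrier M" "w = pmul (cob m) (pmul f f')" by (auto simp: coset_def)
      have "w = pmul (pmul (cob m) f) f'" unfolding m(2) by (rule pmul_assoc[OF cob_Z1[OF m(1)] f f', symmetric])
      moreover have "f' \<in> coset f'" unfolding coset_def using pmul_cob_one[OF f'] M.one_closed by force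
      moreover have "pmul (cob m) f \<in> coset f" unfolding coset_def using m by blast
      ultimately show "w \<in> {pmul u v | u v. u \<in> coset f \<and> v \<in> coset f'}" by blast
    qed
  qed
  finally show ?thesis .
qed

lemma coset_eq_iff:
  assumes f: "f \<in> Z1" and f': "f' \<in> Z1"
  shows "coset f = coset f' \<longleftrightarrow> (\<exists>m\<in>carrier M. f' = pmul (cob m) f)"
proof
  assume "coset f = coset f'"
  moreover have "f' \<in> coset f'" unfolding coset_def using pmul_cob_one[OF f'] M.one_closed by force
  ultimately show "\<exists>m\<in>carrier M. f' = pmul (cob m) f" by (auto simp: coset_def)
next
  assume "\<exists>m\<in>carrier M. f' = pmul (cob m) f"
  then obtain m where m: "m \<in> carrier M" "f' = pmul (cob m) f" by blast
  have 1: "pmul (cob n) f' = pmul (cob (n \<otimes>\<^bsub>M\<^esub> m)) f" if "n \<in> carrier M" for n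
    unfolding m(2) cob_mult[OF that m(1), symmetric] by (rule pmul_assoc[OF cob_Z1[OF that] cob_Z1[OF m(1)] f, symmetric])
  have 2: "pmul (cob n) f = pmul (cob (n \<otimes>\<^bsub>M\<^esub> inv\<^bsub>M\<^esub> m)) f'" if "n \<in> carrier M" for n
    using 1[of "n \<otimes>\<^bsub>M\<^esub> inv\<^bsub>M\<^esub> m"] that m by (simp add: M.m_assoc)
  show "coset f = coset f'"
  proof
    show "coset f \<subseteq> coset f'"
    proof
      fix w assume "w \<in> coset f"
      then obtain n where n: "n \<in> carrier M" "w = pmul (cob n) f" by (auto simp: coset_def)
      then have "w = pmul (cob (n \<otimes>\<^bsub>M\<^esub> inv\<^bsub>M\<^esub> m)) f'" "n \<otimes>\<^bsub>M\<^esub> inv\<^bsub>M\<^esub> m \<in> carrier M" using 2 m(1) by auto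
      then show "w \<in> coset f'" unfolding coset_def by blast
    qed
    show "coset f' \<subseteq> coset f"
    proof
      fix w assume "w \<in> coset f'"
      then obtain n where n: "n \<in> carrier M" "w = pmul (cob n) f'" by (auto simp: coset_def)
      then have "w = pmul (cob (n \<otimes>\<^bsub>M\<^esub> m)) f" "n \<otimes>\<^bsub>M\<^esub> m \<in> carrier M" using 1 m(1) by auto
      then show "w \<in> coset f" unfolding coset_def by blast
    qed
  qed
qed

text \<open>\<open>p\<close> is a family of cocycles meeting every cohomology class and compatible
  with products; \<open>q\<close> records in the target when two members are cohomologous.\<close>

theorem H1_iso:
  assumes p: "\<And>s. s \<in> S \<Longrightarrow> p s \<in> cocycles1 G M act" and q: "q ` S = carrier Y"
    and all: "\<And>f. f \<in> cocycles1 G M act \<Longrightarrow> \<exists>s\<in>S. \<exists>m\<in>carrier M. f = pmul (cob m) (p s)"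
    and eq: "\<And>s t. \<lbrakk>s \<in> S; t \<in> S\<rbrakk> \<Longrightarrow> (\<exists>m\<in>carrier M. p t = pmul (cob m) (p s)) \<longleftrightarrow> q s = q t"
    and mu: "\<And>s t. \<lbrakk>s \<in> S; t \<in> S\<rbrakk> \<Longrightarrow> mu s t \<in> S \<and> p (mu s t) = pmul (p s) (p t) \<and> q (mu s t) = q s \<otimes>\<^bsub>Y\<^esub> q t"
  shows "H1 G M act \<cong> Y"
proof (rule iso_of_surjections[of "\<lambda>s. coset (p s)" S _ q _ mu])
  have Z: "f \<in> Z1" if "f \<in> cocycles1 G M act" for f using that by (simp add: cocycles1_def)
  note pZ = Z[OF p]
  show "(\<lambda>s. coset (p s)) ` S = carrier (H1 G M act)"
  proof
    show "(\<lambda>s. coset (p s)) ` S \<subseteq> carrier (H1 G M act)" using p by (auto simp: H1_carrier)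
    show "carrier (H1 G M act) \<subseteq> (\<lambda>s. coset (p s)) ` S"
    proof
      fix c assume "c \<in> carrier (H1 G M act)"
      then obtain f where f: "f \<in> cocycles1 G M act" "c = coset f" by (auto simp: H1_carrier)
      obtain s m where "s \<in> S" "m \<in> carrier M" "f = pmul (cob m) (p s)" using all[OF f(1)] by blast
      then have "c = coset (p s)" using coset_eq_iff[OF pZ Z[OF f(1)]] f(2) by blast
      then show "c \<in> (\<lambda>s. coset (p s)) ` S" using \<open>s \<in> S\<close> by blast
    qed
  qed
  show "q ` S = carrier Y" by (rule q)
  show "coset (p s) = coset (p t) \<longleftrightarrow> q s = q t" if "s \<in> S" "t \<in> S" for s t
    using coset_eq_iff[OF pZ pZ] eq that by blast
  show "mu s t \<in> S \<and> coset (p (mu s t)) = coset (p s) \<otimes>\<^bsub>H1 G M act\<^esub> coset (p t) \<and> q (mu s t) = q s \<otimes>\<^bsub>Y\<^esub> q t"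
    if "s \<in> S" "t \<in> S" for s t
    using mu[OF that] H1_mult[OF pZ pZ] that by simp
qed

theorem H1_trivial:
  assumes "\<And>f. f \<in> cocycles1 G M act \<Longrightarrow> \<exists>m\<in>carrier M. f = cob m" and "cob \<one>\<^bsub>M\<^esub> \<in> cocycles1 G M act"
  shows "trivial_group (H1 G M act)"
proof -
  let ?H = "H1 G M act" and ?c = "coset (cob \<one>\<^bsub>M\<^esub>)"
  have z: "cob \<one>\<^bsub>M\<^esub> \<in> Z1" by (rule cob_Z1) simp
  have c: "?c = coset f" if f: "f \<in> cocycles1 G M act" for f
  proof -
    obtain m where m: "m \<in> carrier M" "f = cob m" using assms(1)[OF f] by blast
    have "f = pmul (cob m) (cob \<one>\<^bsub>M\<^esub>)" using cob_mult[of m "\<one>\<^bsub>M\<^esub>"] m by simp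
    moreover have fZ: "f \<in> Z1" unfolding m(2) by (rule cob_Z1[OF m(1)])
    ultimately show ?thesis unfolding coset_eq_iff[OF z fZ] using m(1) by (intro bexI)
  qed
  have carr: "carrier ?H = {?c}" proof -
    define k where "k = ?c"
    have "\<forall>f\<in>cocycles1 G M act. coset f = k" using c by (simp add: k_def)
    then show ?thesis unfolding H1_carrier k_def[symmetric] using assms(2) by auto
  qed
  have one: "\<one>\<^bsub>?H\<^esub> = ?c"
  proof -
    have "\<one>\<^bsub>?H\<^esub> = {cob m | m. m \<in> carrier M}" by (simp add: H1_def FactGroup_def coboundaries1_def cob_def)
    also have "\<dots> = ?c" unfolding coset_def using cob_mult[of _ "\<one>\<^bsub>M\<^esub>"] by force
    finally show ?thesis .
  qed
  have mult: "?c \<otimes>\<^bsub>?H\<^esub> ?c = ?c" unfolding H1_mult[OF z z] by (simp add: pmul_cob_one[OF z])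
  have "Group.group ?H" by (rule groupI) (auto simp: carr one mult)
  then show ?thesis by (simp add: trivial_group_def carr one)
qed

end

section \<open>The torus as a module\<close>

definition unit_pairs :: "('a::field \<times> 'a) monoid" where
  "unit_pairs = units_of (fld (UNIV :: 'a set)) \<times>\<times> units_of (fld (UNIV :: 'a set))"

lemma units_fld: "Units (fld (UNIV :: 'a::field set)) = {x. x \<noteq> 0}"
proof -
  have "x \<in> Units (fld (UNIV :: 'a set)) \<longleftrightarrow> x \<noteq> 0" for x
  proof
    assume "x \<noteq> 0"
    then show "x \<in> Units (fld (UNIV :: 'a set))"
      unfolding Units_def by (auto simp: fld_def intro!: exI[of _ "inverse x"])
  qed (auto simp: Units_def fld_def)
  then show ?thesis by auto
qed

lemma monoid_fld: "Group.comm_monoid (fld (UNIV :: 'a::field set))"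
  by (rule comm_monoidI) (auto simp: fld_def algebra_simps)

lemma units_of_fld: "carrier (units_of (fld (UNIV :: 'a::field set))) = {x. x \<noteq> 0}"
  "monoid.mult (units_of (fld (UNIV :: 'a::field set))) = (*)" "one (units_of (fld (UNIV :: 'a::field set))) = 1"
  by (simp_all add: units_of_carrier units_fld units_of_mult units_of_one) (simp_all add: fld_def)

lemma comm_group_units_fld: "comm_group (units_of (fld (UNIV :: 'a::field set)))"
  by (rule comm_monoid.units_comm_group[OF monoid_fld])

lemma unit_pairs_simps:
  "carrier unit_pairs = {(x, y). x \<noteq> 0 \<and> y \<noteq> (0::'a::field)}"
  "(x, y) \<otimes>\<^bsub>unit_pairs\<^esub> (x', y') = (x * x', y * (y' :: 'a))" "\<one>\<^bsub>unit_pairs\<^esub> = (1, 1 :: 'a)"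
  by (auto simp: unit_pairs_def units_of_fld)

lemma comm_group_unit_pairs: "comm_group (unit_pairs :: ('a::field \<times> 'a) monoid)"
proof -
  have "Group.group (unit_pairs :: ('a \<times> 'a) monoid)"
    unfolding unit_pairs_def using comm_group_units_fld comm_group.axioms(2) by (intro DirProd_group) auto
  then show ?thesis
    by (rule group.group_comm_groupI) (auto simp: unit_pairs_simps mult.commute)
qed

lemma unit_pairs_inv: "\<lbrakk>x \<noteq> 0; y \<noteq> 0\<rbrakk> \<Longrightarrow> inv\<^bsub>unit_pairs\<^esub> (x, y) = (inverse x, inverse (y :: 'a::field))"
  by (rule group.inv_equality[OF comm_group.axioms(2)[OF comm_group_unit_pairs]]) (auto simp: unit_pairs_simps)

abbreviation "latt \<equiv> add_monoid (module_vec TYPE(int) 2)"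

lemma latt_simps: "carrier latt = carrier_vec 2" "monoid.mult latt = (+)"
  "carrier (module_vec TYPE(int) 2) = carrier_vec 2" "ring.add (module_vec TYPE(int) 2) = (+)"
  by (simp_all add: module_vec_def)

lemma vec2_carrier: "vec2 a b \<in> carrier_vec 2" by (simp add: vec2_def)
lemma vec2_add: "vec2 a b + vec2 a' b' = vec2 (a + a') (b + b')" by (rule eq_vecI) (auto simp: vec2_def)
lemma vec2_eta: "n \<in> carrier_vec 2 \<Longrightarrow> n = vec2 (n $ 0) (n $ 1)"
  by (rule eq_vecI) (auto simp: vec2_def less_2_cases_iff)

text \<open>Every element of the torus is e_0 tensor x plus e_1 tensor y. Since e_j tensor x goes to
  M e_j tensor g(x), entry (i, j) of \<open>M\<close> becomes the exponent of the
  \<open>j\<close>-th coordinate in the \<open>i\<close>-th.\<close>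

definition pair_act :: "int mat \<Rightarrow> ('a::field \<Rightarrow> 'a) \<Rightarrow> 'a \<times> 'a \<Rightarrow> 'a \<times> 'a" where
  "pair_act M g = (\<lambda>(x, y). (g x powi (M $$ (0, 0)) * g y powi (M $$ (0, 1)), g x powi (M $$ (1, 0)) * g y powi (M $$ (1, 1))))"

text \<open>The parameter is a type token; it fixes the field to which the constants below
  refer.\<close>

locale torus_facts =
  fixes K :: "'a::field itself"
begin

abbreviation kunits :: "'a monoid" where "kunits \<equiv> units_of (fld UNIV)"
abbreviation "TS \<equiv> carrier latt \<times> carrier kunits"
abbreviation "TFG \<equiv> free_Abelian_group TS"
abbreviation "TN \<equiv> tensor_group_rels latt kunits"

lemma TS_iff: "(n, l) \<in> TS \<longleftrightarrow> n \<in> carrier_vec 2 \<and> l \<noteq> 0"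
  by (simp add: latt_simps units_of_fld)

lemma TFG_add: "\<lbrakk>x \<in> carrier TFG; y \<in> carrier TFG\<rbrakk> \<Longrightarrow> x + y \<in> carrier TFG"
  using keys_add[of x y] by fastforce
lemma TFG_diff: "\<lbrakk>x \<in> carrier TFG; y \<in> carrier TFG\<rbrakk> \<Longrightarrow> x - y \<in> carrier TFG"
  using keys_diff[of x y] by fastforce
lemma TFG_of: "frag_of (n, l) \<in> carrier TFG \<longleftrightarrow> n \<in> carrier_vec 2 \<and> l \<noteq> 0"
  unfolding frag_of_in_free_Abelian_group by (rule TS_iff)

lemma TFG_ofI: "\<lbrakk>n \<in> carrier_vec 2; l \<noteq> 0\<rbrakk> \<Longrightarrow> frag_of (n, l) \<in> carrier TFG"
  using TFG_of[of n l] by blast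

lemma relsE:
  assumes "r \<in> bilinear_rels latt kunits"
  obtains n n' l where "n \<in> carrier_vec 2" "n' \<in> carrier_vec 2" "l \<noteq> 0" "r = frag_of (n + n', l) - (frag_of (n, l) + frag_of (n', l))"
  | n l l' where "n \<in> carrier_vec 2" "l \<noteq> 0" "l' \<noteq> 0" "r = frag_of (n, l * l') - (frag_of (n, l) + frag_of (n, l'))"
  using assms unfolding bilinear_rels_def by (auto simp: latt_simps units_of_fld)

lemma rels_left: "\<lbrakk>n \<in> carrier latt; n' \<in> carrier latt; l \<in> carrier kunits\<rbrakk>
    \<Longrightarrow> frag_of (n \<otimes>\<^bsub>latt\<^esub> n', l) - (frag_of (n, l) + frag_of (n', l)) \<in> bilinear_rels latt kunits"
  unfolding bilinear_rels_def by blast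
lemma rels_right: "\<lbrakk>n \<in> carrier latt; l \<in> carrier kunits; l' \<in> carrier kunits\<rbrakk>
    \<Longrightarrow> frag_of (n, l \<otimes>\<^bsub>kunits\<^esub> l') - (frag_of (n, l) + frag_of (n, l')) \<in> bilinear_rels latt kunits"
  unfolding bilinear_rels_def by blast

lemma rels_TFG: "bilinear_rels latt kunits \<subseteq> carrier TFG"
proof
  fix r assume "r \<in> bilinear_rels latt kunits"
  then show "r \<in> carrier TFG"
  proof (cases rule: relsE)
    case (1 n n' l)
    then show ?thesis using TFG_diff[OF TFG_ofI TFG_add[OF TFG_ofI TFG_ofI], of "n + n'" l n l n' l] by simp
  next
    case (2 n l l')
    then show ?thesis using TFG_diff[OF TFG_ofI TFG_add[OF TFG_ofI TFG_ofI], of n "l * l'" n l n l'] by simp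
  qed
qed

lemma TN_eq: "TN = generate TFG (bilinear_rels latt kunits)"
  by (simp add: tensor_group_rels_def)
lemma TN_zero: "0 \<in> TN" unfolding TN_eq by (rule generate_free_zero[OF rels_TFG])
lemma TN_add: "\<lbrakk>x \<in> TN; y \<in> TN\<rbrakk> \<Longrightarrow> x + y \<in> TN" unfolding TN_eq by (rule generate_free_add[OF rels_TFG])
lemma TN_minus: "x \<in> TN \<Longrightarrow> - x \<in> TN" unfolding TN_eq by (rule generate_free_minus[OF rels_TFG])
lemma TN_diff: "\<lbrakk>x \<in> TN; y \<in> TN\<rbrakk> \<Longrightarrow> x - y \<in> TN" unfolding TN_eq by (rule generate_free_diff[OF rels_TFG])
lemma TN_TFG: "TN \<subseteq> carrier TFG" unfolding TN_eq by (rule generate_free_carrier[OF rels_TFG])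
lemma TN_incl: "x \<in> bilinear_rels latt kunits \<Longrightarrow> x \<in> TN" using generate_free_incl[OF rels_TFG] TN_eq by auto

lemma TN_addl: "\<lbrakk>n \<in> carrier_vec 2; n' \<in> carrier_vec 2; l \<noteq> 0\<rbrakk> \<Longrightarrow> frag_of (n + n', l) - (frag_of (n, l) + frag_of (n', l)) \<in> TN"
  using TN_incl[OF rels_left[of n n' l]] by (simp add: latt_simps units_of_fld)
lemma TN_addr: "\<lbrakk>n \<in> carrier_vec 2; l \<noteq> 0; l' \<noteq> 0\<rbrakk> \<Longrightarrow> frag_of (n, l * l') - (frag_of (n, l) + frag_of (n, l')) \<in> TN"
  using TN_incl[OF rels_right[of n l l']] by (simp add: latt_simps units_of_fld)

lemma TN_one: "n \<in> carrier_vec 2 \<Longrightarrow> frag_of (n, 1) \<in> TN"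
  using TN_minus[OF TN_addr[of n 1 1]] by simp

text \<open>Modulo the relations, multiples of a lattice vector become powers of the unit. One step
  of \<open>z\<close> changes the difference \<open>D z\<close> by a relation, so the induction runs
  in both directions from 0.\<close>

lemma TN_powi:
  assumes v: "\<And>a b. v (a + b) = v a + v b" "\<And>a. v a \<in> carrier_vec 2" and l: "l \<noteq> 0"
  shows "frag_of (v z, l) - frag_of (v 1, l powi z) \<in> TN"
proof -
  define D where "D z = frag_of (v z, l) - frag_of (v 1, l powi z)" for z
  have step: "D (z + 1) - D z \<in> TN" for z
  proof -
    have "frag_of (v z + v 1, l) - (frag_of (v z, l) + frag_of (v 1, l)) - (frag_of (v 1, l powi z * l) - (frag_of (v 1, l powi z) + frag_of (v 1, l))) \<in> TN"
      using v l by (intro TN_diff TN_addl TN_addr) auto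
    moreover have e: "v (z + 1) = v z + v 1" "l powi (z + 1) = l powi z * l"
      using l by (simp_all add: v(1) power_int_add)
    have "D (z + 1) - D z = frag_of (v z + v 1, l) - (frag_of (v z, l) + frag_of (v 1, l)) - (frag_of (v 1, l powi z * l) - (frag_of (v 1, l powi z) + frag_of (v 1, l)))"
      unfolding D_def e by simp
    ultimately show ?thesis by simp
  qed
  have iff: "D (z + 1) \<in> TN \<longleftrightarrow> D z \<in> TN" for z
    using TN_add[OF step[of z], of "D z"] TN_diff[OF _ step[of z], of "D (z + 1)"] by auto
  have v0: "v 0 + v 0 = v 0" using v(1)[of 0 0] by simp
  have "frag_of (v 0, l) \<in> TN" using TN_minus[OF TN_addl[OF v(2) v(2) l, of 0 0]] by (simp add: v0)
  then have "D 0 \<in> TN" using TN_one[OF v(2)] by (simp add: D_def TN_diff)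
  then have "D z \<in> TN"
  proof (induction z rule: int_induct[where k = 0])
    case (step1 i)
    then show ?case using iff by simp
  next
    case (step2 i)
    then show ?case using iff[of "i - 1"] by simp
  qed
  then show ?thesis by (simp add: D_def)
qed

abbreviation "e0 \<equiv> vec2 1 0 :: int vec"
abbreviation "e1 \<equiv> vec2 0 1 :: int vec"

lemma free_TFG_induct:
  assumes "x \<in> carrier TFG" "Q 0" "\<And>x y. \<lbrakk>x \<in> carrier TFG; y \<in> carrier TFG; Q x; Q y\<rbrakk> \<Longrightarrow> Q (x - y)"
    "\<And>n l. \<lbrakk>n \<in> carrier_vec 2; l \<noteq> 0\<rbrakk> \<Longrightarrow> Q (frag_of (n, l))"
  shows "Q x"
proof -
  have "Poly_Mapping.keys x \<subseteq> TS" using assms(1) by simp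
  then show ?thesis
  proof (induction rule: free_Abelian_group_induct[consumes 1, case_names zero diff of])
    case (diff x y)
    then show ?case using assms(3) by simp
  next
    case (of p)
    then show ?case using assms(4) TS_iff by (cases p) auto
  qed (rule assms(2))
qed

text \<open>A normal form modulo the relations. As \<open>T\<Phi>\<close> reads the two units off
  it, an element of the kernel has both equal to 1 and hence is a consequence of the
  relations.\<close>

lemma T_represent:
  assumes "x \<in> carrier TFG" shows "\<exists>l m. l \<noteq> 0 \<and> m \<noteq> 0 \<and> x - (frag_of (e0, l) + frag_of (e1, m)) \<in> TN"
  using assms
proof (rule free_TFG_induct)
  have "0 - (frag_of (e0, 1) + frag_of (e1, 1)) \<in> TN"
    by (intro TN_diff TN_zero TN_add TN_one vec2_carrier)
  then show "\<exists>l m. l \<noteq> 0 \<and> m \<noteq> 0 \<and> 0 - (frag_of (e0, l) + frag_of (e1, m)) \<in> TN"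
    by (intro exI[of _ 1]) auto
next
  fix x y
  assume "\<exists>l m. l \<noteq> 0 \<and> m \<noteq> 0 \<and> x - (frag_of (e0, l) + frag_of (e1, m)) \<in> TN"
    "\<exists>l m. l \<noteq> 0 \<and> m \<noteq> 0 \<and> y - (frag_of (e0, l) + frag_of (e1, m)) \<in> TN"
  then obtain l m l' m' where x: "l \<noteq> 0" "m \<noteq> 0" "x - (frag_of (e0, l) + frag_of (e1, m)) \<in> TN"
    and y: "l' \<noteq> 0" "m' \<noteq> 0" "y - (frag_of (e0, l') + frag_of (e1, m')) \<in> TN" by blast
  have q: "frag_of (n, a) - (frag_of (n, a / b) + frag_of (n, b)) \<in> TN" if "n \<in> carrier_vec 2" "a \<noteq> 0" "b \<noteq> 0" for n a b
    using TN_addr[OF that(1), of "a / b" b] that by simp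
  have "x - y - (frag_of (e0, l / l') + frag_of (e1, m / m')) =
     (x - (frag_of (e0, l) + frag_of (e1, m))) - (y - (frag_of (e0, l') + frag_of (e1, m')))
     + (frag_of (e0, l) - (frag_of (e0, l / l') + frag_of (e0, l'))) + (frag_of (e1, m) - (frag_of (e1, m / m') + frag_of (e1, m')))"
    by (simp add: algebra_simps)
  also have "\<dots> \<in> TN" using x y by (intro TN_add TN_diff[OF x(3) y(3)] q vec2_carrier)
  finally show "\<exists>l m. l \<noteq> 0 \<and> m \<noteq> 0 \<and> x - y - (frag_of (e0, l) + frag_of (e1, m)) \<in> TN"
    using x y by (intro exI[of _ "l / l'"] exI[of _ "m / m'"]) auto
next
  fix n :: "int vec" and l :: 'a assume n: "n \<in> carrier_vec 2" and l: "l \<noteq> 0"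
  have s: "vec2 (n $ 0) 0 + vec2 0 (n $ 1) = n" using vec2_eta[OF n] by (simp add: vec2_add)
  have 1: "frag_of (n, l) - (frag_of (vec2 (n $ 0) 0, l) + frag_of (vec2 0 (n $ 1), l)) \<in> TN"
    using TN_addl[OF vec2_carrier vec2_carrier l, of "n $ 0" 0 0 "n $ 1"] unfolding s .
  have 2: "frag_of (vec2 (n $ 0) 0, l) - frag_of (e0, l powi (n $ 0)) \<in> TN"
    by (rule TN_powi[of "\<lambda>z. vec2 z 0"]) (auto simp: vec2_add vec2_carrier l)
  have 3: "frag_of (vec2 0 (n $ 1), l) - frag_of (e1, l powi (n $ 1)) \<in> TN"
    by (rule TN_powi[of "\<lambda>z. vec2 0 z"]) (auto simp: vec2_add vec2_carrier l)
  have "frag_of (n, l) - (frag_of (e0, l powi (n $ 0)) + frag_of (e1, l powi (n $ 1))) \<in> TN"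
    using TN_add[OF TN_add[OF 1 2] 3] by (simp add: algebra_simps)
  then show "\<exists>a b. a \<noteq> 0 \<and> b \<noteq> 0 \<and> frag_of (n, l) - (frag_of (e0, a) + frag_of (e1, b)) \<in> TN"
    using l by (intro exI[of _ "l powi (n $ 0)"] exI[of _ "l powi (n $ 1)"]) auto
qed

definition "T\<Phi> = (SOME h. h \<in> hom TFG (unit_pairs :: ('a \<times> 'a) monoid) \<and>
   (\<forall>n\<in>carrier_vec 2. \<forall>l. l \<noteq> 0 \<longrightarrow> h (frag_of (n, l)) = (l powi (n $ 0), l powi (n $ 1))))"

lemma T\<Phi>_hom: "T\<Phi> \<in> hom TFG unit_pairs"
  and T\<Phi>_of: "\<lbrakk>n \<in> carrier_vec 2; l \<noteq> 0\<rbrakk> \<Longrightarrow> T\<Phi> (frag_of (n, l)) = (l powi (n $ 0), l powi (n $ 1))"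
proof -
  have im: "(\<lambda>(n, l). (l powi (n $ 0), l powi (n $ 1))) ` TS \<subseteq> carrier (unit_pairs :: ('a \<times> 'a) monoid)"
    by (auto simp: unit_pairs_simps latt_simps units_of_fld)
  obtain h where "h \<in> hom TFG (unit_pairs :: ('a \<times> 'a) monoid)"
    "\<And>x. x \<in> TS \<Longrightarrow> h (frag_of x) = (\<lambda>(n, l). (l powi (n $ 0), l powi (n $ 1))) x"
    using comm_group.free_Abelian_group_universal[OF comm_group_unit_pairs im] by blast
  then have "\<exists>h. h \<in> hom TFG (unit_pairs :: ('a \<times> 'a) monoid) \<and>
     (\<forall>n\<in>carrier_vec 2. \<forall>l. l \<noteq> 0 \<longrightarrow> h (frag_of (n, l)) = (l powi (n $ 0), l powi (n $ 1)))"
    using TS_iff by (intro exI[of _ h]) auto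
  from someI_ex[OF this] show "T\<Phi> \<in> hom TFG unit_pairs"
    "\<lbrakk>n \<in> carrier_vec 2; l \<noteq> 0\<rbrakk> \<Longrightarrow> T\<Phi> (frag_of (n, l)) = (l powi (n $ 0), l powi (n $ 1))"
    unfolding T\<Phi>_def by auto
qed

lemma T_group_hom: "group_hom TFG (unit_pairs :: ('a \<times> 'a) monoid) T\<Phi>"
  using T\<Phi>_hom comm_group.axioms(2)[OF comm_group_unit_pairs] by (simp add: group_hom_def group_hom_axioms_def)

lemma T\<Phi>_add: "\<lbrakk>x \<in> carrier TFG; y \<in> carrier TFG\<rbrakk> \<Longrightarrow> T\<Phi> (x + y) = T\<Phi> x \<otimes>\<^bsub>unit_pairs\<^esub> T\<Phi> y"
  using T\<Phi>_hom by (auto simp: hom_def)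
lemma T\<Phi>_closed: "x \<in> carrier TFG \<Longrightarrow> T\<Phi> x \<in> carrier unit_pairs"
  using T\<Phi>_hom by (auto simp: hom_def)
lemma T\<Phi>_minus: "x \<in> carrier TFG \<Longrightarrow> T\<Phi> (- x) = inv\<^bsub>unit_pairs\<^esub> T\<Phi> x"
  using group_hom.hom_inv[OF T_group_hom, of x] by simp
lemma T\<Phi>_diff: "\<lbrakk>x \<in> carrier TFG; y \<in> carrier TFG\<rbrakk> \<Longrightarrow> T\<Phi> (x - y) = T\<Phi> x \<otimes>\<^bsub>unit_pairs\<^esub> inv\<^bsub>unit_pairs\<^esub> T\<Phi> y"
  using T\<Phi>_add[of x "- y"] T\<Phi>_minus[of y] by simp

lemma T\<Phi>_rels: "r \<in> bilinear_rels latt kunits \<Longrightarrow> T\<Phi> r = \<one>\<^bsub>unit_pairs\<^esub>"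
proof -
  interpret U: comm_group "unit_pairs :: ('a \<times> 'a) monoid" by (rule comm_group_unit_pairs)
  have z: "u = v \<Longrightarrow> v \<in> carrier unit_pairs \<Longrightarrow> u \<otimes>\<^bsub>unit_pairs\<^esub> inv\<^bsub>unit_pairs\<^esub> v = \<one>\<^bsub>unit_pairs\<^esub>" for u v :: "'a \<times> 'a" by simp
  assume "r \<in> bilinear_rels latt kunits"
  then show ?thesis
  proof (cases rule: relsE)
    case (1 n n' l)
    then have f: "frag_of (n + n', l) \<in> carrier TFG" "frag_of (n, l) \<in> carrier TFG" "frag_of (n', l) \<in> carrier TFG"
      using TFG_ofI[of "n + n'" l] TFG_ofI[of n l] TFG_ofI[of n' l] by simp_all
    show ?thesis unfolding 1(4) T\<Phi>_diff[OF f(1) TFG_add[OF f(2,3)]]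
    proof (rule z)
      show "T\<Phi> (frag_of (n + n', l)) = T\<Phi> (frag_of (n, l) + frag_of (n', l))"
        using 1 by (simp add: T\<Phi>_add[OF f(2,3)] T\<Phi>_of unit_pairs_simps power_int_add)
      show "T\<Phi> (frag_of (n, l) + frag_of (n', l)) \<in> carrier unit_pairs" by (rule T\<Phi>_closed[OF TFG_add[OF f(2,3)]])
    qed
  next
    case (2 n l l')
    then have f: "frag_of (n, l * l') \<in> carrier TFG" "frag_of (n, l) \<in> carrier TFG" "frag_of (n, l') \<in> carrier TFG"
      using TFG_ofI[of n "l * l'"] TFG_ofI[of n l] TFG_ofI[of n l'] by simp_all
    show ?thesis unfolding 2(4) T\<Phi>_diff[OF f(1) TFG_add[OF f(2,3)]]
    proof (rule z)
      show "T\<Phi> (frag_of (n, l * l')) = T\<Phi> (frag_of (n, l) + frag_of (n, l'))"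
        using 2 by (simp add: T\<Phi>_add[OF f(2,3)] T\<Phi>_of unit_pairs_simps power_int_mult_distrib)
      show "T\<Phi> (frag_of (n, l) + frag_of (n, l')) \<in> carrier unit_pairs" by (rule T\<Phi>_closed[OF TFG_add[OF f(2,3)]])
    qed
  qed
qed

lemma T\<Phi>_TN: "x \<in> TN \<Longrightarrow> T\<Phi> x = \<one>\<^bsub>unit_pairs\<^esub>"
proof -
  assume x: "x \<in> TN"
  have "bilinear_rels latt kunits \<subseteq> kernel TFG unit_pairs T\<Phi>"
    using T\<Phi>_rels rels_TFG by (auto simp: kernel_def simp del: carrier_free_Abelian_group_iff)
  then have "generate TFG (bilinear_rels latt kunits) \<subseteq> kernel TFG unit_pairs T\<Phi>"
    using group.generate_subgroup_incl[OF group_free_Abelian_group] group_hom.subgroup_kernel[OF T_group_hom] by blast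
  then show ?thesis using x unfolding TN_eq kernel_def by auto
qed

lemma T\<Phi>_pair: "\<lbrakk>l \<noteq> 0; m \<noteq> 0\<rbrakk> \<Longrightarrow> T\<Phi> (frag_of (e0, l) + frag_of (e1, m)) = (l, m)"
  using T\<Phi>_add[OF TFG_of[THEN iffD2] TFG_of[THEN iffD2], of e0 l e1 m]
  by (simp add: T\<Phi>_of vec2_carrier unit_pairs_simps)

lemma pair_TFG: "\<lbrakk>l \<noteq> 0; m \<noteq> 0\<rbrakk> \<Longrightarrow> frag_of (e0, l) + frag_of (e1, m) \<in> carrier TFG"
  by (intro TFG_add TFG_of[THEN iffD2] conjI vec2_carrier)

lemma TN_kernel: "TN = {x \<in> carrier TFG. T\<Phi> x = \<one>\<^bsub>unit_pairs\<^esub>}"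
proof
  show "TN \<subseteq> {x \<in> carrier TFG. T\<Phi> x = \<one>\<^bsub>unit_pairs\<^esub>}" using T\<Phi>_TN TN_TFG by (auto simp del: carrier_free_Abelian_group_iff)
  show "{x \<in> carrier TFG. T\<Phi> x = \<one>\<^bsub>unit_pairs\<^esub>} \<subseteq> TN"
  proof
    fix x assume "x \<in> {x \<in> carrier TFG. T\<Phi> x = \<one>\<^bsub>unit_pairs\<^esub>}"
    then have x: "x \<in> carrier TFG" "T\<Phi> x = \<one>\<^bsub>unit_pairs\<^esub>" by auto
    interpret U: comm_group "unit_pairs :: ('a \<times> 'a) monoid" by (rule comm_group_unit_pairs)
    obtain l m where lm: "l \<noteq> 0" "m \<noteq> 0" "x - (frag_of (e0, l) + frag_of (e1, m)) \<in> TN" using T_represent[OF x(1)] by blast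
    have f: "frag_of (e0, l) + frag_of (e1, m) \<in> carrier TFG" by (rule pair_TFG[OF lm(1,2)])
    have "T\<Phi> (frag_of (e0, l) + frag_of (e1, m)) \<in> carrier unit_pairs" by (rule T\<Phi>_closed[OF f])
    then have "T\<Phi> (frag_of (e0, l) + frag_of (e1, m)) = \<one>\<^bsub>unit_pairs\<^esub>"
      using T\<Phi>_TN[OF lm(3)] U.inv_solve_right'[of "\<one>\<^bsub>unit_pairs\<^esub>" x2 for x2] unfolding T\<Phi>_diff[OF x(1) f] x(2)
      by (metis U.inv_inv U.l_one U.inv_closed U.inv_one)
    then have "l = 1" "m = 1" unfolding T\<Phi>_pair[OF lm(1,2)] by (auto simp: unit_pairs_simps)
    then have "frag_of (e0, l) + frag_of (e1, m) \<in> TN"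
      using TN_add[OF TN_one[OF vec2_carrier] TN_one[OF vec2_carrier]] by simp
    from TN_add[OF lm(3) this] show "x \<in> TN" by simp
  qed
qed

sublocale Q: free_quotient "unit_pairs :: ('a \<times> 'a) monoid" TS T\<Phi> TN
proof -
  interpret U: comm_group "unit_pairs :: ('a \<times> 'a) monoid" by (rule comm_group_unit_pairs)
  show "free_quotient (unit_pairs :: ('a \<times> 'a) monoid) TS T\<Phi> TN"
  proof unfold_locales
    show "carrier unit_pairs \<subseteq> T\<Phi> ` carrier TFG"
    proof
      fix p :: "'a \<times> 'a" assume "p \<in> carrier unit_pairs"
      then obtain l m where p: "p = (l, m)" "l \<noteq> 0" "m \<noteq> 0" by (auto simp: unit_pairs_simps)
      have "frag_of (e0, l) + frag_of (e1, m) \<in> carrier TFG" by (rule pair_TFG[OF p(2,3)])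
      then show "p \<in> T\<Phi> ` carrier TFG" unfolding p(1) T\<Phi>_pair[OF p(2,3), symmetric] by (rule imageI)
    qed
  qed (use T\<Phi>_hom TN_kernel in auto)
qed

lemma torus_eq: "(torus :: (int vec \<times> 'a \<Rightarrow>\<^sub>0 int) set monoid) = TFG Mod TN"
  by (simp add: torus_def tensor_group_def)

lemma torus_simps:
  "carrier (torus :: (int vec \<times> 'a \<Rightarrow>\<^sub>0 int) set monoid) = Q.fib ` {(x, y). x \<noteq> 0 \<and> y \<noteq> 0}"
  "\<lbrakk>x \<noteq> 0; y \<noteq> 0; x' \<noteq> 0; y' \<noteq> 0\<rbrakk> \<Longrightarrow> Q.fib (x, y) \<otimes>\<^bsub>torus\<^esub> Q.fib (x', y') = Q.fib (x * x', y * y')"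
  "\<one>\<^bsub>(torus :: (int vec \<times> 'a \<Rightarrow>\<^sub>0 int) set monoid)\<^esub> = Q.fib (1, 1)"
  using Q.carrier_Mod Q.mult_Mod[of "(x, y)" "(x', y')"] Q.one_Mod by (simp_all add: torus_eq unit_pairs_simps)

lemma torus_fib_eq: "\<lbrakk>x \<noteq> 0; y \<noteq> 0\<rbrakk> \<Longrightarrow> Q.fib (x, y) = Q.fib (x', y') \<longleftrightarrow> x = x' \<and> y = y'"
  using Q.fib_inj[of "(x, y)" "(x', y')"] by (auto simp: unit_pairs_simps)

lemma comm_group_torus: "comm_group (torus :: (int vec \<times> 'a \<Rightarrow>\<^sub>0 int) set monoid)"
  unfolding torus_eq TN_eq
  by (rule comm_group.abelian_FactGroup[OF abelian_free_Abelian_group])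
     (rule group.generate_is_subgroup[OF group_free_Abelian_group rels_TFG])

lemma torus_inv:
  assumes "x \<noteq> 0" "y \<noteq> 0"
  shows "inv\<^bsub>torus\<^esub> (Q.fib (x, y)) = Q.fib (inverse x, inverse y)"
proof (rule group.inv_equality[OF comm_group.axioms(2)[OF comm_group_torus]])
  show "Q.fib (inverse x, inverse y) \<otimes>\<^bsub>torus\<^esub> Q.fib (x, y) = \<one>\<^bsub>torus\<^esub>"
    unfolding torus_simps(3) using torus_simps(2)[of "inverse x" "inverse y" x y] assms by simp
  show "Q.fib (x, y) \<in> carrier torus" "Q.fib (inverse x, inverse y) \<in> carrier torus"
    unfolding torus_simps(1) by (rule imageI, use assms in simp)+
qed

text \<open>On formal sums, acting on representatives corresponds under \<open>T\<Phi>\<close> to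
  acting on pairs of units. Each fibre therefore goes into a single fibre, and the union defining
  the action collapses.\<close>

lemma torus_act_fib:
  assumes g: "\<And>x y. g (x * y) = g x * g y" "g 1 = (1 :: 'a)" "g 0 = 0"
    and M: "\<phi> g \<in> carrier_mat 2 2" and xy: "x \<noteq> 0" "y \<noteq> 0"
  shows "torus_action \<phi> g (Q.fib (x, y)) = Q.fib (pair_act (\<phi> g) g (x, y))"
proof -
  interpret U: comm_group "unit_pairs :: ('a \<times> 'a) monoid" by (rule comm_group_unit_pairs)
  have gn: "g z \<noteq> 0" if "z \<noteq> 0" for z
  proof
    assume "g z = 0"
    then have "g (z * inverse z) = 0" by (simp add: g(1))
    then show False using that g(2) by simp
  qed
  have ginv: "g (inverse z) = inverse (g z)" for z
  proof (cases "z = 0")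
    case False
    then have "g z * g (inverse z) = 1" using g(1)[of z "inverse z"] g(2) by simp
    then show ?thesis by (metis inverse_unique)
  qed (simp add: g(3))
  have gpow: "g (z ^ n) = g z ^ n" for z n by (induction n) (auto simp: g)
  have gpowi: "g (z powi n) = g z powi n" for z n by (simp add: power_int_def gpow ginv)
  let ?M = "\<phi> g"
  let ?a = "\<lambda>p. pair_act ?M g p"
  have pn: "g z powi n \<noteq> 0" if "z \<noteq> 0" for z n using gn[OF that] by simp
  have up: "\<exists>u v. p = (u, v) \<and> u \<noteq> 0 \<and> v \<noteq> 0" if "p \<in> carrier unit_pairs" for p :: "'a \<times> 'a"
    using that by (cases p) (simp add: unit_pairs_simps)
  have ac: "?a p \<in> carrier unit_pairs" if p: "p \<in> carrier unit_pairs" for p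
  proof -
    obtain u v where "p = (u, v)" "u \<noteq> 0" "v \<noteq> 0" using up[OF p] by blast
    then show ?thesis using pn by (simp add: unit_pairs_simps pair_act_def)
  qed
  have am: "?a (p \<otimes>\<^bsub>unit_pairs\<^esub> q) = ?a p \<otimes>\<^bsub>unit_pairs\<^esub> ?a q" for p q
    by (cases p; cases q) (simp add: unit_pairs_simps pair_act_def g(1) power_int_mult_distrib)
  have ai: "?a (inv\<^bsub>unit_pairs\<^esub> p) = inv\<^bsub>unit_pairs\<^esub> (?a p)" if p: "p \<in> carrier unit_pairs" for p
  proof -
    obtain u v where "p = (u, v)" "u \<noteq> 0" "v \<noteq> 0" using up[OF p] by blast
    then show ?thesis using pn by (simp add: pair_act_def unit_pairs_inv ginv power_int_inverse)
  qed
  define rep where "rep x = frag_extend (\<lambda>(n, l). frag_of (?M *\<^sub>v n, g l)) x" for x :: "int vec \<times> 'a \<Rightarrow>\<^sub>0 int"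
  have rep: "rep z \<in> carrier TFG \<and> T\<Phi> (rep z) = ?a (T\<Phi> z)" if "z \<in> carrier TFG" for z
    using that
  proof (rule free_TFG_induct)
    have "T\<Phi> 0 = (1, 1)" using T\<Phi>_TN[OF TN_zero] by (simp add: unit_pairs_simps)
    then show "rep 0 \<in> carrier TFG \<and> T\<Phi> (rep 0) = ?a (T\<Phi> 0)" by (simp add: rep_def pair_act_def g)
  next
    fix u v assume u: "u \<in> carrier TFG" and v: "v \<in> carrier TFG"
      and h: "rep u \<in> carrier TFG \<and> T\<Phi> (rep u) = ?a (T\<Phi> u)" "rep v \<in> carrier TFG \<and> T\<Phi> (rep v) = ?a (T\<Phi> v)"
    have "rep (u - v) = rep u - rep v" by (simp add: rep_def frag_extend_diff)
    moreover have "T\<Phi> (rep u - rep v) = ?a (T\<Phi> (u - v))"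
      using h T\<Phi>_diff[of "rep u" "rep v"] am ai[OF T\<Phi>_closed[OF v]]
      by (simp add: T\<Phi>_diff[OF u v] del: carrier_free_Abelian_group_iff)
    ultimately show "rep (u - v) \<in> carrier TFG \<and> T\<Phi> (rep (u - v)) = ?a (T\<Phi> (u - v))"
      using h TFG_diff by (simp del: carrier_free_Abelian_group_iff)
  next
    fix n :: "int vec" and l :: 'a assume n: "n \<in> carrier_vec 2" and l: "l \<noteq> 0"
    have e: "(?M *\<^sub>v n) $ i = ?M $$ (i, 0) * n $ 0 + ?M $$ (i, 1) * n $ 1" if "i < 2" for i
      using M n that by (simp add: scalar_prod_def numeral_2_eq_2)
    have c: "?M *\<^sub>v n \<in> carrier_vec 2" by (rule mult_mat_vec_carrier[OF M n])
    have "T\<Phi> (frag_of (?M *\<^sub>v n, g l)) = ?a (T\<Phi> (frag_of (n, l)))"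
      unfolding T\<Phi>_of[OF n l] T\<Phi>_of[OF c gn[OF l]] using gn[OF l]
      by (simp add: pair_act_def e gpowi power_int_add power_int_mult[symmetric] mult.commute)
    then show "rep (frag_of (n, l)) \<in> carrier TFG \<and> T\<Phi> (rep (frag_of (n, l))) = ?a (T\<Phi> (frag_of (n, l)))"
      using TFG_ofI[OF c gn[OF l]] by (simp add: rep_def)
  qed
  have "torus_action \<phi> g (Q.fib (x, y)) = (\<Union>z\<in>Q.fib (x, y). TN #>\<^bsub>TFG\<^esub> rep z)"
    by (simp add: torus_action_def Let_def rep_def)
  also have "\<dots> = Q.fib (?a (x, y))"
    by (rule Q.UN_coset) (use rep Q.fibD Q.fib_nonempty[of "(x, y)"] xy in \<open>auto simp: unit_pairs_simps\<close>)
  finally show ?thesis .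
qed

end

section \<open>Cohomology of monomial actions\<close>

text \<open>\<open>pw\<close> raises to the power +1 or -1, with \<open>True\<close> for the
  positive sign, so that composing signs is comparing Booleans. \<open>cl l\<close> is the
  normalised cocycle value: 1 where the character is positive and \<open>l\<close>
  elsewhere.\<close>

definition pw :: "bool \<Rightarrow> 'a::field \<Rightarrow> 'a" where "pw b z = (if b then z else inverse z)"
definition cl :: "'a::field \<Rightarrow> bool \<Rightarrow> 'a" where "cl l b = (if b then 1 else l)"

lemma pw_simps [simp]: "pw True z = z" "pw False z = inverse z" "pw b 1 = 1" "pw b z = 0 \<longleftrightarrow> z = 0"
  by (auto simp: pw_def)
lemma cl_simps [simp]: "cl l True = 1" "cl l False = l" "cl 1 b = 1" by (auto simp: cl_def)
lemma cl_nonzero: "l \<noteq> 0 \<Longrightarrow> cl l b \<noteq> 0" by (simp add: cl_def)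
lemma pw_mult: "pw b (x * y) = pw b x * pw b y" by (simp add: pw_def)
lemma pw_pw: "pw b (pw b' z) = pw (b = b') z" by (simp add: pw_def)
lemma cl_mult: "cl (l * l') b = cl l b * cl l' b" by (simp add: cl_def)

locale auts =
  fixes H :: "('a::field \<Rightarrow> 'a) set"
  assumes add: "\<lbrakk>g \<in> H\<rbrakk> \<Longrightarrow> g (x + y) = g x + g y" and mult: "\<lbrakk>g \<in> H\<rbrakk> \<Longrightarrow> g (x * y) = g x * g y"
    and one: "g \<in> H \<Longrightarrow> g 1 = 1" and id: "id \<in> H" and comp: "\<lbrakk>g \<in> H; h \<in> H\<rbrakk> \<Longrightarrow> g \<circ> h \<in> H"
    and inverses: "g \<in> H \<Longrightarrow> \<exists>h\<in>H. g \<circ> h = id \<and> h \<circ> g = id"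
begin

lemma zero: "g \<in> H \<Longrightarrow> g 0 = 0" using add[of g 0 0] by (metis add.right_neutral add_left_cancel)
lemma minus: "g \<in> H \<Longrightarrow> g (- x) = - g x"
  using add[of g x "- x"] zero[of g] by (simp add: eq_neg_iff_add_eq_0 add.commute)
lemma nonzero: "\<lbrakk>g \<in> H; x \<noteq> 0\<rbrakk> \<Longrightarrow> g x \<noteq> 0"
  using mult[of g x "inverse x"] one[of g] by auto
lemma eq_0: "g \<in> H \<Longrightarrow> g x = 0 \<longleftrightarrow> x = 0" using nonzero zero by blast
lemma inv: "g \<in> H \<Longrightarrow> g (inverse x) = inverse (g x)"
proof (cases "x = 0")
  case False
  assume "g \<in> H"
  then have "g x * g (inverse x) = 1" using mult[of g x "inverse x"] one[of g] False by simp
  then show ?thesis by (metis inverse_unique)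
qed (simp add: zero)
lemma div: "g \<in> H \<Longrightarrow> g (x / y) = g x / g y" by (simp add: divide_inverse mult inv)
lemma pw: "g \<in> H \<Longrightarrow> g (pw b x) = pw b (g x)" by (simp add: pw_def inv)
lemma cl: "g \<in> H \<Longrightarrow> g (cl l b) = cl (g l) b" by (simp add: cl_def one)

definition "fixed = {x. \<forall>g\<in>H. g x = x}"

lemma fixed_mult:
  assumes "l \<in> fixed" "m \<in> fixed" shows "l * m \<in> fixed"
proof -
  have "g (l * m) = l * m" if g: "g \<in> H" for g
    unfolding mult[OF g] using assms g by (metis (mono_tags, lifting) fixed_def mem_Collect_eq)
  then show ?thesis by (simp add: fixed_def)
qed

end

text \<open>\<open>e\<close> is the character, true where the sign is positive; its kernel is \<open>{id, c}\<close>, where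
  \<open>c = id\<close> is allowed.\<close>

locale rank1 = auts H for H :: "('a::field \<Rightarrow> 'a) set" +
  fixes e :: "('a \<Rightarrow> 'a) \<Rightarrow> bool" and c :: "'a \<Rightarrow> 'a"
  assumes e_comp: "\<lbrakk>g \<in> H; h \<in> H\<rbrakk> \<Longrightarrow> e (g \<circ> h) \<longleftrightarrow> e g = e h"
    and c: "c \<in> H" "e c" and small: "\<lbrakk>g \<in> H; e g\<rbrakk> \<Longrightarrow> g = id \<or> g = c"
begin

lemma e_id: "e id" using e_comp[OF id id] by simp

definition "E = {x. \<forall>g\<in>H. e g \<longrightarrow> g x = x}"

lemma E_iff: "x \<in> E \<longleftrightarrow> c x = x"
proof
  assume x: "c x = x"
  have "g x = x" if "g \<in> H" "e g" for g using small[OF that] x by auto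
  then show "x \<in> E" by (simp add: E_def)
qed (use c in \<open>auto simp: E_def\<close>)

text \<open>The composite of \<open>c\<close> with itself lies in the kernel, so it is the identity
  or \<open>c\<close>; in the latter case \<open>c\<close> is the identity. Kernels of order 1 and 2
  are thus treated together.\<close>

lemma cc: "c (c x) = x"
proof -
  have "c \<circ> c = id \<or> c \<circ> c = c" using small[OF comp[OF c(1) c(1)]] e_comp[OF c(1) c(1)] by simp
  then show ?thesis
  proof
    assume cc: "c \<circ> c = c"
    obtain h where "h \<in> H" "h \<circ> c = id" using inverses[OF c(1)] by blast
    then have "c = id" using cc by (metis comp_assoc comp_id id_comp)
    then show ?thesis by simp
  qed (metis comp_apply id_apply)
qed

text \<open>For the kernel {id, c} the resolvent t + a(c) c(t) is invariant under y \<mapsto> a(c)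
  c(y), and its inverse solves the equation. It is nonzero for t = 1 unless a(c) = -1, and in that
  case for any t moved by \<open>c\<close>. For \<open>c = id\<close> the cocycle is already
  trivial.\<close>

lemma hilbert90:
  assumes a: "\<And>g. \<lbrakk>g \<in> H; e g\<rbrakk> \<Longrightarrow> a g \<noteq> 0"
    and coc: "\<And>g h. \<lbrakk>g \<in> H; h \<in> H; e g; e h\<rbrakk> \<Longrightarrow> a (g \<circ> h) = a g * g (a h)"
  shows "\<exists>x. x \<noteq> 0 \<and> (\<forall>g\<in>H. e g \<longrightarrow> a g * x = g x)"
proof -
  have "a id = a id * a id" using coc[OF id id e_id e_id] by simp
  then have a1: "a id = 1" using a[OF id e_id] by simp
  show ?thesis
  proof (cases "c = id")
    case True
    have "a g * 1 = g 1" if "g \<in> H" "e g" for g using small[OF that] a1 True by auto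
    then show ?thesis by (intro exI[of _ 1]) simp
  next
    case False
    have "c \<circ> c = id" using cc by (intro ext) simp
    then have ac: "a c * c (a c) = 1" using coc[OF c(1) c(1) c(2) c(2)] a1 by simp
    have "\<exists>t. t + a c * c t \<noteq> 0"
    proof (cases "1 + a c = 0")
      case True
      obtain t where "c t \<noteq> t" using False by (metis eq_id_iff)
      then have "t + a c * c t \<noteq> 0" using True by (simp add: add_eq_0_iff)
      then show ?thesis by blast
    next
      case False
      then show ?thesis using one[OF c(1)] by (intro exI[of _ 1]) simp
    qed
    then obtain t where t: "t + a c * c t \<noteq> 0" by blast
    let ?y = "t + a c * c t"
    have "a c * c ?y = ?y"
      using ac by (simp add: add[OF c(1)] mult[OF c(1)] cc algebra_simps)
    then have "a c * inverse ?y = c (inverse ?y)"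
    proof -
      assume e: "a c * c ?y = ?y"
      have "a c * inverse ?y = a c * inverse (a c * c ?y)" unfolding e ..
      also have "\<dots> = inverse (c ?y)" using a[OF c] by simp
      finally show ?thesis unfolding inv[OF c(1)] .
    qed
    then have "a g * inverse ?y = g (inverse ?y)" if "g \<in> H" "e g" for g using small[OF that] a1 by auto
    then show ?thesis using t by (intro exI[of _ "inverse ?y"]) simp
  qed
qed

definition coc :: "(('a \<Rightarrow> 'a) \<Rightarrow> 'a) \<Rightarrow> bool" where
  "coc a \<longleftrightarrow> (\<forall>g\<in>H. a g \<noteq> 0) \<and> (\<forall>g\<in>H. \<forall>h\<in>H. a (g \<circ> h) = a g * pw (e g) (g (a h)))"

text \<open>The coboundary of \<open>x\<close> for the action of \<open>g\<close> on units by x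
  \<mapsto> g(x) with exponent given by the sign \<open>e g\<close>; \<open>coc\<close> above is the
  matching cocycle condition.\<close>

definition twist_by :: "'a \<Rightarrow> ('a \<Rightarrow> 'a) \<Rightarrow> 'a" where
  "twist_by x g = pw (e g) (g x) / x"

lemma coc_cl:
  assumes l: "l \<noteq> 0" "l \<in> fixed"
  shows "coc (\<lambda>g. cl l (e g))"
  unfolding coc_def
proof (intro conjI ballI)
  fix g h assume g: "g \<in> H" and h: "h \<in> H"
  have "g l = l" using l(2) g by (simp add: fixed_def)
  then show "cl l (e (g \<circ> h)) = cl l (e g) * pw (e g) (g (cl l (e h)))"
    using l(1) by (cases "e g"; cases "e h") (simp_all add: e_comp[OF g h] one[OF g])
qed (use l(1) in \<open>simp add: cl_nonzero\<close>)

lemma trivial_character: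
  assumes "coc a" and all: "\<forall>g\<in>H. e g"
  shows "\<exists>x. x \<noteq> 0 \<and> (\<forall>g\<in>H. a g = twist_by x g)"
proof -
  have "\<exists>x. x \<noteq> 0 \<and> (\<forall>g\<in>H. e g \<longrightarrow> a g * x = g x)"
    by (rule hilbert90) (use assms in \<open>auto simp: coc_def\<close>)
  then obtain x where x: "x \<noteq> 0" "\<forall>g\<in>H. e g \<longrightarrow> a g * x = g x" by blast
  then show ?thesis using all by (intro exI[of _ x]) (auto simp: twist_by_def field_simps)
qed

text \<open>Hilbert 90 on the kernel makes the cocycle trivial there after division by a coboundary.
  It is then constant on the other coset, and the cocycle relation forces this constant to be fixed
  by the whole group.\<close>

lemma nontrivial_character:
  assumes a: "coc a" and s: "s \<in> H" "\<not> e s"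
  shows "\<exists>x l. x \<noteq> 0 \<and> l \<noteq> 0 \<and> l \<in> fixed \<and> (\<forall>g\<in>H. a g = twist_by x g * cl l (e g))"
proof -
  have an: "\<And>g. g \<in> H \<Longrightarrow> a g \<noteq> 0" and ac: "\<And>g h. \<lbrakk>g \<in> H; h \<in> H\<rbrakk> \<Longrightarrow> a (g \<circ> h) = a g * pw (e g) (g (a h))"
    using a by (auto simp: coc_def)
  have "\<exists>x. x \<noteq> 0 \<and> (\<forall>g\<in>H. e g \<longrightarrow> a g * x = g x)"
    by (rule hilbert90) (use an ac in auto)
  then obtain x where x: "x \<noteq> 0" "\<And>g. \<lbrakk>g \<in> H; e g\<rbrakk> \<Longrightarrow> a g * x = g x" by blast
  define b where "b g = a g * x / pw (e g) (g x)" for g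
  have bn: "b g \<noteq> 0" if "g \<in> H" for g using an[OF that] x(1) nonzero[OF that x(1)] by (simp add: b_def)
  have bc: "b (g \<circ> h) = b g * pw (e g) (g (b h))" if g: "g \<in> H" and h: "h \<in> H" for g h
  proof -
    have "g (b h) = g (a h) * g x / pw (e h) (g (h x))" by (simp add: b_def mult[OF g] div[OF g] pw[OF g])
    then have "pw (e g) (g (b h)) = pw (e g) (g (a h)) * pw (e g) (g x) / pw (e g = e h) (g (h x))"
      by (auto simp: pw_def field_simps)
    moreover have "b (g \<circ> h) = a g * pw (e g) (g (a h)) * x / pw (e g = e h) (g (h x))"
      unfolding b_def ac[OF g h] by (simp add: e_comp[OF g h])
    ultimately show ?thesis using nonzero[OF g x(1)] by (simp add: b_def)
  qed
  have b1: "b n = 1" if "n \<in> H" "e n" for n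
    using x(2)[OF that] nonzero[OF that(1) x(1)] that by (simp add: b_def)
  obtain si where si: "si \<in> H" "s \<circ> si = id" "si \<circ> s = id" using inverses[OF s(1)] by blast
  have esi: "\<not> e si" using e_comp[OF s(1) si(1)] e_id s(2) si(2) by simp
  have bs: "b g = b s" if g: "g \<in> H" "\<not> e g" for g
  proof -
    have "s \<circ> (si \<circ> g) = g" using si by (metis comp_assoc id_comp)
    moreover have "si \<circ> g \<in> H" "e (si \<circ> g)" using comp[OF si(1) g(1)] e_comp[OF si(1) g(1)] esi g(2) by auto
    ultimately show ?thesis using bc[OF s(1), of "si \<circ> g"] b1[of "si \<circ> g"] one[OF s(1)] by simp
  qed
  \<comment> \<open>The relation at g o s determines g(b s), because \<open>b\<close> is known on
    each coset: for \<open>g\<close> in the kernel the composite lies outside it, otherwise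
    inside.\<close>
  have inv_b: "g (b s) = b s" if g: "g \<in> H" for g
  proof (cases "e g")
    case True
    have "\<not> e (g \<circ> s)" using e_comp[OF g s(1)] True s(2) by simp
    then have "b (g \<circ> s) = b s" using bs[OF comp[OF g s(1)]] by simp
    then show ?thesis using bc[OF g s(1)] b1[OF g True] True by simp
  next
    case False
    have "e (g \<circ> s)" using e_comp[OF g s(1)] False s(2) by simp
    then have "b (g \<circ> s) = 1" using b1[OF comp[OF g s(1)]] by simp
    then have "1 = b s * inverse (g (b s))" using bc[OF g s(1)] bs[OF g False] False by simp
    then show ?thesis using nonzero[OF g bn[OF s(1)]] by (simp add: field_simps)
  qed
  have "a g = twist_by x g * cl (b s) (e g)" if g: "g \<in> H" for g
  proof -
    have "b g = cl (b s) (e g)" using b1[OF g] bs[OF g] by (auto simp: cl_def)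
    then show ?thesis using x(1) nonzero[OF g x(1)] by (auto simp: b_def twist_by_def field_simps pw_def split: if_splits)
  qed
  then show ?thesis using x(1) bn[OF s(1)] inv_b by (intro exI[of _ x] exI[of _ "b s"]) (auto simp: fixed_def)
qed

text \<open>A coboundary that is 1 on the kernel comes from \<open>x\<close> in \<open>E\<close>;
  off the kernel its value is the inverse of x s(x). Passing to the inverse of \<open>x\<close>
  turns this into multiplication by a norm.\<close>

lemma character_eq_iff:
  assumes s: "s \<in> H" "\<not> e s" and l: "l \<noteq> 0" "l' \<noteq> 0"
  shows "(\<exists>x. x \<noteq> 0 \<and> (\<forall>g\<in>H. cl l' (e g) = twist_by x g * cl l (e g))) \<longleftrightarrow> (\<exists>x\<in>E. x \<noteq> 0 \<and> l' = l * (x * s x))"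
proof
  assume "\<exists>x. x \<noteq> 0 \<and> (\<forall>g\<in>H. cl l' (e g) = twist_by x g * cl l (e g))"
  then obtain x where x: "x \<noteq> 0" "\<And>g. g \<in> H \<Longrightarrow> cl l' (e g) = twist_by x g * cl l (e g)" by blast
  have "x \<in> E" unfolding E_iff using x(2)[OF c(1)] c(2) x(1) by (simp add: twist_by_def field_simps)
  then have "inverse x \<in> E" unfolding E_iff by (simp add: inv[OF c(1)])
  moreover have "l' = l * (inverse x * s (inverse x))"
    using x(2)[OF s(1)] s(2) by (simp add: twist_by_def inv[OF s(1)] divide_inverse ac_simps)
  ultimately show "\<exists>x\<in>E. x \<noteq> 0 \<and> l' = l * (x * s x)" using x(1) by (intro bexI[of _ "inverse x"]) auto
next
  assume "\<exists>x\<in>E. x \<noteq> 0 \<and> l' = l * (x * s x)"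
  then obtain x where x: "x \<in> E" "x \<noteq> 0" "l' = l * (x * s x)" by blast
  obtain si where si: "si \<in> H" "s \<circ> si = id" "si \<circ> s = id" using inverses[OF s(1)] by blast
  have esi: "\<not> e si" using e_comp[OF s(1) si(1)] e_id s(2) si(2) by simp
  have "cl l' (e g) = twist_by (inverse x) g * cl l (e g)" if g: "g \<in> H" for g
  proof (cases "e g")
    case True
    then have "g x = x" using x(1) g by (simp add: E_def)
    then show ?thesis using True x(2) by (simp add: twist_by_def inv[OF g])
  next
    case False
    have "(si \<circ> g) \<in> H" "e (si \<circ> g)" using comp[OF si(1) g] e_comp[OF si(1) g] esi False by auto
    then have "(si \<circ> g) x = x" using x(1) unfolding E_def by blast
    then have "s x = g x" using si(2) by (metis comp_apply id_apply)
    then show ?thesis using False x(2,3) by (simp add: twist_by_def inv[OF g] divide_inverse ac_simps)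
  qed
  then show "\<exists>x. x \<noteq> 0 \<and> (\<forall>g\<in>H. cl l' (e g) = twist_by x g * cl l (e g))" using x(2) by (intro exI[of _ "inverse x"]) auto
qed

text \<open>If \<open>s\<close> fixed all of \<open>E\<close>, then \<open>s x\<close> would be a root of \<open>(T - x) (T - c x)\<close> for every \<open>x\<close>,
  and the field would be the union of the two proper additive subgroups \<open>s x = x\<close> and
  \<open>s x = c x\<close>.\<close>

lemma quad_ext:
  assumes s: "s \<in> H" "\<not> e s"
  shows "\<exists>om. quad fixed E s om"
proof -
  obtain si where si: "si \<in> H" "s \<circ> si = id" "si \<circ> s = id" using inverses[OF s(1)] by blast
  have esi: "\<not> e si" using e_comp[OF s(1) si(1)] e_id s(2) si(2) by simp
  have "\<exists>om\<in>E. s om \<noteq> om"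
  proof (rule ccontr)
    assume "\<not> (\<exists>om\<in>E. s om \<noteq> om)"
    then have fx: "s x = x" if "x \<in> E" for x using that by blast
    have alt: "s x = x \<or> s x = c x" for x
    proof -
      have 1: "x + c x \<in> E" "x * c x \<in> E" unfolding E_iff by (auto simp: add[OF c(1)] mult[OF c(1)] cc algebra_simps)
      have 2: "s x + s (c x) = x + c x" "s x * s (c x) = x * c x"
        using fx[OF 1(1)] fx[OF 1(2)] by (auto simp: add[OF s(1)] mult[OF s(1)])
      have "(s x - x) * (s x - c x) = s x * s x - s x * (x + c x) + x * c x" by (simp add: algebra_simps)
      also have "\<dots> = 0" unfolding 2[symmetric] by (simp add: algebra_simps)
      finally show ?thesis by auto
    qed
    have "s \<noteq> id" "s \<noteq> c" using s(2) e_id c(2) by auto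
    then obtain x y where xy: "s x \<noteq> x" "s y \<noteq> c y" by (metis eq_id_iff ext)
    then have "s x = c x" "s y = y" using alt by blast+
    moreover have "s (x + y) = x + y \<or> s (x + y) = c (x + y)" by (rule alt)
    ultimately show False using xy by (auto simp: add[OF s(1)] add[OF c(1)])
  qed
  then obtain om where om: "om \<in> E" "s om \<noteq> om" by blast
  have "quad fixed E s om"
  proof
    fix x assume x: "x \<in> E"
    have Ex: "g x = x" if "g \<in> H" "e g" for g using x that by (simp add: E_def)
    \<comment> \<open>The kernel of the character is normal: conjugating \<open>c\<close> by
      \<open>s\<close> stays in it, so \<open>s\<close> preserves the fixed field
      \<open>E\<close>.\<close>
    have "(si \<circ> (c \<circ> s)) \<in> H" "e (si \<circ> (c \<circ> s))"
      using comp[OF si(1) comp[OF c(1) s(1)]] e_comp[OF si(1) comp[OF c(1) s(1)]] e_comp[OF c(1) s(1)] c(2) s(2) esi by auto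
    then have "(si \<circ> (c \<circ> s)) x = x" by (rule Ex)
    then have "c (s x) = s x" using si(2) by (metis comp_apply id_apply)
    then show "s x \<in> E" by (simp add: E_iff)
    have "s \<circ> s \<in> H" "e (s \<circ> s)" using comp[OF s(1) s(1)] e_comp[OF s(1) s(1)] by auto
    then have "(s \<circ> s) x = x" by (rule Ex)
    then show "s (s x) = x" by simp
  next
    show "fixed = {x \<in> E. s x = x}"
    proof
      show "fixed \<subseteq> {x \<in> E. s x = x}" using s(1) by (auto simp: fixed_def E_def)
      show "{x \<in> E. s x = x} \<subseteq> fixed"
      proof
        fix x assume "x \<in> {x \<in> E. s x = x}"
        then have x: "x \<in> E" "s x = x" by auto
        have "g x = x" if g: "g \<in> H" for g
        proof (cases "e g")
          case True
          then show ?thesis using x(1) g by (simp add: E_def)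
        next
          case False
          have "(si \<circ> g) \<in> H" "e (si \<circ> g)" using comp[OF si(1) g] e_comp[OF si(1) g] esi False by auto
          then have "(si \<circ> g) x = x" using x(1) unfolding E_def by blast
          then have "s x = g x" using si(2) by (metis comp_apply id_apply)
          then show ?thesis using x(2) by simp
        qed
        then show "x \<in> fixed" by (simp add: fixed_def)
      qed
    qed
  qed (use om s(1) in \<open>auto simp: add mult one E_iff inv[OF c(1)] minus[OF c(1)] add[OF c(1)] mult[OF c(1)] one[OF c(1)]\<close>)
  then show ?thesis by blast
qed

end

text \<open>\<open>g\<close> acts by the signed permutation matrix that is diagonal iff \<open>dg g\<close> and whose rows have
  positive signs iff \<open>r g\<close> and \<open>r' g\<close>, respectively.\<close>

locale monomial = auts G for G :: "('a::field \<Rightarrow> 'a) set" +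
  fixes dg r r' :: "('a \<Rightarrow> 'a) \<Rightarrow> bool"
  assumes dg_comp: "\<lbrakk>g \<in> G; h \<in> G\<rbrakk> \<Longrightarrow> dg (g \<circ> h) \<longleftrightarrow> dg g = dg h"
    and r_comp: "\<lbrakk>g \<in> G; h \<in> G\<rbrakk> \<Longrightarrow> r (g \<circ> h) \<longleftrightarrow> r g = (if dg g then r h else r' h)"
    and r'_comp: "\<lbrakk>g \<in> G; h \<in> G\<rbrakk> \<Longrightarrow> r' (g \<circ> h) \<longleftrightarrow> r' g = (if dg g then r' h else r h)"
begin

definition pact :: "('a \<Rightarrow> 'a) \<Rightarrow> 'a \<times> 'a \<Rightarrow> 'a \<times> 'a" where
  "pact g p = (if dg g then (pw (r g) (g (fst p)), pw (r' g) (g (snd p))) else (pw (r g) (g (snd p)), pw (r' g) (g (fst p))))"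

definition pmult :: "'a \<times> 'a \<Rightarrow> 'a \<times> 'a \<Rightarrow> 'a \<times> 'a" where "pmult p q = (fst p * fst q, snd p * snd q)"

definition pcoc :: "(('a \<Rightarrow> 'a) \<Rightarrow> 'a \<times> 'a) \<Rightarrow> bool" where
  "pcoc d \<longleftrightarrow> (\<forall>g\<in>G. fst (d g) \<noteq> 0 \<and> snd (d g) \<noteq> 0) \<and> (\<forall>g\<in>G. \<forall>h\<in>G. d (g \<circ> h) = pmult (d g) (pact g (d h)))"

definition pcob :: "'a \<Rightarrow> 'a \<Rightarrow> ('a \<Rightarrow> 'a) \<Rightarrow> 'a \<times> 'a" where
  "pcob x y g = (fst (pact g (x, y)) / x, snd (pact g (x, y)) / y)"

definition pcoh :: "(('a \<Rightarrow> 'a) \<Rightarrow> 'a \<times> 'a) \<Rightarrow> (('a \<Rightarrow> 'a) \<Rightarrow> 'a \<times> 'a) \<Rightarrow> bool" where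
  "pcoh d d' \<longleftrightarrow> (\<exists>x y. x \<noteq> 0 \<and> y \<noteq> 0 \<and> (\<forall>g\<in>G. d' g = pmult (pcob x y g) (d g)))"

lemma dg_id: "dg id" "r id" "r' id"
  using dg_comp[OF id id] r_comp[OF id id] r'_comp[OF id id] by auto

lemma diag_auts: "auts {g \<in> G. dg g}"
proof
  fix g assume "g \<in> {g \<in> G. dg g}"
  then obtain h where h: "h \<in> G" "g \<circ> h = id" "h \<circ> g = id" "g \<in> G" "dg g" using inverses by blast
  then have "dg h" using dg_comp[of g h] dg_id by simp
  then show "\<exists>h\<in>{g \<in> G. dg g}. g \<circ> h = id \<and> h \<circ> g = id" using h by blast
qed (auto simp: add mult one id comp dg_id dg_comp)

lemma pcoc_cong:
  assumes d: "pcoc d" and xy: "x \<noteq> 0" "y \<noteq> 0"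
  shows "pcoc (\<lambda>g. pmult (pcob x y g) (d g))"
  unfolding pcoc_def
proof (intro conjI ballI)
  fix g assume g: "g \<in> G"
  then show "fst (pmult (pcob x y g) (d g)) \<noteq> 0" "snd (pmult (pcob x y g) (d g)) \<noteq> 0"
    using d xy nonzero[OF g] by (auto simp: pcoc_def pmult_def pcob_def pact_def)
next
  fix g h assume g: "g \<in> G" and h: "h \<in> G"
  have dd: "d (g \<circ> h) = pmult (d g) (pact g (d h))" using d g h by (simp add: pcoc_def)
  have n: "g x \<noteq> 0" "g y \<noteq> 0" using nonzero[OF g] xy by auto
  show "pmult (pcob x y (g \<circ> h)) (d (g \<circ> h)) = pmult (pmult (pcob x y g) (d g)) (pact g (pmult (pcob x y h) (d h)))"
    unfolding dd using n xy
    by (cases "dg g"; cases "dg h"; cases "r g"; cases "r' g"; cases "r h"; cases "r' h")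
       (simp_all add: pmult_def pcob_def pact_def dg_comp[OF g h] r_comp[OF g h] r'_comp[OF g h] mult[OF g] div[OF g] inv[OF g] field_simps)
qed

lemma pcohI: "\<lbrakk>x \<noteq> 0; y \<noteq> 0; \<And>g. g \<in> G \<Longrightarrow> d' g = pmult (pcob x y g) (d g)\<rbrakk> \<Longrightarrow> pcoh d d'"
  unfolding pcoh_def by blast

lemma pcob_nonzero: "\<lbrakk>g \<in> G; x \<noteq> 0; y \<noteq> 0\<rbrakk> \<Longrightarrow> fst (pcob x y g) \<noteq> 0 \<and> snd (pcob x y g) \<noteq> 0"
  using nonzero[of g] by (auto simp: pcob_def pact_def)

lemma pcob_mult:
  assumes g: "g \<in> G"
  shows "pmult (pcob x y g) (pcob x' y' g) = pcob (x * x') (y * y') g"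
  by (simp add: pmult_def pcob_def pact_def mult[OF g] pw_mult)

lemma pcoh_trans: "\<lbrakk>pcoh d d'; pcoh d' d''\<rbrakk> \<Longrightarrow> pcoh d d''"
proof -
  assume "pcoh d d'" "pcoh d' d''"
  then obtain x y x' y' where xy: "x \<noteq> 0" "y \<noteq> 0" "x' \<noteq> 0" "y' \<noteq> 0"
    "\<And>g. g \<in> G \<Longrightarrow> d' g = pmult (pcob x y g) (d g)" "\<And>g. g \<in> G \<Longrightarrow> d'' g = pmult (pcob x' y' g) (d' g)"
    unfolding pcoh_def by blast
  show ?thesis
  proof (rule pcohI)
    show "x' * x \<noteq> 0" "y' * y \<noteq> 0" using xy by auto
    fix g assume g: "g \<in> G"
    show "d'' g = pmult (pcob (x' * x) (y' * y) g) (d g)"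
      unfolding xy(6)[OF g] xy(5)[OF g] pcob_mult[OF g, symmetric] by (simp add: pmult_def mult.assoc)
  qed
qed

text \<open>Without a diagonal part, the first components on the stabiliser \<open>dg\<close> of the line
  \<open>e\<^sub>1\<close> already determine a cocycle up to coboundaries (Shapiro's lemma).\<close>

lemma shapiro_one:
  assumes d: "pcoc d" and t: "t \<in> G" "\<not> dg t" and one1: "\<And>h. \<lbrakk>h \<in> G; dg h\<rbrakk> \<Longrightarrow> fst (d h) = 1"
  shows "pcoh d (\<lambda>_. (1, 1))"
proof -
  obtain ti where ti: "ti \<in> G" "t \<circ> ti = id" "ti \<circ> t = id" using inverses[OF t(1)] by blast
  have tti: "t (ti z) = z" for z using ti(2) by (metis comp_apply id_apply)
  have dt: "fst (d t) \<noteq> 0" using d t by (simp add: pcoc_def)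
  \<comment> \<open>The coboundary of (1, y) does not touch first components at diagonal elements.
    At \<open>t\<close> its first component involves t(y), so \<open>y\<close> can be chosen to
    normalise \<open>d\<close> there.\<close>
  define y where "y = ti (pw (r t) (inverse (fst (d t))))"
  have y: "y \<noteq> 0" unfolding y_def using nonzero[OF ti(1)] dt by simp
  have ty: "t y = pw (r t) (inverse (fst (d t)))" by (simp add: y_def tti)
  define f where "f = (\<lambda>g. pmult (pcob 1 y g) (d g))"
  have f: "pcoc f" unfolding f_def by (rule pcoc_cong[OF d _ y]) simp
  have fh: "fst (f h) = 1" if "h \<in> G" "dg h" for h
    using one1[OF that] that by (simp add: f_def pmult_def pcob_def pact_def one)
  have ft: "fst (f t) = 1"
    using t dt ty by (simp add: f_def pmult_def pcob_def pact_def pw_pw)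
  have fc: "f (g \<circ> h) = pmult (f g) (pact g (f h))" if "g \<in> G" "h \<in> G" for g h
    using f that by (simp add: pcoc_def)
  have f1: "fst (f g) = 1" if g: "g \<in> G" for g
  proof (cases "dg g")
    case True then show ?thesis using fh g by blast
  next
    case False
    \<comment> \<open>Writing \<open>g\<close> as a diagonal element times \<open>t\<close>, its
      first component becomes a product of values already normalised to 1.\<close>
    have "g \<circ> ti \<in> G" "dg (g \<circ> ti)"
      using comp[OF g ti(1)] dg_comp[OF g ti(1)] dg_comp[OF t(1) ti(1)] ti(2) dg_id t(2) False by auto
    moreover have "(g \<circ> ti) \<circ> t = g" using ti(3) by (metis comp_assoc comp_id)
    ultimately show ?thesis
      using fc[of "g \<circ> ti" t] fh[of "g \<circ> ti"] t(1) ft one[of "g \<circ> ti"] by (simp add: pmult_def pact_def)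
  qed
  have f2: "snd (f g) = 1" if g: "g \<in> G" for g
  proof -
    \<comment> \<open>Because \<open>t\<close> exchanges the coordinates, the second component at
      \<open>g\<close> is visible in the first component at t o g.\<close>
    have "fst (f (t \<circ> g)) = fst (f t) * pw (r t) (t (snd (f g)))"
      using fc[OF t(1) g] t(2) by (simp add: pmult_def pact_def)
    then have "pw (r t) (t (snd (f g))) = 1" using f1[OF comp[OF t(1) g]] ft by simp
    then have "t (snd (f g)) = 1" by (simp add: pw_def split: if_splits)
    then have "t (snd (f g) - 1) = 0" using add[OF t(1), of "snd (f g) - 1" 1] one[OF t(1)] by simp
    then show ?thesis using eq_0[OF t(1)] by simp
  qed
  show ?thesis
  proof (rule pcohI)
    fix g assume "g \<in> G"
    then show "(1, 1) = pmult (pcob 1 y g) (d g)" using f1 f2 by (metis f_def prod.collapse)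
  qed (use y in auto)
qed

lemma pcoc_div:
  assumes d: "pcoc d" and d': "pcoc d'"
  shows "pcoc (\<lambda>g. (fst (d g) / fst (d' g), snd (d g) / snd (d' g)))"
  unfolding pcoc_def
proof (intro conjI ballI)
  fix g assume "g \<in> G"
  then show "fst (fst (d g) / fst (d' g), snd (d g) / snd (d' g)) \<noteq> 0" "snd (fst (d g) / fst (d' g), snd (d g) / snd (d' g)) \<noteq> 0"
    using d d' by (auto simp: pcoc_def)
next
  fix g h assume g: "g \<in> G" and h: "h \<in> G"
  have e: "d (g \<circ> h) = pmult (d g) (pact g (d h))" "d' (g \<circ> h) = pmult (d' g) (pact g (d' h))"
    using d d' g h by (auto simp: pcoc_def)
  show "(fst (d (g \<circ> h)) / fst (d' (g \<circ> h)), snd (d (g \<circ> h)) / snd (d' (g \<circ> h))) =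
    pmult (fst (d g) / fst (d' g), snd (d g) / snd (d' g)) (pact g (fst (d h) / fst (d' h), snd (d h) / snd (d' h)))"
    unfolding e by (auto simp: pmult_def pact_def div[OF g] pw_def field_simps)
qed

text \<open>Forward is restriction to the diagonal subgroup followed by projection. Backward,
  multiplying \<open>d\<close> by the coboundary of (x, 1) makes its first components agree with
  those of \<open>d'\<close> on that subgroup, and the quotient cocycle is trivial by
  \<open>shapiro_one\<close>.\<close>

lemma shapiro_iff:
  assumes d: "pcoc d" and d': "pcoc d'" and t: "t \<in> G" "\<not> dg t"
  shows "pcoh d d' \<longleftrightarrow> (\<exists>x. x \<noteq> 0 \<and> (\<forall>h\<in>G. dg h \<longrightarrow> fst (d' h) = pw (r h) (h x) / x * fst (d h)))"
proof
  assume "pcoh d d'"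
  then show "\<exists>x. x \<noteq> 0 \<and> (\<forall>h\<in>G. dg h \<longrightarrow> fst (d' h) = pw (r h) (h x) / x * fst (d h))"
    by (auto simp: pcoh_def pmult_def pcob_def pact_def)
next
  assume "\<exists>x. x \<noteq> 0 \<and> (\<forall>h\<in>G. dg h \<longrightarrow> fst (d' h) = pw (r h) (h x) / x * fst (d h))"
  then obtain x where x: "x \<noteq> 0" "\<And>h. \<lbrakk>h \<in> G; dg h\<rbrakk> \<Longrightarrow> fst (d' h) = pw (r h) (h x) / x * fst (d h)" by blast
  define f where "f = (\<lambda>g. pmult (pcob x 1 g) (d g))"
  have f: "pcoc f" unfolding f_def by (rule pcoc_cong[OF d x(1)]) simp
  have df: "pcoh d f" by (rule pcohI[OF x(1), of 1]) (simp_all add: f_def)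
  have nz: "fst (f g) \<noteq> 0" "snd (f g) \<noteq> 0" "fst (d' g) \<noteq> 0" "snd (d' g) \<noteq> 0" if "g \<in> G" for g
    using f d' that by (auto simp: pcoc_def)
  have "pcoh (\<lambda>g. (fst (f g) / fst (d' g), snd (f g) / snd (d' g))) (\<lambda>_. (1, 1))"
  proof (rule shapiro_one[OF pcoc_div[OF f d'] t])
    fix h assume h: "h \<in> G" "dg h"
    have "fst (f h) = fst (d' h)" using x(2)[OF h] h by (simp add: f_def pmult_def pcob_def pact_def)
    then show "fst (fst (f h) / fst (d' h), snd (f h) / snd (d' h)) = 1" using nz[OF h(1)] by simp
  qed
  then obtain a b where ab: "a \<noteq> 0" "b \<noteq> 0"
    "\<And>g. g \<in> G \<Longrightarrow> (1, 1) = pmult (pcob a b g) (fst (f g) / fst (d' g), snd (f g) / snd (d' g))"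
    unfolding pcoh_def by blast
  have "pcoh f d'"
  proof (rule pcohI[OF ab(1,2)])
    fix g assume g: "g \<in> G"
    show "d' g = pmult (pcob a b g) (f g)"
      using ab(3)[OF g] nz[OF g] by (simp add: pmult_def field_simps prod_eq_iff)
  qed
  then show "pcoh d d'" by (rule pcoh_trans[OF df])
qed

text \<open>The cocycle induced from \<open>h \<mapsto> cl l (r h)\<close>, with \<open>t\<close> representing the coset of
  non-diagonal elements and \<open>ti\<close> its inverse.\<close>

definition ind_coc :: "('a \<Rightarrow> 'a) \<Rightarrow> ('a \<Rightarrow> 'a) \<Rightarrow> 'a \<Rightarrow> ('a \<Rightarrow> 'a) \<Rightarrow> 'a \<times> 'a" where
  "ind_coc t ti l g = (cl l (if dg g then r g else r g = r t), cl (pw (r t) (ti l)) (if dg g then r' g else r' g = r t))"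

text \<open>Put l' = \<open>pw (r t) (ti l)\<close>. The diagonal elements have index 2, hence form
  a normal subgroup: they fix both \<open>l\<close> and \<open>l'\<close>, and the other elements
  exchange the two up to the sign \<open>r t\<close>. What remains of the cocycle identity is a
  check over signs.\<close>

lemma ind_coc_pcoc:
  assumes t: "t \<in> G" "\<not> dg t" and ti: "ti \<in> G" "t \<circ> ti = id" "ti \<circ> t = id"
    and l: "l \<noteq> 0" "\<And>g. \<lbrakk>g \<in> G; dg g\<rbrakk> \<Longrightarrow> g l = l"
  shows "pcoc (ind_coc t ti l)"
proof -
  have tti: "t (ti z) = z" "ti (t z) = z" for z using ti(2,3) by (metis comp_apply id_apply)+
  have dti: "\<not> dg ti" using dg_comp[OF t(1) ti(1)] ti(2) dg_id t(2) by simp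
  define l' where "l' = pw (r t) (ti l)"
  have l'n: "l' \<noteq> 0" using nonzero[OF ti(1) l(1)] by (simp add: l'_def)
  have tl: "ti l = pw (r t) l'" by (simp add: l'_def pw_pw)
  have A: "g l' = l'" if g: "g \<in> G" "dg g" for g
  proof -
    have "(t \<circ> (g \<circ> ti)) l = l"
      using comp[OF t(1) comp[OF g(1) ti(1)]] dg_comp[OF t(1) comp[OF g(1) ti(1)]] dg_comp[OF g(1) ti(1)] t(2) dti g(2) l(2) by blast
    then have "g (ti l) = ti l" by (metis comp_apply tti(2))
    then show ?thesis by (simp add: l'_def pw[OF g(1)])
  qed
  have B: "g l' = pw (r t) l" if g: "g \<in> G" "\<not> dg g" for g
  proof -
    have "(g \<circ> ti) l = l" using comp[OF g(1) ti(1)] dg_comp[OF g(1) ti(1)] dti g(2) l(2) by blast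
    then show ?thesis by (simp add: l'_def pw[OF g(1)])
  qed
  have C: "g l = pw (r t) l'" if g: "g \<in> G" "\<not> dg g" for g
  proof -
    have "(t \<circ> g) l = l" using comp[OF t(1) g(1)] dg_comp[OF t(1) g(1)] t(2) g(2) l(2) by blast
    then have "g l = ti l" by (metis comp_apply tti(2))
    then show ?thesis using tl by simp
  qed
  show ?thesis unfolding pcoc_def ind_coc_def l'_def[symmetric]
  proof (intro conjI ballI)
    fix g assume "g \<in> G"
    show "fst (cl l (if dg g then r g else r g = r t), cl l' (if dg g then r' g else r' g = r t)) \<noteq> 0"
      "snd (cl l (if dg g then r g else r g = r t), cl l' (if dg g then r' g else r' g = r t)) \<noteq> 0"
      using l(1) l'n by (simp_all add: cl_nonzero)
  next
    fix g h assume g: "g \<in> G" and h: "h \<in> G"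
    show "(cl l (if dg (g \<circ> h) then r (g \<circ> h) else r (g \<circ> h) = r t), cl l' (if dg (g \<circ> h) then r' (g \<circ> h) else r' (g \<circ> h) = r t)) =
      pmult (cl l (if dg g then r g else r g = r t), cl l' (if dg g then r' g else r' g = r t))
        (pact g (cl l (if dg h then r h else r h = r t), cl l' (if dg h then r' h else r' h = r t)))"
      unfolding dg_comp[OF g h] r_comp[OF g h] r'_comp[OF g h] pmult_def pact_def cl[OF g] fst_conv snd_conv
      using l(1) l'n l(2)[OF g] A[OF g] B[OF g] C[OF g]
      by (cases "dg g"; cases "dg h"; cases "r g"; cases "r' g"; cases "r h"; cases "r' h"; cases "r t")
         (simp_all add: cl_def pw_def)
  qed
qed

lemma ind_coc_mult: "ti \<in> G \<Longrightarrow> ind_coc t ti (l * m) g = pmult (ind_coc t ti l g) (ind_coc t ti m g)"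
  by (simp add: ind_coc_def pmult_def cl_mult mult pw_mult)

lemma diag_coc:
  assumes all: "\<forall>g\<in>G. dg g"
  shows "pcoc d \<longleftrightarrow> (\<forall>g\<in>G. fst (d g) \<noteq> 0) \<and> (\<forall>g\<in>G. \<forall>h\<in>G. fst (d (g \<circ> h)) = fst (d g) * pw (r g) (g (fst (d h)))) \<and>
    (\<forall>g\<in>G. snd (d g) \<noteq> 0) \<and> (\<forall>g\<in>G. \<forall>h\<in>G. snd (d (g \<circ> h)) = snd (d g) * pw (r' g) (g (snd (d h))))"
  unfolding pcoc_def using all by (auto simp: pmult_def pact_def prod_eq_iff)

lemma diag_coh:
  assumes all: "\<forall>g\<in>G. dg g"
  shows "pcoh d d' \<longleftrightarrow> (\<exists>x. x \<noteq> 0 \<and> (\<forall>g\<in>G. fst (d' g) = pw (r g) (g x) / x * fst (d g))) \<and>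
    (\<exists>y. y \<noteq> 0 \<and> (\<forall>g\<in>G. snd (d' g) = pw (r' g) (g y) / y * snd (d g)))"
  unfolding pcoh_def using all by (simp add: pmult_def pcob_def pact_def prod_eq_iff) blast

end

section \<open>Transfer of the cohomology from pairs of units to the torus\<close>

locale monomial_torus = torus_facts K + monomial G dg r r'
  for K :: "'a::field itself" and G :: "('a \<Rightarrow> 'a) set" and dg r r' +
  fixes \<phi> :: "('a \<Rightarrow> 'a) \<Rightarrow> int mat" and \<Gamma> :: "('a \<Rightarrow> 'a) monoid"
  assumes \<Gamma>: "carrier \<Gamma> = G" "monoid.mult \<Gamma> = (\<circ>)"
    and \<phi>: "g \<in> G \<Longrightarrow> \<phi> g \<in> carrier_mat 2 2"
    and pair_act: "\<lbrakk>g \<in> G; x \<noteq> 0; y \<noteq> 0\<rbrakk> \<Longrightarrow> pair_act (\<phi> g) g (x, y) = pact g (x, y)"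
begin

abbreviation TT :: "(int vec \<times> 'a \<Rightarrow>\<^sub>0 int) set monoid" where "TT \<equiv> torus"

lemma pact_nonzero: "\<lbrakk>g \<in> G; x \<noteq> 0; y \<noteq> 0\<rbrakk> \<Longrightarrow> fst (pact g (x, y)) \<noteq> 0 \<and> snd (pact g (x, y)) \<noteq> 0"
  using nonzero[of g] by (auto simp: pact_def)

lemma action: "\<lbrakk>g \<in> G; x \<noteq> 0; y \<noteq> 0\<rbrakk> \<Longrightarrow> torus_action \<phi> g (Q.fib (x, y)) = Q.fib (pact g (x, y))"
proof -
  assume g: "g \<in> G" and xy: "x \<noteq> 0" "y \<noteq> 0"
  have "torus_action \<phi> g (Q.fib (x, y)) = Q.fib (pair_act (\<phi> g) g (x, y))"
    by (rule torus_act_fib[where g = g and \<phi> = \<phi>, OF mult[OF g] one[OF g] zero[OF g] \<phi>[OF g] xy])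
  then show ?thesis unfolding pair_act[OF g xy] .
qed

lemma torus_elem: "m \<in> carrier TT \<Longrightarrow> \<exists>x y. x \<noteq> 0 \<and> y \<noteq> 0 \<and> m = Q.fib (x, y)"
  unfolding torus_simps(1) by auto

lemma fib_torus: "\<lbrakk>x \<noteq> 0; y \<noteq> 0\<rbrakk> \<Longrightarrow> Q.fib (x, y) \<in> carrier TT"
  unfolding torus_simps(1) by auto

sublocale GM: group_module \<Gamma> TT "torus_action \<phi>"
proof -
  interpret T: comm_group TT by (rule comm_group_torus)
  show "group_module \<Gamma> TT (torus_action \<phi>)"
  proof
    fix g m assume g: "g \<in> carrier \<Gamma>" and "m \<in> carrier TT"
    then obtain x y where m: "x \<noteq> 0" "y \<noteq> 0" "m = Q.fib (x, y)" using torus_elem by blast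
    show "torus_action \<phi> g m \<in> carrier TT"
      using action[of g x y] pact_nonzero[of g x y] fib_torus g m \<Gamma>(1) by (cases "pact g (x, y)") simp
    fix n assume "n \<in> carrier TT"
    then obtain u v where n: "u \<noteq> 0" "v \<noteq> 0" "n = Q.fib (u, v)" using torus_elem by blast
    have gG: "g \<in> G" using g \<Gamma>(1) by simp
    have p: "pact g (x * u, y * v) = (fst (pact g (x, y)) * fst (pact g (u, v)), snd (pact g (x, y)) * snd (pact g (u, v)))"
      by (simp add: pact_def mult[OF gG] pw_mult)
    obtain a b where ab: "pact g (x, y) = (a, b)" by fastforce
    obtain a' b' where ab': "pact g (u, v) = (a', b')" by fastforce
    have nz: "a \<noteq> 0" "b \<noteq> 0" "a' \<noteq> 0" "b' \<noteq> 0"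
      using pact_nonzero[OF gG m(1,2)] pact_nonzero[OF gG n(1,2)] ab ab' by auto
    have "torus_action \<phi> g (m \<otimes>\<^bsub>TT\<^esub> n) = Q.fib (pact g (x * u, y * v))"
      unfolding m(3) n(3) torus_simps(2)[OF m(1,2) n(1,2)] using action[OF gG, of "x * u" "y * v"] m n by simp
    also have "\<dots> = Q.fib (a, b) \<otimes>\<^bsub>TT\<^esub> Q.fib (a', b')" unfolding p ab ab' torus_simps(2)[OF nz] by simp
    also have "\<dots> = torus_action \<phi> g m \<otimes>\<^bsub>TT\<^esub> torus_action \<phi> g n"
      unfolding m(3) n(3) action[OF gG m(1,2)] action[OF gG n(1,2)] ab ab' by simp
    finally show "torus_action \<phi> g (m \<otimes>\<^bsub>TT\<^esub> n) = torus_action \<phi> g m \<otimes>\<^bsub>TT\<^esub> torus_action \<phi> g n" .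
  qed
qed

definition "lift d = (\<lambda>g\<in>G. Q.fib (d g))" for d :: "('a \<Rightarrow> 'a) \<Rightarrow> 'a \<times> 'a"

lemma lift_cong: "(\<And>g. g \<in> G \<Longrightarrow> d g = d' g) \<Longrightarrow> lift d = lift d'"
  by (auto simp: lift_def intro: restrict_ext)

lemma fib_mult: "\<lbrakk>fst p \<noteq> 0; snd p \<noteq> 0; fst q \<noteq> 0; snd q \<noteq> 0\<rbrakk> \<Longrightarrow> Q.fib p \<otimes>\<^bsub>TT\<^esub> Q.fib q = Q.fib (pmult p q)"
  using torus_simps(2)[of "fst p" "snd p" "fst q" "snd q"] by (simp add: pmult_def)

lemma fib_eq: "\<lbrakk>fst p \<noteq> 0; snd p \<noteq> 0\<rbrakk> \<Longrightarrow> Q.fib p = Q.fib q \<longleftrightarrow> p = q"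
  using torus_fib_eq[of "fst p" "snd p" "fst q" "snd q"] by (simp add: prod_eq_iff)

lemma action': "\<lbrakk>g \<in> G; fst p \<noteq> 0; snd p \<noteq> 0\<rbrakk> \<Longrightarrow> torus_action \<phi> g (Q.fib p) = Q.fib (pact g p)"
  using action[of g "fst p" "snd p"] by simp

lemma lift_coc:
  assumes nz: "\<And>g. g \<in> G \<Longrightarrow> fst (d g) \<noteq> 0 \<and> snd (d g) \<noteq> 0"
  shows "lift d \<in> cocycles1 \<Gamma> TT (torus_action \<phi>) \<longleftrightarrow> pcoc d"
proof -
  have "lift d \<in> G \<rightarrow>\<^sub>E carrier TT"
  proof -
    have "Q.fib (d g) \<in> carrier TT" if "g \<in> G" for g
      using fib_torus[of "fst (d g)" "snd (d g)"] nz[OF that] by simp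
    then show ?thesis unfolding lift_def by auto
  qed
  moreover have "lift d (g \<circ> h) = lift d g \<otimes>\<^bsub>TT\<^esub> torus_action \<phi> g (lift d h) \<longleftrightarrow> d (g \<circ> h) = pmult (d g) (pact g (d h))"
    if g: "g \<in> G" and h: "h \<in> G" for g h
  proof -
    have p: "fst (pact g (d h)) \<noteq> 0" "snd (pact g (d h)) \<noteq> 0" using pact_nonzero[OF g, of "fst (d h)" "snd (d h)"] nz[OF h] by auto
    have "lift d g \<otimes>\<^bsub>TT\<^esub> torus_action \<phi> g (lift d h) = Q.fib (pmult (d g) (pact g (d h)))"
    proof -
      have "lift d g = Q.fib (d g)" "lift d h = Q.fib (d h)" using g h by (simp_all add: lift_def)
      then show ?thesis using action'[OF g, of "d h"] fib_mult[of "d g" "pact g (d h)"] nz[OF g] nz[OF h] p by metis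
    qed
    then show ?thesis using fib_eq[of "d (g \<circ> h)"] nz[OF comp[OF g h]] comp[OF g h] by (simp add: lift_def)
  qed
  ultimately show ?thesis using nz by (simp add: cocycles1_def \<Gamma> pcoc_def)
qed

lemma pcoc_nonzero: "\<lbrakk>pcoc d; g \<in> G\<rbrakk> \<Longrightarrow> fst (d g) \<noteq> 0 \<and> snd (d g) \<noteq> 0"
  by (simp add: pcoc_def)

lemma cocycle_lift:
  assumes f: "f \<in> cocycles1 \<Gamma> TT (torus_action \<phi>)" shows "\<exists>d. pcoc d \<and> f = lift d"
proof -
  have fc: "f \<in> G \<rightarrow>\<^sub>E carrier TT" using f by (simp add: cocycles1_def \<Gamma>)
  have "\<forall>g\<in>G. \<exists>p. fst p \<noteq> 0 \<and> snd p \<noteq> 0 \<and> f g = Q.fib p"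
  proof
    fix g assume "g \<in> G"
    then have "f g \<in> carrier TT" using fc by auto
    then show "\<exists>p. fst p \<noteq> 0 \<and> snd p \<noteq> 0 \<and> f g = Q.fib p" using torus_elem by (metis fst_conv snd_conv)
  qed
  then obtain d where d: "\<And>g. g \<in> G \<Longrightarrow> fst (d g) \<noteq> 0 \<and> snd (d g) \<noteq> 0 \<and> f g = Q.fib (d g)" by metis
  have "f = lift d" unfolding lift_def using fc d by (intro ext) (auto simp: PiE_def extensional_def)
  then show ?thesis using lift_coc[of d] d f by blast
qed

lemma cob_lift: "\<lbrakk>x \<noteq> 0; y \<noteq> 0\<rbrakk> \<Longrightarrow> GM.cob (Q.fib (x, y)) = lift (pcob x y)"
  unfolding GM.cob_def lift_def \<Gamma>
proof (rule restrict_ext)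
  fix g assume xy: "x \<noteq> 0" "y \<noteq> 0" and g: "g \<in> G"
  show "torus_action \<phi> g (Q.fib (x, y)) \<otimes>\<^bsub>TT\<^esub> inv\<^bsub>TT\<^esub> (Q.fib (x, y)) = Q.fib (pcob x y g)"
    unfolding action[OF g xy] torus_inv[OF xy] using fib_mult[of "pact g (x, y)" "(inverse x, inverse y)"] pact_nonzero[OF g xy] xy
    by (simp add: pmult_def pcob_def divide_inverse)
qed

lemma pmul_lift:
  assumes "\<And>g. g \<in> G \<Longrightarrow> fst (d g) \<noteq> 0 \<and> snd (d g) \<noteq> 0" "\<And>g. g \<in> G \<Longrightarrow> fst (d' g) \<noteq> 0 \<and> snd (d' g) \<noteq> 0"
  shows "GM.pmul (lift d) (lift d') = lift (\<lambda>g. pmult (d g) (d' g))"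
  unfolding GM.pmul_def \<Gamma> lift_def
proof (rule restrict_ext)
  fix g assume g: "g \<in> G"
  have "Q.fib (d g) \<otimes>\<^bsub>TT\<^esub> Q.fib (d' g) = Q.fib (pmult (d g) (d' g))"
    by (rule fib_mult) (use assms g in auto)
  then show "(\<lambda>g\<in>G. Q.fib (d g)) g \<otimes>\<^bsub>TT\<^esub> (\<lambda>g\<in>G. Q.fib (d' g)) g = Q.fib (pmult (d g) (d' g))"
    using g by simp
qed

lemma pcoh_iff:
  assumes d: "pcoc d" and d': "pcoc d'"
  shows "(\<exists>m\<in>carrier TT. lift d' = GM.pmul (GM.cob m) (lift d)) \<longleftrightarrow> pcoh d d'"
proof -
  have e: "lift d' = GM.pmul (GM.cob (Q.fib (x, y))) (lift d) \<longleftrightarrow> (\<forall>g\<in>G. d' g = pmult (pcob x y g) (d g))"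
    if xy: "x \<noteq> 0" "y \<noteq> 0" for x y
  proof -
    have "GM.pmul (GM.cob (Q.fib (x, y))) (lift d) = lift (\<lambda>g. pmult (pcob x y g) (d g))"
      unfolding cob_lift[OF xy] by (rule pmul_lift) (use pcob_nonzero xy pcoc_nonzero[OF d] in auto)
    moreover have "lift d' = lift u \<longleftrightarrow> (\<forall>g\<in>G. d' g = u g)" for u
    proof
      assume l: "lift d' = lift u"
      show "\<forall>g\<in>G. d' g = u g"
      proof
        fix g assume g: "g \<in> G"
        then have "Q.fib (d' g) = Q.fib (u g)" using fun_cong[OF l, of g] by (simp add: lift_def)
        then show "d' g = u g" using fib_eq pcoc_nonzero[OF d' g] by blast
      qed
    qed (rule lift_cong, blast)
    ultimately show ?thesis by simp
  qed
  show ?thesis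
  proof
    assume "\<exists>m\<in>carrier TT. lift d' = GM.pmul (GM.cob m) (lift d)"
    then obtain m where m: "m \<in> carrier TT" "lift d' = GM.pmul (GM.cob m) (lift d)" by blast
    obtain x y where xy: "x \<noteq> 0" "y \<noteq> 0" "m = Q.fib (x, y)" using torus_elem[OF m(1)] by blast
    then show "pcoh d d'" unfolding pcoh_def using e[OF xy(1,2)] m(2) by blast
  next
    assume "pcoh d d'"
    then obtain x y where xy: "x \<noteq> 0" "y \<noteq> 0" "\<forall>g\<in>G. d' g = pmult (pcob x y g) (d g)" unfolding pcoh_def by blast
    then show "\<exists>m\<in>carrier TT. lift d' = GM.pmul (GM.cob m) (lift d)" using e[OF xy(1,2)] fib_torus[OF xy(1,2)] by blast
  qed
qed

lemma torus_H1_iso: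
  assumes p: "\<And>s. s \<in> S \<Longrightarrow> pcoc (p s)" and q: "q ` S = carrier Y"
    and all: "\<And>d. pcoc d \<Longrightarrow> \<exists>s\<in>S. pcoh (p s) d"
    and eq: "\<And>s t. \<lbrakk>s \<in> S; t \<in> S\<rbrakk> \<Longrightarrow> pcoh (p s) (p t) \<longleftrightarrow> q s = q t"
    and mu: "\<And>s t. \<lbrakk>s \<in> S; t \<in> S\<rbrakk> \<Longrightarrow> mu s t \<in> S \<and> (\<forall>g\<in>G. p (mu s t) g = pmult (p s g) (p t g)) \<and> q (mu s t) = q s \<otimes>\<^bsub>Y\<^esub> q t"
  shows "H1 \<Gamma> TT (torus_action \<phi>) \<cong> Y"
proof (rule GM.H1_iso[of S "\<lambda>s. lift (p s)" q Y mu])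
  show "lift (p s) \<in> cocycles1 \<Gamma> TT (torus_action \<phi>)" if "s \<in> S" for s
    using lift_coc[of "p s"] pcoc_nonzero[OF p[OF that]] p[OF that] by blast
  show "\<exists>s\<in>S. \<exists>m\<in>carrier TT. f = GM.pmul (GM.cob m) (lift (p s))" if f: "f \<in> cocycles1 \<Gamma> TT (torus_action \<phi>)" for f
  proof -
    obtain d where d: "pcoc d" "f = lift d" using cocycle_lift[OF f] by blast
    obtain s where s: "s \<in> S" "pcoh (p s) d" using all[OF d(1)] by blast
    then show ?thesis using pcoh_iff[OF p[OF s(1)] d(1)] d(2) by blast
  qed
  show "(\<exists>m\<in>carrier TT. lift (p t) = GM.pmul (GM.cob m) (lift (p s))) \<longleftrightarrow> q s = q t" if "s \<in> S" "t \<in> S" for s t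
    using pcoh_iff[OF p p] eq that by simp
  fix s t assume st: "s \<in> S" "t \<in> S"
  have "lift (p (mu s t)) = lift (\<lambda>g. pmult (p s g) (p t g))" using mu[OF st] by (intro lift_cong) blast
  also have "\<dots> = GM.pmul (lift (p s)) (lift (p t))"
    by (rule pmul_lift[symmetric]) (use pcoc_nonzero p st in blast)+
  finally show "mu s t \<in> S \<and> lift (p (mu s t)) = GM.pmul (lift (p s)) (lift (p t)) \<and> q (mu s t) = q s \<otimes>\<^bsub>Y\<^esub> q t"
    using mu[OF st] by blast
qed (rule q)

lemma pcoc_one: "pcoc (\<lambda>_. (1, 1))"
  by (auto simp: pcoc_def pmult_def pact_def one)

lemma torus_H1_trivial:
  assumes "\<And>d. pcoc d \<Longrightarrow> pcoh (\<lambda>_. (1, 1)) d"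
  shows "trivial_group (H1 \<Gamma> TT (torus_action \<phi>))"
proof (rule GM.H1_trivial)
  have c1: "GM.cob \<one>\<^bsub>TT\<^esub> = lift (\<lambda>_. (1, 1))"
    unfolding torus_simps(3) using cob_lift[of 1 1] lift_cong[of "pcob 1 1" "\<lambda>_. (1, 1)"] by (simp add: pcob_def pact_def one)
  then show "GM.cob \<one>\<^bsub>TT\<^esub> \<in> cocycles1 \<Gamma> TT (torus_action \<phi>)" using lift_coc[of "\<lambda>_. (1, 1)"] pcoc_one by simp
  fix f assume f: "f \<in> cocycles1 \<Gamma> TT (torus_action \<phi>)"
  obtain d where d: "pcoc d" "f = lift d" using cocycle_lift[OF f] by blast
  obtain m where m: "m \<in> carrier TT" "f = GM.pmul (GM.cob m) (lift (\<lambda>_. (1, 1)))"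
    using pcoh_iff[OF pcoc_one d(1)] assms[OF d(1)] d(2) by blast
  have "f = GM.cob m" unfolding m(2) c1[symmetric] using GM.cob_mult[OF m(1) GM.M.one_closed] m(1) by simp
  then show "\<exists>m\<in>carrier TT. f = GM.cob m" using m(1) by blast
qed

text \<open>Diagonal elements preserve the first coordinate line, so restriction and projection
  yield a cocycle for the single character \<open>r\<close>.\<close>

lemma fst_coc:
  assumes "rank1 {g \<in> G. dg g} r c" and d: "pcoc d"
  shows "rank1.coc {g \<in> G. dg g} r (\<lambda>g. fst (d g))"
proof -
  interpret R: rank1 "{g \<in> G. dg g}" r c by fact
  show ?thesis unfolding R.coc_def using d by (auto simp: pcoc_def pmult_def pact_def)
qed

text \<open>The parameters are the units \<open>l\<close> of the fixed field of the diagonal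
  subgroup. Two induced cocycles are cohomologous exactly when the parameters differ by a norm from
  the fixed field of the kernel of \<open>r\<close>, and this is also when the quaternion algebras
  have the same class.\<close>

lemma shapiro_H1:
  assumes R: "rank1 {g \<in> G. dg g} r c" and t: "t \<in> G" "\<not> dg t" and s: "s \<in> G" "dg s" "\<not> r s"
  shows "H1 \<Gamma> TT (torus_action \<phi>) \<cong> Br (auts.fixed {g \<in> G. dg g}) (rank1.E {g \<in> G. dg g} r)"
proof -
  interpret R: rank1 "{g \<in> G. dg g}" r c by (rule R)
  have sH: "s \<in> {g \<in> G. dg g}" using s by simp
  obtain om where "quad R.fixed R.E s om" using R.quad_ext[OF sH s(3)] by blast
  then interpret B: quad R.fixed R.E s om .
  obtain ti where ti: "ti \<in> G" "t \<circ> ti = id" "ti \<circ> t = id" using inverses[OF t(1)] by blast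
  let ?S = "{l \<in> R.fixed. l \<noteq> 0}"
  have pc: "pcoc (ind_coc t ti l)" if "l \<in> ?S" for l
    by (rule ind_coc_pcoc[OF t ti]) (use that in \<open>auto simp: R.fixed_def\<close>)
  have coh: "pcoh (ind_coc t ti l) d \<longleftrightarrow> (\<exists>x. x \<noteq> 0 \<and> (\<forall>h\<in>{g \<in> G. dg g}. fst (d h) = R.twist_by x h * cl l (r h)))"
    if "l \<in> ?S" "pcoc d" for l d
    unfolding shapiro_iff[OF pc[OF that(1)] that(2) t] by (auto simp: R.twist_by_def ind_coc_def)
  show ?thesis
  proof (rule torus_H1_iso[of ?S "ind_coc t ti" B.br _ "(*)"])
    show "pcoc (ind_coc t ti l)" if "l \<in> ?S" for l by (rule pc[OF that])
    show "B.br ` ?S = carrier (Br R.fixed R.E)" using B.br_in_Br B.Br_surj by blast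
    show "\<exists>l\<in>?S. pcoh (ind_coc t ti l) d" if d: "pcoc d" for d
      using R.nontrivial_character[OF fst_coc[OF R d] sH s(3)] coh[OF _ d] by blast
    show "pcoh (ind_coc t ti l) (ind_coc t ti m) \<longleftrightarrow> B.br l = B.br m" if lm: "l \<in> ?S" "m \<in> ?S" for l m
    proof -
      have "fst (ind_coc t ti m h) = cl m (r h)" if "h \<in> {g \<in> G. dg g}" for h using that by (simp add: ind_coc_def)
      then show ?thesis unfolding coh[OF lm(1) pc[OF lm(2)]]
        using R.character_eq_iff[OF sH s(3), of l m] B.br_eq_iff[of l m] lm by simp
    qed
    show "l * m \<in> ?S \<and> (\<forall>g\<in>G. ind_coc t ti (l * m) g = pmult (ind_coc t ti l g) (ind_coc t ti m g)) \<and> B.br (l * m) = B.br l \<otimes>\<^bsub>Br R.fixed R.E\<^esub> B.br m"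
      if lm: "l \<in> ?S" "m \<in> ?S" for l m
      using lm B.br_mult[of l m] ind_coc_mult[OF ti(1)] R.fixed_mult by simp
  qed
qed

lemma shapiro_H1_trivial:
  assumes R: "rank1 {g \<in> G. dg g} r c" and t: "t \<in> G" "\<not> dg t" and all: "\<And>g. \<lbrakk>g \<in> G; dg g\<rbrakk> \<Longrightarrow> r g"
  shows "trivial_group (H1 \<Gamma> TT (torus_action \<phi>))"
proof (rule torus_H1_trivial)
  interpret R: rank1 "{g \<in> G. dg g}" r c by (rule R)
  fix d assume d: "pcoc d"
  obtain x where "x \<noteq> 0" "\<forall>g\<in>{g \<in> G. dg g}. fst (d g) = R.twist_by x g"
    using R.trivial_character[OF fst_coc[OF R d]] all by blast
  then show "pcoh (\<lambda>_. (1, 1)) d"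
    unfolding shapiro_iff[OF pcoc_one d t] by (auto simp: R.twist_by_def)
qed

text \<open>Over a diagonal group the coordinates decouple, and each contributes the units modulo
  norms for its own character. The two quadratic extensions may be different.\<close>

lemma diag_H1:
  assumes R: "rank1 G r c" and R': "rank1 G r' c'" and all: "\<forall>g\<in>G. dg g"
    and s: "s \<in> G" "\<not> r s" and s': "s' \<in> G" "\<not> r' s'"
  shows "H1 \<Gamma> TT (torus_action \<phi>) \<cong> Br (auts.fixed G) (rank1.E G r) \<times>\<times> Br (auts.fixed G) (rank1.E G r')"
proof -
  interpret R: rank1 G r c by (rule R)
  interpret R': rank1 G r' c' by (rule R')
  obtain om where "quad fixed R.E s om" using R.quad_ext[OF s] by blast
  then interpret B: quad fixed R.E s om .
  obtain om' where "quad fixed R'.E s' om'" using R'.quad_ext[OF s'] by blast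
  then interpret B': quad fixed R'.E s' om' .
  let ?L = "{l \<in> fixed. l \<noteq> 0}"
  let ?p = "\<lambda>l g. (cl (fst l) (r g), cl (snd l) (r' g))"
  let ?q = "\<lambda>l. (B.br (fst l), B'.br (snd l))"
  have cc: "pcoc d \<longleftrightarrow> R.coc (\<lambda>g. fst (d g)) \<and> R'.coc (\<lambda>g. snd (d g))" for d
    unfolding diag_coc[OF all] R.coc_def R'.coc_def by blast
  have ch: "pcoh d d' \<longleftrightarrow> (\<exists>x. x \<noteq> 0 \<and> (\<forall>g\<in>G. fst (d' g) = R.twist_by x g * fst (d g))) \<and>
    (\<exists>y. y \<noteq> 0 \<and> (\<forall>g\<in>G. snd (d' g) = R'.twist_by y g * snd (d g)))" for d d'
    unfolding diag_coh[OF all] R.twist_by_def R'.twist_by_def by blast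
  show ?thesis
  proof (rule torus_H1_iso[of "?L \<times> ?L" ?p ?q _ "\<lambda>l m. (fst l * fst m, snd l * snd m)"])
    show "pcoc (?p l)" if "l \<in> ?L \<times> ?L" for l unfolding cc using R.coc_cl R'.coc_cl that by auto
    have "B.br ` ?L = carrier (Br fixed R.E)" using B.br_in_Br B.Br_surj by blast
    moreover have "B'.br ` ?L = carrier (Br fixed R'.E)" using B'.br_in_Br B'.Br_surj by blast
    moreover have "?q ` (?L \<times> ?L) = (B.br ` ?L) \<times> (B'.br ` ?L)" by force
    ultimately show "?q ` (?L \<times> ?L) = carrier (Br fixed R.E \<times>\<times> Br fixed R'.E)" by simp
    show "\<exists>l\<in>?L \<times> ?L. pcoh (?p l) d" if d: "pcoc d" for d
    proof -
      obtain x l where 1: "x \<noteq> 0" "l \<in> ?L" "\<forall>g\<in>G. fst (d g) = R.twist_by x g * cl l (r g)"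
        using R.nontrivial_character[of "\<lambda>g. fst (d g)", OF _ s] d cc[of d] by blast
      obtain x' l' where 2: "x' \<noteq> 0" "l' \<in> ?L" "\<forall>g\<in>G. snd (d g) = R'.twist_by x' g * cl l' (r' g)"
        using R'.nontrivial_character[of "\<lambda>g. snd (d g)", OF _ s'] d cc[of d] by blast
      have "pcoh (?p (l, l')) d" unfolding ch using 1 2 by auto
      then show ?thesis using 1(2) 2(2) by blast
    qed
    show "pcoh (?p l) (?p m) \<longleftrightarrow> ?q l = ?q m" if lm: "l \<in> ?L \<times> ?L" "m \<in> ?L \<times> ?L" for l m
      unfolding ch
      using R.character_eq_iff[OF s, of "fst l" "fst m"] B.br_eq_iff[of "fst l" "fst m"]
        R'.character_eq_iff[OF s', of "snd l" "snd m"] B'.br_eq_iff[of "snd l" "snd m"] lm by auto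
    show "(fst l * fst m, snd l * snd m) \<in> ?L \<times> ?L \<and> (\<forall>g\<in>G. ?p (fst l * fst m, snd l * snd m) g = pmult (?p l g) (?p m g)) \<and>
      ?q (fst l * fst m, snd l * snd m) = ?q l \<otimes>\<^bsub>Br fixed R.E \<times>\<times> Br fixed R'.E\<^esub> ?q m"
      if lm: "l \<in> ?L \<times> ?L" "m \<in> ?L \<times> ?L" for l m
      using lm B.br_mult[of "fst l" "fst m"] B'.br_mult[of "snd l" "snd m"] fixed_mult by (auto simp: cl_mult pmult_def)
  qed
qed

text \<open>The first coordinate carries the trivial character and contributes nothing, by Hilbert
  90.\<close>

lemma half_diag_H1:
  assumes R: "rank1 G r c" and R': "rank1 G r' c'" and all: "\<And>g. g \<in> G \<Longrightarrow> dg g \<and> r g"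
    and s': "s' \<in> G" "\<not> r' s'"
  shows "H1 \<Gamma> TT (torus_action \<phi>) \<cong> Br (auts.fixed G) (rank1.E G r')"
proof -
  interpret R: rank1 G r c by (rule R)
  interpret R': rank1 G r' c' by (rule R')
  obtain om' where "quad fixed R'.E s' om'" using R'.quad_ext[OF s'] by blast
  then interpret B': quad fixed R'.E s' om' .
  have dg: "\<forall>g\<in>G. dg g" and rr: "\<forall>g\<in>G. r g" using all by auto
  let ?L = "{l \<in> fixed. l \<noteq> 0}"
  let ?p = "\<lambda>l g. (1, cl l (r' g))"
  have cc: "pcoc d \<longleftrightarrow> R.coc (\<lambda>g. fst (d g)) \<and> R'.coc (\<lambda>g. snd (d g))" for d
    unfolding diag_coc[OF dg] R.coc_def R'.coc_def by blast
  have ch: "pcoh d d' \<longleftrightarrow> (\<exists>x. x \<noteq> 0 \<and> (\<forall>g\<in>G. fst (d' g) = R.twist_by x g * fst (d g))) \<and>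
    (\<exists>y. y \<noteq> 0 \<and> (\<forall>g\<in>G. snd (d' g) = R'.twist_by y g * snd (d g)))" for d d'
    unfolding diag_coh[OF dg] R.twist_by_def R'.twist_by_def by blast
  have R1: "R.coc (\<lambda>g. 1)" by (simp add: R.coc_def one)
  have x1: "\<exists>x. x \<noteq> 0 \<and> (\<forall>g\<in>G. 1 = R.twist_by x g)" by (intro exI[of _ 1]) (simp add: R.twist_by_def one)
  show ?thesis
  proof (rule torus_H1_iso[of ?L ?p B'.br _ "(*)"])
    show "pcoc (?p l)" if "l \<in> ?L" for l unfolding cc using R1 R'.coc_cl that by auto
    show "B'.br ` ?L = carrier (Br fixed R'.E)" using B'.br_in_Br B'.Br_surj by blast
    show "\<exists>l\<in>?L. pcoh (?p l) d" if d: "pcoc d" for d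
    proof -
      obtain x where 1: "x \<noteq> 0" "\<forall>g\<in>G. fst (d g) = R.twist_by x g"
        using R.trivial_character[of "\<lambda>g. fst (d g)", OF _ rr] d cc[of d] by blast
      obtain x' l' where 2: "x' \<noteq> 0" "l' \<in> ?L" "\<forall>g\<in>G. snd (d g) = R'.twist_by x' g * cl l' (r' g)"
        using R'.nontrivial_character[of "\<lambda>g. snd (d g)", OF _ s'] d cc[of d] by blast
      have "pcoh (?p l') d" unfolding ch using 1 2 by auto
      then show ?thesis using 2(2) by blast
    qed
    show "pcoh (?p l) (?p m) \<longleftrightarrow> B'.br l = B'.br m" if lm: "l \<in> ?L" "m \<in> ?L" for l m
      unfolding ch using x1 R'.character_eq_iff[OF s', of l m] B'.br_eq_iff[of l m] lm by auto
    show "l * m \<in> ?L \<and> (\<forall>g\<in>G. ?p (l * m) g = pmult (?p l g) (?p m g)) \<and> B'.br (l * m) = B'.br l \<otimes>\<^bsub>Br fixed R'.E\<^esub> B'.br m"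
      if lm: "l \<in> ?L" "m \<in> ?L" for l m
      using lm B'.br_mult[of l m] fixed_mult by (auto simp: cl_mult pmult_def)
  qed
qed

lemma diag_H1_trivial:
  assumes R: "rank1 G r c" and R': "rank1 G r' c'" and all: "\<And>g. g \<in> G \<Longrightarrow> dg g \<and> r g \<and> r' g"
  shows "trivial_group (H1 \<Gamma> TT (torus_action \<phi>))"
proof (rule torus_H1_trivial)
  interpret R: rank1 G r c by (rule R)
  interpret R': rank1 G r' c' by (rule R')
  have dg: "\<forall>g\<in>G. dg g" and rr: "\<forall>g\<in>G. r g" "\<forall>g\<in>G. r' g" using all by auto
  fix d assume d: "pcoc d"
  have "R.coc (\<lambda>g. fst (d g))" "R'.coc (\<lambda>g. snd (d g))"
    using d unfolding diag_coc[OF dg] R.coc_def R'.coc_def by blast+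
  then show "pcoh (\<lambda>_. (1, 1)) d"
    using R.trivial_character[of "\<lambda>g. fst (d g)", OF _ rr(1)] R'.trivial_character[of "\<lambda>g. snd (d g)", OF _ rr(2)]
    unfolding diag_coh[OF dg] R.twist_by_def R'.twist_by_def by simp
qed

end

section \<open>The finite subgroups and the theorem\<close>

definition sgnb :: "bool \<Rightarrow> int" where "sgnb b = (if b then 1 else - 1)"

text \<open>Every group in question consists of signed permutation matrices. Coding these by three
  Booleans turns matrix products and inverses into Boolean identities.\<close>

definition spm :: "bool \<Rightarrow> bool \<Rightarrow> bool \<Rightarrow> int mat" where
  "spm d r r' = (if d then mat2 (sgnb r) 0 0 (sgnb r') else mat2 0 (sgnb r) (sgnb r') 0)"

lemma spm_eq_iff: "spm d r r' = spm e s s' \<longleftrightarrow> d = e \<and> r = s \<and> r' = s'"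
  by (auto simp: spm_def mat2_eq_iff sgnb_def)

lemma spm_mult: "spm d r r' * spm e s s' = spm (d = e) (r = (if d then s else s')) (r' = (if d then s' else s))"
  by (cases d; cases r; cases r'; cases e; cases s; cases s') (simp_all add: spm_def mat2_mult sgnb_def)

lemma spm_carrier: "spm d r r' \<in> carrier_mat 2 2"
  by (auto simp: spm_def)

lemma spm_one: "1\<^sub>m 2 = spm True True True"
  by (simp add: spm_def sgnb_def mat2_one)

lemma rows2: "mat_of_rows_list 2 [[a, b], [c, d]] = mat2 a b c d"
  by (rule eq_matI) (auto simp: mat2_def mat_of_rows_list_def less_2_cases_iff)

lemma uminus_mat2: "- mat2 a b c d = mat2 (- a) (- b) (- c) (- (d :: int))"
  by (rule eq_matI) (auto simp: mat2_def less_2_cases_iff)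

lemma matrices_spm:
  "matI = spm True True True" "matB = spm False False True" "matC = spm True True False" "matJ = spm False True True"
  "- spm d r r' = spm d (\<not> r) (\<not> r')"
  by (simp_all add: matI_def matB_def matC_def matJ_def rows2 mat2_one uminus_mat2 spm_def sgnb_def)

lemma GL2Z_simps: "monoid.mult GL2Z = (*)" "one GL2Z = spm True True True"
  by (simp_all add: GL2Z_def units_of_mult units_of_one ring_mat_def spm_one)

lemma spm_GL2Z: "spm d r r' \<in> carrier GL2Z"
proof -
  have "spm d r r' * spm d (if d then r else r') (if d then r' else r) = 1\<^sub>m 2"
    "spm d (if d then r else r') (if d then r' else r) * spm d r r' = 1\<^sub>m 2"
    by (auto simp: spm_mult spm_one spm_eq_iff)
  then show ?thesis using spm_carrier
    unfolding GL2Z_def units_of_carrier Units_def ring_mat_def by auto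
qed

lemma group_GL2Z: "Group.group GL2Z"
proof -
  interpret R: Ring.ring "ring_mat TYPE(int) 2 ()" by (rule ring_mat)
  show ?thesis unfolding GL2Z_def by (rule R.units_group)
qed

lemma spm_inv: "inv\<^bsub>GL2Z\<^esub> (spm d r r') = spm d (if d then r else r') (if d then r' else r)"
  by (rule group.inv_equality[OF group_GL2Z _ spm_GL2Z spm_GL2Z])
     (auto simp: GL2Z_simps spm_mult spm_eq_iff)

text \<open>The subgroup axioms, translated to the Boolean code, bound the generated group from
  above; explicit words in the generators, supplied through \<open>ex\<close>, bound it from
  below.\<close>

lemma generate_spm:
  assumes X: "T \<subseteq> {spm d r r' | d r r'. A d r r'}"
    and one: "A True True True"
    and inv: "\<And>d r r'. A d r r' \<Longrightarrow> A d (if d then r else r') (if d then r' else r)"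
    and mult: "\<And>d r r' e s s'. \<lbrakk>A d r r'; A e s s'\<rbrakk> \<Longrightarrow> A (d = e) (r = (if d then s else s')) (r' = (if d then s' else s))"
    and ex: "\<And>d r r'. A d r r' \<Longrightarrow> spm d r r' \<in> generate GL2Z T"
  shows "generate GL2Z T = {spm d r r' | d r r'. A d r r'}"
proof
  have mem: "A d r r' \<Longrightarrow> spm d r r' \<in> {spm d r r' | d r r'. A d r r'}" for d r r' by blast
  show "generate GL2Z T \<subseteq> {spm d r r' | d r r'. A d r r'}"
  proof
    fix M assume "M \<in> generate GL2Z T"
    then show "M \<in> {spm d r r' | d r r'. A d r r'}"
    proof induction
      case one
      then show ?case using assms(2) by (auto simp: GL2Z_simps)
    next
      case (incl h)
      then show ?case using X by blast
    next
      case (inv h)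
      then obtain d r r' where "h = spm d r r'" "A d r r'" using X by blast
      then show ?case unfolding \<open>h = _\<close> spm_inv by (intro mem assms(3))
    next
      case (eng h1 h2)
      then obtain d r r' e s s' where "h1 = spm d r r'" "A d r r'" "h2 = spm e s s'" "A e s s'" by blast
      then show ?case unfolding GL2Z_simps \<open>h1 = _\<close> \<open>h2 = _\<close> spm_mult by (intro mem mult)
    qed
  qed
qed (use ex in blast)

lemma generate_mult: "\<lbrakk>M \<in> generate GL2Z T; N \<in> generate GL2Z T\<rbrakk> \<Longrightarrow> M * N \<in> generate GL2Z T"
  using generate.eng[of M GL2Z T N] by (simp add: GL2Z_simps)

lemma generate_one: "spm True True True \<in> generate GL2Z T"
  using generate.one[of GL2Z T] by (simp add: GL2Z_simps)

lemma generate_in: "M \<in> T \<Longrightarrow> M \<in> generate GL2Z T"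
  by (rule generate.incl)

lemma D8_spm: "D8 = {spm d r r' | d r r'. True}"
  unfolding D8_def
proof (rule generate_spm)
  let ?g = "generate GL2Z {matB, matJ}"
  fix d r r'
  have B: "spm False False True \<in> ?g" and J: "spm False True True \<in> ?g"
    using generate_in[of _ "{matB, matJ}"] by (simp_all add: matrices_spm)
  have 1: "spm True True False \<in> ?g" "spm True False True \<in> ?g" "spm True False False \<in> ?g"
    using generate_mult[OF J B] generate_mult[OF B J] generate_mult[OF B B] by (simp_all add: spm_mult)
  have 2: "spm False True False \<in> ?g" "spm False False False \<in> ?g"
    using generate_mult[OF 1(3) B] generate_mult[OF 1(3) J] by (simp_all add: spm_mult)
  show "spm d r r' \<in> ?g"
    using B J 1 2 generate_one by (cases d; cases r; cases r') simp_all
qed (auto simp: matrices_spm spm_eq_iff)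

lemma D4_spm: "D4 = {spm d r r' | d r r'. d}"
  unfolding D4_def
proof (rule generate_spm)
  let ?g = "generate GL2Z {- matI, matC}"
  fix d r r' :: bool assume d
  have 1: "spm True False False \<in> ?g" "spm True True False \<in> ?g"
    using generate_in[of _ "{- matI, matC}"] by (simp_all add: matrices_spm)
  have 2: "spm True False True \<in> ?g"
    using generate_mult[OF 1] by (simp add: spm_mult)
  show "spm d r r' \<in> ?g"
    using 1 2 generate_one \<open>d\<close> by (cases r; cases r') simp_all
qed (auto simp: matrices_spm spm_eq_iff)

lemma D4'_spm: "D4' = {spm d r r' | d r r'. r = r'}"
  unfolding D4'_def
proof (rule generate_spm)
  let ?g = "generate GL2Z {- matI, matJ}"
  fix d r r' :: bool assume "r = r'"
  have 1: "spm True False False \<in> ?g" "spm False True True \<in> ?g"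
    using generate_in[of _ "{- matI, matJ}"] by (simp_all add: matrices_spm)
  have 2: "spm False False False \<in> ?g"
    using generate_mult[OF 1] by (simp add: spm_mult)
  show "spm d r r' \<in> ?g"
    using 1 2 generate_one \<open>r = r'\<close> by (cases d; cases r) simp_all
qed (auto simp: matrices_spm spm_eq_iff)

text \<open>The condition singles out determinant 1: equal signs on the diagonal, or opposite signs
  off it.\<close>

lemma C4_spm: "C4 = {spm d r r' | d r r'. d = (r = r')}"
  unfolding C4_def
proof (rule generate_spm)
  let ?g = "generate GL2Z {matB}"
  fix d r r' :: bool assume "d = (r = r')"
  have 1: "spm False False True \<in> ?g"
    using generate_in[of _ "{matB}"] by (simp add: matrices_spm)
  have 2: "spm True False False \<in> ?g"
    using generate_mult[OF 1 1] by (simp add: spm_mult)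
  have 3: "spm False True False \<in> ?g"
    using generate_mult[OF 2 1] by (simp add: spm_mult)
  show "spm d r r' \<in> ?g"
    using 1 2 3 generate_one \<open>d = (r = r')\<close> by (cases r; cases r') simp_all
qed (auto simp: matrices_spm spm_eq_iff)

lemma small_groups_spm:
  "D2 = {spm d r r' | d r r'. d \<and> r}" "D2' = {spm d r r' | d r r'. r \<and> r'}"
  "C2 = {spm d r r' | d r r'. d \<and> r = r'}" "C1 = {spm d r r' | d r r'. d \<and> r \<and> r'}"
  "D2_conj = {spm d r r' | d r r'. d \<and> r'}"
proof -
  have g: "spm d r r' \<in> generate GL2Z {M}" if "spm d r r' = M \<or> (d \<and> r \<and> r')" for d r r' M
    using that generate_in[of _ "{M}"] generate_one by auto
  show "D2 = {spm d r r' | d r r'. d \<and> r}" unfolding D2_def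
    by (rule generate_spm) (auto simp: matrices_spm spm_eq_iff intro: g)
  show "D2' = {spm d r r' | d r r'. r \<and> r'}" unfolding D2'_def
    by (rule generate_spm) (auto simp: matrices_spm spm_eq_iff intro: g)
  show "C2 = {spm d r r' | d r r'. d \<and> r = r'}" unfolding C2_def
    by (rule generate_spm) (auto simp: matrices_spm spm_eq_iff intro: g)
  show "C1 = {spm d r r' | d r r'. d \<and> r \<and> r'}" unfolding C1_def
    by (rule generate_spm) (auto simp: matrices_spm spm_eq_iff intro: g)
  show "D2_conj = {spm d r r' | d r r'. d \<and> r'}" unfolding D2_conj_def
    by (rule generate_spm) (auto simp: matrices_spm spm_eq_iff intro: g)
qed

section \<open>The Galois group as a group of signed permutations\<close>

lemma Gal_simps: "monoid.mult (Gal k) = (\<circ>)" "one (Gal k) = id"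
  by (simp_all add: Gal_def)

lemma auts_Gal: "auts (carrier (Gal (k :: 'a::field set)))"
proof -
  have iff: "g \<in> carrier (Gal k) \<longleftrightarrow> bij g \<and> g 1 = 1 \<and> (\<forall>x y. g (x + y) = g x + g y) \<and> (\<forall>x y. g (x * y) = g x * g y) \<and> (\<forall>x\<in>k. g x = x)"
    for g :: "'a \<Rightarrow> 'a"
    by (auto simp: Gal_def ring_iso_def Ring.ring_hom_def fld_def)
  show ?thesis
  proof
    fix g h assume "g \<in> carrier (Gal k)" "h \<in> carrier (Gal k)"
    then show "g \<circ> h \<in> carrier (Gal k)" unfolding iff by (auto intro: bij_comp)
  next
    fix g assume g: "g \<in> carrier (Gal k)"
    then have b: "bij g" by (simp add: iff)
    have gi: "g (inv_into UNIV g z) = z" for z using b by (simp add: bij_is_surj surj_f_inv_f)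
    have i: "inv_into UNIV g z = w \<longleftrightarrow> z = g w" for z w using b by (metis bij_inv_eq_iff)
    have "inv_into UNIV g \<in> carrier (Gal k)"
      unfolding iff using g[unfolded iff] by (auto simp: i gi bij_imp_bij_inv)
    moreover have "g \<circ> inv_into UNIV g = id" "inv_into UNIV g \<circ> g = id"
      using b by (auto simp: gi i intro!: ext)
    ultimately show "\<exists>h\<in>carrier (Gal k). g \<circ> h = id \<and> h \<circ> g = id" by blast
  qed (simp_all add: iff)
qed

text \<open>The predicate \<open>A\<close> selects the image among the eight signed permutation
  matrices, so that one locale serves all the groups.\<close>

locale signed_galois =
  fixes k :: "'a::field set" and \<phi> :: "('a \<Rightarrow> 'a) \<Rightarrow> int mat" and A :: "bool \<Rightarrow> bool \<Rightarrow> bool \<Rightarrow> bool"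
  assumes fixed_k: "fixed_field (carrier (Gal k)) = k"
    and hom: "\<phi> \<in> hom (Gal k) GL2Z" and inj: "inj_on \<phi> (carrier (Gal k))"
    and image: "\<phi> ` carrier (Gal k) = {spm d r r' | d r r'. A d r r'}"
begin

abbreviation "G \<equiv> carrier (Gal k)"

definition "dg g \<longleftrightarrow> (\<exists>r r'. \<phi> g = spm True r r')"
definition "r1 g \<longleftrightarrow> (\<exists>d r'. \<phi> g = spm d True r')"
definition "r2 g \<longleftrightarrow> (\<exists>d r. \<phi> g = spm d r True)"

lemma phi_spm: "g \<in> G \<Longrightarrow> \<phi> g = spm (dg g) (r1 g) (r2 g) \<and> A (dg g) (r1 g) (r2 g)"
proof -
  assume "g \<in> G"
  then obtain d r r' where e: "\<phi> g = spm d r r'" "A d r r'" using image by blast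
  then have "dg g = d" "r1 g = r" "r2 g = r'" by (auto simp: dg_def r1_def r2_def spm_eq_iff)
  then show ?thesis using e by simp
qed

lemma signs: "A d r r' \<Longrightarrow> \<exists>g\<in>G. dg g = d \<and> r1 g = r \<and> r2 g = r'"
proof -
  assume "A d r r'"
  then have "spm d r r' \<in> \<phi> ` G" unfolding image by blast
  then obtain g where g: "g \<in> G" "\<phi> g = spm d r r'" by auto
  then have "dg g = d \<and> r1 g = r \<and> r2 g = r'" by (auto simp: dg_def r1_def r2_def spm_eq_iff)
  then show ?thesis using g(1) by blast
qed

lemma signs_inj: "\<lbrakk>g \<in> G; h \<in> G; dg g = dg h; r1 g = r1 h; r2 g = r2 h\<rbrakk> \<Longrightarrow> g = h"
  using phi_spm[of g] phi_spm[of h] inj by (auto simp: inj_on_def)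

sublocale auts G by (rule auts_Gal)

sublocale monomial G dg r1 r2
proof
  have m: "spm (dg (g \<circ> h)) (r1 (g \<circ> h)) (r2 (g \<circ> h)) =
      spm (dg g = dg h) (r1 g = (if dg g then r1 h else r2 h)) (r2 g = (if dg g then r2 h else r1 h))"
    if "g \<in> G" "h \<in> G" for g h
    using hom_mult[OF hom that] phi_spm[of g] phi_spm[of h] phi_spm[OF comp[OF that]] that
    by (simp add: Gal_simps GL2Z_simps spm_mult)
  fix g h assume g: "g \<in> G" and h: "h \<in> G"
  from m[OF g h] show "dg (g \<circ> h) \<longleftrightarrow> dg g = dg h" "r1 (g \<circ> h) \<longleftrightarrow> r1 g = (if dg g then r1 h else r2 h)"
    "r2 (g \<circ> h) \<longleftrightarrow> r2 g = (if dg g then r2 h else r1 h)" by (simp_all only: spm_eq_iff)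
qed

sublocale monomial_torus "TYPE('a)" G dg r1 r2 \<phi> "Gal k"
proof
  fix g assume g: "g \<in> G"
  show "\<phi> g \<in> carrier_mat 2 2" using phi_spm[OF g] spm_carrier by metis
  fix x y :: 'a assume xy: "x \<noteq> 0" "y \<noteq> 0"
  show "pair_act (\<phi> g) g (x, y) = pact g (x, y)"
    using phi_spm[OF g] by (cases "dg g"; cases "r1 g"; cases "r2 g")
      (simp_all add: pair_act_def pact_def spm_def sgnb_def power_int_minus)
qed (simp_all add: Gal_simps)

lemma via: "fixed_field_via k \<phi> {spm d r r' | d r r'. P d r r'} = {x. \<forall>g\<in>G. P (dg g) (r1 g) (r2 g) \<longrightarrow> g x = x}"
  unfolding fixed_field_via_def fixed_field_def using phi_spm by (auto simp: spm_eq_iff)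

lemma fixed_G: "auts.fixed G = k"
  using fixed_k by (simp add: fixed_def fixed_field_def)

text \<open>By injectivity of \<phi> an automorphism is determined by its Boolean code. It is
  therefore enough that the elements of the kernel share their signs with the identity or with
  \<open>c\<close>.\<close>

lemma rank1_sub:
  assumes H: "auts H" "H \<subseteq> G" and e_comp: "\<And>g h. \<lbrakk>g \<in> H; h \<in> H\<rbrakk> \<Longrightarrow> e (g \<circ> h) \<longleftrightarrow> e g = e h"
    and c: "c \<in> H" "e c" and u: "\<And>g. \<lbrakk>g \<in> H; e g\<rbrakk> \<Longrightarrow> dg g \<and> (r1 g \<and> r2 g \<or> r1 g = r1 c \<and> r2 g = r2 c)" and "dg c"
  shows "rank1 H e c"
proof -
  interpret A: auts H by (rule H)
  show ?thesis
  proof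
    fix g assume g: "g \<in> H" "e g"
    have G: "g \<in> G" "c \<in> G" using g c H(2) by auto
    show "g = id \<or> g = c"
      using u[OF g] signs_inj[OF G(1) id] signs_inj[OF G] dg_id \<open>dg c\<close> by auto
  qed (use e_comp c in auto)
qed

lemma rank1_E: "rank1 H e c \<Longrightarrow> rank1.E H e = {x. \<forall>g\<in>H. e g \<longrightarrow> g x = x}"
  by (rule rank1.E_def)

text \<open>A faithful character has trivial kernel, so the quadratic extension reaches all of
  \<open>K\<close>.\<close>

lemma E_UNIV:
  assumes "rank1 H e id" shows "rank1.E H e = UNIV"
proof -
  interpret R: rank1 H e id by (rule assms)
  show ?thesis using R.E_iff by auto
qed

end

text \<open>For \<open>D\<^sub>8\<close>, \<open>D\<^sub>4'\<close>, \<open>C\<^sub>4\<close> and \<open>D\<^sub>2'\<close> the lattice is induced from the subgroup of diagonal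
  matrices; for the other groups it is a sum of two characters.\<close>

theorem theorem5p5:
  fixes k :: "'a::field set"
    and \<phi> :: "('a \<Rightarrow> 'a) \<Rightarrow> int mat"
  assumes galois: "finite_galois k"
    and hom: "\<phi> \<in> hom (Gal k) GL2Z"
    and inj: "inj_on \<phi> (carrier (Gal k))"
  shows
    "(\<phi> ` carrier (Gal k) = D8 \<longrightarrow>
        H1 (Gal k) torus (torus_action \<phi>) \<cong>
          Br (fixed_field_via k \<phi> D4) (fixed_field_via k \<phi> D2)) \<and>
     (\<phi> ` carrier (Gal k) = D4 \<longrightarrow>
        H1 (Gal k) torus (torus_action \<phi>) \<cong>
          Br k (fixed_field_via k \<phi> D2) \<times>\<times> Br k (fixed_field_via k \<phi> D2_conj)) \<and>
     (\<phi> ` carrier (Gal k) = D4' \<longrightarrow>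
        H1 (Gal k) torus (torus_action \<phi>) \<cong> Br (fixed_field_via k \<phi> C2) UNIV) \<and>
     (\<phi> ` carrier (Gal k) = C4 \<longrightarrow>
        H1 (Gal k) torus (torus_action \<phi>) \<cong> Br (fixed_field_via k \<phi> C2) UNIV) \<and>
     (\<phi> ` carrier (Gal k) = D2 \<longrightarrow>
        H1 (Gal k) torus (torus_action \<phi>) \<cong> Br k UNIV) \<and>
     (\<phi> ` carrier (Gal k) = D2' \<longrightarrow>
        trivial_group (H1 (Gal k) torus (torus_action \<phi>))) \<and>
     (\<phi> ` carrier (Gal k) = C2 \<longrightarrow>
        H1 (Gal k) torus (torus_action \<phi>) \<cong> Br k UNIV \<times>\<times> Br k UNIV) \<and>
     (\<phi> ` carrier (Gal k) = C1 \<longrightarrow>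
        trivial_group (H1 (Gal k) torus (torus_action \<phi>)))"
proof -
  let ?H = "H1 (Gal k) (torus :: (int vec \<times> 'a \<Rightarrow>\<^sub>0 int) set monoid) (torus_action \<phi>)"
  let ?G = "carrier (Gal k)"
  have sg: "signed_galois k \<phi> A" if "\<phi> ` ?G = {spm d r r' | d r r'. A d r r'}" for A
    using galois hom inj that by (simp add: signed_galois_def finite_galois_def)
  note simps = D8_spm D4_spm D4'_spm C4_spm small_groups_spm
  have 1: "?H \<cong> Br (fixed_field_via k \<phi> D4) (fixed_field_via k \<phi> D2)" if im: "\<phi> ` ?G = D8"
  proof -
    interpret S: signed_galois k \<phi> "\<lambda>_ _ _. True" by (rule sg) (use im D8_spm in simp)
    obtain t where t: "t \<in> ?G" "\<not> S.dg t" using S.signs[of False] by blast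
    obtain s where s: "s \<in> ?G" "S.dg s" "\<not> S.r1 s" using S.signs[of True False] by blast
    \<comment> \<open>The element that maps to \<open>matC\<close>. The diagonal subgroup is D4, and
      its first character has kernel {I, C}; hence the quadratic extension is the fixed field of D2
      over that of D4.\<close>
    obtain c where c: "c \<in> ?G" "S.dg c" "S.r1 c" "\<not> S.r2 c" using S.signs[of True True False] by blast
    have R: "rank1 {g \<in> ?G. S.dg g} S.r1 c"
      by (rule S.rank1_sub[OF S.diag_auts]) (use c S.r_comp in auto)
    have L: "auts.fixed {g \<in> ?G. S.dg g} = fixed_field_via k \<phi> D4"
      unfolding D4_spm S.via auts.fixed_def[OF S.diag_auts] by auto
    have E: "rank1.E {g \<in> ?G. S.dg g} S.r1 = fixed_field_via k \<phi> D2"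
      unfolding small_groups_spm S.via S.rank1_E[OF R] by auto
    show ?thesis using S.shapiro_H1[OF R t s] unfolding L E .
  qed
  \<comment> \<open>Shared by D4' and C4: in both, the diagonal elements are I and -I, on which the
    first sign is a faithful character.\<close>
  have diag: "?H \<cong> Br (fixed_field_via k \<phi> C2) UNIV"
    if im: "\<phi> ` ?G = {spm d r r' | d r r'. A d r r'}" and A: "\<And>r r'. A True r r' \<longleftrightarrow> r = r'" "A False b b'" for A b b'
  proof -
    interpret S: signed_galois k \<phi> A by (rule sg[OF im])
    have Sdg: "S.r1 g = S.r2 g" if "g \<in> ?G" "S.dg g" for g using S.phi_spm[OF that(1)] that(2) A(1) by simp
    obtain t where t: "t \<in> ?G" "\<not> S.dg t" using S.signs[OF A(2)] by blast
    obtain s where s: "s \<in> ?G" "S.dg s" "\<not> S.r1 s" using S.signs[of True False False] A(1) by blast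
    have R: "rank1 {g \<in> ?G. S.dg g} S.r1 id"
      by (rule S.rank1_sub[OF S.diag_auts]) (use S.r_comp S.dg_id S.id Sdg in auto)
    have L: "auts.fixed {g \<in> ?G. S.dg g} = fixed_field_via k \<phi> C2"
      unfolding small_groups_spm S.via auts.fixed_def[OF S.diag_auts] using Sdg by auto
    show ?thesis using S.shapiro_H1[OF R t s] unfolding L S.E_UNIV[OF R] .
  qed
  \<comment> \<open>The characters of the two coordinate lines have kernels D2 and its conjugate,
    which yields two quadratic extensions of \<open>k\<close>.\<close>
  have 2: "?H \<cong> Br k (fixed_field_via k \<phi> D2) \<times>\<times> Br k (fixed_field_via k \<phi> D2_conj)" if im: "\<phi> ` ?G = D4"
  proof -
    interpret S: signed_galois k \<phi> "\<lambda>d _ _. d" by (rule sg) (use im D4_spm in simp)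
    have dg: "\<forall>g\<in>?G. S.dg g" using S.phi_spm by blast
    obtain s where s: "s \<in> ?G" "\<not> S.r1 s" "\<not> S.r2 s" using S.signs[of True False False] by blast
    obtain c where c: "c \<in> ?G" "S.r1 c" "\<not> S.r2 c" using S.signs[of True True False] by blast
    obtain c' where c': "c' \<in> ?G" "\<not> S.r1 c'" "S.r2 c'" using S.signs[of True False True] by blast
    have R: "rank1 ?G S.r1 c"
      by (rule S.rank1_sub[OF auts_Gal]) (use c S.r_comp dg in auto)
    have R': "rank1 ?G S.r2 c'"
      by (rule S.rank1_sub[OF auts_Gal]) (use c' S.r'_comp dg in auto)
    have E: "rank1.E ?G S.r1 = fixed_field_via k \<phi> D2" "rank1.E ?G S.r2 = fixed_field_via k \<phi> D2_conj"
      unfolding small_groups_spm S.via S.rank1_E[OF R] S.rank1_E[OF R'] using dg by auto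
    show ?thesis using S.diag_H1[OF R R' dg s(1,2) s(1,3)] unfolding S.fixed_G E .
  qed
  \<comment> \<open>The first line is fixed by the whole group, while the second carries its
    faithful character.\<close>
  have 3: "?H \<cong> Br k UNIV" if im: "\<phi> ` ?G = D2"
  proof -
    interpret S: signed_galois k \<phi> "\<lambda>d r _. d \<and> r" by (rule sg) (use im small_groups_spm in simp)
    have dg: "\<forall>g\<in>?G. S.dg g \<and> S.r1 g" using S.phi_spm by blast
    obtain s where s: "s \<in> ?G" "\<not> S.r2 s" using S.signs[of True True False] by blast
    have R: "rank1 ?G S.r1 s"
      by (rule S.rank1_sub[OF auts_Gal]) (use s S.r_comp dg in auto)
    have R': "rank1 ?G S.r2 id"
      by (rule S.rank1_sub[OF auts_Gal]) (use S.r'_comp S.dg_id S.id dg in auto)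
    show ?thesis using S.half_diag_H1[OF R R' _ s] dg unfolding S.fixed_G S.E_UNIV[OF R'] by blast
  qed
  \<comment> \<open>The identity is the only diagonal element here, so Shapiro's lemma reduces to
    the cohomology of the trivial group.\<close>
  have 4: "trivial_group ?H" if im: "\<phi> ` ?G = D2'"
  proof -
    interpret S: signed_galois k \<phi> "\<lambda>_ r r'. r \<and> r'" by (rule sg) (use im small_groups_spm in simp)
    have rr: "\<forall>g\<in>?G. S.r1 g \<and> S.r2 g" using S.phi_spm by blast
    obtain t where t: "t \<in> ?G" "\<not> S.dg t" using S.signs[where d = False and r = True and r' = True] by blast
    have R: "rank1 {g \<in> ?G. S.dg g} S.r1 id"
      by (rule S.rank1_sub[OF S.diag_auts]) (use S.r_comp S.dg_id S.id rr in auto)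
    show ?thesis by (rule S.shapiro_H1_trivial[OF R t]) (use rr in blast)
  qed
  \<comment> \<open>Both coordinate lines carry the same faithful character, so the extension K of
    \<open>k\<close> occurs twice.\<close>
  have 5: "?H \<cong> Br k UNIV \<times>\<times> Br k UNIV" if im: "\<phi> ` ?G = C2"
  proof -
    interpret S: signed_galois k \<phi> "\<lambda>d r r'. d \<and> r = r'" by (rule sg) (use im small_groups_spm in simp)
    have dg: "\<forall>g\<in>?G. S.dg g" and rr: "\<forall>g\<in>?G. S.r1 g = S.r2 g" using S.phi_spm by blast+
    obtain s where s: "s \<in> ?G" "\<not> S.r1 s" "\<not> S.r2 s" using S.signs[of True False False] by blast
    have R: "rank1 ?G S.r1 id" "rank1 ?G S.r2 id"
      by (rule S.rank1_sub[OF auts_Gal], use S.r_comp S.r'_comp S.dg_id S.id dg rr in auto)+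
    show ?thesis using S.diag_H1[OF R dg s(1,2) s(1,3)] unfolding S.fixed_G S.E_UNIV[OF R(1)] S.E_UNIV[OF R(2)] .
  qed
  have 6: "trivial_group ?H" if im: "\<phi> ` ?G = C1"
  proof -
    interpret S: signed_galois k \<phi> "\<lambda>d r r'. d \<and> r \<and> r'" by (rule sg) (use im small_groups_spm in simp)
    have all: "\<forall>g\<in>?G. S.dg g \<and> S.r1 g \<and> S.r2 g" using S.phi_spm by blast
    have R: "rank1 ?G S.r1 id" "rank1 ?G S.r2 id"
      by (rule S.rank1_sub[OF auts_Gal], use S.r_comp S.r'_comp S.dg_id S.id all in auto)+
    show ?thesis by (rule S.diag_H1_trivial[OF R]) (use all in blast)
  qed
  have 7: "?H \<cong> Br (fixed_field_via k \<phi> C2) UNIV" if "\<phi> ` ?G = D4'"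
    by (rule diag[of "\<lambda>_ r r'. r = r'" True True]) (use that D4'_spm in auto)
  have 8: "?H \<cong> Br (fixed_field_via k \<phi> C2) UNIV" if "\<phi> ` ?G = C4"
    by (rule diag[of "\<lambda>d r r'. d = (r = r')" False True]) (use that C4_spm in auto)
  show ?thesis using 1 2 3 4 5 6 7 8 by blast
qed

end
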